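(* Let $k$ be a commutative ring, $H$ a $k$-bialgebra, $A$ a left $H$-module algebra and $\mathcal{C}$ an $(H,A)$-coring. Assume that $\mathcal{C}$ is flat as a left $A$-module. Then the category ${}_H\mathcal{M}^{\mathcal{C}}$ of right $(H,\mathcal{C})$-comodules is a Grothendieck category.
   Context: Sweedler notation with summation suppressed is used: $\Delta_H(h)=h_1\otimes h_2$; $\epsilon_H$ is the counit of $H$. A left $H$-module algebra is a $k$-algebra $A$ with a left $H$-module structure such that $h.(aa')=(h_1.a)(h_2.a')$ and $h.1_A=\epsilon_H(h)1_A$. A left-right $(H,A)$-module is a left $H$-module and right $A$-module $M$ with $h(ma)=(h_1m)(h_2.a)$. A left $(H,A)$-bimodule is an $A$-bimodule and left $H$-module $M$ with $h(am)=(h_1.a)(h_2m)$ and $h(ma)=(h_1m)(h_2.a)$. If $M$ is a left-right $(H,A)$-module and $N$ a left $(H,A)$-bimodule, $H$ acts on $M\otimes_AN$ diagonally: $h(m\otimes_An)=h_1m\otimes_Ah_2n$. An $A$-coring is a coassociative counital coalgebra $(\mathcal C,\Delta_{\mathcal C},\epsilon_{\mathcal C})$ in the monoidal category of $A$-bimodules. An $(H,A)$-coring is an $A$-coring $\mathcal C$ that is also a left $(H,A)$-bimodule (with the same $A$-bimodule structure) such that $\Delta_{\mathcal C}:\mathcal C\to\mathcal C\otimes_A\mathcal C$ and $\epsilon_{\mathcal C}:\mathcal C\to A$ are $H$-linear. A right $(H,\mathcal C)$-comodule is a right $\mathcal C$-comodule $M$ (right $A$-module with coassociative counital right $A$-linear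 coaction $\rho_M:M\to M\otimes_A\mathcal C$) that is also a left-right $(H,A)$-module such that $\rho_M$ is $H$-linear. Morphisms in ${}_H\mathcal M^{\mathcal C}$ are the right $A$-linear, $H$-linear, $\mathcal C$-colinear maps. *)

theory Defs
  imports "HOL-Algebra.Free_Abelian_Groups" "HOL-Algebra.Generated_Groups" "HOL-Algebra.Module"
begin

section \<open>Categories\<close>

record ('o, 'f) category =
  Ob :: "'o set"
  Arr :: "'f set"
  Dom :: "'f \<Rightarrow> 'o"
  Cod :: "'f \<Rightarrow> 'o"
  Idt :: "'o \<Rightarrow> 'f"
  Comp :: "'f \<Rightarrow> 'f \<Rightarrow> 'f"  (infixl \<open>\<star>\<index>\<close> 70)

definition Hom :: "('o, 'f) category \<Rightarrow> 'o \<Rightarrow> 'o \<Rightarrow> 'f set" where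
  "Hom C X Y = {f \<in> Arr C. Dom C f = X \<and> Cod C f = Y}"

locale category =
  fixes C :: "('o, 'f) category" (structure)
  assumes Dom_Ob: "f \<in> Arr C \<Longrightarrow> Dom C f \<in> Ob C"
    and Cod_Ob: "f \<in> Arr C \<Longrightarrow> Cod C f \<in> Ob C"
    and Idt_Hom: "X \<in> Ob C \<Longrightarrow> Idt C X \<in> Hom C X X"
    and Comp_Hom: "f \<in> Hom C X Y \<Longrightarrow> g \<in> Hom C Y Z \<Longrightarrow> g \<star> f \<in> Hom C X Z"
    and Comp_Idt: "f \<in> Hom C X Y \<Longrightarrow> f \<star> Idt C X = f"
    and Idt_Comp: "f \<in> Hom C X Y \<Longrightarrow> Idt C Y \<star> f = f"
    and Comp_assoc: "f \<in> Hom C W X \<Longrightarrow> g \<in> Hom C X Y \<Longrightarrow> h \<in> Hom C Y Z \<Longrightarrow>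
      (h \<star> g) \<star> f = h \<star> (g \<star> f)"

subsection \<open>Abelian categories\<close>

definition zero_object :: "('o, 'f) category \<Rightarrow> 'o \<Rightarrow> bool" where
  "zero_object C Z \<longleftrightarrow> Z \<in> Ob C \<and>
     (\<forall>X\<in>Ob C. (\<exists>!f. f \<in> Hom C X Z) \<and> (\<exists>!f. f \<in> Hom C Z X))"

definition zero_arrow :: "('o, 'f) category \<Rightarrow> 'f \<Rightarrow> bool" where
  "zero_arrow C f \<longleftrightarrow> f \<in> Arr C \<and>
     (\<exists>Z g h. zero_object C Z \<and> g \<in> Hom C (Dom C f) Z \<and> h \<in> Hom C Z (Cod C f) \<and> f = h \<star>\<^bsub>C\<^esub> g)"

definition monic :: "('o, 'f) category \<Rightarrow> 'f \<Rightarrow> bool" where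
  "monic C f \<longleftrightarrow> f \<in> Arr C \<and>
     (\<forall>X. \<forall>g\<in>Hom C X (Dom C f). \<forall>h\<in>Hom C X (Dom C f). f \<star>\<^bsub>C\<^esub> g = f \<star>\<^bsub>C\<^esub> h \<longrightarrow> g = h)"

definition epic :: "('o, 'f) category \<Rightarrow> 'f \<Rightarrow> bool" where
  "epic C f \<longleftrightarrow> f \<in> Arr C \<and>
     (\<forall>X. \<forall>g\<in>Hom C (Cod C f) X. \<forall>h\<in>Hom C (Cod C f) X. g \<star>\<^bsub>C\<^esub> f = h \<star>\<^bsub>C\<^esub> f \<longrightarrow> g = h)"

definition kernel_of :: "('o, 'f) category \<Rightarrow> 'f \<Rightarrow> 'f \<Rightarrow> bool" where
  "kernel_of C f i \<longleftrightarrow> f \<in> Arr C \<and> i \<in> Arr C \<and> Cod C i = Dom C f \<and> zero_arrow C (f \<star>\<^bsub>C\<^esub> i) \<and>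
     (\<forall>X. \<forall>g\<in>Hom C X (Dom C f). zero_arrow C (f \<star>\<^bsub>C\<^esub> g) \<longrightarrow>
        (\<exists>!u. u \<in> Hom C X (Dom C i) \<and> i \<star>\<^bsub>C\<^esub> u = g))"

definition cokernel_of :: "('o, 'f) category \<Rightarrow> 'f \<Rightarrow> 'f \<Rightarrow> bool" where
  "cokernel_of C f p \<longleftrightarrow> f \<in> Arr C \<and> p \<in> Arr C \<and> Dom C p = Cod C f \<and> zero_arrow C (p \<star>\<^bsub>C\<^esub> f) \<and>
     (\<forall>X. \<forall>g\<in>Hom C (Cod C f) X. zero_arrow C (g \<star>\<^bsub>C\<^esub> f) \<longrightarrow>
        (\<exists>!u. u \<in> Hom C (Cod C p) X \<and> u \<star>\<^bsub>C\<^esub> p = g))"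

definition binary_product :: "('o, 'f) category \<Rightarrow> 'o \<Rightarrow> 'o \<Rightarrow> 'o \<Rightarrow> 'f \<Rightarrow> 'f \<Rightarrow> bool" where
  "binary_product C X Y P p q \<longleftrightarrow> p \<in> Hom C P X \<and> q \<in> Hom C P Y \<and>
     (\<forall>Z. \<forall>f\<in>Hom C Z X. \<forall>g\<in>Hom C Z Y.
        \<exists>!u. u \<in> Hom C Z P \<and> p \<star>\<^bsub>C\<^esub> u = f \<and> q \<star>\<^bsub>C\<^esub> u = g)"

definition binary_coproduct :: "('o, 'f) category \<Rightarrow> 'o \<Rightarrow> 'o \<Rightarrow> 'o \<Rightarrow> 'f \<Rightarrow> 'f \<Rightarrow> bool" where
  "binary_coproduct C X Y S i j \<longleftrightarrow> i \<in> Hom C X S \<and> j \<in> Hom C Y S \<and>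
     (\<forall>Z. \<forall>f\<in>Hom C X Z. \<forall>g\<in>Hom C Y Z.
        \<exists>!u. u \<in> Hom C S Z \<and> u \<star>\<^bsub>C\<^esub> i = f \<and> u \<star>\<^bsub>C\<^esub> j = g)"

definition preadditive :: "('o, 'f) category \<Rightarrow> bool" where
  "preadditive C \<longleftrightarrow> (\<exists>add :: 'f \<Rightarrow> 'f \<Rightarrow> 'f.
     (\<forall>X\<in>Ob C. \<forall>Y\<in>Ob C. \<exists>z. comm_group \<lparr>carrier = Hom C X Y, monoid.mult = add, one = z\<rparr>) \<and>
     (\<forall>X Y Z. \<forall>f\<in>Hom C X Y. \<forall>f'\<in>Hom C X Y. \<forall>g\<in>Hom C Y Z. \<forall>g'\<in>Hom C Y Z.
        g \<star>\<^bsub>C\<^esub> add f f' = add (g \<star>\<^bsub>C\<^esub> f) (g \<star>\<^bsub>C\<^esub> f') \<and>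
        add g g' \<star>\<^bsub>C\<^esub> f = add (g \<star>\<^bsub>C\<^esub> f) (g' \<star>\<^bsub>C\<^esub> f)))"

locale abelian_category = category +
  assumes preadditive: "preadditive C"
    and ex_zero_object: "\<exists>Z. zero_object C Z"
    and ex_product: "X \<in> Ob C \<Longrightarrow> Y \<in> Ob C \<Longrightarrow> \<exists>P p q. binary_product C X Y P p q"
    and ex_coproduct: "X \<in> Ob C \<Longrightarrow> Y \<in> Ob C \<Longrightarrow> \<exists>S i j. binary_coproduct C X Y S i j"
    and ex_kernel: "f \<in> Arr C \<Longrightarrow> \<exists>i. kernel_of C f i"
    and ex_cokernel: "f \<in> Arr C \<Longrightarrow> \<exists>p. cokernel_of C f p"
    and monic_normal: "monic C f \<Longrightarrow> \<exists>g. kernel_of C g f"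
    and epic_normal: "epic C f \<Longrightarrow> \<exists>g. cokernel_of C g f"

definition short_exact :: "('o, 'f) category \<Rightarrow> 'f \<Rightarrow> 'f \<Rightarrow> bool" where
  "short_exact C f g \<longleftrightarrow> kernel_of C g f \<and> cokernel_of C f g"

subsection \<open>Universes\<close>

text \<open>
  HOL has no type of all sets, so ``the category of all comodules'' and ``all set-indexed
  colimits'' are taken relative to a family \<open>U\<close> of small subsets of a type \<open>'u\<close>. The members of a
  Grothendieck universe containing the natural numbers satisfy the axioms below.
  Closure of \<open>U\<close> under power sets is not demanded; it is replaced by the requirement that
  the power sets of some given sets (here, of the natural numbers; in the theorem,
  also of the carriers of the structures the comodules are formed over) are small. So the family of
  all subsets of a sufficiently large type \<open>'u\<close> is admissible too.
\<close>

definition small :: "'u set set \<Rightarrow> 'b set \<Rightarrow> bool" where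
  "small U S \<longleftrightarrow> (\<exists>X\<in>U. S \<lesssim> X)"

locale universe =
  fixes U :: "'u set set"
  assumes subset_closed: "X \<in> U \<Longrightarrow> Y \<subseteq> X \<Longrightarrow> Y \<in> U"
    and image_closed: "X \<in> U \<Longrightarrow> (f :: 'u \<Rightarrow> 'u) ` X \<in> U"
    and Union_closed: "I \<in> U \<Longrightarrow> (\<And>i. i \<in> I \<Longrightarrow> F i \<in> U) \<Longrightarrow> (\<Union>i\<in>I. F i) \<in> U"
    and small_Pow_nat: "small U (Pow (UNIV :: nat set))"

subsection \<open>Grothendieck categories\<close>

definition diagram ::
  "('i, 'j) category \<Rightarrow> ('o, 'f) category \<Rightarrow> ('i \<Rightarrow> 'o) \<Rightarrow> ('j \<Rightarrow> 'f) \<Rightarrow> bool" where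
  "diagram J C D D' \<longleftrightarrow>
     (\<forall>i\<in>Ob J. D i \<in> Ob C) \<and>
     (\<forall>a\<in>Arr J. D' a \<in> Hom C (D (Dom J a)) (D (Cod J a))) \<and>
     (\<forall>i\<in>Ob J. D' (Idt J i) = Idt C (D i)) \<and>
     (\<forall>a\<in>Arr J. \<forall>b\<in>Arr J. Dom J b = Cod J a \<longrightarrow> D' (b \<star>\<^bsub>J\<^esub> a) = D' b \<star>\<^bsub>C\<^esub> D' a)"

definition natural ::
  "('i, 'j) category \<Rightarrow> ('o, 'f) category \<Rightarrow> ('i \<Rightarrow> 'o) \<Rightarrow> ('j \<Rightarrow> 'f) \<Rightarrow>
   ('i \<Rightarrow> 'o) \<Rightarrow> ('j \<Rightarrow> 'f) \<Rightarrow> ('i \<Rightarrow> 'f) \<Rightarrow> bool" where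
  "natural J C D D' E E' t \<longleftrightarrow>
     (\<forall>i\<in>Ob J. t i \<in> Hom C (D i) (E i)) \<and>
     (\<forall>a\<in>Arr J. t (Cod J a) \<star>\<^bsub>C\<^esub> D' a = E' a \<star>\<^bsub>C\<^esub> t (Dom J a))"

definition cocone ::
  "('i, 'j) category \<Rightarrow> ('o, 'f) category \<Rightarrow> ('i \<Rightarrow> 'o) \<Rightarrow> ('j \<Rightarrow> 'f) \<Rightarrow>
   'o \<Rightarrow> ('i \<Rightarrow> 'f) \<Rightarrow> bool" where
  "cocone J C D D' L c \<longleftrightarrow> L \<in> Ob C \<and>
     (\<forall>i\<in>Ob J. c i \<in> Hom C (D i) L) \<and>
     (\<forall>a\<in>Arr J. c (Cod J a) \<star>\<^bsub>C\<^esub> D' a = c (Dom J a))"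

definition colimit ::
  "('i, 'j) category \<Rightarrow> ('o, 'f) category \<Rightarrow> ('i \<Rightarrow> 'o) \<Rightarrow> ('j \<Rightarrow> 'f) \<Rightarrow>
   'o \<Rightarrow> ('i \<Rightarrow> 'f) \<Rightarrow> bool" where
  "colimit J C D D' L c \<longleftrightarrow> cocone J C D D' L c \<and>
     (\<forall>X d. cocone J C D D' X d \<longrightarrow>
        (\<exists>!u. u \<in> Hom C L X \<and> (\<forall>i\<in>Ob J. u \<star>\<^bsub>C\<^esub> c i = d i)))"

locale filtered_category = category +
  assumes nonempty: "Ob C \<noteq> {}"
    and upper_bound: "X \<in> Ob C \<Longrightarrow> Y \<in> Ob C \<Longrightarrow>
      \<exists>Z. Hom C X Z \<noteq> {} \<and> Hom C Y Z \<noteq> {}"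
    and coequalize: "f \<in> Hom C X Y \<Longrightarrow> g \<in> Hom C X Y \<Longrightarrow>
      \<exists>Z. \<exists>h\<in>Hom C Y Z. h \<star> f = h \<star> g"

definition generator :: "('o, 'f) category \<Rightarrow> 'o \<Rightarrow> bool" where
  "generator C G \<longleftrightarrow> G \<in> Ob C \<and>
     (\<forall>X Y. \<forall>f\<in>Hom C X Y. \<forall>g\<in>Hom C X Y. f \<noteq> g \<longrightarrow>
        (\<exists>h\<in>Hom C G X. f \<star>\<^bsub>C\<^esub> h \<noteq> g \<star>\<^bsub>C\<^esub> h))"

text \<open>A cocomplete abelian category with a generator and exact filtered colimits.\<close>

locale grothendieck_category = abelian_category C
  for U :: "'u set set" and C :: "('o, 'f) category" (structure) +
  assumes cocomplete:
    "category (J :: ('u, 'u) category) \<Longrightarrow> Ob J \<in> U \<Longrightarrow> Arr J \<in> U \<Longrightarrow> diagram J C D D' \<Longrightarrow>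
       \<exists>L c. colimit J C D D' L c"
    and filtered_colimits_exact:
    "filtered_category (J :: ('u, 'u) category) \<Longrightarrow> Ob J \<in> U \<Longrightarrow> Arr J \<in> U \<Longrightarrow>
       diagram J C D1 D1' \<Longrightarrow> diagram J C D2 D2' \<Longrightarrow> diagram J C D3 D3' \<Longrightarrow>
       natural J C D1 D1' D2 D2' s \<Longrightarrow> natural J C D2 D2' D3 D3' t \<Longrightarrow>
       (\<And>i. i \<in> Ob J \<Longrightarrow> short_exact C (s i) (t i)) \<Longrightarrow>
       colimit J C D1 D1' L1 c1 \<Longrightarrow> colimit J C D2 D2' L2 c2 \<Longrightarrow> colimit J C D3 D3' L3 c3 \<Longrightarrow>
       f \<in> Hom C L1 L2 \<Longrightarrow> (\<And>i. i \<in> Ob J \<Longrightarrow> f \<star> c1 i = c2 i \<star> s i) \<Longrightarrow>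
       g \<in> Hom C L2 L3 \<Longrightarrow> (\<And>i. i \<in> Ob J \<Longrightarrow> g \<star> c2 i = c3 i \<star> t i) \<Longrightarrow>
       short_exact C f g"
    and ex_generator: "\<exists>G. generator C G"


section \<open>Modules over noncommutative rings and tensor products\<close>

text \<open>
  As for \<^const>\<open>module\<close> in the library, the multiplicative fields of a record that is
  only regarded as a module carry no meaning.
\<close>

locale left_module =
  fixes R :: "('r, 'x) ring_scheme" and M :: "('m, 'y) ring_scheme" and l :: "'r \<Rightarrow> 'm \<Rightarrow> 'm"
  assumes ring: "ring R" and abelian_group: "abelian_group M"
    and closed: "r \<in> carrier R \<Longrightarrow> m \<in> carrier M \<Longrightarrow> l r m \<in> carrier M"
    and add_left: "r \<in> carrier R \<Longrightarrow> s \<in> carrier R \<Longrightarrow> m \<in> carrier M \<Longrightarrow>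
      l (r \<oplus>\<^bsub>R\<^esub> s) m = l r m \<oplus>\<^bsub>M\<^esub> l s m"
    and add_right: "r \<in> carrier R \<Longrightarrow> m \<in> carrier M \<Longrightarrow> n \<in> carrier M \<Longrightarrow>
      l r (m \<oplus>\<^bsub>M\<^esub> n) = l r m \<oplus>\<^bsub>M\<^esub> l r n"
    and mult: "r \<in> carrier R \<Longrightarrow> s \<in> carrier R \<Longrightarrow> m \<in> carrier M \<Longrightarrow>
      l (r \<otimes>\<^bsub>R\<^esub> s) m = l r (l s m)"
    and one: "m \<in> carrier M \<Longrightarrow> l \<one>\<^bsub>R\<^esub> m = m"

locale right_module =
  fixes R :: "('r, 'x) ring_scheme" and M :: "('m, 'y) ring_scheme" and r :: "'m \<Rightarrow> 'r \<Rightarrow> 'm"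
  assumes ring: "ring R" and abelian_group: "abelian_group M"
    and closed: "a \<in> carrier R \<Longrightarrow> m \<in> carrier M \<Longrightarrow> r m a \<in> carrier M"
    and add_right: "a \<in> carrier R \<Longrightarrow> b \<in> carrier R \<Longrightarrow> m \<in> carrier M \<Longrightarrow>
      r m (a \<oplus>\<^bsub>R\<^esub> b) = r m a \<oplus>\<^bsub>M\<^esub> r m b"
    and add_left: "a \<in> carrier R \<Longrightarrow> m \<in> carrier M \<Longrightarrow> n \<in> carrier M \<Longrightarrow>
      r (m \<oplus>\<^bsub>M\<^esub> n) a = r m a \<oplus>\<^bsub>M\<^esub> r n a"
    and mult: "a \<in> carrier R \<Longrightarrow> b \<in> carrier R \<Longrightarrow> m \<in> carrier M \<Longrightarrow>
      r m (a \<otimes>\<^bsub>R\<^esub> b) = r (r m a) b"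
    and one: "m \<in> carrier M \<Longrightarrow> r m \<one>\<^bsub>R\<^esub> = m"

subsection \<open>The tensor product of a right and a left module\<close>

type_synonym ('m, 'n) tensor = "('m \<times> 'n \<Rightarrow>\<^sub>0 int) set"

definition tensor_relations ::
  "('r, 'x) ring_scheme \<Rightarrow> ('m, 'y) ring_scheme \<Rightarrow> ('m \<Rightarrow> 'r \<Rightarrow> 'm) \<Rightarrow>
   ('n, 'z) ring_scheme \<Rightarrow> ('r \<Rightarrow> 'n \<Rightarrow> 'n) \<Rightarrow> ('m \<times> 'n \<Rightarrow>\<^sub>0 int) set" where
  "tensor_relations R M r N l =
     {frag_of (m \<oplus>\<^bsub>M\<^esub> m', n) - frag_of (m, n) - frag_of (m', n) | m m' n.
        m \<in> carrier M \<and> m' \<in> carrier M \<and> n \<in> carrier N} \<union>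
     {frag_of (m, n \<oplus>\<^bsub>N\<^esub> n') - frag_of (m, n) - frag_of (m, n') | m n n'.
        m \<in> carrier M \<and> n \<in> carrier N \<and> n' \<in> carrier N} \<union>
     {frag_of (r m a, n) - frag_of (m, l a n) | m a n.
        m \<in> carrier M \<and> a \<in> carrier R \<and> n \<in> carrier N}"

definition tensor_group ::
  "('r, 'x) ring_scheme \<Rightarrow> ('m, 'y) ring_scheme \<Rightarrow> ('m \<Rightarrow> 'r \<Rightarrow> 'm) \<Rightarrow>
   ('n, 'z) ring_scheme \<Rightarrow> ('r \<Rightarrow> 'n \<Rightarrow> 'n) \<Rightarrow> ('m, 'n) tensor monoid" where
  "tensor_group R M r N l =
     (let F = free_Abelian_group (carrier M \<times> carrier N)
      in F Mod generate F (tensor_relations R M r N l))"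

text \<open>The same group written additively; the multiplicative fields are dummies.\<close>

definition tensor ::
  "('r, 'x) ring_scheme \<Rightarrow> ('m, 'y) ring_scheme \<Rightarrow> ('m \<Rightarrow> 'r \<Rightarrow> 'm) \<Rightarrow>
   ('n, 'z) ring_scheme \<Rightarrow> ('r \<Rightarrow> 'n \<Rightarrow> 'n) \<Rightarrow> ('m, 'n) tensor ring" where
  "tensor R M r N l = (let T = tensor_group R M r N l in
     \<lparr>carrier = carrier T, monoid.mult = undefined, one = undefined,
      zero = one T, add = monoid.mult T\<rparr>)"

text \<open>The residue class of the generator \<open>(m, n)\<close>.\<close>

definition pure :: "('m, 'n) tensor ring \<Rightarrow> 'm \<Rightarrow> 'n \<Rightarrow> ('m, 'n) tensor" where
  "pure T m n = (THE X. X \<in> carrier T \<and> frag_of (m, n) \<in> X)"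

text \<open>
  \<open>sweedler G t \<beta>\<close> is the image of the tensor \<open>t = \<Sum> m\<^sub>i \<otimes> n\<^sub>i\<close> under the additive map with
  \<open>m \<otimes> n \<mapsto> \<beta> m n\<close>, that is, \<open>\<Sum> \<beta> m\<^sub>i n\<^sub>i\<close> in \<open>G\<close>. For \<open>t = \<Delta>(h)\<close> this is the Sweedler notation
  \<open>\<beta>(h\<^sub>1, h\<^sub>2)\<close>. The choice of the representative is irrelevant as soon as \<open>\<beta>\<close> is
  biadditive and balanced, as it is in every use below.
\<close>

definition sweedler ::
  "('g, 'x) ring_scheme \<Rightarrow> ('m, 'n) tensor \<Rightarrow> ('m \<Rightarrow> 'n \<Rightarrow> 'g) \<Rightarrow> 'g" where
  "sweedler G t \<beta> = (let x = (SOME x. x \<in> t) in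
     \<Oplus>\<^bsub>G\<^esub>p\<in>Poly_Mapping.keys x. [Poly_Mapping.lookup x p] \<cdot>\<^bsub>G\<^esub> \<beta> (fst p) (snd p))"

subsection \<open>Flatness\<close>

text \<open>
  \<open>N\<close> is a flat left \<open>R\<close>-module if \<open>- \<otimes>\<^sub>R N\<close> preserves injectivity of right \<open>R\<close>-linear maps
  (between modules in the universe).
\<close>

definition right_linear ::
  "('r, 'x) ring_scheme \<Rightarrow> ('m, 'y) ring_scheme \<Rightarrow> ('m \<Rightarrow> 'r \<Rightarrow> 'm) \<Rightarrow>
   ('n, 'z) ring_scheme \<Rightarrow> ('n \<Rightarrow> 'r \<Rightarrow> 'n) \<Rightarrow> ('m \<Rightarrow> 'n) \<Rightarrow> bool" where
  "right_linear R M r N s f \<longleftrightarrow> f \<in> carrier M \<rightarrow> carrier N \<and>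
     (\<forall>m\<in>carrier M. \<forall>m'\<in>carrier M. f (m \<oplus>\<^bsub>M\<^esub> m') = f m \<oplus>\<^bsub>N\<^esub> f m') \<and>
     (\<forall>m\<in>carrier M. \<forall>a\<in>carrier R. f (r m a) = s (f m) a)"

definition flat_left_module ::
  "'u set set \<Rightarrow> ('r, 'x) ring_scheme \<Rightarrow> ('n, 'z) ring_scheme \<Rightarrow> ('r \<Rightarrow> 'n \<Rightarrow> 'n) \<Rightarrow> bool" where
  "flat_left_module U R N l \<longleftrightarrow> left_module R N l \<and>
     (\<forall>(M :: 'u ring) r (M' :: 'u ring) r' f.
        carrier M \<in> U \<and> carrier M' \<in> U \<and> right_module R M r \<and> right_module R M' r' \<and>
        right_linear R M r M' r' f \<and> inj_on f (carrier M) \<longrightarrow>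
        inj_on (\<lambda>t. sweedler (tensor R M' r' N l) t (\<lambda>m n. pure (tensor R M' r' N l) (f m) n))
          (carrier (tensor R M r N l)))"


section \<open>Bialgebras and module algebras\<close>

record ('k, 'h) bialgebra = "('k, 'h) module" +
  comult :: "'h \<Rightarrow> ('h, 'h) tensor"
  counit :: "'h \<Rightarrow> 'k"

locale k_algebra =
  fixes k :: "'k ring" and A :: "('k, 'a, 'x) module_scheme"
  assumes module: "module k A" and ring: "ring A"
    and smult_mult: "c \<in> carrier k \<Longrightarrow> x \<in> carrier A \<Longrightarrow> y \<in> carrier A \<Longrightarrow>
      c \<odot>\<^bsub>A\<^esub> (x \<otimes>\<^bsub>A\<^esub> y) = (c \<odot>\<^bsub>A\<^esub> x) \<otimes>\<^bsub>A\<^esub> y"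
    and mult_smult: "c \<in> carrier k \<Longrightarrow> x \<in> carrier A \<Longrightarrow> y \<in> carrier A \<Longrightarrow>
      c \<odot>\<^bsub>A\<^esub> (x \<otimes>\<^bsub>A\<^esub> y) = x \<otimes>\<^bsub>A\<^esub> (c \<odot>\<^bsub>A\<^esub> y)"

definition tensor_k ::
  "'k ring \<Rightarrow> ('k, 'm, 'x) module_scheme \<Rightarrow> ('k, 'n, 'y) module_scheme \<Rightarrow> ('m, 'n) tensor ring" where
  "tensor_k k M N = tensor k M (\<lambda>m c. c \<odot>\<^bsub>M\<^esub> m) N (\<lambda>c n. c \<odot>\<^bsub>N\<^esub> n)"

text \<open>\<open>k\<close>-structure on \<open>M \<otimes>\<^sub>k N\<close>, needed to form \<open>(H \<otimes>\<^sub>k H) \<otimes>\<^sub>k H\<close>.\<close>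

definition tensor_k_module ::
  "'k ring \<Rightarrow> ('k, 'm, 'x) module_scheme \<Rightarrow> ('k, 'n, 'y) module_scheme \<Rightarrow>
   ('k, ('m, 'n) tensor) module" where
  "tensor_k_module k M N = (let T = tensor_k k M N in
     ring.extend T \<lparr>smult = \<lambda>c t. sweedler T t (\<lambda>m n. pure T (c \<odot>\<^bsub>M\<^esub> m) n)\<rparr>)"

text \<open>
  Coassociativity is stated in \<open>(H \<otimes> H) \<otimes> H\<close>:
  \<open>h\<^sub>1\<^sub>1 \<otimes> h\<^sub>1\<^sub>2 \<otimes> h\<^sub>2 = h\<^sub>1 \<otimes> h\<^sub>2\<^sub>1 \<otimes> h\<^sub>2\<^sub>2\<close>. Likewise for corings and comodules below.
\<close>

locale bialgebra = k_algebra k H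
  for k :: "'k ring" and H :: "('k, 'h) bialgebra" +
  fixes HH HHH
  defines "HH \<equiv> tensor_k k H H" and "HHH \<equiv> tensor_k k (tensor_k_module k H H) H"
  assumes cring: "cring k"
    and comult_closed: "h \<in> carrier H \<Longrightarrow> comult H h \<in> carrier HH"
    and comult_add: "h \<in> carrier H \<Longrightarrow> g \<in> carrier H \<Longrightarrow>
      comult H (h \<oplus>\<^bsub>H\<^esub> g) = comult H h \<oplus>\<^bsub>HH\<^esub> comult H g"
    and comult_smult: "c \<in> carrier k \<Longrightarrow> h \<in> carrier H \<Longrightarrow>
      comult H (c \<odot>\<^bsub>H\<^esub> h) = c \<odot>\<^bsub>tensor_k_module k H H\<^esub> comult H h"
    and comult_mult: "h \<in> carrier H \<Longrightarrow> g \<in> carrier H \<Longrightarrow>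
      comult H (h \<otimes>\<^bsub>H\<^esub> g) =
        sweedler HH (comult H h) (\<lambda>h1 h2. sweedler HH (comult H g) (\<lambda>g1 g2.
          pure HH (h1 \<otimes>\<^bsub>H\<^esub> g1) (h2 \<otimes>\<^bsub>H\<^esub> g2)))"
    and comult_one: "comult H \<one>\<^bsub>H\<^esub> = pure HH \<one>\<^bsub>H\<^esub> \<one>\<^bsub>H\<^esub>"
    and coassoc: "h \<in> carrier H \<Longrightarrow>
      sweedler HHH (comult H h) (\<lambda>h1 h2. sweedler HHH (comult H h1) (\<lambda>x y.
        pure HHH (pure HH x y) h2)) =
      sweedler HHH (comult H h) (\<lambda>h1 h2. sweedler HHH (comult H h2) (\<lambda>x y.
        pure HHH (pure HH h1 x) y))"
    and counit_closed: "h \<in> carrier H \<Longrightarrow> counit H h \<in> carrier k"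
    and counit_add: "h \<in> carrier H \<Longrightarrow> g \<in> carrier H \<Longrightarrow>
      counit H (h \<oplus>\<^bsub>H\<^esub> g) = counit H h \<oplus>\<^bsub>k\<^esub> counit H g"
    and counit_smult: "c \<in> carrier k \<Longrightarrow> h \<in> carrier H \<Longrightarrow>
      counit H (c \<odot>\<^bsub>H\<^esub> h) = c \<otimes>\<^bsub>k\<^esub> counit H h"
    and counit_mult: "h \<in> carrier H \<Longrightarrow> g \<in> carrier H \<Longrightarrow>
      counit H (h \<otimes>\<^bsub>H\<^esub> g) = counit H h \<otimes>\<^bsub>k\<^esub> counit H g"
    and counit_one: "counit H \<one>\<^bsub>H\<^esub> = \<one>\<^bsub>k\<^esub>"
    and counit_left: "h \<in> carrier H \<Longrightarrow>
      sweedler H (comult H h) (\<lambda>h1 h2. counit H h1 \<odot>\<^bsub>H\<^esub> h2) = h"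
    and counit_right: "h \<in> carrier H \<Longrightarrow>
      sweedler H (comult H h) (\<lambda>h1 h2. counit H h2 \<odot>\<^bsub>H\<^esub> h1) = h"

record ('k, 'h, 'm) H_module = "('k, 'm) module" +
  hact :: "'h \<Rightarrow> 'm \<Rightarrow> 'm"

text \<open>\<open>k\<close>-linearity of the actions says that they induce the given \<open>k\<close>-module structure.\<close>

locale H_module =
  fixes k :: "'k ring" and H :: "('k, 'h) bialgebra" and M :: "('k, 'h, 'm, 'x) H_module_scheme"
  assumes k_module: "module k M"
    and left_H_module: "left_module H M (hact M)"
    and hact_smult: "c \<in> carrier k \<Longrightarrow> h \<in> carrier H \<Longrightarrow> m \<in> carrier M \<Longrightarrow>
      hact M (c \<odot>\<^bsub>H\<^esub> h) m = c \<odot>\<^bsub>M\<^esub> hact M h m"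

locale module_algebra = k_algebra k A + H_module k H A
  for k :: "'k ring" and H :: "('k, 'h) bialgebra" and A :: "('k, 'h, 'a) H_module" +
  assumes hact_mult: "h \<in> carrier H \<Longrightarrow> a \<in> carrier A \<Longrightarrow> b \<in> carrier A \<Longrightarrow>
      hact A h (a \<otimes>\<^bsub>A\<^esub> b) = sweedler A (comult H h) (\<lambda>h1 h2. hact A h1 a \<otimes>\<^bsub>A\<^esub> hact A h2 b)"
    and hact_one: "h \<in> carrier H \<Longrightarrow> hact A h \<one>\<^bsub>A\<^esub> = counit H h \<odot>\<^bsub>A\<^esub> \<one>\<^bsub>A\<^esub>"


section \<open>Modules and bimodules over a module algebra\<close>

record ('k, 'h, 'a, 'm) HA_module = "('k, 'h, 'm) H_module" +
  ract :: "'m \<Rightarrow> 'a \<Rightarrow> 'm"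

record ('k, 'h, 'a, 'm) HA_bimodule = "('k, 'h, 'a, 'm) HA_module" +
  lact :: "'a \<Rightarrow> 'm \<Rightarrow> 'm"

locale HA_module = H_module k H M
  for k :: "'k ring" and H :: "('k, 'h) bialgebra" and A :: "('k, 'h, 'a) H_module"
    and M :: "('k, 'h, 'a, 'm, 'x) HA_module_scheme" +
  assumes right_A_module: "right_module A M (ract M)"
    and ract_smult: "c \<in> carrier k \<Longrightarrow> a \<in> carrier A \<Longrightarrow> m \<in> carrier M \<Longrightarrow>
      ract M m (c \<odot>\<^bsub>A\<^esub> a) = c \<odot>\<^bsub>M\<^esub> ract M m a"
    and hact_ract: "h \<in> carrier H \<Longrightarrow> a \<in> carrier A \<Longrightarrow> m \<in> carrier M \<Longrightarrow>
      hact M h (ract M m a) = sweedler M (comult H h) (\<lambda>h1 h2. ract M (hact M h1 m) (hact A h2 a))"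

locale HA_bimodule = HA_module k H A M
  for k :: "'k ring" and H :: "('k, 'h) bialgebra" and A :: "('k, 'h, 'a) H_module"
    and M :: "('k, 'h, 'a, 'm, 'x) HA_bimodule_scheme" +
  assumes left_A_module: "left_module A M (lact M)"
    and lact_smult: "c \<in> carrier k \<Longrightarrow> a \<in> carrier A \<Longrightarrow> m \<in> carrier M \<Longrightarrow>
      lact M (c \<odot>\<^bsub>A\<^esub> a) m = c \<odot>\<^bsub>M\<^esub> lact M a m"
    and lact_ract: "a \<in> carrier A \<Longrightarrow> b \<in> carrier A \<Longrightarrow> m \<in> carrier M \<Longrightarrow>
      ract M (lact M a m) b = lact M a (ract M m b)"
    and hact_lact: "h \<in> carrier H \<Longrightarrow> a \<in> carrier A \<Longrightarrow> m \<in> carrier M \<Longrightarrow>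
      hact M h (lact M a m) = sweedler M (comult H h) (\<lambda>h1 h2. lact M (hact A h1 a) (hact M h2 m))"

subsection \<open>Tensor products over \<open>A\<close> and their actions\<close>

definition tensor_A ::
  "('k, 'h, 'a) H_module \<Rightarrow> ('k, 'h, 'a, 'm, 'x) HA_module_scheme \<Rightarrow>
   ('k, 'h, 'a, 'n, 'y) HA_bimodule_scheme \<Rightarrow> ('m, 'n) tensor ring" where
  "tensor_A A M N = tensor A M (ract M) N (lact N)"

definition tensor_ract ::
  "('k, 'h, 'a) H_module \<Rightarrow> ('k, 'h, 'a, 'm, 'x) HA_module_scheme \<Rightarrow>
   ('k, 'h, 'a, 'n, 'y) HA_bimodule_scheme \<Rightarrow> ('m, 'n) tensor \<Rightarrow> 'a \<Rightarrow> ('m, 'n) tensor" where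
  "tensor_ract A M N t a = (let T = tensor_A A M N in
     sweedler T t (\<lambda>m n. pure T m (ract N n a)))"

definition tensor_lact ::
  "('k, 'h, 'a) H_module \<Rightarrow> ('k, 'h, 'a, 'm, 'x) HA_bimodule_scheme \<Rightarrow>
   ('k, 'h, 'a, 'n, 'y) HA_bimodule_scheme \<Rightarrow> 'a \<Rightarrow> ('m, 'n) tensor \<Rightarrow> ('m, 'n) tensor" where
  "tensor_lact A M N a t = (let T = tensor_A A M N in
     sweedler T t (\<lambda>m n. pure T (lact M a m) n))"

definition tensor_hact ::
  "('k, 'h) bialgebra \<Rightarrow> ('k, 'h, 'a) H_module \<Rightarrow> ('k, 'h, 'a, 'm, 'x) HA_module_scheme \<Rightarrow>
   ('k, 'h, 'a, 'n, 'y) HA_bimodule_scheme \<Rightarrow> 'h \<Rightarrow> ('m, 'n) tensor \<Rightarrow> ('m, 'n) tensor" where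
  "tensor_hact H A M N h t = (let T = tensor_A A M N in
     sweedler T t (\<lambda>m n. sweedler T (comult H h) (\<lambda>h1 h2. pure T (hact M h1 m) (hact N h2 n))))"

text \<open>\<open>(M \<otimes>\<^sub>A N) \<otimes>\<^sub>A N\<close>\<close>

definition tensor_A2 ::
  "('k, 'h, 'a) H_module \<Rightarrow> ('k, 'h, 'a, 'm, 'x) HA_module_scheme \<Rightarrow>
   ('k, 'h, 'a, 'n, 'y) HA_bimodule_scheme \<Rightarrow> (('m, 'n) tensor, 'n) tensor ring" where
  "tensor_A2 A M N = tensor A (tensor_A A M N) (tensor_ract A M N) N (lact N)"


section \<open>Corings and comodules\<close>

record ('k, 'h, 'a, 'c) HA_coring = "('k, 'h, 'a, 'c) HA_bimodule" +
  ccomult :: "'c \<Rightarrow> ('c, 'c) tensor"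
  ccounit :: "'c \<Rightarrow> 'a"

locale HA_coring = HA_bimodule k H A C
  for k :: "'k ring" and H :: "('k, 'h) bialgebra" and A :: "('k, 'h, 'a) H_module"
    and C :: "('k, 'h, 'a, 'c) HA_coring" +
  fixes CC CCC
  defines "CC \<equiv> tensor_A A C C" and "CCC \<equiv> tensor_A2 A C C"
  assumes ccomult_closed: "c \<in> carrier C \<Longrightarrow> ccomult C c \<in> carrier CC"
    and ccomult_add: "c \<in> carrier C \<Longrightarrow> d \<in> carrier C \<Longrightarrow>
      ccomult C (c \<oplus>\<^bsub>C\<^esub> d) = ccomult C c \<oplus>\<^bsub>CC\<^esub> ccomult C d"
    and ccomult_lact: "a \<in> carrier A \<Longrightarrow> c \<in> carrier C \<Longrightarrow>
      ccomult C (lact C a c) = tensor_lact A C C a (ccomult C c)"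
    and ccomult_ract: "a \<in> carrier A \<Longrightarrow> c \<in> carrier C \<Longrightarrow>
      ccomult C (ract C c a) = tensor_ract A C C (ccomult C c) a"
    and ccomult_hact: "h \<in> carrier H \<Longrightarrow> c \<in> carrier C \<Longrightarrow>
      ccomult C (hact C h c) = tensor_hact H A C C h (ccomult C c)"
    and ccoassoc: "c \<in> carrier C \<Longrightarrow>
      sweedler CCC (ccomult C c) (\<lambda>c1 c2. sweedler CCC (ccomult C c1) (\<lambda>x y.
        pure CCC (pure CC x y) c2)) =
      sweedler CCC (ccomult C c) (\<lambda>c1 c2. sweedler CCC (ccomult C c2) (\<lambda>x y.
        pure CCC (pure CC c1 x) y))"
    and ccounit_closed: "c \<in> carrier C \<Longrightarrow> ccounit C c \<in> carrier A"
    and ccounit_add: "c \<in> carrier C \<Longrightarrow> d \<in> carrier C \<Longrightarrow>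
      ccounit C (c \<oplus>\<^bsub>C\<^esub> d) = ccounit C c \<oplus>\<^bsub>A\<^esub> ccounit C d"
    and ccounit_lact: "a \<in> carrier A \<Longrightarrow> c \<in> carrier C \<Longrightarrow>
      ccounit C (lact C a c) = a \<otimes>\<^bsub>A\<^esub> ccounit C c"
    and ccounit_ract: "a \<in> carrier A \<Longrightarrow> c \<in> carrier C \<Longrightarrow>
      ccounit C (ract C c a) = ccounit C c \<otimes>\<^bsub>A\<^esub> a"
    and ccounit_hact: "h \<in> carrier H \<Longrightarrow> c \<in> carrier C \<Longrightarrow>
      ccounit C (hact C h c) = hact A h (ccounit C c)"
    and ccounit_left: "c \<in> carrier C \<Longrightarrow>
      sweedler C (ccomult C c) (\<lambda>c1 c2. lact C (ccounit C c1) c2) = c"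
    and ccounit_right: "c \<in> carrier C \<Longrightarrow>
      sweedler C (ccomult C c) (\<lambda>c1 c2. ract C c1 (ccounit C c2)) = c"

record ('k, 'h, 'a, 'c, 'm) HC_comodule = "('k, 'h, 'a, 'm) HA_module" +
  coact :: "'m \<Rightarrow> ('m, 'c) tensor"

locale HC_comodule = HA_module k H A M
  for k :: "'k ring" and H :: "('k, 'h) bialgebra" and A :: "('k, 'h, 'a) H_module"
    and C :: "('k, 'h, 'a, 'c) HA_coring" and M :: "('k, 'h, 'a, 'c, 'm) HC_comodule" +
  fixes MC MCC
  defines "MC \<equiv> tensor_A A M C" and "MCC \<equiv> tensor_A2 A M C"
  assumes coact_closed: "m \<in> carrier M \<Longrightarrow> coact M m \<in> carrier MC"
    and coact_add: "m \<in> carrier M \<Longrightarrow> n \<in> carrier M \<Longrightarrow>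
      coact M (m \<oplus>\<^bsub>M\<^esub> n) = coact M m \<oplus>\<^bsub>MC\<^esub> coact M n"
    and coact_ract: "a \<in> carrier A \<Longrightarrow> m \<in> carrier M \<Longrightarrow>
      coact M (ract M m a) = tensor_ract A M C (coact M m) a"
    and coact_hact: "h \<in> carrier H \<Longrightarrow> m \<in> carrier M \<Longrightarrow>
      coact M (hact M h m) = tensor_hact H A M C h (coact M m)"
    and coact_coassoc: "m \<in> carrier M \<Longrightarrow>
      sweedler MCC (coact M m) (\<lambda>m0 c. sweedler MCC (coact M m0) (\<lambda>n d.
        pure MCC (pure MC n d) c)) =
      sweedler MCC (coact M m) (\<lambda>m0 c. sweedler MCC (ccomult C c) (\<lambda>x y.
        pure MCC (pure MC m0 x) y))"
    and coact_counit: "m \<in> carrier M \<Longrightarrow>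
      sweedler M (coact M m) (\<lambda>m0 c. ract M m0 (ccounit C c)) = m"

definition HC_hom ::
  "('k, 'h) bialgebra \<Rightarrow> ('k, 'h, 'a) H_module \<Rightarrow> ('k, 'h, 'a, 'c) HA_coring \<Rightarrow>
   ('k, 'h, 'a, 'c, 'm) HC_comodule \<Rightarrow> ('k, 'h, 'a, 'c, 'n) HC_comodule \<Rightarrow> ('m \<Rightarrow> 'n) set" where
  "HC_hom H A C M N = {f. f \<in> extensional (carrier M) \<and>
     right_linear A M (ract M) N (ract N) f \<and>
     (\<forall>h\<in>carrier H. \<forall>m\<in>carrier M. f (hact M h m) = hact N h (f m)) \<and>
     (\<forall>m\<in>carrier M. coact N (f m) =
        sweedler (tensor_A A N C) (coact M m) (\<lambda>m0 c. pure (tensor_A A N C) (f m0) c))}"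

text \<open>The category of right \<open>(H, C)\<close>-comodules with carrier in the universe.\<close>

definition comodule_category ::
  "'u set set \<Rightarrow> 'k ring \<Rightarrow> ('k, 'h) bialgebra \<Rightarrow> ('k, 'h, 'a) H_module \<Rightarrow>
   ('k, 'h, 'a, 'c) HA_coring \<Rightarrow>
   (('k, 'h, 'a, 'c, 'u) HC_comodule,
    ('k, 'h, 'a, 'c, 'u) HC_comodule \<times> ('u \<Rightarrow> 'u) \<times> ('k, 'h, 'a, 'c, 'u) HC_comodule) category" where
  "comodule_category U k H A C =
     (let obs = {M. HC_comodule k H A C M \<and> carrier M \<in> U} in
     \<lparr>Ob = obs,
      Arr = {(M, f, N). M \<in> obs \<and> N \<in> obs \<and> f \<in> HC_hom H A C M N},
      Dom = (\<lambda>(M, f, N). M),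
      Cod = (\<lambda>(M, f, N). N),
      Idt = (\<lambda>M. (M, \<lambda>x\<in>carrier M. x, M)),
      Comp = (\<lambda>(N, g, P) (M, f, N'). (M, compose (carrier M) g f, P))\<rparr>)"

end

theory Submission
  imports Defs
begin

text \<open>
  Every comodule is determined by additive maps on abelian groups, and the axioms of a comodule
  can be checked on additive generators. Colimits are therefore formed on the underlying abelian
  groups, where the structure maps extend by the universal property; no flatness is needed for
  this. Flatness makes \<open>- \<otimes>\<^sub>A C\<close> preserve kernels, so that a sub-\<open>(H, A)\<close>-module \<open>S\<close> of \<open>M\<close>
  whose coaction takes values in the image of \<open>S \<otimes>\<^sub>A C\<close> is a subcomodule; in particular kernels
  are computed on underlying groups. Exactness of filtered colimits is then an elementwise
  statement, proved by mapping into the group of germs. A subcomodule containing a given element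
  is obtained by closing under \<open>H\<close>, \<open>A\<close> and the components of the coaction; its cardinality is
  bounded independently of \<open>M\<close>, and the coproduct of all comodules of bounded size is a generator.
\<close>

section \<open>Additive maps and presented abelian groups\<close>

text \<open>The difficulty is well-definedness rather than algebra. \<open>sweedler\<close>
  evaluates a sum at an arbitrarily chosen representative, so each map out of a tensor product must
  be shown balanced before it can be used; for the diagonal action of H on
  \<open>M \<otimes>\<^sub>A C\<close> this costs the coassociativity of H. To keep that work in one
  place, tensor products and colimits are both treated as abelian groups presented by generators and
  relations, and additive maps are compared on generators. Size shapes the rest. Flatness speaks
  only of modules carried by members of U, whereas coassociativity lives in
  \<open>(M \<otimes>\<^sub>A C) \<otimes>\<^sub>A C\<close>, of another type; hence the transport
  lemmas. A generator must be a small coproduct, but the records of comodules on a given set form no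
  evidently small family, because their fields are arbitrary outside the carriers. The summands are
  therefore indexed by graphs of the structure maps, whose number is bounded by the power sets of H,
  A, C and the natural numbers.\<close>

definition additive :: "('m, 'x) ring_scheme \<Rightarrow> ('n, 'y) ring_scheme \<Rightarrow> ('m \<Rightarrow> 'n) \<Rightarrow> bool" where
  "additive M N f \<longleftrightarrow> f \<in> carrier M \<rightarrow> carrier N \<and>
     (\<forall>x\<in>carrier M. \<forall>y\<in>carrier M. f (x \<oplus>\<^bsub>M\<^esub> y) = f x \<oplus>\<^bsub>N\<^esub> f y)"

lemma additiveI:
  assumes "\<And>x. x \<in> carrier M \<Longrightarrow> f x \<in> carrier N"
    and "\<And>x y. x \<in> carrier M \<Longrightarrow> y \<in> carrier M \<Longrightarrow> f (x \<oplus>\<^bsub>M\<^esub> y) = f x \<oplus>\<^bsub>N\<^esub> f y"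
  shows "additive M N f"
  using assms by (auto simp: additive_def)

lemma additive_closed: "additive M N f \<Longrightarrow> x \<in> carrier M \<Longrightarrow> f x \<in> carrier N"
  by (auto simp: additive_def)

lemma additive_add:
  "additive M N f \<Longrightarrow> x \<in> carrier M \<Longrightarrow> y \<in> carrier M \<Longrightarrow> f (x \<oplus>\<^bsub>M\<^esub> y) = f x \<oplus>\<^bsub>N\<^esub> f y"
  by (auto simp: additive_def)

lemma additive_iff_hom: "additive M N f \<longleftrightarrow> f \<in> hom (add_monoid M) (add_monoid N)"
  by (simp add: additive_def hom_def)

lemma additive_comp:
  assumes "additive M N f" "additive N P g"
  shows "additive M P (\<lambda>x. g (f x))"
  using assms by (intro additiveI) (simp_all add: additive_closed additive_add)

lemma additive_cong:
  assumes "\<And>x. x \<in> carrier M \<Longrightarrow> f x = g x" and "abelian_group M"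
  shows "additive M N f = additive M N g"
proof -
  interpret abelian_group M by fact
  show ?thesis using assms(1) by (auto simp: additive_def Pi_def)
qed

lemma additive_group_hom:
  assumes "abelian_group M" "abelian_group N" "additive M N f"
  shows "group_hom (add_monoid M) (add_monoid N) f"
proof -
  interpret M: abelian_group M by fact
  interpret N: abelian_group N by fact
  show ?thesis
    using assms(3) M.a_group N.a_group
    by (simp add: group_hom_def group_hom_axioms_def additive_iff_hom)
qed

lemma additive_zero:
  assumes "abelian_group M" "abelian_group N" "additive M N f"
  shows "f \<zero>\<^bsub>M\<^esub> = \<zero>\<^bsub>N\<^esub>"
  using group_hom.hom_one[OF additive_group_hom[OF assms]] by simp

lemma additive_uminus:
  assumes "abelian_group M" "abelian_group N" "additive M N f" "x \<in> carrier M"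
  shows "f (\<ominus>\<^bsub>M\<^esub> x) = \<ominus>\<^bsub>N\<^esub> f x"
  using group_hom.hom_inv[OF additive_group_hom[OF assms(1-3)]] assms(4)
  by (simp add: a_inv_def)

lemma additive_minus:
  assumes "abelian_group M" "abelian_group N" "additive M N f" "x \<in> carrier M" "y \<in> carrier M"
  shows "f (x \<ominus>\<^bsub>M\<^esub> y) = f x \<ominus>\<^bsub>N\<^esub> f y"
proof -
  interpret M: abelian_group M by fact
  show ?thesis
    using assms by (simp add: a_minus_def additive_add[OF assms(3)] additive_uminus[OF assms(1-3)])
qed

lemma (in abelian_group) minus_eq_zero_iff:
  assumes "x \<in> carrier G" "y \<in> carrier G"
  shows "x \<ominus> y = \<zero> \<longleftrightarrow> x = y"
  using assms minus_equality[of x "\<ominus> y"] by (auto simp: a_minus_def r_neg)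

lemma additive_inj_onI:
  assumes "abelian_group M" "abelian_group N" "additive M N f"
    and "\<And>x. x \<in> carrier M \<Longrightarrow> f x = \<zero>\<^bsub>N\<^esub> \<Longrightarrow> x = \<zero>\<^bsub>M\<^esub>"
  shows "inj_on f (carrier M)"
proof -
  interpret M: abelian_group M by fact
  interpret N: abelian_group N by fact
  show ?thesis
  proof (rule inj_onI)
    fix x y assume xy: "x \<in> carrier M" "y \<in> carrier M" "f x = f y"
    then have "f (x \<ominus>\<^bsub>M\<^esub> y) = \<zero>\<^bsub>N\<^esub>"
      using additive_closed[OF assms(3)]
      by (simp add: additive_minus[OF assms(1-3)] N.minus_eq_zero_iff)
    then have "x \<ominus>\<^bsub>M\<^esub> y = \<zero>\<^bsub>M\<^esub>" using xy assms(4) by simp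
    then show "x = y" using xy M.minus_eq_zero_iff by simp
  qed
qed

lemma additive_finsum:
  assumes "abelian_group M" "abelian_group N" "additive M N f"
    and "finite I" "\<And>i. i \<in> I \<Longrightarrow> \<beta> i \<in> carrier M"
  shows "f (\<Oplus>\<^bsub>M\<^esub>i\<in>I. \<beta> i) = (\<Oplus>\<^bsub>N\<^esub>i\<in>I. f (\<beta> i))"
  using assms(4,5)
proof (induction I rule: finite_induct)
  case empty
  interpret M: abelian_group M by fact
  interpret N: abelian_group N by fact
  show ?case by (simp add: additive_zero[OF assms(1-3)])
next
  case (insert i I)
  interpret M: abelian_group M by fact
  interpret N: abelian_group N by fact
  have "f (\<Oplus>\<^bsub>M\<^esub>j\<in>insert i I. \<beta> j) = f (\<beta> i \<oplus>\<^bsub>M\<^esub> (\<Oplus>\<^bsub>M\<^esub>j\<in>I. \<beta> j))"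
    using insert by (subst M.finsum_insert) auto
  also have "\<dots> = f (\<beta> i) \<oplus>\<^bsub>N\<^esub> (\<Oplus>\<^bsub>N\<^esub>j\<in>I. f (\<beta> j))"
    using insert by (subst additive_add[OF assms(3)]) (auto intro!: M.finsum_closed)
  also have "\<dots> = (\<Oplus>\<^bsub>N\<^esub>j\<in>insert i I. f (\<beta> j))"
    using insert additive_closed[OF assms(3)] by (subst N.finsum_insert) auto
  finally show ?case .
qed

lemma additive_add_pow_int:
  assumes "abelian_group M" "abelian_group N" "additive M N f" "x \<in> carrier M"
  shows "f ([(n::int)] \<cdot>\<^bsub>M\<^esub> x) = [n] \<cdot>\<^bsub>N\<^esub> (f x)"
  using group_hom.hom_int_pow[OF additive_group_hom[OF assms(1-3)]] assms(4)
  by (simp add: add_pow_def)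

lemma additive_zero_map:
  assumes "abelian_group N" shows "additive M N (\<lambda>_. \<zero>\<^bsub>N\<^esub>)"
proof -
  interpret abelian_group N by fact
  show ?thesis by (simp add: additive_def)
qed

lemma additive_sum_map:
  assumes "abelian_group N" "additive M N f" "additive M N g"
  shows "additive M N (\<lambda>x. f x \<oplus>\<^bsub>N\<^esub> g x)"
proof -
  interpret abelian_group N by fact
  show ?thesis using assms by (intro additiveI) (auto simp: additive_closed additive_add a_ac)
qed

lemma additive_uminus_map:
  assumes "abelian_group N" "additive M N f"
  shows "additive M N (\<lambda>x. \<ominus>\<^bsub>N\<^esub> f x)"
proof -
  interpret abelian_group N by fact
  show ?thesis using assms by (intro additiveI) (auto simp: additive_closed additive_add minus_add)
qed

subsection \<open>Additive extension to the free abelian group\<close>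

text \<open>The value at \<open>x\<close> of the homomorphism from the free abelian group that
  extends \<open>\<beta>\<close>. \<open>sweedler\<close> is this sum at a chosen element of a
  coset, see \<open>sweedler_eq_frag_sum\<close>.\<close>

definition frag_sum :: "('g, 'x) ring_scheme \<Rightarrow> ('s \<Rightarrow> 'g) \<Rightarrow> ('s \<Rightarrow>\<^sub>0 int) \<Rightarrow> 'g" where
  "frag_sum G \<beta> x =
     (\<Oplus>\<^bsub>G\<^esub>p\<in>Poly_Mapping.keys x. [Poly_Mapping.lookup x p] \<cdot>\<^bsub>G\<^esub> \<beta> p)"

lemma frag_sum_cong:
  assumes "abelian_group G" "\<And>p. p \<in> Poly_Mapping.keys x \<Longrightarrow> \<beta> p \<in> carrier G"
    "\<And>p. p \<in> Poly_Mapping.keys x \<Longrightarrow> \<beta> p = \<beta>' p"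
  shows "frag_sum G \<beta> x = frag_sum G \<beta>' x"
proof -
  interpret abelian_group G by fact
  show ?thesis unfolding frag_sum_def
    using assms(2,3) by (intro finsum_cong') (auto)
qed

lemma frag_sum_additive:
  assumes "abelian_group M" "abelian_group N" "additive M N f"
    and "\<And>p. p \<in> Poly_Mapping.keys x \<Longrightarrow> \<beta> p \<in> carrier M"
  shows "f (frag_sum M \<beta> x) = frag_sum N (\<lambda>p. f (\<beta> p)) x"
proof -
  interpret M: abelian_group M by fact
  interpret N: abelian_group N by fact
  have "f (frag_sum M \<beta> x) =
    (\<Oplus>\<^bsub>N\<^esub>p\<in>Poly_Mapping.keys x. f ([Poly_Mapping.lookup x p] \<cdot>\<^bsub>M\<^esub> \<beta> p))"
    unfolding frag_sum_def using assms by (intro additive_finsum) auto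
  also have "\<dots> = frag_sum N (\<lambda>p. f (\<beta> p)) x"
    unfolding frag_sum_def using assms(4) additive_closed[OF assms(3)]
    by (intro N.finsum_cong') (auto simp: additive_add_pow_int[OF assms(1-3)])
  finally show ?thesis .
qed

context abelian_group
begin

lemma frag_sum_closed:
  "(\<And>p. p \<in> Poly_Mapping.keys x \<Longrightarrow> \<beta> p \<in> carrier G) \<Longrightarrow> frag_sum G \<beta> x \<in> carrier G"
  unfolding frag_sum_def by (intro finsum_closed) auto

text \<open>Summation over a common finite index set makes two elements with different supports
  comparable; the added indices have coefficient 0.\<close>

lemma frag_sum_superset:
  assumes "finite B" "Poly_Mapping.keys x \<subseteq> B" "\<And>p. p \<in> B \<Longrightarrow> \<beta> p \<in> carrier G"
  shows "frag_sum G \<beta> x = (\<Oplus>p\<in>B. [Poly_Mapping.lookup x p] \<cdot> \<beta> p)"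
proof -
  have "[Poly_Mapping.lookup x p] \<cdot> \<beta> p = \<zero>" if "p \<in> B - Poly_Mapping.keys x" for p
    using that by (simp add: in_keys_iff add_pow_def)
  then show ?thesis
    unfolding frag_sum_def using assms by (intro add.finprod_mono_neutral_cong_left) auto
qed

lemma frag_sum_0 [simp]: "frag_sum G \<beta> 0 = \<zero>"
  by (simp add: frag_sum_def)

lemma frag_sum_frag_of:
  assumes "\<beta> s \<in> carrier G" shows "frag_sum G \<beta> (frag_of s) = \<beta> s"
proof -
  have "(\<Oplus>p\<in>{s}. [Poly_Mapping.lookup (frag_of s) p] \<cdot> \<beta> p) = [(1::int)] \<cdot> \<beta> s"
    using assms by (subst finsum_insert) auto
  also have "\<dots> = \<beta> s" using assms by (rule add.int_pow_1)
  finally show ?thesis by (simp add: frag_sum_def)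
qed

lemma frag_sum_add:
  assumes "\<And>p. p \<in> Poly_Mapping.keys x \<union> Poly_Mapping.keys y \<Longrightarrow> \<beta> p \<in> carrier G"
  shows "frag_sum G \<beta> (x + y) = frag_sum G \<beta> x \<oplus> frag_sum G \<beta> y"
proof -
  let ?B = "Poly_Mapping.keys x \<union> Poly_Mapping.keys y"
  have "frag_sum G \<beta> (x + y) = (\<Oplus>p\<in>?B. [Poly_Mapping.lookup (x + y) p] \<cdot> \<beta> p)"
    using assms by (intro frag_sum_superset) (auto dest: subsetD[OF keys_add])
  also have "\<dots> = (\<Oplus>p\<in>?B. [Poly_Mapping.lookup x p] \<cdot> \<beta> p \<oplus> [Poly_Mapping.lookup y p] \<cdot> \<beta> p)"
    using assms by (intro finsum_cong') (auto simp: lookup_add add.int_pow_mult)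
  also have "\<dots> = (\<Oplus>p\<in>?B. [Poly_Mapping.lookup x p] \<cdot> \<beta> p) \<oplus> (\<Oplus>p\<in>?B. [Poly_Mapping.lookup y p] \<cdot> \<beta> p)"
    using assms by (intro finsum_addf) auto
  also have "\<dots> = frag_sum G \<beta> x \<oplus> frag_sum G \<beta> y"
    using assms frag_sum_superset[of ?B x \<beta>] frag_sum_superset[of ?B y \<beta>] by auto
  finally show ?thesis .
qed

text \<open>Additivity applied to \<open>(x - y) + y\<close> and solved for the first
  summand.\<close>

lemma frag_sum_diff:
  assumes "\<And>p. p \<in> Poly_Mapping.keys x \<union> Poly_Mapping.keys y \<Longrightarrow> \<beta> p \<in> carrier G"
  shows "frag_sum G \<beta> (x - y) = frag_sum G \<beta> x \<ominus> frag_sum G \<beta> y"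
proof -
  have "frag_sum G \<beta> (x - y) \<oplus> frag_sum G \<beta> y = frag_sum G \<beta> ((x - y) + y)"
    using assms by (intro frag_sum_add[symmetric]) (auto dest: subsetD[OF keys_diff])
  moreover have "frag_sum G \<beta> (x - y) \<in> carrier G"
    using assms by (intro frag_sum_closed) (auto dest: subsetD[OF keys_diff])
  moreover have "frag_sum G \<beta> x \<in> carrier G" "frag_sum G \<beta> y \<in> carrier G"
    using assms by (auto intro: frag_sum_closed)
  ultimately show ?thesis
    by (simp add: a_minus_def add.inv_solve_right)
qed

lemma frag_sum_hom:
  assumes "\<And>p. p \<in> S \<Longrightarrow> \<beta> p \<in> carrier G"
  shows "frag_sum G \<beta> \<in> hom (free_Abelian_group S) (add_monoid G)"
proof (rule homI)
  show "frag_sum G \<beta> x \<in> carrier (add_monoid G)" if "x \<in> carrier (free_Abelian_group S)" for x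
    using that assms by (auto intro: frag_sum_closed)
  show "frag_sum G \<beta> (x \<otimes>\<^bsub>free_Abelian_group S\<^esub> y) =
      frag_sum G \<beta> x \<otimes>\<^bsub>add_monoid G\<^esub> frag_sum G \<beta> y"
    if "x \<in> carrier (free_Abelian_group S)" "y \<in> carrier (free_Abelian_group S)" for x y
    using that assms frag_sum_add[of x y \<beta>] by auto
qed

text \<open>The kernel of the extended homomorphism is a subgroup, so with the relations it contains
  everything that they generate.\<close>

lemma frag_sum_generate:
  assumes "\<And>p. p \<in> S \<Longrightarrow> \<beta> p \<in> carrier G"
    and "R \<subseteq> carrier (free_Abelian_group S)" "\<And>r. r \<in> R \<Longrightarrow> frag_sum G \<beta> r = \<zero>"
    and "x \<in> generate (free_Abelian_group S) R"
  shows "frag_sum G \<beta> x = \<zero>"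
proof -
  interpret F: group "free_Abelian_group S" by simp
  interpret group_hom "free_Abelian_group S" "add_monoid G" "frag_sum G \<beta>"
    using frag_sum_hom[OF assms(1)] by unfold_locales auto
  have "R \<subseteq> kernel (free_Abelian_group S) (add_monoid G) (frag_sum G \<beta>)"
    using assms(2,3) by (auto simp: kernel_def simp del: carrier_free_Abelian_group_iff)
  then have "generate (free_Abelian_group S) R \<subseteq> kernel (free_Abelian_group S) (add_monoid G) (frag_sum G \<beta>)"
    by (intro F.generate_subgroup_incl subgroup_kernel)
  then show ?thesis using assms(4) by (auto simp: kernel_def)
qed

lemma frag_sum_add_fun:
  assumes "\<And>p. p \<in> Poly_Mapping.keys x \<Longrightarrow> \<beta> p \<in> carrier G"
    "\<And>p. p \<in> Poly_Mapping.keys x \<Longrightarrow> \<gamma> p \<in> carrier G"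
  shows "frag_sum G (\<lambda>p. \<beta> p \<oplus> \<gamma> p) x = frag_sum G \<beta> x \<oplus> frag_sum G \<gamma> x"
proof -
  have "frag_sum G (\<lambda>p. \<beta> p \<oplus> \<gamma> p) x = (\<Oplus>p\<in>Poly_Mapping.keys x.
    [Poly_Mapping.lookup x p] \<cdot> \<beta> p \<oplus> [Poly_Mapping.lookup x p] \<cdot> \<gamma> p)"
    unfolding frag_sum_def using assms
    by (intro finsum_cong') (auto simp: add.int_pow_distrib)
  also have "\<dots> = frag_sum G \<beta> x \<oplus> frag_sum G \<gamma> x"
    unfolding frag_sum_def using assms by (intro finsum_addf) auto
  finally show ?thesis .
qed

end

subsection \<open>Quotients\<close>

text \<open>The dummy fields agree with those of \<open>tensor\<close>, so a tensor product is
  literally of this form (\<open>T_eq\<close>) and the coset facts below apply to it.\<close>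

definition additive_group :: "('a, 'x) monoid_scheme \<Rightarrow> 'a ring" where
  "additive_group Q = \<lparr>carrier = carrier Q, monoid.mult = undefined, one = undefined,
     zero = \<one>\<^bsub>Q\<^esub>, add = monoid.mult Q\<rparr>"

lemma carrier_additive_group [simp]: "carrier (additive_group Q) = carrier Q"
  and zero_additive_group [simp]: "\<zero>\<^bsub>additive_group Q\<^esub> = \<one>\<^bsub>Q\<^esub>"
  and add_additive_group [simp]: "x \<oplus>\<^bsub>additive_group Q\<^esub> y = x \<otimes>\<^bsub>Q\<^esub> y"
  by (simp_all add: additive_group_def)

lemma abelian_group_additive_group:
  assumes "comm_group Q" shows "abelian_group (additive_group Q)"
proof -
  interpret comm_group Q by fact
  show ?thesis
    by (intro abelian_groupI) (auto simp: m_ac intro: l_inv_ex)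
qed

text \<open>Besides the group structure the list records which elements a coset has:
  \<open>pure\<close> and \<open>sweedler\<close> work with members of cosets, and the last two
  facts translate membership into equality of cosets.\<close>

lemma quotient_group:
  assumes "comm_group F" "subgroup K F"
  shows "abelian_group (additive_group (F Mod K))"
    and "carrier (additive_group (F Mod K)) = (\<lambda>x. K #>\<^bsub>F\<^esub> x) ` carrier F"
    and "x \<in> carrier F \<Longrightarrow> y \<in> carrier F \<Longrightarrow>
      (K #>\<^bsub>F\<^esub> (x \<otimes>\<^bsub>F\<^esub> y)) = (K #>\<^bsub>F\<^esub> x) \<oplus>\<^bsub>additive_group (F Mod K)\<^esub> (K #>\<^bsub>F\<^esub> y)"
    and "x \<in> carrier F \<Longrightarrow> y \<in> carrier F \<Longrightarrow>
      (K #>\<^bsub>F\<^esub> x) = (K #>\<^bsub>F\<^esub> y) \<longleftrightarrow> x \<otimes>\<^bsub>F\<^esub> inv\<^bsub>F\<^esub> y \<in> K"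
    and "x \<in> carrier F \<Longrightarrow> (K #>\<^bsub>F\<^esub> x) = \<zero>\<^bsub>additive_group (F Mod K)\<^esub> \<longleftrightarrow> x \<in> K"
    and "x \<in> carrier F \<Longrightarrow> x \<in> (K #>\<^bsub>F\<^esub> x)"
    and "x \<in> carrier F \<Longrightarrow> y \<in> (K #>\<^bsub>F\<^esub> x) \<Longrightarrow> y \<in> carrier F \<and> (K #>\<^bsub>F\<^esub> y) = (K #>\<^bsub>F\<^esub> x)"
proof -
  interpret F: comm_group F by fact
  interpret K: subgroup K F by fact
  interpret N: normal K F using F.subgroup_imp_normal assms(2) by blast
  show "abelian_group (additive_group (F Mod K))"
    by (intro abelian_group_additive_group F.abelian_FactGroup assms)
  show "carrier (additive_group (F Mod K)) = (\<lambda>x. K #>\<^bsub>F\<^esub> x) ` carrier F"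
    by (simp add: carrier_FactGroup)
  show "(K #>\<^bsub>F\<^esub> (x \<otimes>\<^bsub>F\<^esub> y)) = (K #>\<^bsub>F\<^esub> x) \<oplus>\<^bsub>additive_group (F Mod K)\<^esub> (K #>\<^bsub>F\<^esub> y)"
    if "x \<in> carrier F" "y \<in> carrier F" for x y
    using that by (simp add: N.rcos_sum)
  show *: "(K #>\<^bsub>F\<^esub> x) = (K #>\<^bsub>F\<^esub> y) \<longleftrightarrow> x \<otimes>\<^bsub>F\<^esub> inv\<^bsub>F\<^esub> y \<in> K" if "x \<in> carrier F" "y \<in> carrier F" for x y
    using that assms(2) K.rcos_module[OF F.is_group, of y x] F.rcos_self[of x K]
      F.repr_independence[of x K y] by auto
  have K1: "K = K #>\<^bsub>F\<^esub> \<one>\<^bsub>F\<^esub>"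
    using K.subset by simp
  show "(K #>\<^bsub>F\<^esub> x) = \<zero>\<^bsub>additive_group (F Mod K)\<^esub> \<longleftrightarrow> x \<in> K" if "x \<in> carrier F" for x
    using *[of x "\<one>\<^bsub>F\<^esub>"] that K1 by simp
  show "x \<in> (K #>\<^bsub>F\<^esub> x)" if "x \<in> carrier F" for x
    using that assms(2) by (rule F.rcos_self)
  show "y \<in> carrier F \<and> (K #>\<^bsub>F\<^esub> y) = (K #>\<^bsub>F\<^esub> x)" if "x \<in> carrier F" "y \<in> (K #>\<^bsub>F\<^esub> x)" for x y
    using that assms(2) F.repr_independence[of y K x] K.elemrcos_carrier[OF F.is_group] by blast
qed

subsection \<open>Groups given by generators and relations\<close>

text \<open>The quotient is described by a surjection \<open>q\<close> with prescribed kernel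
  instead of being fixed as a set of cosets. So one theory serves tensor products, which are sets of
  cosets, and colimits, which must be copied onto a subset of \<open>'u\<close>.\<close>

locale presented =
  fixes S :: "'s set" and R :: "('s \<Rightarrow>\<^sub>0 int) set" and L :: "('l, 'x) ring_scheme"
    and q :: "('s \<Rightarrow>\<^sub>0 int) \<Rightarrow> 'l"
  assumes L_group: "abelian_group L"
    and relations: "R \<subseteq> carrier (free_Abelian_group S)"
    and q_hom: "q \<in> hom (free_Abelian_group S) (add_monoid L)"
    and q_surj: "q ` carrier (free_Abelian_group S) = carrier L"
    and q_kernel: "Poly_Mapping.keys x \<subseteq> S \<Longrightarrow> q x = \<zero>\<^bsub>L\<^esub> \<longleftrightarrow> x \<in> generate (free_Abelian_group S) R"
begin

text \<open>Defined by an arbitrary preimage; \<open>lift_q\<close> shows independence of it once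
  \<open>\<beta>\<close> kills the relations.\<close>

definition lift :: "('g, 'y) ring_scheme \<Rightarrow> ('s \<Rightarrow> 'g) \<Rightarrow> 'l \<Rightarrow> 'g" where
  "lift G \<beta> y = frag_sum G \<beta> (SOME x. Poly_Mapping.keys x \<subseteq> S \<and> q x = y)"

lemma q_closed: "Poly_Mapping.keys x \<subseteq> S \<Longrightarrow> q x \<in> carrier L"
  using q_hom by (auto simp: hom_def)

lemma q_add:
  "Poly_Mapping.keys x \<subseteq> S \<Longrightarrow> Poly_Mapping.keys y \<subseteq> S \<Longrightarrow> q (x + y) = q x \<oplus>\<^bsub>L\<^esub> q y"
  using q_hom by (auto simp: hom_def)

lemma ex_q: assumes "y \<in> carrier L" obtains x where "Poly_Mapping.keys x \<subseteq> S" "q x = y"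
proof -
  have "y \<in> q ` carrier (free_Abelian_group S)" using assms by (simp only: q_surj)
  then show thesis using that by (elim imageE) simp
qed

lemma q_diff:
  assumes "Poly_Mapping.keys x \<subseteq> S" "Poly_Mapping.keys y \<subseteq> S"
  shows "q (x - y) = q x \<ominus>\<^bsub>L\<^esub> q y"
proof -
  interpret L: abelian_group L by (rule L_group)
  have k: "Poly_Mapping.keys (x - y) \<subseteq> S" using assms keys_diff[of x y] by blast
  have "q (x - y) \<oplus>\<^bsub>L\<^esub> q y = q x" using q_add[OF k assms(2)] by (simp only: diff_add_cancel)
  then show ?thesis
    using q_closed[OF k] q_closed[OF assms(1)] q_closed[OF assms(2)]
    by (simp add: a_minus_def L.add.inv_solve_right)
qed

lemma q_zero: "q 0 = \<zero>\<^bsub>L\<^esub>"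
proof -
  interpret L: abelian_group L by (rule L_group)
  have "group_hom (free_Abelian_group S) (add_monoid L) q"
    using q_hom L.a_group by (simp add: group_hom_def group_hom_axioms_def)
  from group_hom.hom_one[OF this] show ?thesis by simp
qed

lemma induct_presented [consumes 1, case_names gen zero add uminus]:
  assumes "y \<in> carrier L" and gen: "\<And>s. s \<in> S \<Longrightarrow> P (q (frag_of s))"
    and zero: "P \<zero>\<^bsub>L\<^esub>"
    and add: "\<And>x y. x \<in> carrier L \<Longrightarrow> y \<in> carrier L \<Longrightarrow> P x \<Longrightarrow> P y \<Longrightarrow> P (x \<oplus>\<^bsub>L\<^esub> y)"
    and uminus: "\<And>x. x \<in> carrier L \<Longrightarrow> P x \<Longrightarrow> P (\<ominus>\<^bsub>L\<^esub> x)"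
  shows "P y"
proof -
  interpret L: abelian_group L by (rule L_group)
  obtain x where x: "Poly_Mapping.keys x \<subseteq> S" "q x = y" using ex_q[OF assms(1)] .
  have "P (q x)"
  proof (rule free_Abelian_group_induct[OF x(1)])
    show "P (q 0)" by (simp add: q_zero zero)
    show "P (q (x - y))"
      if "Poly_Mapping.keys x \<subseteq> S" "Poly_Mapping.keys y \<subseteq> S" "P (q x)" "P (q y)" for x y
      using that by (simp add: q_diff a_minus_def add uminus q_closed)
  qed (rule gen)
  then show ?thesis using x by simp
qed

context
  fixes G :: "('g, 'y) ring_scheme" and \<beta> :: "'s \<Rightarrow> 'g"
  assumes G: "abelian_group G"
    and \<beta>: "\<And>s. s \<in> S \<Longrightarrow> \<beta> s \<in> carrier G"
    and kills: "\<And>x. x \<in> R \<Longrightarrow> frag_sum G \<beta> x = \<zero>\<^bsub>G\<^esub>"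
begin

text \<open>Two preimages of the same element differ by a member of the subgroup generated by
  \<open>R\<close>, on which \<open>frag_sum_generate\<close> gives the value 0.\<close>

lemma lift_q:
  assumes "Poly_Mapping.keys x \<subseteq> S" shows "lift G \<beta> (q x) = frag_sum G \<beta> x"
proof -
  interpret G: abelian_group G by (rule G)
  interpret L: abelian_group L by (rule L_group)
  define z where "z = (SOME z. Poly_Mapping.keys z \<subseteq> S \<and> q z = q x)"
  have "Poly_Mapping.keys z \<subseteq> S \<and> q z = q x"
    unfolding z_def by (rule someI_ex) (use assms in blast)
  then have z: "Poly_Mapping.keys z \<subseteq> S" and zx: "q z = q x" by blast+
  have k: "Poly_Mapping.keys (z - x) \<subseteq> S" using assms z keys_diff[of z x] by blast
  have "q (z - x) = q x \<ominus>\<^bsub>L\<^esub> q x" using q_diff[OF z assms] by (simp only: zx)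
  also have "\<dots> = \<zero>\<^bsub>L\<^esub>" using L.minus_eq_zero_iff q_closed[OF assms] by blast
  finally have mem: "z - x \<in> generate (free_Abelian_group S) R" by (simp only: q_kernel[OF k])
  have 1: "frag_sum G \<beta> (z - x) = \<zero>\<^bsub>G\<^esub>"
    by (rule G.frag_sum_generate[OF \<beta> relations kills mem])
  have cl: "\<beta> p \<in> carrier G" if "p \<in> Poly_Mapping.keys z \<union> Poly_Mapping.keys x" for p
    using that z assms \<beta> by blast
  have 2: "frag_sum G \<beta> (z - x) = frag_sum G \<beta> z \<ominus>\<^bsub>G\<^esub> frag_sum G \<beta> x"
    using cl by (rule G.frag_sum_diff)
  have "frag_sum G \<beta> z \<in> carrier G" "frag_sum G \<beta> x \<in> carrier G"
    using cl by (blast intro: G.frag_sum_closed)+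
  then have "frag_sum G \<beta> z = frag_sum G \<beta> x"
    using 1 2 G.minus_eq_zero_iff by simp
  then show ?thesis by (simp only: lift_def z_def)
qed

lemma lift_gen: "s \<in> S \<Longrightarrow> lift G \<beta> (q (frag_of s)) = \<beta> s"
  using lift_q[of "frag_of s"] abelian_group.frag_sum_frag_of[OF G, of \<beta> s] \<beta>[of s] by simp

lemma lift_additive: "additive L G (lift G \<beta>)"
proof -
  interpret G: abelian_group G by (rule G)
  show ?thesis
  proof (rule additiveI)
    fix x y assume "x \<in> carrier L" "y \<in> carrier L"
    then obtain x' y' where *: "Poly_Mapping.keys x' \<subseteq> S" "q x' = x"
      "Poly_Mapping.keys y' \<subseteq> S" "q y' = y"
      by (meson ex_q)
    then have "x \<oplus>\<^bsub>L\<^esub> y = q (x' + y')" by (simp add: q_add)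
    moreover have "Poly_Mapping.keys (x' + y') \<subseteq> S" using * keys_add[of x' y'] by blast
    ultimately show "lift G \<beta> (x \<oplus>\<^bsub>L\<^esub> y) = lift G \<beta> x \<oplus>\<^bsub>G\<^esub> lift G \<beta> y"
      using * lift_q[of x'] lift_q[of y'] lift_q[of "x' + y'"] \<beta>
      by (auto intro!: G.frag_sum_add)
  next
    fix x assume "x \<in> carrier L"
    then obtain x' where "Poly_Mapping.keys x' \<subseteq> S" "q x' = x" by (meson ex_q)
    then show "lift G \<beta> x \<in> carrier G"
      using lift_q[of x'] \<beta> by (auto intro!: G.frag_sum_closed)
  qed
qed

end

end

lemma presented_quotient:
  assumes "R \<subseteq> carrier (free_Abelian_group S)"
  defines "F \<equiv> free_Abelian_group S"
  defines "K \<equiv> generate F R"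
  shows "presented S R (additive_group (F Mod K)) (\<lambda>x. K #>\<^bsub>F\<^esub> x)"
proof -
  interpret F: comm_group F unfolding F_def by (rule abelian_free_Abelian_group)
  have K: "subgroup K F"
    unfolding K_def using assms(1) by (intro F.generate_is_subgroup) (simp add: F_def)
  note quot = quotient_group[OF F.comm_group_axioms K]
  show ?thesis
  proof (rule presented.intro)
    show "abelian_group (additive_group (F Mod K))" by (rule quot(1))
    show "R \<subseteq> carrier (free_Abelian_group S)" by fact
    show "(\<lambda>x. K #>\<^bsub>F\<^esub> x) \<in> hom (free_Abelian_group S) (add_monoid (additive_group (F Mod K)))"
      using quot(2,3) unfolding F_def[symmetric] by (intro homI) auto
    show "(\<lambda>x. K #>\<^bsub>F\<^esub> x) ` carrier (free_Abelian_group S) = carrier (additive_group (F Mod K))"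
      using quot(2) by (simp add: F_def)
    show "(K #>\<^bsub>F\<^esub> x) = \<zero>\<^bsub>additive_group (F Mod K)\<^esub> \<longleftrightarrow> x \<in> generate (free_Abelian_group S) R"
      if "Poly_Mapping.keys x \<subseteq> S" for x
      using quot(5)[of x] that by (simp add: F_def K_def)
  qed
qed

section \<open>Tensor products\<close>

lemma sweedler_eq_frag_sum:
  "sweedler G t \<beta> = frag_sum G (\<lambda>p. \<beta> (fst p) (snd p)) (SOME x. x \<in> t)"
  by (simp add: sweedler_def frag_sum_def Let_def)

definition balanced ::
  "('r, 'x) ring_scheme \<Rightarrow> ('m, 'y) ring_scheme \<Rightarrow> ('m \<Rightarrow> 'r \<Rightarrow> 'm) \<Rightarrow>
   ('n, 'z) ring_scheme \<Rightarrow> ('r \<Rightarrow> 'n \<Rightarrow> 'n) \<Rightarrow> ('g, 'w) ring_scheme \<Rightarrow> ('m \<Rightarrow> 'n \<Rightarrow> 'g) \<Rightarrow> bool" where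
  "balanced R M r N l G \<beta> \<longleftrightarrow>
     (\<forall>n\<in>carrier N. additive M G (\<lambda>m. \<beta> m n)) \<and> (\<forall>m\<in>carrier M. additive N G (\<beta> m)) \<and>
     (\<forall>m\<in>carrier M. \<forall>a\<in>carrier R. \<forall>n\<in>carrier N. \<beta> (r m a) n = \<beta> m (l a n))"

lemma balancedI:
  assumes "\<And>n. n \<in> carrier N \<Longrightarrow> additive M G (\<lambda>m. \<beta> m n)"
    and "\<And>m. m \<in> carrier M \<Longrightarrow> additive N G (\<beta> m)"
    and "\<And>m a n. m \<in> carrier M \<Longrightarrow> a \<in> carrier R \<Longrightarrow> n \<in> carrier N \<Longrightarrow> \<beta> (r m a) n = \<beta> m (l a n)"
  shows "balanced R M r N l G \<beta>"
  using assms by (auto simp: balanced_def)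

lemma balanced_closed:
  "balanced R M r N l G \<beta> \<Longrightarrow> m \<in> carrier M \<Longrightarrow> n \<in> carrier N \<Longrightarrow> \<beta> m n \<in> carrier G"
  by (auto simp: balanced_def additive_closed)

locale tensor_pair =
  fixes R :: "('r, 'x) ring_scheme" and M :: "('m, 'y) ring_scheme" and r :: "'m \<Rightarrow> 'r \<Rightarrow> 'm"
    and N :: "('n, 'z) ring_scheme" and l :: "'r \<Rightarrow> 'n \<Rightarrow> 'n"
  assumes right: "right_module R M r" and left: "left_module R N l"
begin

abbreviation T :: "('m, 'n) tensor ring" where "T \<equiv> tensor R M r N l"
abbreviation F :: "('m \<times> 'n \<Rightarrow>\<^sub>0 int) monoid" where "F \<equiv> free_Abelian_group (carrier M \<times> carrier N)"
abbreviation K :: "('m \<times> 'n \<Rightarrow>\<^sub>0 int) set" where "K \<equiv> generate F (tensor_relations R M r N l)"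

lemma T_eq: "T = additive_group (F Mod K)"
  by (simp add: tensor_def tensor_group_def additive_group_def Let_def)

lemma M_group: "abelian_group M" and N_group: "abelian_group N"
  using right left by (auto simp: right_module_def left_module_def)

lemma relations: "tensor_relations R M r N l \<subseteq> carrier F"
proof -
  interpret M: abelian_group M by (rule M_group)
  interpret N: abelian_group N by (rule N_group)
  have cl: "r m a \<in> carrier M" "l a n \<in> carrier N"
    if "m \<in> carrier M" "a \<in> carrier R" "n \<in> carrier N" for m a n
    using that right_module.closed[OF right] left_module.closed[OF left] by auto
  show ?thesis
    unfolding tensor_relations_def
    by (auto dest!: subsetD[OF keys_diff] simp: cl split: if_splits)
qed

sublocale presented "carrier M \<times> carrier N" "tensor_relations R M r N l" T "\<lambda>x. K #>\<^bsub>F\<^esub> x"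
  using presented_quotient[OF relations] by (simp add: T_eq)

lemma F_comm: "comm_group F" by (rule abelian_free_Abelian_group)

lemma K_subgroup: "subgroup K F"
  using relations by (intro group.generate_is_subgroup) auto

lemmas quot = quotient_group[OF F_comm K_subgroup]

text \<open>Cosets that share an element coincide, so the coset of the generator is the only member
  of \<open>T\<close> containing it and the definite description is legitimate.\<close>

lemma pure_eq:
  assumes "m \<in> carrier M" "n \<in> carrier N"
  shows "pure T m n = (K #>\<^bsub>F\<^esub> frag_of (m, n))"
  unfolding pure_def
proof (rule the_equality)
  show "(K #>\<^bsub>F\<^esub> frag_of (m, n)) \<in> carrier T \<and> frag_of (m, n) \<in> (K #>\<^bsub>F\<^esub> frag_of (m, n))"
    using assms quot(2,6) by (auto simp: T_eq)
next
  fix X assume X: "X \<in> carrier T \<and> frag_of (m, n) \<in> X"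
  then obtain x where x: "x \<in> carrier F" "X = (K #>\<^bsub>F\<^esub> x)" using quot(2) by (auto simp: T_eq)
  then show "X = (K #>\<^bsub>F\<^esub> frag_of (m, n))" using quot(7)[OF x(1)] X by auto
qed

text \<open>Whatever element the choice in \<open>sweedler\<close> picks, it is a formal sum over
  the carriers and represents the same coset.\<close>

lemma ex_rep:
  assumes "t \<in> carrier T"
  defines "x \<equiv> SOME x. x \<in> t"
  shows "Poly_Mapping.keys x \<subseteq> carrier M \<times> carrier N" "t = (K #>\<^bsub>F\<^esub> x)" "x \<in> t"
proof -
  obtain y where y: "y \<in> carrier F" "t = (K #>\<^bsub>F\<^esub> y)" using assms(1) quot(2) by (auto simp: T_eq)
  then have "y \<in> t" using quot(6) by auto
  then show "x \<in> t" unfolding x_def by (rule someI[of "\<lambda>x. x \<in> t"])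
  then show "Poly_Mapping.keys x \<subseteq> carrier M \<times> carrier N" "t = (K #>\<^bsub>F\<^esub> x)"
    using quot(7)[OF y(1), of x] y(2) by auto
qed

lemma keys_rep:
  assumes "t \<in> carrier T" "p \<in> Poly_Mapping.keys (SOME x. x \<in> t)"
  shows "fst p \<in> carrier M" "snd p \<in> carrier N"
  using ex_rep(1)[OF assms(1)] assms(2) by auto

lemma sweedler_closed:
  assumes "abelian_group G" "t \<in> carrier T"
    "\<And>m n. m \<in> carrier M \<Longrightarrow> n \<in> carrier N \<Longrightarrow> \<beta> m n \<in> carrier G"
  shows "sweedler G t \<beta> \<in> carrier G"
  using assms(3) ex_rep(1)[OF assms(2)] unfolding sweedler_eq_frag_sum
  by (intro abelian_group.frag_sum_closed[OF assms(1)]) auto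

lemma sweedler_cong:
  assumes "abelian_group G" "t \<in> carrier T"
    "\<And>m n. m \<in> carrier M \<Longrightarrow> n \<in> carrier N \<Longrightarrow> \<beta> m n \<in> carrier G"
    "\<And>m n. m \<in> carrier M \<Longrightarrow> n \<in> carrier N \<Longrightarrow> \<beta> m n = \<beta>' m n"
  shows "sweedler G t \<beta> = sweedler G t \<beta>'"
  unfolding sweedler_eq_frag_sum
  by (rule frag_sum_cong[OF assms(1)]) (use keys_rep[OF assms(2)] assms(3,4) in blast)+

lemma sweedler_additive:
  assumes "abelian_group G" "abelian_group G'" "additive G G' f" "t \<in> carrier T"
    "\<And>m n. m \<in> carrier M \<Longrightarrow> n \<in> carrier N \<Longrightarrow> \<beta> m n \<in> carrier G"
  shows "f (sweedler G t \<beta>) = sweedler G' t (\<lambda>m n. f (\<beta> m n))"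
  using assms(5) ex_rep(1)[OF assms(4)] unfolding sweedler_eq_frag_sum
  by (intro frag_sum_additive[OF assms(1-3)]) auto

lemma sweedler_add_fun:
  assumes "abelian_group G" "t \<in> carrier T"
    "\<And>m n. m \<in> carrier M \<Longrightarrow> n \<in> carrier N \<Longrightarrow> \<beta> m n \<in> carrier G"
    "\<And>m n. m \<in> carrier M \<Longrightarrow> n \<in> carrier N \<Longrightarrow> \<gamma> m n \<in> carrier G"
  shows "sweedler G t (\<lambda>m n. \<beta> m n \<oplus>\<^bsub>G\<^esub> \<gamma> m n) = sweedler G t \<beta> \<oplus>\<^bsub>G\<^esub> sweedler G t \<gamma>"
  using assms(3,4) ex_rep(1)[OF assms(2)] unfolding sweedler_eq_frag_sum
  by (intro abelian_group.frag_sum_add_fun[OF assms(1)]) auto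

text \<open>Fixing \<open>t\<close> fixes its chosen representative, so additivity in the parameter
  holds summand by summand. It provides additivity in the variables that a Sweedler sum merely
  carries along.\<close>

lemma sweedler_param_additive:
  assumes "abelian_group G" "t \<in> carrier T"
    "\<And>m n. m \<in> carrier M \<Longrightarrow> n \<in> carrier N \<Longrightarrow> additive X G (\<lambda>x. \<beta> x m n)"
  shows "additive X G (\<lambda>x. sweedler G t (\<beta> x))"
proof (rule additiveI)
  fix x y assume xy: "x \<in> carrier X" "y \<in> carrier X"
  interpret G: abelian_group G by fact
  note cl = additive_closed[OF assms(3)]
  show "sweedler G t (\<beta> x) \<in> carrier G"
    using xy cl assms by (intro sweedler_closed) auto
  have "sweedler G t (\<beta> (x \<oplus>\<^bsub>X\<^esub> y)) = sweedler G t (\<lambda>m n. \<beta> x m n \<oplus>\<^bsub>G\<^esub> \<beta> y m n)"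
    using xy cl assms(1,2) additive_add[OF assms(3)]
    by (intro sweedler_cong[symmetric]) auto
  also have "\<dots> = sweedler G t (\<beta> x) \<oplus>\<^bsub>G\<^esub> sweedler G t (\<beta> y)"
    using xy cl assms(1,2) by (intro sweedler_add_fun) auto
  finally show "sweedler G t (\<beta> (x \<oplus>\<^bsub>X\<^esub> y)) = sweedler G t (\<beta> x) \<oplus>\<^bsub>G\<^esub> sweedler G t (\<beta> y)" .
qed

context
  fixes G :: "('g, 'w) ring_scheme" and \<beta> :: "'m \<Rightarrow> 'n \<Rightarrow> 'g"
  assumes G: "abelian_group G" and \<beta>: "balanced R M r N l G \<beta>"
begin

text \<open>Each of the three families of tensor relations encodes the difference of the two sides
  of one clause of \<open>balanced\<close>.\<close>

lemma balanced_kills: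
  assumes "x \<in> tensor_relations R M r N l"
  shows "frag_sum G (\<lambda>p. \<beta> (fst p) (snd p)) x = \<zero>\<^bsub>G\<^esub>"
proof -
  interpret G: abelian_group G by (rule G)
  interpret M: abelian_group M by (rule M_group)
  interpret N: abelian_group N by (rule N_group)
  let ?f = "frag_sum G (\<lambda>p. \<beta> (fst p) (snd p))"
  note cl = balanced_closed[OF \<beta>]
  have f1: "?f (frag_of (m, n)) = \<beta> m n" if "m \<in> carrier M" "n \<in> carrier N" for m n
    using that cl by (simp add: G.frag_sum_frag_of)
  have f2: "?f (frag_of (m, n) - frag_of (m', n')) = \<beta> m n \<ominus>\<^bsub>G\<^esub> \<beta> m' n'"
    if "m \<in> carrier M" "n \<in> carrier N" "m' \<in> carrier M" "n' \<in> carrier N" for m n m' n'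
    using that cl by (subst G.frag_sum_diff) (auto simp: f1)
  have f3: "?f (frag_of (m, n) - frag_of (m', n') - frag_of (m'', n'')) =
      \<beta> m n \<ominus>\<^bsub>G\<^esub> \<beta> m' n' \<ominus>\<^bsub>G\<^esub> \<beta> m'' n''"
    if "m \<in> carrier M" "n \<in> carrier N" "m' \<in> carrier M" "n' \<in> carrier N"
      "m'' \<in> carrier M" "n'' \<in> carrier N" for m n m' n' m'' n''
    using that cl by (subst G.frag_sum_diff) (auto simp: f1 f2 dest!: subsetD[OF keys_diff] split: if_splits)
  have z: "a \<oplus>\<^bsub>G\<^esub> b \<ominus>\<^bsub>G\<^esub> a \<ominus>\<^bsub>G\<^esub> b = \<zero>\<^bsub>G\<^esub>" if "a \<in> carrier G" "b \<in> carrier G" for a b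
  proof -
    have "a \<oplus>\<^bsub>G\<^esub> b \<ominus>\<^bsub>G\<^esub> a \<ominus>\<^bsub>G\<^esub> b = (a \<oplus>\<^bsub>G\<^esub> \<ominus>\<^bsub>G\<^esub> a) \<oplus>\<^bsub>G\<^esub> (b \<oplus>\<^bsub>G\<^esub> \<ominus>\<^bsub>G\<^esub> b)"
      using that by (simp add: a_minus_def G.a_ac)
    then show ?thesis using that by (simp add: G.r_neg)
  qed
  have rl: "r m a \<in> carrier M" "l a n \<in> carrier N"
    if "m \<in> carrier M" "a \<in> carrier R" "n \<in> carrier N" for m a n
    using that right_module.closed[OF right] left_module.closed[OF left] by auto
  consider (1) m m' n where "x = frag_of (m \<oplus>\<^bsub>M\<^esub> m', n) - frag_of (m, n) - frag_of (m', n)"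
      "m \<in> carrier M" "m' \<in> carrier M" "n \<in> carrier N"
    | (2) m n n' where "x = frag_of (m, n \<oplus>\<^bsub>N\<^esub> n') - frag_of (m, n) - frag_of (m, n')"
      "m \<in> carrier M" "n \<in> carrier N" "n' \<in> carrier N"
    | (3) m a n where "x = frag_of (r m a, n) - frag_of (m, l a n)"
      "m \<in> carrier M" "a \<in> carrier R" "n \<in> carrier N"
    using assms unfolding tensor_relations_def by blast
  then show ?thesis
  proof cases
    case 1
    then have "\<beta> (m \<oplus>\<^bsub>M\<^esub> m') n = \<beta> m n \<oplus>\<^bsub>G\<^esub> \<beta> m' n" using \<beta> by (simp add: balanced_def additive_def)
    then show ?thesis using 1 cl by (simp add: f3 z)
  next
    case 2
    then have "\<beta> m (n \<oplus>\<^bsub>N\<^esub> n') = \<beta> m n \<oplus>\<^bsub>G\<^esub> \<beta> m n'" using \<beta> by (simp add: balanced_def additive_def)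
    then show ?thesis using 2 cl by (simp add: f3 z)
  next
    case 3
    then have "\<beta> (r m a) n = \<beta> m (l a n)" using \<beta> by (simp add: balanced_def)
    then show ?thesis using 3 cl rl by (simp add: f2 G.minus_eq_zero_iff)
  qed
qed

text \<open>Balancedness turns evaluation at the chosen representative into the induced
  homomorphism, which removes the dependence on the choice.\<close>

lemma sweedler_eq_lift:
  assumes "t \<in> carrier T"
  shows "sweedler G t \<beta> = lift G (\<lambda>p. \<beta> (fst p) (snd p)) t"
  unfolding sweedler_eq_frag_sum using ex_rep[OF assms] balanced_closed[OF \<beta>] balanced_kills G
  by (subst (2) ex_rep(2)[OF assms], intro lift_q[symmetric]) auto

lemma additive_sweedler: "additive T G (\<lambda>t. sweedler G t \<beta>)"
proof -
  have "additive T G (lift G (\<lambda>p. \<beta> (fst p) (snd p)))"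
    using G balanced_closed[OF \<beta>] balanced_kills by (intro lift_additive) auto
  then show ?thesis
    using additive_cong[of T "\<lambda>t. sweedler G t \<beta>" _ G, OF sweedler_eq_lift L_group] by simp
qed

lemma sweedler_pure:
  assumes "m \<in> carrier M" "n \<in> carrier N"
  shows "sweedler G (pure T m n) \<beta> = \<beta> m n"
proof -
  have "pure T m n \<in> carrier T" using assms pure_eq q_closed by auto
  then show ?thesis
    using assms G balanced_closed[OF \<beta>] balanced_kills lift_gen[of G "\<lambda>p. \<beta> (fst p) (snd p)" "(m, n)"]
    by (auto simp: sweedler_eq_lift pure_eq)
qed

end

lemma pure_closed: "m \<in> carrier M \<Longrightarrow> n \<in> carrier N \<Longrightarrow> pure T m n \<in> carrier T"
  using pure_eq q_closed by auto

lemma q_relation: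
  assumes "x \<in> tensor_relations R M r N l" shows "(K #>\<^bsub>F\<^esub> x) = \<zero>\<^bsub>T\<^esub>"
proof -
  have "x \<in> K" using assms by (rule generate.incl)
  then show ?thesis using q_kernel[of x] assms relations by auto
qed

text \<open>Every relation vanishes in the quotient, and the vanishing of such a difference is the
  corresponding law for pure tensors.\<close>

lemma pure_balanced: "balanced R M r N l T (pure T)"
proof -
  interpret L: abelian_group T by (rule L_group)
  interpret M: abelian_group M by (rule M_group)
  interpret N: abelian_group N by (rule N_group)
  have rl: "r m a \<in> carrier M" "l a n \<in> carrier N"
    if "m \<in> carrier M" "a \<in> carrier R" "n \<in> carrier N" for m a n
    using that right_module.closed[OF right] left_module.closed[OF left] by auto
  have d2: "pure T m n = pure T m' n'"
    if "m \<in> carrier M" "n \<in> carrier N" "m' \<in> carrier M" "n' \<in> carrier N"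
      "frag_of (m, n) - frag_of (m', n') \<in> tensor_relations R M r N l" for m n m' n'
    using q_relation[OF that(5)] that q_diff[of "frag_of (m, n)" "frag_of (m', n')"]
    by (simp add: pure_eq L.minus_eq_zero_iff q_closed)
  have d3: "pure T m n = pure T m' n' \<oplus>\<^bsub>T\<^esub> pure T m'' n''"
    if "m \<in> carrier M" "n \<in> carrier N" "m' \<in> carrier M" "n' \<in> carrier N"
      "m'' \<in> carrier M" "n'' \<in> carrier N"
      "frag_of (m, n) - frag_of (m', n') - frag_of (m'', n'') \<in> tensor_relations R M r N l" for m n m' n' m'' n''
  proof -
    \<comment> \<open>Regrouped as one term minus a sum, the relation is open to
      \<open>q_diff\<close> and \<open>q_add\<close>.\<close>
    have "frag_of (m, n) - (frag_of (m', n') + frag_of (m'', n'')) \<in> tensor_relations R M r N l"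
      using that(7) by (simp add: diff_diff_eq)
    from q_relation[OF this] have
      "(K #>\<^bsub>F\<^esub> (frag_of (m, n) - (frag_of (m', n') + frag_of (m'', n'')))) = \<zero>\<^bsub>T\<^esub>" .
    moreover have "Poly_Mapping.keys (frag_of (m', n') + frag_of (m'', n'')) \<subseteq> carrier M \<times> carrier N"
      using that by (auto dest!: subsetD[OF keys_add] split: if_splits)
    ultimately show ?thesis
      using that q_diff[of "frag_of (m, n)" "frag_of (m', n') + frag_of (m'', n'')"]
      by (simp add: pure_eq L.minus_eq_zero_iff q_closed q_add)
  qed
  show ?thesis
  proof (intro balancedI additiveI)
    fix m m' n assume "m \<in> carrier M" "m' \<in> carrier M" "n \<in> carrier N"
    then show "pure T (m \<oplus>\<^bsub>M\<^esub> m') n = pure T m n \<oplus>\<^bsub>T\<^esub> pure T m' n"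
      by (intro d3) (auto simp: tensor_relations_def)
  next
    fix m n n' assume "m \<in> carrier M" "n' \<in> carrier N" "n \<in> carrier N"
    then show "pure T m (n \<oplus>\<^bsub>N\<^esub> n') = pure T m n \<oplus>\<^bsub>T\<^esub> pure T m n'"
      by (intro d3) (auto simp: tensor_relations_def)
  next
    fix m a n assume "m \<in> carrier M" "a \<in> carrier R" "n \<in> carrier N"
    then show "pure T (r m a) n = pure T m (l a n)"
      by (intro d2) (auto simp: tensor_relations_def rl)
  qed (auto intro: pure_closed)
qed

text \<open>There is no case for negation, since
  \<open>- (m \<otimes> n) = (- m) \<otimes> n\<close> is again pure.\<close>

lemma tensor_induct [consumes 1, case_names pure add]:
  assumes "t \<in> carrier T" and pure: "\<And>m n. m \<in> carrier M \<Longrightarrow> n \<in> carrier N \<Longrightarrow> P (pure T m n)"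
    and add: "\<And>x y. x \<in> carrier T \<Longrightarrow> y \<in> carrier T \<Longrightarrow> P x \<Longrightarrow> P y \<Longrightarrow> P (x \<oplus>\<^bsub>T\<^esub> y)"
  shows "P t"
proof -
  interpret L: abelian_group T by (rule L_group)
  interpret M: abelian_group M by (rule M_group)
  interpret N: abelian_group N by (rule N_group)
  have ad: "additive M T (\<lambda>m. pure T m n)" if "n \<in> carrier N" for n
    using pure_balanced that by (auto simp: balanced_def)
  have um: "\<ominus>\<^bsub>T\<^esub> pure T m n = pure T (\<ominus>\<^bsub>M\<^esub> m) n" if "m \<in> carrier M" "n \<in> carrier N" for m n
    using additive_uminus[OF M_group L_group ad[OF that(2)] that(1)] by simp
  have zero: "P \<zero>\<^bsub>T\<^esub>"
    using additive_zero[OF M_group L_group ad[OF N.zero_closed]] pure[OF M.zero_closed N.zero_closed] by simp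
  have mz: "\<ominus>\<^bsub>T\<^esub> \<zero>\<^bsub>T\<^esub> = \<zero>\<^bsub>T\<^esub>"
    by (rule L.minus_equality) (auto intro: L.l_zero)
  \<comment> \<open>The statement is doubled so that the negation case of
    \<open>induct_presented\<close> merely swaps its two halves.\<close>
  have "P t \<and> P (\<ominus>\<^bsub>T\<^esub> t)" using assms(1)
  proof (induction t rule: induct_presented)
    case (gen s)
    then show ?case using pure um pure_eq by auto
  next
    case (add x y)
    then show ?case using assms(3) by (simp add: L.minus_add)
  qed (simp_all add: zero mz)
  then show ?thesis by blast
qed

lemma additive_eqI:
  assumes "additive T G f" "additive T G g" "t \<in> carrier T"
    "\<And>m n. m \<in> carrier M \<Longrightarrow> n \<in> carrier N \<Longrightarrow> f (pure T m n) = g (pure T m n)"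
  shows "f t = g t"
  using assms(3) by (induction t rule: tensor_induct)
    (auto simp: assms(4) additive_add[OF assms(1)] additive_add[OF assms(2)])

lemma sweedler_pure_id:
  assumes "t \<in> carrier T" shows "sweedler T t (pure T) = t"
  using additive_sweedler[OF L_group pure_balanced] _ assms
  by (rule additive_eqI) (auto simp: additive_def sweedler_pure[OF L_group pure_balanced])

lemmas T_group = L_group

end

subsection \<open>Functoriality\<close>

text \<open>This is \<open>f \<otimes> id\<close>. The codomain is passed because
  \<open>sweedler\<close> sums there; the domain enters only through the tensor
  \<open>t\<close>.\<close>

definition tensor_map ::
  "('m, 'n) tensor ring \<Rightarrow> ('l \<Rightarrow> 'm) \<Rightarrow> ('l, 'n) tensor \<Rightarrow> ('m, 'n) tensor" where
  "tensor_map T f t = sweedler T t (\<lambda>m n. pure T (f m) n)"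

lemma right_linearD:
  assumes "right_linear R M r N s f"
  shows "additive M N f" "m \<in> carrier M \<Longrightarrow> f m \<in> carrier N"
    "m \<in> carrier M \<Longrightarrow> a \<in> carrier R \<Longrightarrow> f (r m a) = s (f m) a"
  using assms by (auto simp: right_linear_def additive_def)

lemma right_linearI:
  assumes "additive M N f" "\<And>m a. m \<in> carrier M \<Longrightarrow> a \<in> carrier R \<Longrightarrow> f (r m a) = s (f m) a"
  shows "right_linear R M r N s f"
  using assms by (auto simp: right_linear_def additive_def)

context
  fixes R :: "('r, 'x) ring_scheme" and M :: "('m, 'y) ring_scheme" and r :: "'m \<Rightarrow> 'r \<Rightarrow> 'm"
    and M' :: "('p, 'w) ring_scheme" and r' :: "'p \<Rightarrow> 'r \<Rightarrow> 'p"
    and N :: "('n, 'z) ring_scheme" and l :: "'r \<Rightarrow> 'n \<Rightarrow> 'n" and f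
  assumes M: "right_module R M r" and M': "right_module R M' r'" and N: "left_module R N l"
    and f: "right_linear R M r M' r' f"
begin

interpretation T: tensor_pair R M r N l using M N by (rule tensor_pair.intro)
interpretation T': tensor_pair R M' r' N l using M' N by (rule tensor_pair.intro)

lemma tensor_map_balanced: "balanced R M r N l T'.T (\<lambda>m n. pure T'.T (f m) n)"
  using T'.pure_balanced right_linearD[OF f]
  by (auto simp: balanced_def intro: additive_comp[of _ _ f])

lemma tensor_map_additive: "additive T.T T'.T (tensor_map T'.T f)"
  unfolding tensor_map_def by (rule T.additive_sweedler[OF T'.T_group tensor_map_balanced])

lemma tensor_map_pure:
  "m \<in> carrier M \<Longrightarrow> n \<in> carrier N \<Longrightarrow> tensor_map T'.T f (pure T.T m n) = pure T'.T (f m) n"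
  unfolding tensor_map_def by (rule T.sweedler_pure[OF T'.T_group tensor_map_balanced])

text \<open>Change of variables in a Sweedler sum. For \<open>\<beta>\<close> of the form
  \<open>pure (g m) n\<close> it is functoriality, \<open>tensor_map_comp\<close>.\<close>

lemma sweedler_tensor_map:
  assumes G: "abelian_group G" and \<beta>: "balanced R M' r' N l G \<beta>" and t: "t \<in> carrier T.T"
  shows "sweedler G (tensor_map T'.T f t) \<beta> = sweedler G t (\<lambda>m n. \<beta> (f m) n)"
proof -
  have b: "balanced R M r N l G (\<lambda>m n. \<beta> (f m) n)"
    using \<beta> right_linearD[OF f] by (auto simp: balanced_def intro: additive_comp[of _ _ f])
  show ?thesis
    using additive_comp[OF tensor_map_additive T'.additive_sweedler[OF G \<beta>]]
      T.additive_sweedler[OF G b] t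
    by (rule T.additive_eqI)
      (use right_linearD(2)[OF f] in
        \<open>auto simp: tensor_map_pure T'.sweedler_pure[OF G \<beta>] T.sweedler_pure[OF G b]\<close>)
qed

end

lemma tensor_map_cong:
  assumes "tensor_pair R M r N l" "abelian_group T'" "t \<in> carrier (tensor R M r N l)"
    "\<And>m n. m \<in> carrier M \<Longrightarrow> n \<in> carrier N \<Longrightarrow> pure T' (f m) n \<in> carrier T'"
    "\<And>m. m \<in> carrier M \<Longrightarrow> f m = g m"
  shows "tensor_map T' f t = tensor_map T' g t"
  unfolding tensor_map_def
  using assms(4,5) by (intro tensor_pair.sweedler_cong[OF assms(1-3)]) auto

lemma tensor_map_comp:
  assumes "right_module R M r" "right_module R M' r'" "right_module R M'' r''" "left_module R N l"
    and f: "right_linear R M r M' r' f" and g: "right_linear R M' r' M'' r'' g"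
    and t: "t \<in> carrier (tensor R M r N l)"
  shows "tensor_map (tensor R M'' r'' N l) g (tensor_map (tensor R M' r' N l) f t) =
    tensor_map (tensor R M'' r'' N l) (\<lambda>x. g (f x)) t"
proof -
  interpret T: tensor_pair R M r N l using assms by (intro tensor_pair.intro)
  interpret T'': tensor_pair R M'' r'' N l using assms by (intro tensor_pair.intro)
  show ?thesis
    using sweedler_tensor_map[OF assms(1,2,4) f T''.T_group tensor_map_balanced[OF assms(2,3,4) g] t]
    by (simp add: tensor_map_def)
qed

lemma tensor_map_id:
  assumes "right_module R M r" "left_module R N l" "t \<in> carrier (tensor R M r N l)"
    "\<And>m. m \<in> carrier M \<Longrightarrow> f m = m"
  shows "tensor_map (tensor R M r N l) f t = t"
proof -
  interpret T: tensor_pair R M r N l using assms by (intro tensor_pair.intro)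
  have "tensor_map T.T f t = tensor_map T.T (\<lambda>x. x) t"
    using assms T.pure_closed T.T_group by (intro tensor_map_cong[OF T.tensor_pair_axioms]) auto
  then show ?thesis using T.sweedler_pure_id[OF assms(3)] by (simp add: tensor_map_def)
qed

lemma right_linear_comp:
  assumes "right_linear R M r M' r' f" "right_linear R M' r' M'' r'' g"
  shows "right_linear R M r M'' r'' (\<lambda>x. g (f x))"
  using right_linearD[OF assms(1)] right_linearD[OF assms(2)]
  by (intro right_linearI) (auto intro: additive_comp)

lemma abelian_group_cong:
  assumes "abelian_group M" "carrier N = carrier M" "\<zero>\<^bsub>N\<^esub> = \<zero>\<^bsub>M\<^esub>"
    "\<And>x y. x \<in> carrier M \<Longrightarrow> y \<in> carrier M \<Longrightarrow> x \<oplus>\<^bsub>N\<^esub> y = x \<oplus>\<^bsub>M\<^esub> y"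
  shows "abelian_group N"
proof -
  interpret M: abelian_group M by fact
  show ?thesis
  proof (rule abelian_groupI)
    show "\<exists>y\<in>carrier N. y \<oplus>\<^bsub>N\<^esub> x = \<zero>\<^bsub>N\<^esub>" if "x \<in> carrier N" for x
      using that by (intro bexI[of _ "\<ominus>\<^bsub>M\<^esub> x"]) (auto simp: assms M.l_neg)
  qed (auto simp: assms M.a_ac)
qed

section \<open>Modules over a bialgebra\<close>

locale coring_setting =
  fixes k :: "'k ring" and H :: "('k, 'h) bialgebra" and A :: "('k, 'h, 'a) H_module"
    and C :: "('k, 'h, 'a, 'c) HA_coring"
  assumes k: "cring k" and H: "bialgebra k H" and A: "module_algebra k H A" and C: "HA_coring k H A C"
begin

lemma H_algebra: "k_algebra k H" and A_algebra: "k_algebra k A" and A_H_module: "H_module k H A"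
  and C_bimodule: "HA_bimodule k H A C" and C_module: "HA_module k H A C"
  using H A C by (auto simp: bialgebra_def module_algebra_def HA_coring_def HA_bimodule_def)

lemma H_module_k: "module k H" and A_module_k: "module k A" and H_ring: "ring H" and A_ring: "ring A"
  using H_algebra A_algebra by (auto simp: k_algebra_def)

lemma H_group: "abelian_group H" and A_group: "abelian_group A"
  using H_ring A_ring by (auto intro: ring.is_abelian_group)

lemma C_left_module: "left_module A C (lact C)"
  using C_bimodule by (auto simp: HA_bimodule_def HA_bimodule_axioms_def)

text \<open>The right action law reverses the order of two scalars, which commutativity of
  \<open>k\<close> repairs.\<close>

lemma module_right_k: "module k M \<Longrightarrow> right_module k M (\<lambda>m c. c \<odot>\<^bsub>M\<^esub> m)"
  and module_left_k: "module k M \<Longrightarrow> left_module k M (\<lambda>c m. c \<odot>\<^bsub>M\<^esub> m)"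
proof -
  assume "module k M"
  then interpret M: module k M .
  show "right_module k M (\<lambda>m c. c \<odot>\<^bsub>M\<^esub> m)"
    by unfold_locales (auto simp: M.smult_l_distr M.smult_r_distr M.smult_assoc1[symmetric] M.R.m_comm)
  show "left_module k M (\<lambda>c m. c \<odot>\<^bsub>M\<^esub> m)"
    by unfold_locales (auto simp: M.smult_l_distr M.smult_r_distr M.smult_assoc1)
qed

text \<open>The rewriting keeps the name \<open>tensor_k\<close>, in which the bialgebra axioms are
  phrased.\<close>

sublocale HH: tensor_pair k H "\<lambda>m c. c \<odot>\<^bsub>H\<^esub> m" H "\<lambda>c n. c \<odot>\<^bsub>H\<^esub> n"
  rewrites "tensor k H (\<lambda>m c. c \<odot>\<^bsub>H\<^esub> m) H (\<lambda>c n. c \<odot>\<^bsub>H\<^esub> n) \<equiv> tensor_k k H H"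
  by (intro tensor_pair.intro module_right_k module_left_k H_module_k)
    (simp add: tensor_k_def)

definition k_bilinear :: "('g, 'w) ring_scheme \<Rightarrow> ('h \<Rightarrow> 'h \<Rightarrow> 'g) \<Rightarrow> bool" where
  "k_bilinear G \<beta> = balanced k H (\<lambda>m c. c \<odot>\<^bsub>H\<^esub> m) H (\<lambda>c n. c \<odot>\<^bsub>H\<^esub> n) G \<beta>"

lemmas HH_additive = HH.additive_sweedler[folded k_bilinear_def]
lemmas HH_pure = HH.sweedler_pure[folded k_bilinear_def]

lemma k_bilinearI:
  assumes "\<And>x. x \<in> carrier H \<Longrightarrow> additive H G (\<lambda>y. \<beta> y x)"
    "\<And>x. x \<in> carrier H \<Longrightarrow> additive H G (\<beta> x)"
    "\<And>x c y. x \<in> carrier H \<Longrightarrow> c \<in> carrier k \<Longrightarrow> y \<in> carrier H \<Longrightarrow> \<beta> (c \<odot>\<^bsub>H\<^esub> x) y = \<beta> x (c \<odot>\<^bsub>H\<^esub> y)"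
  shows "k_bilinear G \<beta>"
  unfolding k_bilinear_def using assms by (intro balancedI)

lemma comult_closed: "h \<in> carrier H \<Longrightarrow> comult H h \<in> carrier (tensor_k k H H)"
  using bialgebra.comult_closed[OF H] .

lemma tensor_k_module_simps [simp]:
  "carrier (tensor_k_module k H H) = carrier (tensor_k k H H)"
  "\<zero>\<^bsub>tensor_k_module k H H\<^esub> = \<zero>\<^bsub>tensor_k k H H\<^esub>"
  "x \<oplus>\<^bsub>tensor_k_module k H H\<^esub> y = x \<oplus>\<^bsub>tensor_k k H H\<^esub> y"
  "c \<odot>\<^bsub>tensor_k_module k H H\<^esub> t = sweedler (tensor_k k H H) t (\<lambda>m n. pure (tensor_k k H H) (c \<odot>\<^bsub>H\<^esub> m) n)"
  by (simp_all add: tensor_k_module_def Let_def ring.defs)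

lemma smult_bilinear:
  assumes c: "c \<in> carrier k"
  shows "k_bilinear (tensor_k k H H) (\<lambda>m n. pure (tensor_k k H H) (c \<odot>\<^bsub>H\<^esub> m) n)"
proof -
  interpret Hm: module k H by (rule H_module_k)
  note b = HH.pure_balanced[unfolded balanced_def]
  have s: "additive H H (\<lambda>m. c \<odot>\<^bsub>H\<^esub> m)"
    using c by (intro additiveI) (auto simp: Hm.smult_r_distr)
  show ?thesis
  proof (rule k_bilinearI)
    fix x assume "x \<in> carrier H"
    then show "additive H (tensor_k k H H) (\<lambda>y. pure (tensor_k k H H) (c \<odot>\<^bsub>H\<^esub> y) x)"
      using b by (intro additive_comp[OF s]) auto
    show "additive H (tensor_k k H H) (pure (tensor_k k H H) (c \<odot>\<^bsub>H\<^esub> x))"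
      using b \<open>x \<in> carrier H\<close> c by auto
  next
    fix x d y assume *: "x \<in> carrier H" "d \<in> carrier k" "y \<in> carrier H"
    have "c \<odot>\<^bsub>H\<^esub> (d \<odot>\<^bsub>H\<^esub> x) = d \<odot>\<^bsub>H\<^esub> (c \<odot>\<^bsub>H\<^esub> x)"
      using * c by (simp add: Hm.smult_assoc1[symmetric] Hm.R.m_comm)
    then show "pure (tensor_k k H H) (c \<odot>\<^bsub>H\<^esub> (d \<odot>\<^bsub>H\<^esub> x)) y = pure (tensor_k k H H) (c \<odot>\<^bsub>H\<^esub> x) (d \<odot>\<^bsub>H\<^esub> y)"
      using b * c by auto
  qed
qed

lemma smult_pure:
  assumes "c \<in> carrier k" "x \<in> carrier H" "y \<in> carrier H"
  shows "c \<odot>\<^bsub>tensor_k_module k H H\<^esub> pure (tensor_k k H H) x y = pure (tensor_k k H H) (c \<odot>\<^bsub>H\<^esub> x) y"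
  using HH_pure[OF HH.T_group smult_bilinear] assms by simp

lemma smult_additive:
  assumes "c \<in> carrier k"
  shows "additive (tensor_k k H H) (tensor_k k H H) (\<lambda>t. c \<odot>\<^bsub>tensor_k_module k H H\<^esub> t)"
  using HH_additive[OF HH.T_group smult_bilinear[OF assms]] by simp

text \<open>Makes \<open>(H \<otimes> H) \<otimes> H\<close> available as a tensor product of
  modules. The scalar laws are equalities of additive maps, hence checked on pure tensors.\<close>

lemma HH_right_module: "right_module k (tensor_k_module k H H) (\<lambda>t c. c \<odot>\<^bsub>tensor_k_module k H H\<^esub> t)"
proof -
  interpret k: cring k by (rule k)
  interpret Hm: module k H by (rule H_module_k)
  interpret G: abelian_group "tensor_k k H H" by (rule HH.T_group)
  let ?T = "tensor_k k H H" and ?s = "\<lambda>c t. c \<odot>\<^bsub>tensor_k_module k H H\<^esub> t"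
  note s = smult_pure smult_additive
  note b = HH.pure_balanced[unfolded balanced_def]
  have cl: "?s c t \<in> carrier ?T" if "c \<in> carrier k" "t \<in> carrier ?T" for c t
    using additive_closed[OF s(2)] that by blast
  have 1: "?s (a \<oplus>\<^bsub>k\<^esub> b) t = ?s a t \<oplus>\<^bsub>?T\<^esub> ?s b t" if "a \<in> carrier k" "b \<in> carrier k" "t \<in> carrier ?T" for a b t
    using s(2)[of "a \<oplus>\<^bsub>k\<^esub> b"] additive_sum_map[OF HH.T_group s(2)[of a] s(2)[of b]] that(3)
  proof (rule HH.additive_eqI)
    fix m n assume mn: "m \<in> carrier H" "n \<in> carrier H"
    have "pure ?T (a \<odot>\<^bsub>H\<^esub> m \<oplus>\<^bsub>H\<^esub> b \<odot>\<^bsub>H\<^esub> m) n = pure ?T (a \<odot>\<^bsub>H\<^esub> m) n \<oplus>\<^bsub>?T\<^esub> pure ?T (b \<odot>\<^bsub>H\<^esub> m) n"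
      using b mn that by (auto simp: additive_def)
    then show "?s (a \<oplus>\<^bsub>k\<^esub> b) (pure ?T m n) = ?s a (pure ?T m n) \<oplus>\<^bsub>?T\<^esub> ?s b (pure ?T m n)"
      using mn that by (simp only: s(1) k.add.m_closed Hm.smult_l_distr)
  qed (use that in auto)
  have 2: "?s (a \<otimes>\<^bsub>k\<^esub> b) t = ?s b (?s a t)" if "a \<in> carrier k" "b \<in> carrier k" "t \<in> carrier ?T" for a b t
    using s(2)[of "a \<otimes>\<^bsub>k\<^esub> b"] additive_comp[OF s(2)[of a] s(2)[of b]] that(3)
  proof (rule HH.additive_eqI)
    fix m n assume mn: "m \<in> carrier H" "n \<in> carrier H"
    have "(a \<otimes>\<^bsub>k\<^esub> b) \<odot>\<^bsub>H\<^esub> m = b \<odot>\<^bsub>H\<^esub> (a \<odot>\<^bsub>H\<^esub> m)"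
      using mn that k.m_comm[of a b] Hm.smult_assoc1[of b a m] by simp
    then show "?s (a \<otimes>\<^bsub>k\<^esub> b) (pure ?T m n) = ?s b (?s a (pure ?T m n))"
      using mn that by (simp only: s(1) k.m_closed Hm.smult_closed)
  qed (use that in auto)
  have 3: "?s \<one>\<^bsub>k\<^esub> t = t" if "t \<in> carrier ?T" for t
    using s(2)[of "\<one>\<^bsub>k\<^esub>"] _ that
  proof (rule HH.additive_eqI)
    show "additive ?T ?T (\<lambda>t. t)" by (simp add: additive_def)
    fix m n assume mn: "m \<in> carrier H" "n \<in> carrier H"
    then show "?s \<one>\<^bsub>k\<^esub> (pure ?T m n) = pure ?T m n"
      by (simp only: s(1) k.one_closed Hm.smult_one)
  qed auto
  show ?thesis
  proof (rule right_module.intro)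
    show "ring k" ..
    show "abelian_group (tensor_k_module k H H)" using HH.T_group by (rule abelian_group_cong) simp_all
  qed (use cl 1 2 3 additive_add[OF s(2)] in \<open>simp_all del: tensor_k_module_simps(4)\<close>)
qed

sublocale HHH: tensor_pair k "tensor_k_module k H H" "\<lambda>t c. c \<odot>\<^bsub>tensor_k_module k H H\<^esub> t" H "\<lambda>c n. c \<odot>\<^bsub>H\<^esub> n"
  rewrites "tensor k (tensor_k_module k H H) (\<lambda>t c. c \<odot>\<^bsub>tensor_k_module k H H\<^esub> t) H (\<lambda>c n. c \<odot>\<^bsub>H\<^esub> n)
    \<equiv> tensor_k k (tensor_k_module k H H) H"
  by (intro tensor_pair.intro HH_right_module module_left_k H_module_k)
    (simp add: tensor_k_def)

text \<open>Coassociativity in Sweedler form: a trilinear \<open>\<tau>\<close> takes the same value on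
  \<open>h\<^sub>1\<^sub>1 \<otimes> h\<^sub>1\<^sub>2 \<otimes> h\<^sub>2\<close> and on \<open>h\<^sub>1 \<otimes> h\<^sub>2\<^sub>1 \<otimes> h\<^sub>2\<^sub>2\<close>.\<close>

lemma coassoc_apply:
  assumes G: "abelian_group G"
    and 1: "\<And>y z. y \<in> carrier H \<Longrightarrow> z \<in> carrier H \<Longrightarrow> additive H G (\<lambda>x. \<tau> x y z)"
    and 2: "\<And>x z. x \<in> carrier H \<Longrightarrow> z \<in> carrier H \<Longrightarrow> additive H G (\<lambda>y. \<tau> x y z)"
    and 3: "\<And>x y. x \<in> carrier H \<Longrightarrow> y \<in> carrier H \<Longrightarrow> additive H G (\<tau> x y)"
    and 4: "\<And>c x y z. c \<in> carrier k \<Longrightarrow> x \<in> carrier H \<Longrightarrow> y \<in> carrier H \<Longrightarrow> z \<in> carrier H \<Longrightarrow>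
      \<tau> (c \<odot>\<^bsub>H\<^esub> x) y z = \<tau> x (c \<odot>\<^bsub>H\<^esub> y) z"
    and 5: "\<And>c x y z. c \<in> carrier k \<Longrightarrow> x \<in> carrier H \<Longrightarrow> y \<in> carrier H \<Longrightarrow> z \<in> carrier H \<Longrightarrow>
      \<tau> (c \<odot>\<^bsub>H\<^esub> x) y z = \<tau> x y (c \<odot>\<^bsub>H\<^esub> z)"
    and h: "h \<in> carrier H"
  shows "sweedler G (comult H h) (\<lambda>h1 h2. sweedler G (comult H h1) (\<lambda>x y. \<tau> x y h2)) =
    sweedler G (comult H h) (\<lambda>h1 h2. sweedler G (comult H h2) (\<lambda>x y. \<tau> h1 x y))"
proof -
  interpret Hm: module k H by (rule H_module_k)
  let ?T = "tensor_k k H H" and ?TT = "tensor_k k (tensor_k_module k H H) H"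
  define inner where "inner t z = sweedler G t (\<lambda>x y. \<tau> x y z)" for t z
  \<comment> \<open>\<open>\<Gamma>\<close> is the additive map induced by \<open>\<tau>\<close> on
    \<open>(H \<otimes> H) \<otimes> H\<close>. Applied to the axiom \<open>coassoc\<close> and
    pushed through the two nested sums, it gives the claim.\<close>
  define \<Gamma> where "\<Gamma> u = sweedler G u inner" for u
  have b: "k_bilinear G (\<lambda>x y. \<tau> x y z)" if "z \<in> carrier H" for z
    using that 1 2 4 by (intro k_bilinearI) auto
  have inner_pure: "inner (pure ?T x y) z = \<tau> x y z" if "x \<in> carrier H" "y \<in> carrier H" "z \<in> carrier H" for x y z
    using that by (simp add: inner_def HH_pure[OF G b])
  have inner_add: "additive ?T G (\<lambda>t. inner t z)" if "z \<in> carrier H" for z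
    unfolding inner_def using that by (rule HH_additive[OF G b])
  have bal: "balanced k (tensor_k_module k H H) (\<lambda>t c. c \<odot>\<^bsub>tensor_k_module k H H\<^esub> t) H (\<lambda>c n. c \<odot>\<^bsub>H\<^esub> n) G inner"
  proof (rule balancedI)
    show "additive (tensor_k_module k H H) G (\<lambda>t. inner t z)" if "z \<in> carrier H" for z
      using inner_add[OF that] by (simp add: additive_def)
    show "additive H G (inner t)" if "t \<in> carrier (tensor_k_module k H H)" for t
      unfolding inner_def using that 3 by (intro HH.sweedler_param_additive[OF G]) auto
    \<comment> \<open>Passing a scalar from \<open>t\<close> to \<open>z\<close> is an equality of
      additive maps in \<open>t\<close>, so the last scalar hypothesis, on pure \<open>t\<close>,
      suffices.\<close>
    fix t c z assume *: "t \<in> carrier (tensor_k_module k H H)" "c \<in> carrier k" "z \<in> carrier H"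
    have "additive ?T G (\<lambda>t. inner (c \<odot>\<^bsub>tensor_k_module k H H\<^esub> t) z)"
      using * by (intro additive_comp[OF smult_additive inner_add])
    moreover have "additive ?T G (\<lambda>t. inner t (c \<odot>\<^bsub>H\<^esub> z))"
      using * by (intro inner_add) auto
    ultimately show "inner (c \<odot>\<^bsub>tensor_k_module k H H\<^esub> t) z = inner t (c \<odot>\<^bsub>H\<^esub> z)"
      by (rule HH.additive_eqI) (use * 5 in \<open>simp_all add: smult_pure inner_pure del: tensor_k_module_simps(4)\<close>)
  qed
  have \<Gamma>_add: "additive ?TT G \<Gamma>" unfolding \<Gamma>_def by (rule HHH.additive_sweedler[OF G bal])
  have \<Gamma>_pure: "\<Gamma> (pure ?TT (pure ?T x y) z) = \<tau> x y z"
    if "x \<in> carrier H" "y \<in> carrier H" "z \<in> carrier H" for x y z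
    using that HH.pure_closed by (simp add: \<Gamma>_def HHH.sweedler_pure[OF G bal] inner_pure)
  have \<tau>_cl: "\<tau> x y z \<in> carrier G" if "x \<in> carrier H" "y \<in> carrier H" "z \<in> carrier H" for x y z
    using additive_closed[OF 3] that by auto
  have pcl: "pure ?TT (pure ?T x y) z \<in> carrier ?TT"
    if "x \<in> carrier H" "y \<in> carrier H" "z \<in> carrier H" for x y z
    using that HHH.pure_closed HH.pure_closed by auto
  note cc = comult_closed
  note push = HH.sweedler_additive[OF HHH.T_group G \<Gamma>_add]
  have l: "\<Gamma> (sweedler ?TT (comult H h) (\<lambda>h1 h2. sweedler ?TT (comult H h1) (\<lambda>x y. pure ?TT (pure ?T x y) h2)))
    = sweedler G (comult H h) (\<lambda>h1 h2. sweedler G (comult H h1) (\<lambda>x y. \<tau> x y h2))"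
    (is "\<Gamma> ?L = _")
  proof -
    have in1: "\<Gamma> (sweedler ?TT (comult H h1) (\<lambda>x y. pure ?TT (pure ?T x y) h2)) =
        sweedler G (comult H h1) (\<lambda>x y. \<tau> x y h2)" if "h1 \<in> carrier H" "h2 \<in> carrier H" for h1 h2
    proof -
      have "\<Gamma> (sweedler ?TT (comult H h1) (\<lambda>x y. pure ?TT (pure ?T x y) h2)) =
        sweedler G (comult H h1) (\<lambda>x y. \<Gamma> (pure ?TT (pure ?T x y) h2))"
        using that cc pcl by (intro push) auto
      also have "\<dots> = sweedler G (comult H h1) (\<lambda>x y. \<tau> x y h2)"
        using that cc \<Gamma>_pure \<tau>_cl by (intro HH.sweedler_cong[OF G]) auto
      finally show ?thesis .
    qed
    have "\<Gamma> ?L = sweedler G (comult H h) (\<lambda>h1 h2. \<Gamma> (sweedler ?TT (comult H h1) (\<lambda>x y. pure ?TT (pure ?T x y) h2)))"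
      using h cc pcl by (intro push HH.sweedler_closed[OF HHH.T_group]) auto
    also have "\<dots> = sweedler G (comult H h) (\<lambda>h1 h2. sweedler G (comult H h1) (\<lambda>x y. \<tau> x y h2))"
      using h cc in1 \<tau>_cl by (intro HH.sweedler_cong[OF G]) (auto intro!: HH.sweedler_closed[OF G])
    finally show ?thesis .
  qed
  have r: "\<Gamma> (sweedler ?TT (comult H h) (\<lambda>h1 h2. sweedler ?TT (comult H h2) (\<lambda>x y. pure ?TT (pure ?T h1 x) y)))
    = sweedler G (comult H h) (\<lambda>h1 h2. sweedler G (comult H h2) (\<lambda>x y. \<tau> h1 x y))"
    (is "\<Gamma> ?R = _")
  proof -
    have in1: "\<Gamma> (sweedler ?TT (comult H h2) (\<lambda>x y. pure ?TT (pure ?T h1 x) y)) =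
        sweedler G (comult H h2) (\<lambda>x y. \<tau> h1 x y)" if "h1 \<in> carrier H" "h2 \<in> carrier H" for h1 h2
    proof -
      have "\<Gamma> (sweedler ?TT (comult H h2) (\<lambda>x y. pure ?TT (pure ?T h1 x) y)) =
        sweedler G (comult H h2) (\<lambda>x y. \<Gamma> (pure ?TT (pure ?T h1 x) y))"
        using that cc pcl by (intro push) auto
      also have "\<dots> = sweedler G (comult H h2) (\<lambda>x y. \<tau> h1 x y)"
        using that cc \<Gamma>_pure \<tau>_cl by (intro HH.sweedler_cong[OF G]) auto
      finally show ?thesis .
    qed
    have "\<Gamma> ?R = sweedler G (comult H h) (\<lambda>h1 h2. \<Gamma> (sweedler ?TT (comult H h2) (\<lambda>x y. pure ?TT (pure ?T h1 x) y)))"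
      using h cc pcl by (intro push HH.sweedler_closed[OF HHH.T_group]) auto
    also have "\<dots> = sweedler G (comult H h) (\<lambda>h1 h2. sweedler G (comult H h2) (\<lambda>x y. \<tau> h1 x y))"
      using h cc in1 \<tau>_cl by (intro HH.sweedler_cong[OF G]) (auto intro!: HH.sweedler_closed[OF G])
    finally show ?thesis .
  qed
  have "\<Gamma> ?L = \<Gamma> ?R" using bialgebra.coassoc[OF H h] by simp
  then show ?thesis unfolding l r .
qed

end

context coring_setting
begin

subsection \<open>The tensor product of a module with the coring\<close>

abbreviation TC :: "('k, 'h, 'a, 'm, 'x) HA_module_scheme \<Rightarrow> ('m, 'c) tensor ring" where
  "TC M \<equiv> tensor_A A M C"

abbreviation TCC :: "('k, 'h, 'a, 'm, 'x) HA_module_scheme \<Rightarrow> (('m, 'c) tensor, 'c) tensor ring" where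
  "TCC M \<equiv> tensor_A2 A M C"

text \<open>\<open>k\<close> acts on \<open>C\<close> through the multiples of the unit of
  \<open>A\<close>; the second claim holds because these commute with all of
  \<open>A\<close>.\<close>

lemma C_lact_smult:
  assumes "c \<in> carrier k" "n \<in> carrier C"
  shows "lact C (c \<odot>\<^bsub>A\<^esub> \<one>\<^bsub>A\<^esub>) n = c \<odot>\<^bsub>C\<^esub> n"
    and "a \<in> carrier A \<Longrightarrow> lact C a (c \<odot>\<^bsub>C\<^esub> n) = c \<odot>\<^bsub>C\<^esub> lact C a n"
proof -
  interpret A: ring A by (rule A_ring)
  interpret Am: module k A by (rule A_module_k)
  interpret L: left_module A C "lact C" by (rule C_left_module)
  have sm: "lact C (c \<odot>\<^bsub>A\<^esub> a) m = c \<odot>\<^bsub>C\<^esub> lact C a m"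
    if "a \<in> carrier A" "m \<in> carrier C" for a m
    using that assms(1) by (intro HA_bimodule.lact_smult[OF C_bimodule])
  show 1: "lact C (c \<odot>\<^bsub>A\<^esub> \<one>\<^bsub>A\<^esub>) n = c \<odot>\<^bsub>C\<^esub> n"
    using assms sm[of "\<one>\<^bsub>A\<^esub>" n] by (simp add: L.one)
  assume a: "a \<in> carrier A"
  have "lact C a (c \<odot>\<^bsub>C\<^esub> n) = lact C (a \<otimes>\<^bsub>A\<^esub> (c \<odot>\<^bsub>A\<^esub> \<one>\<^bsub>A\<^esub>)) n"
    using assms a by (simp add: L.mult 1)
  also have "a \<otimes>\<^bsub>A\<^esub> (c \<odot>\<^bsub>A\<^esub> \<one>\<^bsub>A\<^esub>) = c \<odot>\<^bsub>A\<^esub> a"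
    using assms a k_algebra.mult_smult[OF A_algebra, of c a "\<one>\<^bsub>A\<^esub>"] by simp
  finally show "lact C a (c \<odot>\<^bsub>C\<^esub> n) = c \<odot>\<^bsub>C\<^esub> lact C a n" using a assms sm by simp
qed

lemma C_lact_ract:
  "a \<in> carrier A \<Longrightarrow> b \<in> carrier A \<Longrightarrow> m \<in> carrier C \<Longrightarrow> ract C (lact C a m) b = lact C a (ract C m b)"
  by (rule HA_bimodule.lact_ract[OF C_bimodule])

lemma C_hact_lact:
  "h \<in> carrier H \<Longrightarrow> a \<in> carrier A \<Longrightarrow> m \<in> carrier C \<Longrightarrow>
      hact C h (lact C a m) = sweedler C (comult H h) (\<lambda>h1 h2. lact C (hact A h1 a) (hact C h2 m))"
  by (rule HA_bimodule.hact_lact[OF C_bimodule])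

lemma C_lact_additive:
  "a \<in> carrier A \<Longrightarrow> additive C C (lact C a)" "n \<in> carrier C \<Longrightarrow> additive A C (\<lambda>a. lact C a n)"
  using C_left_module by (auto simp: left_module_def intro!: additiveI)

lemma A_hact_additive: "h \<in> carrier H \<Longrightarrow> additive A A (hact A h)"
  "a \<in> carrier A \<Longrightarrow> additive H A (\<lambda>h. hact A h a)"
  using A_H_module by (auto simp: H_module_def left_module_def intro!: additiveI)

lemma A_hact_closed: "h \<in> carrier H \<Longrightarrow> a \<in> carrier A \<Longrightarrow> hact A h a \<in> carrier A"
  by (rule additive_closed[OF A_hact_additive(1)])

lemma A_hact_smult:
  "c \<in> carrier k \<Longrightarrow> h \<in> carrier H \<Longrightarrow> a \<in> carrier A \<Longrightarrow> hact A (c \<odot>\<^bsub>H\<^esub> h) a = c \<odot>\<^bsub>A\<^esub> hact A h a"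
  using A_H_module by (auto simp: H_module_def)

context
  fixes M :: "('k, 'h, 'a, 'm, 'x) HA_module_scheme"
  assumes M: "HA_module k H A M"
begin

lemma M_right_module: "right_module A M (ract M)"
  and M_left_H_module: "left_module H M (hact M)"
  and M_k_module: "module k M"
  using M by (auto simp: HA_module_def HA_module_axioms_def H_module_def)

lemma M_group: "abelian_group M"
  using M_right_module by (simp add: right_module_def)

lemma M_hact_additive: "h \<in> carrier H \<Longrightarrow> additive M M (hact M h)"
  "m \<in> carrier M \<Longrightarrow> additive H M (\<lambda>h. hact M h m)"
  using M_left_H_module by (auto simp: left_module_def intro!: additiveI)

lemma M_ract_additive: "a \<in> carrier A \<Longrightarrow> additive M M (\<lambda>m. ract M m a)"
  "m \<in> carrier M \<Longrightarrow> additive A M (ract M m)"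
  using M_right_module by (auto simp: right_module_def intro!: additiveI)

lemma M_smult_additive: "c \<in> carrier k \<Longrightarrow> additive M M (\<lambda>m. c \<odot>\<^bsub>M\<^esub> m)"
proof -
  interpret Mk: module k M by (rule M_k_module)
  assume "c \<in> carrier k"
  then show ?thesis by (intro additiveI) (auto simp: Mk.smult_r_distr)
qed

lemma M_hact_closed: "h \<in> carrier H \<Longrightarrow> m \<in> carrier M \<Longrightarrow> hact M h m \<in> carrier M"
  by (rule additive_closed[OF M_hact_additive(1)])

lemma M_ract_closed: "a \<in> carrier A \<Longrightarrow> m \<in> carrier M \<Longrightarrow> ract M m a \<in> carrier M"
  by (rule right_module.closed[OF M_right_module])

lemma M_hact_smult:
  "c \<in> carrier k \<Longrightarrow> h \<in> carrier H \<Longrightarrow> m \<in> carrier M \<Longrightarrow> hact M (c \<odot>\<^bsub>H\<^esub> h) m = c \<odot>\<^bsub>M\<^esub> hact M h m"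
  using M by (auto simp: HA_module_def H_module_def)

lemma M_ract_smult:
  "c \<in> carrier k \<Longrightarrow> a \<in> carrier A \<Longrightarrow> m \<in> carrier M \<Longrightarrow> ract M m (c \<odot>\<^bsub>A\<^esub> a) = c \<odot>\<^bsub>M\<^esub> ract M m a"
  using M by (auto simp: HA_module_def HA_module_axioms_def)

lemma M_hact_ract:
  "h \<in> carrier H \<Longrightarrow> a \<in> carrier A \<Longrightarrow> m \<in> carrier M \<Longrightarrow>
      hact M h (ract M m a) = sweedler M (comult H h) (\<lambda>h1 h2. ract M (hact M h1 m) (hact A h2 a))"
  using M by (auto simp: HA_module_def HA_module_axioms_def)

text \<open>Scalars act through \<open>A\<close>, so closure under \<open>k\<close> and
  compatibility of maps with \<open>k\<close> reduce to the same statements for the right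
  \<open>A\<close>-action.\<close>

lemma M_smult_eq: "c \<in> carrier k \<Longrightarrow> m \<in> carrier M \<Longrightarrow> c \<odot>\<^bsub>M\<^esub> m = ract M m (c \<odot>\<^bsub>A\<^esub> \<one>\<^bsub>A\<^esub>)"
proof -
  interpret A: ring A by (rule A_ring)
  assume "c \<in> carrier k" "m \<in> carrier M"
  then show ?thesis using M_ract_smult[of c "\<one>\<^bsub>A\<^esub>" m] right_module.one[OF M_right_module] by simp
qed

lemma TC_pair: "tensor_pair A M (ract M) C (lact C)"
  using M_right_module C_left_module by (rule tensor_pair.intro)

lemma TC_eq: "tensor A M (ract M) C (lact C) \<equiv> TC M"
  by (simp add: tensor_A_def)

interpretation T: tensor_pair A M "ract M" C "lact C"
  rewrites "tensor A M (ract M) C (lact C) \<equiv> TC M"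
  by (rule TC_pair) (rule TC_eq)

lemmas TC_group = T.T_group
lemmas TC_additive_sweedler = T.additive_sweedler
lemmas TC_sweedler_pure = T.sweedler_pure
lemmas TC_sweedler_cong = T.sweedler_cong
lemmas TC_sweedler_additive = T.sweedler_additive
lemmas TC_param_additive = T.sweedler_param_additive
lemmas TC_pure_closed = T.pure_closed
lemmas TC_additive_eqI = T.additive_eqI

lemma TC_pure:
  "n \<in> carrier C \<Longrightarrow> additive M (TC M) (\<lambda>m. pure (TC M) m n)"
  "m \<in> carrier M \<Longrightarrow> additive C (TC M) (pure (TC M) m)"
  "m \<in> carrier M \<Longrightarrow> a \<in> carrier A \<Longrightarrow> n \<in> carrier C \<Longrightarrow> pure (TC M) (ract M m a) n = pure (TC M) m (lact C a n)"
  using T.pure_balanced by (auto simp: balanced_def)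

text \<open>Scalars cross the tensor sign because they act through \<open>A\<close> on both sides;
  this supplies the \<open>k\<close>-bilinearity behind the diagonal action.\<close>

lemma TC_pure_smult:
  assumes "c \<in> carrier k" "m \<in> carrier M" "n \<in> carrier C"
  shows "pure (TC M) (c \<odot>\<^bsub>M\<^esub> m) n = pure (TC M) m (c \<odot>\<^bsub>C\<^esub> n)"
proof -
  interpret A: ring A by (rule A_ring)
  interpret Am: module k A by (rule A_module_k)
  show ?thesis using assms TC_pure(3)[of m "c \<odot>\<^bsub>A\<^esub> \<one>\<^bsub>A\<^esub>" n] by (simp add: M_smult_eq C_lact_smult(1))
qed

end

lemmas C_group = M_group[OF C_module]
lemmas C_ract_additive = M_ract_additive[OF C_module]
lemmas C_hact_additive = M_hact_additive[OF C_module]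
lemmas C_hact_closed = M_hact_closed[OF C_module]
lemmas C_ract_closed = M_ract_closed[OF C_module]

context
  fixes M :: "('k, 'h, 'a, 'm, 'x) HA_module_scheme"
  assumes M: "HA_module k H A M"
begin

lemma tensor_ract_balanced:
  assumes a: "a \<in> carrier A"
  shows "balanced A M (ract M) C (lact C) (TC M) (\<lambda>m n. pure (TC M) m (ract C n a))"
proof (rule balancedI)
  note p = TC_pure[OF M]
  show "additive M (TC M) (\<lambda>m. pure (TC M) m (ract C n a))" if "n \<in> carrier C" for n
    using that a by (intro p C_ract_closed)
  show "additive C (TC M) (\<lambda>n. pure (TC M) m (ract C n a))" if "m \<in> carrier M" for m
    using that a by (intro additive_comp[OF C_ract_additive(1)] p)
  show "pure (TC M) (ract M m b) (ract C n a) = pure (TC M) m (ract C (lact C b n) a)"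
    if "m \<in> carrier M" "b \<in> carrier A" "n \<in> carrier C" for m b n
    using that a C_lact_ract[of b a n] p(3)[of m b "ract C n a"] C_ract_closed by simp
qed

lemma tensor_ract_additive: "a \<in> carrier A \<Longrightarrow> additive (TC M) (TC M) (\<lambda>t. tensor_ract A M C t a)"
  unfolding tensor_ract_def Let_def
  by (rule TC_additive_sweedler[OF M TC_group[OF M] tensor_ract_balanced])

lemma tensor_ract_pure:
  "a \<in> carrier A \<Longrightarrow> m \<in> carrier M \<Longrightarrow> n \<in> carrier C \<Longrightarrow>
    tensor_ract A M C (pure (TC M) m n) a = pure (TC M) m (ract C n a)"
  unfolding tensor_ract_def Let_def
  by (rule TC_sweedler_pure[OF M TC_group[OF M] tensor_ract_balanced])

text \<open>Gives meaning to the iterated product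
  \<open>(M \<otimes>\<^sub>A C) \<otimes>\<^sub>A C\<close>.\<close>

lemma TC_right_module: "right_module A (TC M) (tensor_ract A M C)"
proof -
  interpret A: ring A by (rule A_ring)
  interpret Cr: right_module A C "ract C" by (rule M_right_module[OF C_module])
  note p = TC_pure[OF M] and ad = tensor_ract_additive and pu = tensor_ract_pure and gr = TC_group[OF M]
  note cl = additive_closed[OF ad] and eq = TC_additive_eqI[OF M]
  show ?thesis
  proof (rule right_module.intro)
    show "ring A" by (rule A_ring)
    show "abelian_group (TC M)" by (rule gr)
    show "tensor_ract A M C m a \<in> carrier (TC M)" if "a \<in> carrier A" "m \<in> carrier (TC M)" for a m
      using that cl by blast
    show "tensor_ract A M C (t \<oplus>\<^bsub>TC M\<^esub> u) a = tensor_ract A M C t a \<oplus>\<^bsub>TC M\<^esub> tensor_ract A M C u a"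
      if "a \<in> carrier A" "t \<in> carrier (TC M)" "u \<in> carrier (TC M)" for a t u
      using that additive_add[OF ad] by blast
    show "tensor_ract A M C t (a \<oplus>\<^bsub>A\<^esub> b) = tensor_ract A M C t a \<oplus>\<^bsub>TC M\<^esub> tensor_ract A M C t b"
      if "a \<in> carrier A" "b \<in> carrier A" "t \<in> carrier (TC M)" for a b t
      using ad[of "a \<oplus>\<^bsub>A\<^esub> b"] additive_sum_map[OF gr ad[of a] ad[of b]] that(3)
    proof (rule eq)
      fix m n assume "m \<in> carrier M" "n \<in> carrier C"
      then show "tensor_ract A M C (pure (TC M) m n) (a \<oplus>\<^bsub>A\<^esub> b) =
        tensor_ract A M C (pure (TC M) m n) a \<oplus>\<^bsub>TC M\<^esub> tensor_ract A M C (pure (TC M) m n) b"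
        using that by (simp add: pu Cr.add_right Cr.closed additive_add[OF p(2)])
    qed (use that in auto)
    show "tensor_ract A M C t (a \<otimes>\<^bsub>A\<^esub> b) = tensor_ract A M C (tensor_ract A M C t a) b"
      if "a \<in> carrier A" "b \<in> carrier A" "t \<in> carrier (TC M)" for a b t
      using ad[of "a \<otimes>\<^bsub>A\<^esub> b"] additive_comp[OF ad[of a] ad[of b]] that(3)
    proof (rule eq)
      fix m n assume "m \<in> carrier M" "n \<in> carrier C"
      then show "tensor_ract A M C (pure (TC M) m n) (a \<otimes>\<^bsub>A\<^esub> b) =
        tensor_ract A M C (tensor_ract A M C (pure (TC M) m n) a) b"
        using that by (simp add: pu Cr.mult Cr.closed)
    qed (use that in auto)
    show "tensor_ract A M C t \<one>\<^bsub>A\<^esub> = t" if "t \<in> carrier (TC M)" for t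
      using ad[of "\<one>\<^bsub>A\<^esub>"] _ that
    proof (rule eq)
      show "additive (TC M) (TC M) (\<lambda>t. t)" by (simp add: additive_def)
    qed (auto simp: pu Cr.one)
  qed
qed

text \<open>The diagonal action on a pure tensor, as a function of the two factors: its balancedness
  is what makes the action on the whole tensor product well defined.\<close>

definition hpure :: "'h \<Rightarrow> 'm \<Rightarrow> 'c \<Rightarrow> ('m, 'c) tensor" where
  "hpure h m n = sweedler (TC M) (comult H h) (\<lambda>h1 h2. pure (TC M) (hact M h1 m) (hact C h2 n))"

text \<open>\<open>h\<^sub>1(ma) \<otimes> h\<^sub>2n = h\<^sub>1m \<otimes> h\<^sub>2(an)\<close>: both sides are \<open>h\<^sub>1m \<otimes> (h\<^sub>2a)(h\<^sub>3n)\<close>.\<close>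

lemma hpure_balanced:
  assumes h: "h \<in> carrier H"
  shows "balanced A M (ract M) C (lact C) (TC M) (hpure h)"
proof (rule balancedI)
  note p = TC_pure[OF M] and cl = M_hact_closed[OF M] C_hact_closed A_hact_closed
  note gr = TC_group[OF M] and dh = comult_closed[OF h]
  show "additive M (TC M) (\<lambda>m. hpure h m n)" if "n \<in> carrier C" for n
    unfolding hpure_def using that
    by (intro HH.sweedler_param_additive[OF gr dh] additive_comp[OF M_hact_additive(1)[OF M]] p cl)
  show "additive C (TC M) (hpure h m)" if "m \<in> carrier M" for m
    unfolding hpure_def using that
    by (intro HH.sweedler_param_additive[OF gr dh] additive_comp[OF C_hact_additive(1)] p cl)
  fix m a n assume *: "m \<in> carrier M" "a \<in> carrier A" "n \<in> carrier C"
  interpret L: left_module A C "lact C" by (rule C_left_module)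
  interpret Rm: right_module A M "ract M" by (rule M_right_module[OF M])
  interpret Am: module k A by (rule A_module_k)
  interpret Cm: module k C by (rule M_k_module[OF C_module])
  define \<tau> where "\<tau> x y z = pure (TC M) (hact M x m) (lact C (hact A y a) (hact C z n))" for x y z
  have pc: "pure (TC M) (hact M x m) (lact C (hact A y a) (hact C z n)) \<in> carrier (TC M)"
    if "x \<in> carrier H" "y \<in> carrier H" "z \<in> carrier H" for x y z
    using that * by (intro TC_pure_closed[OF M] cl L.closed)
  have eq: "sweedler (TC M) (comult H h) (\<lambda>h1 h2. sweedler (TC M) (comult H h1) (\<lambda>x y. \<tau> x y h2)) =
    sweedler (TC M) (comult H h) (\<lambda>h1 h2. sweedler (TC M) (comult H h2) (\<lambda>x y. \<tau> h1 x y))"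
    unfolding \<tau>_def
  proof (rule coassoc_apply[OF gr _ _ _ _ _ h])
    fix y z assume yz: "y \<in> carrier H" "z \<in> carrier H"
    show "additive H (TC M) (\<lambda>x. pure (TC M) (hact M x m) (lact C (hact A y a) (hact C z n)))"
      using * yz by (intro additive_comp[OF M_hact_additive(2)[OF M]] p L.closed cl)
    show "additive H (TC M) (\<lambda>x. pure (TC M) (hact M y m) (lact C (hact A x a) (hact C z n)))"
      using * yz by (intro additive_comp[OF additive_comp[OF A_hact_additive(2) C_lact_additive(2)]] p cl)
    show "additive H (TC M) (\<lambda>x. pure (TC M) (hact M y m) (lact C (hact A z a) (hact C x n)))"
      using * yz by (intro additive_comp[OF additive_comp[OF C_hact_additive(2) C_lact_additive(1)]] p cl)
  next
    fix c x y z assume c: "c \<in> carrier k" "x \<in> carrier H" "y \<in> carrier H" "z \<in> carrier H"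
    \<comment> \<open>The scalar is moved from \<open>x\<close> into the right-hand factor, where it
      can be absorbed into \<open>y\<close> or into \<open>z\<close>; this settles both scalar
      conditions of \<open>coassoc_apply\<close>.\<close>
    have 1: "pure (TC M) (hact M (c \<odot>\<^bsub>H\<^esub> x) m) (lact C (hact A y a) (hact C z n)) =
      pure (TC M) (hact M x m) (c \<odot>\<^bsub>C\<^esub> lact C (hact A y a) (hact C z n))"
      using c * by (simp add: M_hact_smult[OF M] TC_pure_smult[OF M] cl L.closed)
    have sm: "lact C (c \<odot>\<^bsub>A\<^esub> b) w = c \<odot>\<^bsub>C\<^esub> lact C b w"
      if "b \<in> carrier A" "w \<in> carrier C" for b w
      using that c by (intro HA_bimodule.lact_smult[OF C_bimodule])
    show "pure (TC M) (hact M (c \<odot>\<^bsub>H\<^esub> x) m) (lact C (hact A y a) (hact C z n)) =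
      pure (TC M) (hact M x m) (lact C (hact A (c \<odot>\<^bsub>H\<^esub> y) a) (hact C z n))"
      unfolding 1 using c * by (simp add: A_hact_smult sm cl)
    show "pure (TC M) (hact M (c \<odot>\<^bsub>H\<^esub> x) m) (lact C (hact A y a) (hact C z n)) =
      pure (TC M) (hact M x m) (lact C (hact A y a) (hact C (c \<odot>\<^bsub>H\<^esub> z) n))"
      unfolding 1 using c * by (simp add: M_hact_smult[OF C_module] C_lact_smult(2) cl)
  qed
  have inner1: "pure (TC M) (hact M h1 (ract M m a)) (hact C h2 n) = sweedler (TC M) (comult H h1) (\<lambda>x y. \<tau> x y h2)"
    if "h1 \<in> carrier H" "h2 \<in> carrier H" for h1 h2
  proof -
    have "pure (TC M) (hact M h1 (ract M m a)) (hact C h2 n) =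
      pure (TC M) (sweedler M (comult H h1) (\<lambda>x y. ract M (hact M x m) (hact A y a))) (hact C h2 n)"
      using that * by (simp add: M_hact_ract[OF M])
    also have "\<dots> = sweedler (TC M) (comult H h1) (\<lambda>x y. pure (TC M) (ract M (hact M x m) (hact A y a)) (hact C h2 n))"
      using that * by (intro HH.sweedler_additive[OF M_group[OF M] gr p(1)] comult_closed Rm.closed cl)
    also have "\<dots> = sweedler (TC M) (comult H h1) (\<lambda>x y. \<tau> x y h2)"
      unfolding \<tau>_def using that * by (intro HH.sweedler_cong[OF gr] comult_closed p(3) TC_pure_closed[OF M] Rm.closed cl)
    finally show ?thesis .
  qed
  have inner2: "pure (TC M) (hact M h1 m) (hact C h2 (lact C a n)) = sweedler (TC M) (comult H h2) (\<lambda>x y. \<tau> h1 x y)"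
    if "h1 \<in> carrier H" "h2 \<in> carrier H" for h1 h2
  proof -
    have "pure (TC M) (hact M h1 m) (hact C h2 (lact C a n)) =
      pure (TC M) (hact M h1 m) (sweedler C (comult H h2) (\<lambda>x y. lact C (hact A x a) (hact C y n)))"
      using that * by (simp add: C_hact_lact)
    also have "\<dots> = sweedler (TC M) (comult H h2) (\<lambda>x y. \<tau> h1 x y)"
      unfolding \<tau>_def using that * by (intro HH.sweedler_additive[OF C_group gr p(2)] comult_closed L.closed cl)
    finally show ?thesis .
  qed
  have "hpure h (ract M m a) n = sweedler (TC M) (comult H h) (\<lambda>h1 h2. sweedler (TC M) (comult H h1) (\<lambda>x y. \<tau> x y h2))"
    unfolding hpure_def using *
    by (intro HH.sweedler_cong[OF gr dh] inner1 TC_pure_closed[OF M] cl Rm.closed)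
  moreover have "hpure h m (lact C a n) = sweedler (TC M) (comult H h) (\<lambda>h1 h2. sweedler (TC M) (comult H h2) (\<lambda>x y. \<tau> h1 x y))"
    unfolding hpure_def using *
    by (intro HH.sweedler_cong[OF gr dh] inner2 TC_pure_closed[OF M] cl L.closed)
  ultimately show "hpure h (ract M m a) n = hpure h m (lact C a n)" using eq by simp
qed

lemma tensor_hact_eq: "tensor_hact H A M C h t = sweedler (TC M) t (hpure h)"
  by (simp add: tensor_hact_def hpure_def[abs_def] Let_def)

lemma tensor_hact_additive: "h \<in> carrier H \<Longrightarrow> additive (TC M) (TC M) (tensor_hact H A M C h)"
  unfolding tensor_hact_eq[abs_def]
  by (rule TC_additive_sweedler[OF M TC_group[OF M] hpure_balanced])

lemma tensor_hact_pure:
  "h \<in> carrier H \<Longrightarrow> m \<in> carrier M \<Longrightarrow> n \<in> carrier C \<Longrightarrow>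
    tensor_hact H A M C h (pure (TC M) m n) = hpure h m n"
  unfolding tensor_hact_eq
  by (rule TC_sweedler_pure[OF M TC_group[OF M] hpure_balanced])

lemma TCC_pair: "tensor_pair A (TC M) (tensor_ract A M C) C (lact C)"
  using TC_right_module C_left_module by (rule tensor_pair.intro)

lemma TCC_eq: "tensor A (TC M) (tensor_ract A M C) C (lact C) \<equiv> TCC M"
  by (simp add: tensor_A2_def)

interpretation T: tensor_pair A "TC M" "tensor_ract A M C" C "lact C"
  rewrites "tensor A (TC M) (tensor_ract A M C) C (lact C) \<equiv> TCC M"
  by (rule TCC_pair) (rule TCC_eq)

lemmas TCC_group = T.T_group
lemmas TCC_pure_closed = T.pure_closed

lemma TCC_pure:
  "n \<in> carrier C \<Longrightarrow> additive (TC M) (TCC M) (\<lambda>t. pure (TCC M) t n)"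
  "t \<in> carrier (TC M) \<Longrightarrow> additive C (TCC M) (pure (TCC M) t)"
  "t \<in> carrier (TC M) \<Longrightarrow> a \<in> carrier A \<Longrightarrow> n \<in> carrier C \<Longrightarrow>
    pure (TCC M) (tensor_ract A M C t a) n = pure (TCC M) t (lact C a n)"
  using T.pure_balanced by (auto simp: balanced_def)

end

end

context coring_setting
begin

subsection \<open>Maps of modules\<close>

text \<open>Scalars from \<open>k\<close> act through \<open>A\<close>, so
  \<open>k\<close>-linearity is contained in right \<open>A\<close>-linearity.\<close>

definition HA_map ::
  "('k, 'h, 'a, 'm, 'x) HA_module_scheme \<Rightarrow> ('k, 'h, 'a, 'n, 'y) HA_module_scheme \<Rightarrow> ('m \<Rightarrow> 'n) \<Rightarrow> bool" where
  "HA_map M N f \<longleftrightarrow> right_linear A M (ract M) N (ract N) f \<and>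
     (\<forall>h\<in>carrier H. \<forall>m\<in>carrier M. f (hact M h m) = hact N h (f m))"

lemma HA_mapI:
  assumes "additive M N f" "\<And>a m. a \<in> carrier A \<Longrightarrow> m \<in> carrier M \<Longrightarrow> f (ract M m a) = ract N (f m) a"
    "\<And>h m. h \<in> carrier H \<Longrightarrow> m \<in> carrier M \<Longrightarrow> f (hact M h m) = hact N h (f m)"
  shows "HA_map M N f"
  using assms by (auto simp: HA_map_def intro!: right_linearI)

lemma HA_mapD:
  assumes "HA_map M N f"
  shows "right_linear A M (ract M) N (ract N) f" "additive M N f"
    "m \<in> carrier M \<Longrightarrow> f m \<in> carrier N"
    "a \<in> carrier A \<Longrightarrow> m \<in> carrier M \<Longrightarrow> f (ract M m a) = ract N (f m) a"
    "h \<in> carrier H \<Longrightarrow> m \<in> carrier M \<Longrightarrow> f (hact M h m) = hact N h (f m)"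
proof -
  have *: "right_linear A M (ract M) N (ract N) f" using assms by (simp add: HA_map_def)
  show "right_linear A M (ract M) N (ract N) f" by (rule *)
  show "additive M N f" "m \<in> carrier M \<Longrightarrow> f m \<in> carrier N"
    "a \<in> carrier A \<Longrightarrow> m \<in> carrier M \<Longrightarrow> f (ract M m a) = ract N (f m) a"
    using right_linearD[OF *] by auto
  show "h \<in> carrier H \<Longrightarrow> m \<in> carrier M \<Longrightarrow> f (hact M h m) = hact N h (f m)"
    using assms by (simp add: HA_map_def)
qed

context
  fixes M :: "('k, 'h, 'a, 'm, 'x) HA_module_scheme" and N :: "('k, 'h, 'a, 'n, 'y) HA_module_scheme"
    and f :: "'m \<Rightarrow> 'n"
  assumes M: "HA_module k H A M" and N: "HA_module k H A N"
    and f: "right_linear A M (ract M) N (ract N) f"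
begin

lemmas TC_map_additive = tensor_map_additive[OF M_right_module[OF M] M_right_module[OF N] C_left_module f,
  folded tensor_A_def]
lemmas TC_map_pure = tensor_map_pure[OF M_right_module[OF M] M_right_module[OF N] C_left_module f,
  folded tensor_A_def]
lemmas sweedler_TC_map = sweedler_tensor_map[OF M_right_module[OF M] M_right_module[OF N] C_left_module f,
  folded tensor_A_def]

lemma TC_map_closed: "t \<in> carrier (TC M) \<Longrightarrow> tensor_map (TC N) f t \<in> carrier (TC N)"
  by (rule additive_closed[OF TC_map_additive])

lemma TC_map_ract:
  assumes "a \<in> carrier A" "t \<in> carrier (TC M)"
  shows "tensor_map (TC N) f (tensor_ract A M C t a) = tensor_ract A N C (tensor_map (TC N) f t) a"
  using additive_comp[OF tensor_ract_additive[OF M assms(1)] TC_map_additive]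
    additive_comp[OF TC_map_additive tensor_ract_additive[OF N assms(1)]] assms(2)
  by (rule TC_additive_eqI[OF M])
    (use assms right_linearD(2)[OF f] in
      \<open>simp add: tensor_ract_pure[OF M] tensor_ract_pure[OF N] TC_map_pure C_ract_closed\<close>)

lemma TC_map_right_linear:
  "right_linear A (TC M) (tensor_ract A M C) (TC N) (tensor_ract A N C) (tensor_map (TC N) f)"
  using TC_map_additive TC_map_ract by (intro right_linearI)

lemmas TCC_map_additive = tensor_map_additive[OF TC_right_module[OF M] TC_right_module[OF N]
  C_left_module TC_map_right_linear, folded tensor_A2_def]
lemmas TCC_map_pure = tensor_map_pure[OF TC_right_module[OF M] TC_right_module[OF N]
  C_left_module TC_map_right_linear, folded tensor_A2_def]

lemma TC_map_hact:
  assumes fh: "\<And>h m. h \<in> carrier H \<Longrightarrow> m \<in> carrier M \<Longrightarrow> f (hact M h m) = hact N h (f m)"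
    and h: "h \<in> carrier H" and t: "t \<in> carrier (TC M)"
  shows "tensor_map (TC N) f (tensor_hact H A M C h t) = tensor_hact H A N C h (tensor_map (TC N) f t)"
  using additive_comp[OF tensor_hact_additive[OF M h] TC_map_additive]
    additive_comp[OF TC_map_additive tensor_hact_additive[OF N h]] t
proof (rule TC_additive_eqI[OF M])
  fix m n assume mn: "m \<in> carrier M" "n \<in> carrier C"
  note fm = right_linearD(2)[OF f]
  have "tensor_map (TC N) f (tensor_hact H A M C h (pure (TC M) m n)) =
    tensor_map (TC N) f (sweedler (TC M) (comult H h) (\<lambda>h1 h2. pure (TC M) (hact M h1 m) (hact C h2 n)))"
    using h mn by (simp add: tensor_hact_pure[OF M] hpure_def[OF M])
  also have "\<dots> = sweedler (TC N) (comult H h) (\<lambda>h1 h2. tensor_map (TC N) f (pure (TC M) (hact M h1 m) (hact C h2 n)))"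
    using h mn by (intro HH.sweedler_additive[OF TC_group[OF M] TC_group[OF N] TC_map_additive]
      comult_closed TC_pure_closed[OF M] M_hact_closed[OF M] C_hact_closed)
  also have "\<dots> = sweedler (TC N) (comult H h) (\<lambda>h1 h2. pure (TC N) (hact N h1 (f m)) (hact C h2 n))"
    using h mn fm
    by (intro HH.sweedler_cong[OF TC_group[OF N]] comult_closed)
      (simp_all add: TC_map_pure M_hact_closed[OF M] C_hact_closed fh[symmetric] TC_pure_closed[OF N])
  also have "\<dots> = tensor_hact H A N C h (tensor_map (TC N) f (pure (TC M) m n))"
    using h mn fm by (simp add: TC_map_pure tensor_hact_pure[OF N] hpure_def[OF N])
  finally show "tensor_map (TC N) f (tensor_hact H A M C h (pure (TC M) m n)) =
    tensor_hact H A N C h (tensor_map (TC N) f (pure (TC M) m n))" .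
qed

end

subsection \<open>The comodule axioms in terms of additive maps\<close>

lemma ccomult_additive: "additive C (TC C) (ccomult C)"
  using HA_coring.ccomult_closed[OF C] HA_coring.ccomult_add[OF C] by (intro additiveI)

lemma ccomult_closed: "c \<in> carrier C \<Longrightarrow> ccomult C c \<in> carrier (TC C)"
  by (rule additive_closed[OF ccomult_additive])

lemma ccounit_additive: "additive C A (ccounit C)"
  using HA_coring.ccounit_closed[OF C] HA_coring.ccounit_add[OF C] by (intro additiveI)

lemma ccounit_closed: "c \<in> carrier C \<Longrightarrow> ccounit C c \<in> carrier A"
  by (rule additive_closed[OF ccounit_additive])

lemma tensor_lact_pure_balanced:
  assumes a: "a \<in> carrier A"
  shows "balanced A C (ract C) C (lact C) (TC C) (\<lambda>m n. pure (TC C) (lact C a m) n)"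
proof (rule balancedI)
  interpret L: left_module A C "lact C" by (rule C_left_module)
  note p = TC_pure[OF C_module]
  show "additive C (TC C) (\<lambda>m. pure (TC C) (lact C a m) n)" if "n \<in> carrier C" for n
    using a that by (intro additive_comp[OF C_lact_additive(1)] p)
  show "additive C (TC C) (pure (TC C) (lact C a m))" if "m \<in> carrier C" for m
    using a that by (intro p L.closed)
  show "pure (TC C) (lact C a (ract C m b)) n = pure (TC C) (lact C a m) (lact C b n)"
    if "m \<in> carrier C" "b \<in> carrier A" "n \<in> carrier C" for m b n
    using a that p(3)[of "lact C a m" b n] L.closed by (simp add: C_lact_ract)
qed

lemma tensor_lact_additive: "a \<in> carrier A \<Longrightarrow> additive (TC C) (TC C) (tensor_lact A C C a)"
  unfolding tensor_lact_def Let_def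
  by (rule TC_additive_sweedler[OF C_module TC_group[OF C_module] tensor_lact_pure_balanced])

lemma tensor_lact_pure:
  "a \<in> carrier A \<Longrightarrow> m \<in> carrier C \<Longrightarrow> n \<in> carrier C \<Longrightarrow>
    tensor_lact A C C a (pure (TC C) m n) = pure (TC C) (lact C a m) n"
  unfolding tensor_lact_def Let_def
  by (rule TC_sweedler_pure[OF C_module TC_group[OF C_module] tensor_lact_pure_balanced])

text \<open>The associativity \<open>m \<otimes> (x \<otimes> y) \<mapsto> (m \<otimes> x) \<otimes>
  y\<close> as a family of maps indexed by \<open>m\<close>, so that
  \<open>M \<otimes> (C \<otimes> C)\<close> never has to be formed.\<close>

definition assoc :: "('k, 'h, 'a, 'm, 'x) HA_module_scheme \<Rightarrow> 'm \<Rightarrow> ('c, 'c) tensor \<Rightarrow> (('m, 'c) tensor, 'c) tensor" where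
  "assoc M m t = sweedler (TCC M) t (\<lambda>x y. pure (TCC M) (pure (TC M) m x) y)"

text \<open>\<open>id \<otimes> \<Delta>\<close> followed by associativity.\<close>

definition id_tensor_comult :: "('k, 'h, 'a, 'm, 'x) HA_module_scheme \<Rightarrow> ('m, 'c) tensor \<Rightarrow> (('m, 'c) tensor, 'c) tensor" where
  "id_tensor_comult M t = sweedler (TCC M) t (\<lambda>m c. assoc M m (ccomult C c))"

text \<open>\<open>id \<otimes> \<epsilon>\<close> followed by the identification of
  \<open>M \<otimes>\<^sub>A A\<close> with \<open>M\<close>.\<close>

definition counit_map :: "('k, 'h, 'a, 'm, 'x) HA_module_scheme \<Rightarrow> ('m, 'c) tensor \<Rightarrow> 'm" where
  "counit_map M t = sweedler M t (\<lambda>m c. ract M m (ccounit C c))"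

context
  fixes M :: "('k, 'h, 'a, 'm, 'x) HA_module_scheme"
  assumes M: "HA_module k H A M"
begin

lemma assoc_balanced:
  assumes m: "m \<in> carrier M"
  shows "balanced A C (ract C) C (lact C) (TCC M) (\<lambda>x y. pure (TCC M) (pure (TC M) m x) y)"
proof (rule balancedI)
  note p = TC_pure[OF M] and pp = TCC_pure[OF M] and cl = TC_pure_closed[OF M] C_ract_closed
  show "additive C (TCC M) (\<lambda>x. pure (TCC M) (pure (TC M) m x) n)" if "n \<in> carrier C" for n
    using m that by (intro additive_comp[OF p(2)] pp)
  show "additive C (TCC M) (pure (TCC M) (pure (TC M) m x))" if "x \<in> carrier C" for x
    using m that by (intro pp cl)
  show "pure (TCC M) (pure (TC M) m (ract C x a)) y = pure (TCC M) (pure (TC M) m x) (lact C a y)"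
    if "x \<in> carrier C" "a \<in> carrier A" "y \<in> carrier C" for x a y
    using m that pp(3)[of "pure (TC M) m x" a y] cl by (simp add: tensor_ract_pure[OF M])
qed

lemma assoc_additive: "m \<in> carrier M \<Longrightarrow> additive (TC C) (TCC M) (assoc M m)"
  unfolding assoc_def by (rule TC_additive_sweedler[OF C_module TCC_group[OF M] assoc_balanced])

lemma assoc_pure:
  "m \<in> carrier M \<Longrightarrow> x \<in> carrier C \<Longrightarrow> y \<in> carrier C \<Longrightarrow>
    assoc M m (pure (TC C) x y) = pure (TCC M) (pure (TC M) m x) y"
  unfolding assoc_def by (rule TC_sweedler_pure[OF C_module TCC_group[OF M] assoc_balanced])

text \<open>The compatibility over \<open>A\<close> that lets \<open>assoc\<close> vary with
  \<open>m\<close> inside a balanced map.\<close>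

lemma assoc_lact:
  assumes "m \<in> carrier M" "a \<in> carrier A" "t \<in> carrier (TC C)"
  shows "assoc M (ract M m a) t = assoc M m (tensor_lact A C C a t)"
proof -
  interpret L: left_module A C "lact C" by (rule C_left_module)
  have ma: "ract M m a \<in> carrier M" using assms by (intro M_ract_closed[OF M])
  show ?thesis
    using assoc_additive[OF ma] additive_comp[OF tensor_lact_additive[OF assms(2)] assoc_additive[OF assms(1)]] assms(3)
    by (rule TC_additive_eqI[OF C_module])
      (use assms ma L.closed in \<open>simp add: assoc_pure tensor_lact_pure TC_pure(3)[OF M]\<close>)
qed

lemma id_tensor_comult_balanced: "balanced A M (ract M) C (lact C) (TCC M) (\<lambda>m c. assoc M m (ccomult C c))"
proof (rule balancedI)
  show "additive M (TCC M) (\<lambda>m. assoc M m (ccomult C c))" if "c \<in> carrier C" for c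
    unfolding assoc_def using that
    by (intro TC_param_additive[OF C_module TCC_group[OF M] ccomult_closed]
        additive_comp[OF TC_pure(1)[OF M]] TCC_pure(1)[OF M])
  show "additive C (TCC M) (\<lambda>c. assoc M m (ccomult C c))" if "m \<in> carrier M" for m
    using that by (intro additive_comp[OF ccomult_additive] assoc_additive)
  show "assoc M (ract M m a) (ccomult C c) = assoc M m (ccomult C (lact C a c))"
    if "m \<in> carrier M" "a \<in> carrier A" "c \<in> carrier C" for m a c
    using that ccomult_closed by (simp add: assoc_lact HA_coring.ccomult_lact[OF C])
qed

lemma id_tensor_comult_additive: "additive (TC M) (TCC M) (id_tensor_comult M)"
  unfolding id_tensor_comult_def by (rule TC_additive_sweedler[OF M TCC_group[OF M] id_tensor_comult_balanced])

lemma id_tensor_comult_pure: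
  "m \<in> carrier M \<Longrightarrow> c \<in> carrier C \<Longrightarrow> id_tensor_comult M (pure (TC M) m c) = assoc M m (ccomult C c)"
  unfolding id_tensor_comult_def by (rule TC_sweedler_pure[OF M TCC_group[OF M] id_tensor_comult_balanced])

lemma counit_balanced: "balanced A M (ract M) C (lact C) M (\<lambda>m c. ract M m (ccounit C c))"
proof (rule balancedI)
  interpret Mr: right_module A M "ract M" by (rule M_right_module[OF M])
  show "additive M M (\<lambda>m. ract M m (ccounit C c))" if "c \<in> carrier C" for c
    using that by (intro M_ract_additive[OF M] ccounit_closed)
  show "additive C M (\<lambda>c. ract M m (ccounit C c))" if "m \<in> carrier M" for m
    using that by (intro additive_comp[OF ccounit_additive] M_ract_additive[OF M])
  show "ract M (ract M m a) (ccounit C c) = ract M m (ccounit C (lact C a c))"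
    if "m \<in> carrier M" "a \<in> carrier A" "c \<in> carrier C" for m a c
    using that by (simp add: HA_coring.ccounit_lact[OF C] Mr.mult ccounit_closed)
qed

lemma counit_map_additive: "additive (TC M) M (counit_map M)"
  unfolding counit_map_def by (rule TC_additive_sweedler[OF M M_group[OF M] counit_balanced])

text \<open>The inner sum of the coassociativity axiom only reassembles the tensor
  \<open>\<rho> m\<close> (\<open>sweedler_pure_id\<close>), so the left-hand side is
  \<open>\<rho> \<otimes> id\<close>.\<close>

lemma coact_coassoc_eq:
  assumes \<rho>: "\<And>m. m \<in> carrier M \<Longrightarrow> \<rho> m \<in> carrier (TC M)" and t: "t \<in> carrier (TC M)"
  shows "sweedler (TCC M) t (\<lambda>m c. sweedler (TCC M) (\<rho> m) (\<lambda>n d. pure (TCC M) (pure (TC M) n d) c)) =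
    tensor_map (TCC M) \<rho> t"
proof -
  have 1: "sweedler (TCC M) u (\<lambda>n d. pure (TCC M) (pure (TC M) n d) c) = pure (TCC M) u c"
    if "u \<in> carrier (TC M)" "c \<in> carrier C" for u c
  proof -
    have "pure (TCC M) (sweedler (TC M) u (pure (TC M))) c =
        sweedler (TCC M) u (\<lambda>n d. pure (TCC M) (pure (TC M) n d) c)"
      using that by (intro TC_sweedler_additive[OF M TC_group[OF M] TCC_group[OF M] TCC_pure(1)[OF M]]
          TC_pure_closed[OF M])
    then show ?thesis
      using tensor_pair.sweedler_pure_id[OF TC_pair[OF M]] that by (simp add: tensor_A_def)
  qed
  show ?thesis
    unfolding tensor_map_def using \<rho> t
    by (intro TC_sweedler_cong[OF M TCC_group[OF M]]) (simp_all add: 1 TCC_pure_closed[OF M])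
qed

end

context
  fixes M :: "('k, 'h, 'a, 'm, 'x) HA_module_scheme" and N :: "('k, 'h, 'a, 'n, 'y) HA_module_scheme"
    and f :: "'m \<Rightarrow> 'n"
  assumes M: "HA_module k H A M" and N: "HA_module k H A N"
    and f: "right_linear A M (ract M) N (ract N) f"
begin

text \<open>Checked on \<open>m \<otimes> c\<close>, where both sides are additive in the tensor
  \<open>ccomult C c\<close> and are compared on pure tensors once more.\<close>

lemma id_tensor_comult_natural:
  assumes t: "t \<in> carrier (TC M)"
  shows "tensor_map (TCC N) (tensor_map (TC N) f) (id_tensor_comult M t) = id_tensor_comult N (tensor_map (TC N) f t)"
  using additive_comp[OF id_tensor_comult_additive[OF M] TCC_map_additive[OF M N f]]
    additive_comp[OF TC_map_additive[OF M N f] id_tensor_comult_additive[OF N]] t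
proof (rule TC_additive_eqI[OF M])
  fix m c assume mc: "m \<in> carrier M" "c \<in> carrier C"
  have fm: "f m \<in> carrier N" by (rule right_linearD(2)[OF f mc(1)])
  let ?F = "tensor_map (TC N) f" and ?FF = "tensor_map (TCC N) (tensor_map (TC N) f)"
  have "?FF (assoc M m t) = assoc N (f m) t" if "t \<in> carrier (TC C)" for t
    using additive_comp[OF assoc_additive[OF M mc(1)] TCC_map_additive[OF M N f]]
      assoc_additive[OF N fm] that
    by (rule TC_additive_eqI[OF C_module])
      (use mc fm in \<open>simp add: assoc_pure[OF M] assoc_pure[OF N] TCC_map_pure[OF M N f]
        TC_map_pure[OF M N f] TC_pure_closed[OF M]\<close>)
  then show "?FF (id_tensor_comult M (pure (TC M) m c)) = id_tensor_comult N (?F (pure (TC M) m c))"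
    using mc fm ccomult_closed by (simp add: id_tensor_comult_pure[OF M] id_tensor_comult_pure[OF N] TC_map_pure[OF M N f])
qed

lemma counit_natural:
  assumes t: "t \<in> carrier (TC M)"
  shows "f (counit_map M t) = counit_map N (tensor_map (TC N) f t)"
proof -
  have "f (counit_map M t) = sweedler N t (\<lambda>m c. f (ract M m (ccounit C c)))"
    unfolding counit_map_def using t
    by (intro TC_sweedler_additive[OF M M_group[OF M] M_group[OF N] right_linearD(1)[OF f]]
        M_ract_closed[OF M] ccounit_closed)
  also have "\<dots> = sweedler N t (\<lambda>m c. ract N (f m) (ccounit C c))"
    using t right_linearD(2,3)[OF f] ccounit_closed M_ract_closed[OF N]
    by (intro TC_sweedler_cong[OF M M_group[OF N]]) auto
  also have "\<dots> = counit_map N (tensor_map (TC N) f t)"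
    unfolding counit_map_def by (rule sweedler_TC_map[OF M N f M_group[OF N] counit_balanced[OF N] t, symmetric])
  finally show ?thesis .
qed

end

definition colinear ::
  "('k, 'h, 'a, 'c, 'm) HC_comodule \<Rightarrow> ('k, 'h, 'a, 'c, 'n) HC_comodule \<Rightarrow> ('m \<Rightarrow> 'n) \<Rightarrow> bool" where
  "colinear M N f \<longleftrightarrow> (\<forall>m\<in>carrier M. coact N (f m) = tensor_map (TC N) f (coact M m))"

definition coaction :: "('k, 'h, 'a, 'c, 'm) HC_comodule \<Rightarrow> bool" where
  "coaction M \<longleftrightarrow> right_linear A M (ract M) (TC M) (tensor_ract A M C) (coact M)"

text \<open>The axioms other than right linearity, stated at one element: in this form they pass
  along a morphism from \<open>m\<close> to \<open>f m\<close>, and they can be checked on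
  generators.\<close>

definition comodule_at :: "('k, 'h, 'a, 'c, 'm) HC_comodule \<Rightarrow> 'm \<Rightarrow> bool" where
  "comodule_at M m \<longleftrightarrow>
     (\<forall>h\<in>carrier H. coact M (hact M h m) = tensor_hact H A M C h (coact M m)) \<and>
     tensor_map (TCC M) (coact M) (coact M m) = id_tensor_comult M (coact M m) \<and>
     counit_map M (coact M m) = m"

lemma HC_comodule_iff:
  "HC_comodule k H A C M \<longleftrightarrow> HA_module k H A M \<and> coaction M \<and> (\<forall>m\<in>carrier M. comodule_at M m)"
proof (cases "HA_module k H A M \<and> (\<forall>m\<in>carrier M. coact M m \<in> carrier (TC M))")
  case True
  then have M: "HA_module k H A M" and cl: "\<And>m. m \<in> carrier M \<Longrightarrow> coact M m \<in> carrier (TC M)" by auto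
  show ?thesis
    unfolding HC_comodule_def HC_comodule_axioms_def coaction_def right_linear_def comodule_at_def
      id_tensor_comult_def assoc_def counit_map_def
    using M cl coact_coassoc_eq[OF M cl cl] by auto
qed (auto simp: HC_comodule_def HC_comodule_axioms_def coaction_def right_linear_def)

lemma HC_comoduleD:
  assumes "HC_comodule k H A C M"
  shows "HA_module k H A M" "coaction M" "additive M (TC M) (coact M)"
    "m \<in> carrier M \<Longrightarrow> coact M m \<in> carrier (TC M)"
    "m \<in> carrier M \<Longrightarrow> comodule_at M m"
proof -
  note * = assms[unfolded HC_comodule_iff]
  show "HA_module k H A M" "coaction M" "m \<in> carrier M \<Longrightarrow> comodule_at M m" using * by auto
  show "additive M (TC M) (coact M)" "m \<in> carrier M \<Longrightarrow> coact M m \<in> carrier (TC M)"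
    using * right_linearD[of A M "ract M" "TC M" "tensor_ract A M C" "coact M"] by (auto simp: coaction_def)
qed

text \<open>Both sides are induced by
  \<open>\<rho> \<circ> f = (f \<otimes> id) \<circ> \<rho>\<close>, factored in the two possible
  ways.\<close>

lemma coassoc_natural:
  assumes M: "HA_module k H A M" and N: "HA_module k H A N" and cM: "coaction M" and cN: "coaction N"
    and f: "right_linear A M (ract M) N (ract N) f" and co: "colinear M N f"
    and t: "t \<in> carrier (TC M)"
  shows "tensor_map (TCC N) (tensor_map (TC N) f) (tensor_map (TCC M) (coact M) t) =
    tensor_map (TCC N) (coact N) (tensor_map (TC N) f t)"
proof -
  note rm = M_right_module[OF M] TC_right_module[OF M] TC_right_module[OF N] C_left_module
    M_right_module[OF N]
  note F = TC_map_right_linear[OF M N f]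
  note cM' = cM[unfolded coaction_def] and cN' = cN[unfolded coaction_def]
  have "tensor_map (TCC N) (tensor_map (TC N) f) (tensor_map (TCC M) (coact M) t) =
    tensor_map (TCC N) (\<lambda>m. tensor_map (TC N) f (coact M m)) t"
    using tensor_map_comp[OF rm(1-4) cM' F, folded tensor_A_def, folded tensor_A2_def, OF t] .
  also have "\<dots> = tensor_map (TCC N) (\<lambda>m. coact N (f m)) t"
    using co t right_linearD(2)[OF cM'] TC_map_closed[OF M N f]
    by (intro tensor_map_cong[OF TC_pair[OF M] TCC_group[OF N]])
      (auto simp: colinear_def tensor_A_def[symmetric] intro!: TCC_pure_closed[OF N])
  also have "\<dots> = tensor_map (TCC N) (coact N) (tensor_map (TC N) f t)"
    using tensor_map_comp[OF rm(1) rm(5) rm(3) rm(4) f cN', folded tensor_A_def, folded tensor_A2_def, OF t] by simp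
  finally show ?thesis .
qed

text \<open>Every axiom at \<open>f m\<close> is the image of the axiom at \<open>m\<close>, by
  naturality of the maps occurring in it. Together with generators this yields the axioms on
  colimits.\<close>

lemma comodule_at_image:
  assumes M: "HC_comodule k H A C M" and N: "HA_module k H A N" and cN: "coaction N"
    and f: "HA_map M N f" and co: "colinear M N f" and m: "m \<in> carrier M"
  shows "comodule_at N (f m)"
proof -
  note M' = HC_comoduleD[OF M]
  note fd = HA_mapD[OF f]
  note at = M'(5)[OF m, unfolded comodule_at_def]
  have co': "coact N (f m') = tensor_map (TC N) f (coact M m')" if "m' \<in> carrier M" for m'
    using co that by (simp add: colinear_def)
  show ?thesis
    unfolding comodule_at_def
  proof (intro conjI ballI)
    fix h assume h: "h \<in> carrier H"
    have "coact N (hact N h (f m)) = coact N (f (hact M h m))" using h m fd by simp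
    also have "\<dots> = tensor_map (TC N) f (tensor_hact H A M C h (coact M m))"
      using at h m by (simp add: co' M_hact_closed[OF M'(1)])
    also have "\<dots> = tensor_hact H A N C h (coact N (f m))"
      using h m by (simp add: co' TC_map_hact[OF M'(1) N fd(1) fd(5)] M'(4))
    finally show "coact N (hact N h (f m)) = tensor_hact H A N C h (coact N (f m))" .
  next
    have "tensor_map (TCC N) (coact N) (coact N (f m)) =
        tensor_map (TCC N) (tensor_map (TC N) f) (tensor_map (TCC M) (coact M) (coact M m))"
      using m by (simp add: co' coassoc_natural[OF M'(1) N M'(2) cN fd(1) co] M'(4))
    also have "\<dots> = id_tensor_comult N (coact N (f m))"
      using m at by (simp add: co' id_tensor_comult_natural[OF M'(1) N fd(1)] M'(4))
    finally show "tensor_map (TCC N) (coact N) (coact N (f m)) = id_tensor_comult N (coact N (f m))" .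
  next
    show "counit_map N (coact N (f m)) = f m"
      using m at by (simp add: co' counit_natural[OF M'(1) N fd(1), symmetric] M'(4))
  qed
qed

text \<open>The axioms are equations in \<open>N\<close>, \<open>N \<otimes> C\<close> and
  \<open>(N \<otimes> C) \<otimes> C\<close> whose images hold in \<open>M\<close>; hence the three
  injectivity hypotheses.\<close>

lemma HC_comodule_pullback:
  assumes M: "HC_comodule k H A C M" and N: "HA_module k H A N" and aN: "additive N (TC N) (coact N)"
    and f: "HA_map N M f" and co: "colinear N M f"
    and inj: "inj_on f (carrier N)" "inj_on (tensor_map (TC M) f) (carrier (TC N))"
      "inj_on (tensor_map (TCC M) (tensor_map (TC M) f)) (carrier (TCC N))"
  shows "HC_comodule k H A C N"
proof -
  note M' = HC_comoduleD[OF M]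
  note fd = HA_mapD[OF f]
  have co': "tensor_map (TC M) f (coact N n) = coact M (f n)" if "n \<in> carrier N" for n
    using co that by (simp add: colinear_def)
  note cl = additive_closed[OF aN]
  note injD = inj_onD[OF inj(1)] inj_onD[OF inj(2)] inj_onD[OF inj(3)]
  have cN: "coaction N"
    unfolding coaction_def
  proof (rule right_linearI[OF aN])
    fix n a assume *: "n \<in> carrier N" "a \<in> carrier A"
    have "tensor_map (TC M) f (coact N (ract N n a)) = coact M (ract M (f n) a)"
      using * fd by (simp add: co' M_ract_closed[OF N])
    also have "\<dots> = tensor_ract A M C (coact M (f n)) a"
      using right_linearD(3)[OF M'(2)[unfolded coaction_def]] fd * by simp
    also have "\<dots> = tensor_map (TC M) f (tensor_ract A N C (coact N n) a)"
      using * cl by (simp add: TC_map_ract[OF N M'(1) fd(1)] co')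
    finally show "coact N (ract N n a) = tensor_ract A N C (coact N n) a"
      using * by (intro injD(2) cl M_ract_closed[OF N] additive_closed[OF tensor_ract_additive[OF N]])
  qed
  have "comodule_at N n" if n: "n \<in> carrier N" for n
    unfolding comodule_at_def
  proof (intro conjI ballI)
    note at = M'(5)[OF fd(3)[OF n], unfolded comodule_at_def]
    fix h assume h: "h \<in> carrier H"
    have "tensor_map (TC M) f (coact N (hact N h n)) = tensor_hact H A M C h (coact M (f n))"
      using h n fd at by (simp add: co' M_hact_closed[OF N])
    also have "\<dots> = tensor_map (TC M) f (tensor_hact H A N C h (coact N n))"
      using h n cl by (simp add: TC_map_hact[OF N M'(1) fd(1) fd(5)] co')
    finally show "coact N (hact N h n) = tensor_hact H A N C h (coact N n)"
      using h n by (intro injD(2) cl M_hact_closed[OF N] additive_closed[OF tensor_hact_additive[OF N]])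
  next
    note at = M'(5)[OF fd(3)[OF n], unfolded comodule_at_def]
    have "tensor_map (TCC M) (tensor_map (TC M) f) (tensor_map (TCC N) (coact N) (coact N n)) =
      tensor_map (TCC M) (coact M) (coact M (f n))"
      using n by (simp add: co' coassoc_natural[OF N M'(1) cN M'(2) fd(1) co] cl)
    also have "\<dots> = tensor_map (TCC M) (tensor_map (TC M) f) (id_tensor_comult N (coact N n))"
      using n at by (simp add: co' id_tensor_comult_natural[OF N M'(1) fd(1)] cl)
    finally show "tensor_map (TCC N) (coact N) (coact N n) = id_tensor_comult N (coact N n)"
      using n tensor_map_additive[OF M_right_module[OF N] TC_right_module[OF N] C_left_module cN[unfolded coaction_def],
        folded tensor_A_def, folded tensor_A2_def]
      by (intro injD(3) additive_closed[OF id_tensor_comult_additive[OF N]] cl) (auto intro: additive_closed cl)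
  next
    note at = M'(5)[OF fd(3)[OF n], unfolded comodule_at_def]
    have "f (counit_map N (coact N n)) = f n"
      using n at by (simp add: co' counit_natural[OF N M'(1) fd(1)] cl)
    then show "counit_map N (coact N n) = n"
      using n by (intro injD(1) additive_closed[OF counit_map_additive[OF N]] cl)
  qed
  then show ?thesis using N cN by (simp add: HC_comodule_iff)
qed

end

section \<open>Transfer of the axioms from generators and along injections\<close>

definition spans :: "('l, 'x) ring_scheme \<Rightarrow> 'l set \<Rightarrow> bool" where
  "spans L X \<longleftrightarrow> generate (add_monoid L) X = carrier L"

lemma spans_induct [consumes 3, case_names incl zero add uminus]:
  assumes "abelian_group L" "spans L X" "x \<in> carrier L"
    and incl: "\<And>x. x \<in> X \<Longrightarrow> P x" and zero: "P \<zero>\<^bsub>L\<^esub>"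
    and add: "\<And>x y. x \<in> carrier L \<Longrightarrow> y \<in> carrier L \<Longrightarrow> P x \<Longrightarrow> P y \<Longrightarrow> P (x \<oplus>\<^bsub>L\<^esub> y)"
    and uminus: "\<And>x. x \<in> carrier L \<Longrightarrow> P x \<Longrightarrow> P (\<ominus>\<^bsub>L\<^esub> x)"
  shows "P x"
proof -
  have "x \<in> generate (add_monoid L) X" using assms(2,3) by (simp add: spans_def)
  then show ?thesis
  proof (induction x rule: generate.induct)
    case one
    then show ?case using zero by simp
  next
    case (incl h)
    then show ?case by (rule assms(4))
  next
    case (inv h)
    then have "h \<in> carrier L" using assms(2) generate.incl[of h X "add_monoid L"] by (simp add: spans_def)
    then show ?case using uminus[of h] assms(4)[OF inv] by (simp add: a_inv_def)
  next
    case (eng h1 h2)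
    then show ?case using add[of h1 h2] assms(2) by (simp add: spans_def)
  qed
qed

lemma spans_additive_eqI:
  assumes "abelian_group L" "abelian_group G" "spans L X" "additive L G f" "additive L G g"
    and "\<And>x. x \<in> X \<Longrightarrow> f x = g x" "x \<in> carrier L"
  shows "f x = g x"
  using assms(1,3,7)
  by (induction x rule: spans_induct)
    (auto simp: assms(6) additive_zero[OF assms(1,2)] additive_uminus[OF assms(1,2)]
      additive_add[OF assms(4)] additive_add[OF assms(5)] assms(4,5))

lemma (in presented) spans_presented: "spans L ((\<lambda>s. q (frag_of s)) ` S)"
proof -
  interpret L: abelian_group L by (rule L_group)
  let ?X = "(\<lambda>s. q (frag_of s)) ` S"
  have X: "?X \<subseteq> carrier L" using q_closed by auto
  have sg: "subgroup (generate (add_monoid L) ?X) (add_monoid L)"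
    using X by (intro L.add.generate_is_subgroup) simp
  have "y \<in> generate (add_monoid L) ?X" if "y \<in> carrier L" for y
    using that
  proof (induction y rule: induct_presented)
    case (gen s)
    then show ?case by (intro generate.incl) auto
  next
    case zero
    then show ?case using generate.one[of "add_monoid L"] by simp
  next
    case (add x y)
    then show ?case using generate.eng[of x "add_monoid L"] by simp
  next
    case (uminus x)
    then show ?case using subgroup.m_inv_closed[OF sg] by (simp add: a_inv_def)
  qed
  moreover have "generate (add_monoid L) ?X \<subseteq> carrier L"
    using L.add.generate_incl[of ?X] X by simp
  ultimately show ?thesis by (auto simp: spans_def)
qed

context coring_setting
begin

text \<open>Both sides of each module law are additive in the element of \<open>L\<close>, so it
  suffices to compare them on the images \<open>f i m\<close>, where the law is the image of one in
  \<open>M i\<close>.\<close>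

lemma HA_module_generated:
  fixes L :: "('k, 'h, 'a, 'l, 'x) HA_module_scheme" and M :: "'i \<Rightarrow> ('k, 'h, 'a, 'm, 'y) HA_module_scheme"
  assumes M: "\<And>i. i \<in> I \<Longrightarrow> HA_module k H A (M i)" and L: "abelian_group L"
    and smult_add: "\<And>c. c \<in> carrier k \<Longrightarrow> additive L L (\<lambda>x. c \<odot>\<^bsub>L\<^esub> x)"
    and hact_add: "\<And>h. h \<in> carrier H \<Longrightarrow> additive L L (hact L h)"
    and ract_add: "\<And>a. a \<in> carrier A \<Longrightarrow> additive L L (\<lambda>x. ract L x a)"
    and f_add: "\<And>i. i \<in> I \<Longrightarrow> additive (M i) L (f i)"
    and f_smult: "\<And>i c m. i \<in> I \<Longrightarrow> c \<in> carrier k \<Longrightarrow> m \<in> carrier (M i) \<Longrightarrow> f i (c \<odot>\<^bsub>M i\<^esub> m) = c \<odot>\<^bsub>L\<^esub> f i m"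
    and f_hact: "\<And>i h m. i \<in> I \<Longrightarrow> h \<in> carrier H \<Longrightarrow> m \<in> carrier (M i) \<Longrightarrow> f i (hact (M i) h m) = hact L h (f i m)"
    and f_ract: "\<And>i a m. i \<in> I \<Longrightarrow> a \<in> carrier A \<Longrightarrow> m \<in> carrier (M i) \<Longrightarrow> f i (ract (M i) m a) = ract L (f i m) a"
    and spans: "spans L (\<Union>i\<in>I. f i ` carrier (M i))"
  shows "HA_module k H A L"
proof -
  interpret k: cring k by (rule k)
  interpret H: ring H by (rule H_ring)
  interpret A: ring A by (rule A_ring)
  interpret Am: module k A by (rule A_module_k)
  interpret Hm: module k H by (rule H_module_k)
  have eq: "p x = q x" if "additive L L p" "additive L L q" "x \<in> carrier L"
    "\<And>i m. i \<in> I \<Longrightarrow> m \<in> carrier (M i) \<Longrightarrow> p (f i m) = q (f i m)" for p q x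
    by (rule spans_additive_eqI[OF L L spans that(1,2) _ that(3)]) (use that(4) in auto)
  note cl = additive_closed[OF smult_add] additive_closed[OF hact_add] additive_closed[OF ract_add]
  have idm: "additive L L (\<lambda>x. x)" by (simp add: additive_def)
  note fadd = additive_add[OF f_add, symmetric]
  note Mcl = M_hact_closed[OF M] M_ract_closed[OF M] additive_closed[OF M_smult_additive[OF M]]
  have mod: "module k L"
  proof (rule moduleI)
    show "cring k" by (rule k)
    show "abelian_group L" by (rule L)
    show "c \<odot>\<^bsub>L\<^esub> x \<in> carrier L" if "c \<in> carrier k" "x \<in> carrier L" for c x using that cl by blast
    show "c \<odot>\<^bsub>L\<^esub> (x \<oplus>\<^bsub>L\<^esub> y) = c \<odot>\<^bsub>L\<^esub> x \<oplus>\<^bsub>L\<^esub> c \<odot>\<^bsub>L\<^esub> y"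
      if "c \<in> carrier k" "x \<in> carrier L" "y \<in> carrier L" for c x y
      using that additive_add[OF smult_add] by blast
    show "(a \<oplus>\<^bsub>k\<^esub> b) \<odot>\<^bsub>L\<^esub> x = a \<odot>\<^bsub>L\<^esub> x \<oplus>\<^bsub>L\<^esub> b \<odot>\<^bsub>L\<^esub> x"
      if "a \<in> carrier k" "b \<in> carrier k" "x \<in> carrier L" for a b x
    proof (rule eq[OF smult_add additive_sum_map[OF L smult_add smult_add] that(3)])
      fix i m assume *: "i \<in> I" "m \<in> carrier (M i)"
      interpret Mk: module k "M i" by (rule M_k_module[OF M[OF *(1)]])
      show "(a \<oplus>\<^bsub>k\<^esub> b) \<odot>\<^bsub>L\<^esub> f i m = a \<odot>\<^bsub>L\<^esub> f i m \<oplus>\<^bsub>L\<^esub> b \<odot>\<^bsub>L\<^esub> f i m"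
        using * that by (simp add: f_smult[symmetric] fadd Mk.smult_l_distr)
    qed (use that in auto)
    show "(a \<otimes>\<^bsub>k\<^esub> b) \<odot>\<^bsub>L\<^esub> x = a \<odot>\<^bsub>L\<^esub> (b \<odot>\<^bsub>L\<^esub> x)"
      if "a \<in> carrier k" "b \<in> carrier k" "x \<in> carrier L" for a b x
    proof (rule eq[OF smult_add additive_comp[OF smult_add smult_add] that(3)])
      fix i m assume *: "i \<in> I" "m \<in> carrier (M i)"
      interpret Mk: module k "M i" by (rule M_k_module[OF M[OF *(1)]])
      show "(a \<otimes>\<^bsub>k\<^esub> b) \<odot>\<^bsub>L\<^esub> f i m = a \<odot>\<^bsub>L\<^esub> (b \<odot>\<^bsub>L\<^esub> f i m)"
        using * that by (simp add: f_smult[symmetric] Mk.smult_assoc1)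
    qed (use that in auto)
    show "\<one>\<^bsub>k\<^esub> \<odot>\<^bsub>L\<^esub> x = x" if "x \<in> carrier L" for x
    proof (rule eq[OF smult_add idm that])
      fix i m assume *: "i \<in> I" "m \<in> carrier (M i)"
      interpret Mk: module k "M i" by (rule M_k_module[OF M[OF *(1)]])
      show "\<one>\<^bsub>k\<^esub> \<odot>\<^bsub>L\<^esub> f i m = f i m"
        using * by (simp add: f_smult[symmetric])
    qed auto
  qed
  have left: "left_module H L (hact L)"
  proof (rule left_module.intro)
    show "ring H" by (rule H_ring)
    show "abelian_group L" by (rule L)
    show "hact L h x \<in> carrier L" if "h \<in> carrier H" "x \<in> carrier L" for h x using that cl by blast
    show "hact L h (x \<oplus>\<^bsub>L\<^esub> y) = hact L h x \<oplus>\<^bsub>L\<^esub> hact L h y"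
      if "h \<in> carrier H" "x \<in> carrier L" "y \<in> carrier L" for h x y
      using that additive_add[OF hact_add] by blast
    show "hact L (a \<oplus>\<^bsub>H\<^esub> b) x = hact L a x \<oplus>\<^bsub>L\<^esub> hact L b x"
      if "a \<in> carrier H" "b \<in> carrier H" "x \<in> carrier L" for a b x
    proof (rule eq[OF hact_add additive_sum_map[OF L hact_add hact_add] that(3)])
      fix i m assume *: "i \<in> I" "m \<in> carrier (M i)"
      show "hact L (a \<oplus>\<^bsub>H\<^esub> b) (f i m) = hact L a (f i m) \<oplus>\<^bsub>L\<^esub> hact L b (f i m)"
        using * that left_module.add_left[OF M_left_H_module[OF M[OF *(1)]], of a b m]
        by (simp add: f_hact[symmetric] fadd Mcl)
    qed (use that in auto)
    show "hact L (a \<otimes>\<^bsub>H\<^esub> b) x = hact L a (hact L b x)"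
      if "a \<in> carrier H" "b \<in> carrier H" "x \<in> carrier L" for a b x
    proof (rule eq[OF hact_add additive_comp[OF hact_add hact_add] that(3)])
      fix i m assume *: "i \<in> I" "m \<in> carrier (M i)"
      show "hact L (a \<otimes>\<^bsub>H\<^esub> b) (f i m) = hact L a (hact L b (f i m))"
        using * that left_module.mult[OF M_left_H_module[OF M[OF *(1)]], of a b m]
        by (simp add: f_hact[symmetric] Mcl)
    qed (use that in auto)
    show "hact L \<one>\<^bsub>H\<^esub> x = x" if "x \<in> carrier L" for x
    proof (rule eq[OF hact_add idm that])
      fix i m assume *: "i \<in> I" "m \<in> carrier (M i)"
      show "hact L \<one>\<^bsub>H\<^esub> (f i m) = f i m"
        using * left_module.one[OF M_left_H_module[OF M[OF *(1)]], of m] by (simp add: f_hact[symmetric])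
    qed auto
  qed
  have right: "right_module A L (ract L)"
  proof (rule right_module.intro)
    show "ring A" by (rule A_ring)
    show "abelian_group L" by (rule L)
    show "ract L x h \<in> carrier L" if "h \<in> carrier A" "x \<in> carrier L" for h x using that cl by blast
    show "ract L (x \<oplus>\<^bsub>L\<^esub> y) h = ract L x h \<oplus>\<^bsub>L\<^esub> ract L y h"
      if "h \<in> carrier A" "x \<in> carrier L" "y \<in> carrier L" for h x y
      using that additive_add[OF ract_add] by blast
    show "ract L x (a \<oplus>\<^bsub>A\<^esub> b) = ract L x a \<oplus>\<^bsub>L\<^esub> ract L x b"
      if "a \<in> carrier A" "b \<in> carrier A" "x \<in> carrier L" for a b x
    proof (rule eq[OF ract_add additive_sum_map[OF L ract_add ract_add] that(3)])
      fix i m assume *: "i \<in> I" "m \<in> carrier (M i)"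
      show "ract L (f i m) (a \<oplus>\<^bsub>A\<^esub> b) = ract L (f i m) a \<oplus>\<^bsub>L\<^esub> ract L (f i m) b"
        using * that right_module.add_right[OF M_right_module[OF M[OF *(1)]], of a b m]
        by (simp add: f_ract[symmetric] fadd Mcl)
    qed (use that in auto)
    show "ract L x (a \<otimes>\<^bsub>A\<^esub> b) = ract L (ract L x a) b"
      if "a \<in> carrier A" "b \<in> carrier A" "x \<in> carrier L" for a b x
    proof (rule eq[OF ract_add additive_comp[OF ract_add ract_add] that(3)])
      fix i m assume *: "i \<in> I" "m \<in> carrier (M i)"
      show "ract L (f i m) (a \<otimes>\<^bsub>A\<^esub> b) = ract L (ract L (f i m) a) b"
        using * that right_module.mult[OF M_right_module[OF M[OF *(1)]], of a b m]
        by (simp add: f_ract[symmetric] Mcl)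
    qed (use that in auto)
    show "ract L x \<one>\<^bsub>A\<^esub> = x" if "x \<in> carrier L" for x
    proof (rule eq[OF ract_add idm that])
      fix i m assume *: "i \<in> I" "m \<in> carrier (M i)"
      show "ract L (f i m) \<one>\<^bsub>A\<^esub> = f i m"
        using * right_module.one[OF M_right_module[OF M[OF *(1)]], of m] by (simp add: f_ract[symmetric])
    qed auto
  qed
  show ?thesis
    unfolding HA_module_def HA_module_axioms_def H_module_def
  proof (intro conjI allI impI mod left right)
    fix c h x assume that: "c \<in> carrier k" "h \<in> carrier H" "x \<in> carrier L"
    show "hact L (c \<odot>\<^bsub>H\<^esub> h) x = c \<odot>\<^bsub>L\<^esub> hact L h x"
    proof (rule eq[OF hact_add additive_comp[OF hact_add smult_add] that(3)])
      fix i m assume *: "i \<in> I" "m \<in> carrier (M i)"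
      show "hact L (c \<odot>\<^bsub>H\<^esub> h) (f i m) = c \<odot>\<^bsub>L\<^esub> hact L h (f i m)"
        using * that M_hact_smult[OF M[OF *(1)], of c h m]
        by (simp add: f_hact[symmetric] f_smult[symmetric] Mcl)
    qed (use that in auto)
  next
    fix c a x assume that: "c \<in> carrier k" "a \<in> carrier A" "x \<in> carrier L"
    show "ract L x (c \<odot>\<^bsub>A\<^esub> a) = c \<odot>\<^bsub>L\<^esub> ract L x a"
    proof (rule eq[OF ract_add additive_comp[OF ract_add smult_add] that(3)])
      fix i m assume *: "i \<in> I" "m \<in> carrier (M i)"
      show "ract L (f i m) (c \<odot>\<^bsub>A\<^esub> a) = c \<odot>\<^bsub>L\<^esub> ract L (f i m) a"
        using * that M_ract_smult[OF M[OF *(1)], of c a m]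
        by (simp add: f_ract[symmetric] f_smult[symmetric] Mcl)
    qed (use that in auto)
  next
    fix h a x assume that: "h \<in> carrier H" "a \<in> carrier A" "x \<in> carrier L"
    \<comment> \<open>The tensor \<open>comult H h\<close> does not involve \<open>x\<close>, so the
      sum is additive in \<open>x\<close> summand by summand.\<close>
    have ad: "additive L L (\<lambda>x. sweedler L (comult H h) (\<lambda>h1 h2. ract L (hact L h1 x) (hact A h2 a)))"
      using that by (intro HH.sweedler_param_additive[OF L comult_closed] additive_comp[OF hact_add ract_add] A_hact_closed)
    show "hact L h (ract L x a) = sweedler L (comult H h) (\<lambda>h1 h2. ract L (hact L h1 x) (hact A h2 a))"
    proof (rule eq[OF additive_comp[OF ract_add hact_add] ad that(3)])
      fix i m assume *: "i \<in> I" "m \<in> carrier (M i)"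
      note Mi = M[OF *(1)]
      have "hact L h (ract L (f i m) a) = f i (sweedler (M i) (comult H h) (\<lambda>h1 h2. ract (M i) (hact (M i) h1 m) (hact A h2 a)))"
        using * that by (simp add: f_ract[symmetric] f_hact[symmetric] Mcl M_hact_ract[OF Mi, symmetric])
      also have "\<dots> = sweedler L (comult H h) (\<lambda>h1 h2. f i (ract (M i) (hact (M i) h1 m) (hact A h2 a)))"
        using * that by (intro HH.sweedler_additive[OF M_group[OF Mi] L f_add] comult_closed
          M_ract_closed[OF Mi] M_hact_closed[OF Mi] A_hact_closed)
      also have "\<dots> = sweedler L (comult H h) (\<lambda>h1 h2. ract L (hact L h1 (f i m)) (hact A h2 a))"
        using * that additive_closed[OF f_add]
        by (intro HH.sweedler_cong[OF L] comult_closed)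
          (auto simp: f_ract f_hact Mcl A_hact_closed intro!: cl)
      finally show "hact L h (ract L (f i m) a) =
        sweedler L (comult H h) (\<lambda>h1 h2. ract L (hact L h1 (f i m)) (hact A h2 a))" .
    qed (use that in auto)
  qed
qed

text \<open>The dual principle: an equation in \<open>N\<close> is tested after applying the
  injective \<open>f\<close>.\<close>

lemma HA_module_injective:
  fixes N :: "('k, 'h, 'a, 'n, 'x) HA_module_scheme" and M :: "('k, 'h, 'a, 'm, 'y) HA_module_scheme"
  assumes M: "HA_module k H A M" and N: "abelian_group N"
    and f: "additive N M f" and inj: "inj_on f (carrier N)"
    and smult_cl: "\<And>c n. c \<in> carrier k \<Longrightarrow> n \<in> carrier N \<Longrightarrow> c \<odot>\<^bsub>N\<^esub> n \<in> carrier N"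
    and hact_cl: "\<And>h n. h \<in> carrier H \<Longrightarrow> n \<in> carrier N \<Longrightarrow> hact N h n \<in> carrier N"
    and ract_cl: "\<And>a n. a \<in> carrier A \<Longrightarrow> n \<in> carrier N \<Longrightarrow> ract N n a \<in> carrier N"
    and f_smult: "\<And>c n. c \<in> carrier k \<Longrightarrow> n \<in> carrier N \<Longrightarrow> f (c \<odot>\<^bsub>N\<^esub> n) = c \<odot>\<^bsub>M\<^esub> f n"
    and f_hact: "\<And>h n. h \<in> carrier H \<Longrightarrow> n \<in> carrier N \<Longrightarrow> f (hact N h n) = hact M h (f n)"
    and f_ract: "\<And>a n. a \<in> carrier A \<Longrightarrow> n \<in> carrier N \<Longrightarrow> f (ract N n a) = ract M (f n) a"
  shows "HA_module k H A N"
proof -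
  interpret k: cring k by (rule k)
  interpret H: ring H by (rule H_ring)
  interpret A: ring A by (rule A_ring)
  interpret Am: module k A by (rule A_module_k)
  interpret Hm: module k H by (rule H_module_k)
  interpret Ng: abelian_group N by (rule N)
  interpret Mk: module k M by (rule M_k_module[OF M])
  interpret Ml: left_module H M "hact M" by (rule M_left_H_module[OF M])
  interpret Mr: right_module A M "ract M" by (rule M_right_module[OF M])
  note fc = additive_closed[OF f] and fa = additive_add[OF f]
  note eq = inj_onD[OF inj]
  have mod: "module k N"
    by (rule moduleI[OF k N])
      (auto intro!: eq simp: smult_cl fa fc f_smult Mk.smult_l_distr Mk.smult_r_distr Mk.smult_assoc1)
  have left: "left_module H N (hact N)"
    by (rule left_module.intro[OF H_ring N])
      (auto intro!: eq simp: hact_cl fa fc f_hact Ml.add_left Ml.add_right Ml.mult Ml.one)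
  have right: "right_module A N (ract N)"
    by (rule right_module.intro[OF A_ring N])
      (auto intro!: eq simp: ract_cl fa fc f_ract Mr.add_left Mr.add_right Mr.mult Mr.one)
  show ?thesis
    unfolding HA_module_def HA_module_axioms_def H_module_def
  proof (intro conjI allI impI mod left right)
    fix c h x assume "c \<in> carrier k" "h \<in> carrier H" "x \<in> carrier N"
    then show "hact N (c \<odot>\<^bsub>H\<^esub> h) x = c \<odot>\<^bsub>N\<^esub> hact N h x"
      by (intro eq) (simp_all add: hact_cl smult_cl f_hact f_smult fc M_hact_smult[OF M])
  next
    fix c a x assume "c \<in> carrier k" "a \<in> carrier A" "x \<in> carrier N"
    then show "ract N x (c \<odot>\<^bsub>A\<^esub> a) = c \<odot>\<^bsub>N\<^esub> ract N x a"
      by (intro eq) (simp_all add: ract_cl smult_cl f_ract f_smult fc M_ract_smult[OF M])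
  next
    fix h a x assume *: "h \<in> carrier H" "a \<in> carrier A" "x \<in> carrier N"
    have rc: "ract N (hact N h1 x) (hact A h2 a) \<in> carrier N" if "h1 \<in> carrier H" "h2 \<in> carrier H" for h1 h2
      using that * by (intro ract_cl hact_cl A_hact_closed)
    have "f (sweedler N (comult H h) (\<lambda>h1 h2. ract N (hact N h1 x) (hact A h2 a))) =
      sweedler M (comult H h) (\<lambda>h1 h2. f (ract N (hact N h1 x) (hact A h2 a)))"
      using * rc by (intro HH.sweedler_additive[OF N M_group[OF M] f] comult_closed)
    also have "\<dots> = sweedler M (comult H h) (\<lambda>h1 h2. ract M (hact M h1 (f x)) (hact A h2 a))"
      using * rc fc by (intro HH.sweedler_cong[OF M_group[OF M]] comult_closed)
        (auto simp: f_ract f_hact hact_cl A_hact_closed Ml.closed Mr.closed)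
    also have "\<dots> = f (hact N h (ract N x a))"
      using * by (simp add: f_ract f_hact ract_cl fc M_hact_ract[OF M])
    finally show "hact N h (ract N x a) = sweedler N (comult H h) (\<lambda>h1 h2. ract N (hact N h1 x) (hact A h2 a))"
      using * rc by (intro eq) (auto intro!: hact_cl ract_cl A_hact_closed HH.sweedler_closed[OF N] comult_closed)
  qed
qed

text \<open>Right linearity of the coaction comes first, because \<open>\<rho> \<otimes> id\<close>
  is known to be additive only for right linear \<open>\<rho>\<close>. The remaining axioms hold on
  the images by \<open>comodule_at_image\<close> and extend additively.\<close>

lemma HC_comodule_generated:
  fixes L :: "('k, 'h, 'a, 'c, 'l) HC_comodule" and M :: "'i \<Rightarrow> ('k, 'h, 'a, 'c, 'm) HC_comodule"
  assumes M: "\<And>i. i \<in> I \<Longrightarrow> HC_comodule k H A C (M i)" and L: "HA_module k H A L"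
    and coact_add: "additive L (TC L) (coact L)"
    and f: "\<And>i. i \<in> I \<Longrightarrow> HA_map (M i) L (f i)" "\<And>i. i \<in> I \<Longrightarrow> colinear (M i) L (f i)"
    and spans: "spans L (\<Union>i\<in>I. f i ` carrier (M i))"
  shows "HC_comodule k H A C L"
proof -
  note Lg = M_group[OF L] and TL = TC_group[OF L] and TTL = TCC_group[OF L]
  note Md = HC_comoduleD[OF M]
  note fd = HA_mapD[OF f(1)]
  have co: "coact L (f i m) = tensor_map (TC L) (f i) (coact (M i) m)" if "i \<in> I" "m \<in> carrier (M i)" for i m
    using f(2)[OF that(1)] that(2) by (simp add: colinear_def)
  have cL: "coaction L"
    unfolding coaction_def
  proof (rule right_linearI[OF coact_add])
    fix x a assume x: "x \<in> carrier L" and a: "a \<in> carrier A"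
    show "coact L (ract L x a) = tensor_ract A L C (coact L x) a"
    proof (rule spans_additive_eqI[OF Lg TL spans additive_comp[OF M_ract_additive(1)[OF L a] coact_add]
          additive_comp[OF coact_add tensor_ract_additive[OF L a]] _ x])
      fix y assume "y \<in> (\<Union>i\<in>I. f i ` carrier (M i))"
      then obtain i m where *: "i \<in> I" "m \<in> carrier (M i)" "y = f i m" by auto
      note Mi = Md(1)[OF *(1)]
      have "coact L (ract L (f i m) a) = coact L (f i (ract (M i) m a))"
        using * a fd(4)[OF *(1)] by simp
      also have "\<dots> = tensor_map (TC L) (f i) (tensor_ract A (M i) C (coact (M i) m) a)"
        using * a right_linearD(3)[OF Md(2)[OF *(1), unfolded coaction_def]]
        by (simp add: co M_ract_closed[OF Mi])
      also have "\<dots> = tensor_ract A L C (coact L (f i m)) a"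
        using * a Md(4) by (simp add: co TC_map_ract[OF Mi L fd(1)[OF *(1)]])
      finally show "coact L (ract L y a) = tensor_ract A L C (coact L y) a" using * by simp
    qed
  qed
  have at: "comodule_at L (f i m)" if "i \<in> I" "m \<in> carrier (M i)" for i m
    using that by (intro comodule_at_image[OF M L cL f])
  have "comodule_at L x" if x: "x \<in> carrier L" for x
    unfolding comodule_at_def
  proof (intro conjI ballI)
    fix h assume h: "h \<in> carrier H"
    show "coact L (hact L h x) = tensor_hact H A L C h (coact L x)"
      by (rule spans_additive_eqI[OF Lg TL spans additive_comp[OF M_hact_additive(1)[OF L h] coact_add]
            additive_comp[OF coact_add tensor_hact_additive[OF L h]] _ x])
        (use at h in \<open>auto simp: comodule_at_def\<close>)
  next
    have 1: "additive (TC L) (TCC L) (tensor_map (TCC L) (coact L))"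
      using tensor_map_additive[OF M_right_module[OF L] TC_right_module[OF L] C_left_module cL[unfolded coaction_def],
        folded tensor_A_def, folded tensor_A2_def] .
    show "tensor_map (TCC L) (coact L) (coact L x) = id_tensor_comult L (coact L x)"
      by (rule spans_additive_eqI[OF Lg TTL spans additive_comp[OF coact_add 1]
            additive_comp[OF coact_add id_tensor_comult_additive[OF L]] _ x])
        (use at in \<open>auto simp: comodule_at_def\<close>)
  next
    show "counit_map L (coact L x) = x"
      by (rule spans_additive_eqI[OF Lg Lg spans additive_comp[OF coact_add counit_map_additive[OF L]]
            _ _ x])
        (use at in \<open>auto simp: comodule_at_def additive_def\<close>)
  qed
  then show ?thesis using L cL by (simp add: HC_comodule_iff)
qed

end

section \<open>Small sets and flatness\<close>

context universe
begin

lemma small_lepoll: "A \<lesssim> B \<Longrightarrow> small U B \<Longrightarrow> small U A"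
  unfolding small_def using lepoll_trans by blast

lemma small_member: "X \<in> U \<Longrightarrow> small U X"
  unfolding small_def by blast

lemma small_subset: "small U B \<Longrightarrow> A \<subseteq> B \<Longrightarrow> small U A"
  using small_lepoll subset_imp_lepoll by blast

lemma small_image: "small U A \<Longrightarrow> small U (f ` A)"
  using small_lepoll image_lepoll by blast

lemma small_obtain:
  assumes "small U A" obtains e where "inj_on e A" "e ` A \<in> U"
  using assms subset_closed unfolding small_def lepoll_def by blast

lemma obtain_infinite: obtains Z where "Z \<in> U" "infinite Z"
proof -
  obtain X where X: "X \<in> U" "Pow (UNIV :: nat set) \<lesssim> X"
    using small_Pow_nat by (auto simp: small_def)
  then have "(UNIV :: nat set) \<lesssim> X" using lepoll_Pow_self lepoll_trans by blast
  then have "infinite X" by (simp add: infinite_le_lepoll)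
  then show thesis using X that by blast
qed

text \<open>The axioms give unions only over index sets that belong to \<open>U\<close>; a
  two-element subset of an infinite member serves as index set.\<close>

lemma Un_member: assumes "X \<in> U" "Y \<in> U" shows "X \<union> Y \<in> U"
proof -
  obtain Z where Z: "Z \<in> U" "infinite Z" by (rule obtain_infinite)
  obtain a where a: "a \<in> Z" using Z(2) by fastforce
  obtain b where b: "b \<in> Z" "b \<noteq> a" using Z(2) by (metis finite.simps insertCI subset_eq subset_singleton_iff)
  have "{a, b} \<in> U" using subset_closed[OF Z(1)] a b by simp
  then have "(\<Union>i\<in>{a, b}. if i = a then X else Y) \<in> U"
    using assms by (intro Union_closed) auto
  moreover have "(\<Union>i\<in>{a, b}. if i = a then X else Y) = X \<union> Y" using b by auto
  ultimately show ?thesis by simp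
qed

lemma small_obtain_infinite:
  assumes "small U A" "small U B"
  obtains Z where "Z \<in> U" "infinite Z" "A \<lesssim> Z" "B \<lesssim> Z"
proof -
  obtain Z where Z: "Z \<in> U" "infinite Z" by (rule obtain_infinite)
  obtain X Y where XY: "X \<in> U" "Y \<in> U" "A \<lesssim> X" "B \<lesssim> Y" using assms by (auto simp: small_def)
  have "X \<union> Y \<union> Z \<in> U" using Un_member XY Z by blast
  moreover have "A \<lesssim> X \<union> Y \<union> Z" "B \<lesssim> X \<union> Y \<union> Z"
    using XY by (meson lepoll_trans subset_imp_lepoll sup.cobounded1 sup.cobounded2 le_supI1)+
  ultimately show thesis using that Z(2) by blast
qed

lemma infinite_times_lepoll: "infinite Z \<Longrightarrow> Z \<times> Z \<lesssim> Z"
  using card_of_Times_same_infinite[of Z] by (metis eqpoll_iff_card_of_ordIso eqpoll_imp_lepoll)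

lemma infinite_lists_lepoll: "infinite Z \<Longrightarrow> lists Z \<lesssim> Z"
  using card_of_lists_infinite[of Z] by (metis eqpoll_iff_card_of_ordIso eqpoll_imp_lepoll)

lemma small_times:
  assumes "small U A" "small U B" shows "small U (A \<times> B)"
proof -
  obtain Z where Z: "Z \<in> U" "infinite Z" "A \<lesssim> Z" "B \<lesssim> Z" using small_obtain_infinite[OF assms] .
  have "A \<times> B \<lesssim> Z" using times_lepoll_mono[OF Z(3,4)] infinite_times_lepoll[OF Z(2)] lepoll_trans by blast
  then show ?thesis using Z(1) by (auto simp: small_def)
qed

lemma small_lists: assumes "small U A" shows "small U (lists A)"
proof -
  obtain Z where Z: "Z \<in> U" "infinite Z" "A \<lesssim> Z" using small_obtain_infinite[OF assms assms] .
  have "lists A \<lesssim> Z" using lists_lepoll_mono[OF Z(3)] infinite_lists_lepoll[OF Z(2)] lepoll_trans by blast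
  then show ?thesis using Z(1) by (auto simp: small_def)
qed

lemma small_nat: "small U (UNIV :: nat set)"
  using small_Pow_nat lepoll_Pow_self small_lepoll by blast

lemma small_countable: "countable A \<Longrightarrow> small U A"
  using small_lepoll[OF _ small_nat] by (auto simp: countable_def lepoll_def)

text \<open>\<open>Union_closed\<close> speaks of subsets of \<open>'u\<close>, so the index set and
  the fibres are first embedded there. The embedded fibres may overlap, hence the pairing with the
  index.\<close>

lemma small_Sigma:
  assumes "small U I" "\<And>i. i \<in> I \<Longrightarrow> small U (X i)"
  shows "small U (Sigma I X)"
proof -
  obtain g where g: "inj_on g I" "g ` I \<in> U" using small_obtain[OF assms(1)] .
  have "\<exists>e. inj_on e (X i) \<and> e ` X i \<in> U" if "i \<in> I" for i
    using small_obtain[OF assms(2)[OF that]] by blast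
  then obtain e where e: "\<And>i. i \<in> I \<Longrightarrow> inj_on (e i) (X i)" "\<And>i. i \<in> I \<Longrightarrow> e i ` X i \<in> U" by metis
  define F where "F j = e (inv_into I g j) ` X (inv_into I g j)" for j
  have "(\<Union>j\<in>g ` I. F j) \<in> U"
    unfolding F_def using g e by (intro Union_closed) auto
  then have "small U (g ` I \<times> (\<Union>j\<in>g ` I. F j))" using g by (intro small_times small_member)
  moreover have "Sigma I X \<lesssim> g ` I \<times> (\<Union>j\<in>g ` I. F j)"
    unfolding lepoll_def
  proof (intro exI conjI)
    show "inj_on (\<lambda>(i, x). (g i, e i x)) (Sigma I X)"
      using g e by (auto simp: inj_on_def)
    show "(\<lambda>(i, x). (g i, e i x)) ` Sigma I X \<subseteq> g ` I \<times> (\<Union>j\<in>g ` I. F j)"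
      using g by (auto simp: F_def)
  qed
  ultimately show ?thesis using small_lepoll by blast
qed

text \<open>A formal sum is coded by a list of its pairs of basis element and coefficient. The order
  of the list is arbitrary, since the set of its entries already determines the sum.\<close>

lemma free_Abelian_group_lepoll_lists: "carrier (free_Abelian_group S) \<lesssim> lists (S \<times> (UNIV :: int set))"
proof -
  define e :: "('a \<Rightarrow>\<^sub>0 int) \<Rightarrow> ('a \<times> int) list" where
    "e x = (SOME l. set l = (\<lambda>p. (p, Poly_Mapping.lookup x p)) ` Poly_Mapping.keys x)" for x
  have e: "set (e x) = (\<lambda>p. (p, Poly_Mapping.lookup x p)) ` Poly_Mapping.keys x" for x
    unfolding e_def by (rule someI_ex) (rule finite_list, simp)
  have "x = y" if xy: "e x = e y" for x y
  proof (rule poly_mapping_eqI)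
    fix p
    have keys: "Poly_Mapping.keys z = fst ` set (e z)" for z unfolding e by force
    have val: "Poly_Mapping.lookup z p = n" if "(p, n) \<in> set (e z)" for z n
      using that unfolding e by auto
    show "Poly_Mapping.lookup x p = Poly_Mapping.lookup y p"
    proof (cases "p \<in> Poly_Mapping.keys x")
      case True
      then have "(p, Poly_Mapping.lookup x p) \<in> set (e y)" using e[of x] xy by auto
      then show ?thesis using val by simp
    next
      case False
      then have "p \<notin> Poly_Mapping.keys y" using keys[of x] keys[of y] xy by simp
      then show ?thesis using False by (simp add: in_keys_iff)
    qed
  qed
  then have "inj_on e (carrier (free_Abelian_group S))" by (auto intro: inj_onI)
  moreover have "e ` carrier (free_Abelian_group S) \<subseteq> lists (S \<times> (UNIV :: int set))"
    using e by (auto simp: in_lists_conv_set)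
  ultimately show ?thesis by (auto simp: lepoll_def)
qed

lemma small_free_Abelian_group: "small U S \<Longrightarrow> small U (carrier (free_Abelian_group S))"
  by (rule small_lepoll[OF free_Abelian_group_lepoll_lists])
    (intro small_lists small_times small_countable[of "UNIV :: int set"], auto)

lemma (in presented) small_presented:
  assumes "universe V" "small V S" shows "small V (carrier L)"
proof -
  interpret V: universe V by fact
  show ?thesis using V.small_image[OF V.small_free_Abelian_group[OF assms(2)], of q] q_surj by simp
qed

lemma small_tensor:
  assumes "tensor_pair R M r N l" "small U (carrier M)" "small U (carrier N)"
  shows "small U (carrier (tensor R M r N l))"
proof -
  interpret tensor_pair R M r N l by fact
  show ?thesis using assms by (intro small_presented universe_axioms small_times)
qed

text \<open>The structure is copied along an injection onto a member of \<open>U\<close>; both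
  directions are returned as linear maps, so that maps and tensors can be moved back and
  forth.\<close>

lemma transport_right_module:
  assumes "right_module R M r" "small U (carrier M)"
  obtains M' :: "'u ring" and r' e g where "carrier M' \<in> U" "right_module R M' r'"
    "right_linear R M r M' r' e" "right_linear R M' r' M r g"
    "\<And>m. m \<in> carrier M \<Longrightarrow> g (e m) = m" "\<And>x. x \<in> carrier M' \<Longrightarrow> e (g x) = x"
proof -
  interpret M: right_module R M r by fact
  interpret Mg: abelian_group M by (rule M.abelian_group)
  obtain e where e: "inj_on e (carrier M)" "e ` carrier M \<in> U" using small_obtain[OF assms(2)] .
  define g where "g = inv_into (carrier M) e"
  define M' :: "'u ring" where "M' = \<lparr>carrier = e ` carrier M, monoid.mult = undefined, one = undefined,
    zero = e \<zero>\<^bsub>M\<^esub>, add = \<lambda>x y. e (g x \<oplus>\<^bsub>M\<^esub> g y)\<rparr>"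
  define r' where "r' x a = e (r (g x) a)" for x a
  have ge [simp]: "g (e m) = m" if "m \<in> carrier M" for m using that e by (simp add: g_def)
  have eg: "e (g x) = x" if "x \<in> carrier M'" for x using that by (auto simp: M'_def)
  have [simp]: "carrier M' = e ` carrier M" "\<zero>\<^bsub>M'\<^esub> = e \<zero>\<^bsub>M\<^esub>" "x \<oplus>\<^bsub>M'\<^esub> y = e (g x \<oplus>\<^bsub>M\<^esub> g y)" for x y
    by (simp_all add: M'_def)
  have gr: "abelian_group M'"
  proof (rule abelian_groupI)
    show "\<exists>y\<in>carrier M'. y \<oplus>\<^bsub>M'\<^esub> x = \<zero>\<^bsub>M'\<^esub>" if "x \<in> carrier M'" for x
      using that by (intro bexI[of _ "e (\<ominus>\<^bsub>M\<^esub> g x)"]) (auto simp: Mg.l_neg)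
  qed (auto simp: Mg.a_ac)
  have "right_module R M' r'"
    by (rule right_module.intro[OF M.ring gr])
      (auto simp: r'_def M.closed M.add_right M.add_left M.mult M.one)
  moreover have "right_linear R M r M' r' e" "right_linear R M' r' M r g"
    by (auto simp: right_linear_def r'_def M.closed)
  ultimately show thesis using that[of M' r' e g] e eg by simp
qed

end

text \<open>Flatness is only assumed for modules over \<open>'u ring\<close>; it is transported to small modules of any type.\<close>

lemma (in universe) flat_small:
  assumes flat: "flat_left_module U R N l"
    and M: "right_module R M r" "small U (carrier M)" and M': "right_module R M' r'" "small U (carrier M')"
    and f: "right_linear R M r M' r' f" "inj_on f (carrier M)"
  shows "inj_on (tensor_map (tensor R M' r' N l) f) (carrier (tensor R M r N l))"
proof -
  have N: "left_module R N l" using flat by (simp add: flat_left_module_def)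
  obtain M1 :: "'u ring" and r1 e g where 1: "carrier M1 \<in> U" "right_module R M1 r1"
    "right_linear R M r M1 r1 e" "right_linear R M1 r1 M r g"
    "\<And>m. m \<in> carrier M \<Longrightarrow> g (e m) = m" "\<And>x. x \<in> carrier M1 \<Longrightarrow> e (g x) = x"
    using transport_right_module[OF M] by blast
  obtain M1' :: "'u ring" and r1' e' g' where 2: "carrier M1' \<in> U" "right_module R M1' r1'"
    "right_linear R M' r' M1' r1' e'" "right_linear R M1' r1' M' r' g'"
    "\<And>m. m \<in> carrier M' \<Longrightarrow> g' (e' m) = m" "\<And>x. x \<in> carrier M1' \<Longrightarrow> e' (g' x) = x"
    using transport_right_module[OF M'] by blast
  \<comment> \<open>\<open>f\<close> conjugated to the two copies; the flatness hypothesis applies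
    to it directly.\<close>
  define f1 where "f1 x = e' (f (g x))" for x
  have fe: "right_linear R M r M1' r1' (\<lambda>m. e' (f m))" by (rule right_linear_comp[OF f(1) 2(3)])
  have f1: "right_linear R M1 r1 M1' r1' f1"
    unfolding f1_def by (rule right_linear_comp[OF 1(4) fe])
  have "inj_on f1 (carrier M1)"
  proof (rule inj_onI)
    fix x y assume *: "x \<in> carrier M1" "y \<in> carrier M1" "f1 x = f1 y"
    have gx: "g x \<in> carrier M" "g y \<in> carrier M" using * right_linearD(2)[OF 1(4)] by auto
    then have "f (g x) = f (g y)"
      using *(3) 2(5) right_linearD(2)[OF f(1)] unfolding f1_def by metis
    then have "g x = g y" using gx inj_onD[OF f(2)] by blast
    then show "x = y" using * 1(6) by metis
  qed
  then have inj1: "inj_on (tensor_map (tensor R M1' r1' N l) f1) (carrier (tensor R M1 r1 N l))"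
    using flat 1(1,2) 2(1,2) f1 unfolding flat_left_module_def tensor_map_def by blast
  interpret T: tensor_pair R M r N l using M N by (intro tensor_pair.intro)
  interpret T1': tensor_pair R M1' r1' N l using 2 N by (intro tensor_pair.intro)
  let ?e = "tensor_map (tensor R M1 r1 N l) e" and ?g = "tensor_map (tensor R M r N l) g"
  have ge: "?g (?e t) = t" if "t \<in> carrier T.T" for t
    using tensor_map_comp[OF M(1) 1(2) M(1) N 1(3,4) that] tensor_map_id[OF M(1) N that] 1(5) by simp
  show ?thesis
  proof (rule inj_onI)
    fix t u assume tu: "t \<in> carrier T.T" "u \<in> carrier T.T"
      "tensor_map (tensor R M' r' N l) f t = tensor_map (tensor R M' r' N l) f u"
    \<comment> \<open>The naturality square for the two copies. As \<open>?e\<close> has the left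
      inverse \<open>?g\<close>, injectivity for \<open>f1\<close> descends to
      \<open>f\<close>.\<close>
    have *: "tensor_map (tensor R M1' r1' N l) f1 (?e s) =
        tensor_map (tensor R M1' r1' N l) e' (tensor_map (tensor R M' r' N l) f s)" if s: "s \<in> carrier T.T" for s
    proof -
      have "tensor_map (tensor R M1' r1' N l) f1 (?e s) = tensor_map (tensor R M1' r1' N l) (\<lambda>m. f1 (e m)) s"
        by (rule tensor_map_comp[OF M(1) 1(2) 2(2) N 1(3) f1 s])
      also have "\<dots> = tensor_map (tensor R M1' r1' N l) (\<lambda>m. e' (f m)) s"
        using right_linearD(2)[OF fe] s
        by (intro tensor_map_cong[OF T.tensor_pair_axioms T1'.T_group])
          (auto simp: f1_def 1(5) intro!: T1'.pure_closed)
      also have "\<dots> = tensor_map (tensor R M1' r1' N l) e' (tensor_map (tensor R M' r' N l) f s)"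
        by (rule tensor_map_comp[OF M(1) M'(1) 2(2) N f(1) 2(3) s, symmetric])
      finally show ?thesis .
    qed
    have "?e t \<in> carrier (tensor R M1 r1 N l)" "?e u \<in> carrier (tensor R M1 r1 N l)"
      using additive_closed[OF tensor_map_additive[OF M(1) 1(2) N 1(3)]] tu by auto
    then have "?e t = ?e u"
      using inj_onD[OF inj1, of "?e t" "?e u"] *[OF tu(1)] *[OF tu(2)] tu(3) by metis
    then show "t = u" using ge tu by metis
  qed
qed

text \<open>Right exactness of the tensor product: the map \<open>(M \<otimes> N) / I \<rightarrow> Q \<otimes> N\<close> has an explicit inverse,
  built from a section of \<open>p\<close>.\<close>

lemma tensor_map_kernel:
  assumes M: "right_module R M r" and Q: "right_module R Q s" and N: "left_module R N l"
    and p: "right_linear R M r Q s p" and surj: "p ` carrier M = carrier Q"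
    and I: "subgroup I (add_monoid (tensor R M r N l))"
    and I_pure: "\<And>m n. m \<in> carrier M \<Longrightarrow> n \<in> carrier N \<Longrightarrow> p m = \<zero>\<^bsub>Q\<^esub> \<Longrightarrow> pure (tensor R M r N l) m n \<in> I"
    and t: "t \<in> carrier (tensor R M r N l)"
    and zero: "tensor_map (tensor R Q s N l) p t = \<zero>\<^bsub>tensor R Q s N l\<^esub>"
  shows "t \<in> I"
proof -
  interpret T: tensor_pair R M r N l using M N by (intro tensor_pair.intro)
  interpret TQ: tensor_pair R Q s N l using Q N by (intro tensor_pair.intro)
  interpret M: right_module R M r by (rule M)
  interpret Q: right_module R Q s by (rule Q)
  interpret Mg: abelian_group M by (rule T.M_group)
  interpret Qg: abelian_group Q by (rule TQ.M_group)
  interpret Tg: abelian_group T.T by (rule T.T_group)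
  note quot = quotient_group[OF Tg.a_comm_group I]
  define G where "G = additive_group (add_monoid T.T Mod I)"
  define \<pi> where "\<pi> x = (I #>\<^bsub>add_monoid T.T\<^esub> x)" for x
  have G: "abelian_group G" unfolding G_def by (rule quot(1))
  interpret G: abelian_group G by (rule G)
  have \<pi>: "additive T.T G \<pi>"
    unfolding G_def \<pi>_def using quot(2,3) by (intro additiveI) auto
  have \<pi>0: "\<pi> x = \<zero>\<^bsub>G\<^esub> \<longleftrightarrow> x \<in> I" if "x \<in> carrier T.T" for x
    using quot(5)[of x] that unfolding \<pi>_def G_def by simp
  note pa = right_linearD(1)[OF p] and pc = right_linearD(2)[OF p]
  note pb = T.pure_balanced[unfolded balanced_def]
  \<comment> \<open>Modulo \<open>I\<close> a pure tensor depends on \<open>m\<close> only through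
    \<open>p m\<close>: two choices differ by \<open>(m - m') \<otimes> n\<close>, which lies in
    \<open>I\<close>. This makes the map built from the section balanced.\<close>
  have dep: "\<pi> (pure T.T m n) = \<pi> (pure T.T m' n)"
    if *: "m \<in> carrier M" "m' \<in> carrier M" "n \<in> carrier N" "p m = p m'" for m m' n
  proof -
    have ad: "additive M T.T (\<lambda>m. pure T.T m n)" using pb * by auto
    have "p (m \<ominus>\<^bsub>M\<^esub> m') = \<zero>\<^bsub>Q\<^esub>"
      using * pc by (simp add: additive_minus[OF T.M_group TQ.M_group pa] Qg.minus_eq_zero_iff)
    then have "\<pi> (pure T.T (m \<ominus>\<^bsub>M\<^esub> m') n) = \<zero>\<^bsub>G\<^esub>"
      using * I_pure \<pi>0 T.pure_closed by simp
    then have "\<pi> (pure T.T m n) \<ominus>\<^bsub>G\<^esub> \<pi> (pure T.T m' n) = \<zero>\<^bsub>G\<^esub>"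
      using additive_minus[OF T.M_group G additive_comp[OF ad \<pi>] *(1,2)] by simp
    then show ?thesis using * additive_closed[OF \<pi>] T.pure_closed G.minus_eq_zero_iff by simp
  qed
  define \<sigma> where "\<sigma> = inv_into (carrier M) p"
  have \<sigma>: "\<sigma> x \<in> carrier M" "p (\<sigma> x) = x" if "x \<in> carrier Q" for x
    using that surj unfolding \<sigma>_def by (auto intro: inv_into_into f_inv_into_f)
  have bal: "balanced R Q s N l G (\<lambda>x n. \<pi> (pure T.T (\<sigma> x) n))"
  proof (rule balancedI)
    fix n assume n: "n \<in> carrier N"
    have ad: "additive M T.T (\<lambda>m. pure T.T m n)" using pb n by auto
    show "additive Q G (\<lambda>x. \<pi> (pure T.T (\<sigma> x) n))"
    proof (rule additiveI)
      fix x y assume xy: "x \<in> carrier Q" "y \<in> carrier Q"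
      have "\<pi> (pure T.T (\<sigma> (x \<oplus>\<^bsub>Q\<^esub> y)) n) = \<pi> (pure T.T (\<sigma> x \<oplus>\<^bsub>M\<^esub> \<sigma> y) n)"
        using xy n \<sigma> by (intro dep) (auto simp: additive_add[OF pa])
      then show "\<pi> (pure T.T (\<sigma> (x \<oplus>\<^bsub>Q\<^esub> y)) n) = \<pi> (pure T.T (\<sigma> x) n) \<oplus>\<^bsub>G\<^esub> \<pi> (pure T.T (\<sigma> y) n)"
        using xy \<sigma> additive_add[OF additive_comp[OF ad \<pi>]] by simp
    qed (use n \<sigma> in \<open>auto intro!: additive_closed[OF \<pi>] T.pure_closed\<close>)
  next
    fix x assume "x \<in> carrier Q"
    then show "additive N G (\<lambda>n. \<pi> (pure T.T (\<sigma> x) n))"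
      using pb \<sigma> by (intro additive_comp[OF _ \<pi>]) auto
  next
    fix x a n assume *: "x \<in> carrier Q" "a \<in> carrier R" "n \<in> carrier N"
    have "\<pi> (pure T.T (\<sigma> (s x a)) n) = \<pi> (pure T.T (r (\<sigma> x) a) n)"
      using * \<sigma> Q.closed M.closed right_linearD(3)[OF p] by (intro dep) auto
    then show "\<pi> (pure T.T (\<sigma> (s x a)) n) = \<pi> (pure T.T (\<sigma> x) (l a n))"
      using * \<sigma> pb by simp
  qed
  \<comment> \<open>Following \<open>p \<otimes> id\<close> by the constructed map gives the
    projection to the quotient by \<open>I\<close>, so a tensor killed by
    \<open>p \<otimes> id\<close> lies in \<open>I\<close>.\<close>
  have "sweedler G (tensor_map TQ.T p t) (\<lambda>x n. \<pi> (pure T.T (\<sigma> x) n)) = \<pi> t"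
    using additive_comp[OF tensor_map_additive[OF M Q N p] TQ.additive_sweedler[OF G bal]] \<pi> t
  proof (rule T.additive_eqI)
    fix m n assume "m \<in> carrier M" "n \<in> carrier N"
    then show "sweedler G (tensor_map TQ.T p (pure T.T m n)) (\<lambda>x n. \<pi> (pure T.T (\<sigma> x) n)) = \<pi> (pure T.T m n)"
      using pc \<sigma> by (simp add: tensor_map_pure[OF M Q N p] TQ.sweedler_pure[OF G bal]) (intro dep, auto)
  qed
  moreover have "sweedler G \<zero>\<^bsub>TQ.T\<^esub> (\<lambda>x n. \<pi> (pure T.T (\<sigma> x) n)) = \<zero>\<^bsub>G\<^esub>"
    using additive_zero[OF TQ.T_group G TQ.additive_sweedler[OF G bal]] .
  ultimately show ?thesis using zero \<pi>0[OF t] by simp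
qed

section \<open>Subcomodules\<close>

text \<open>Smallness of the power sets serves to count, in \<open>ex_test_set\<close>, the comodule
  structures on subsets of a fixed set; smallness of \<open>H\<close>, \<open>A\<close> and
  \<open>C\<close> themselves is a consequence.\<close>

locale flat_coring = coring_setting k H A C + universe U
  for k :: "'k ring" and H :: "('k, 'h) bialgebra" and A :: "('k, 'h, 'a) H_module"
    and C :: "('k, 'h, 'a, 'c) HA_coring" and U :: "'u set set" +
  assumes flat: "flat_left_module U A C (lact C)"
    and small_Pow: "small U (Pow (carrier H))" "small U (Pow (carrier A))" "small U (Pow (carrier C))"
begin

lemma small_HAC: "small U (carrier H)" "small U (carrier A)" "small U (carrier C)"
  using small_Pow lepoll_Pow_self small_lepoll by blast+

lemma small_TC: "HA_module k H A M \<Longrightarrow> small U (carrier M) \<Longrightarrow> small U (carrier (TC M))"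
  using small_tensor[OF TC_pair _ small_HAC(3), of M] by (simp add: tensor_A_def)

lemma TC_map_inj:
  assumes "HA_module k H A M" "HA_module k H A N" "small U (carrier M)" "small U (carrier N)"
    "right_linear A M (ract M) N (ract N) f" "inj_on f (carrier M)"
  shows "inj_on (tensor_map (TC N) f) (carrier (TC M))"
  using flat_small[OF flat M_right_module[OF assms(1)] assms(3) M_right_module[OF assms(2)] assms(4-6)]
  by (simp add: tensor_A_def)

text \<open>Flatness used twice: \<open>f \<otimes> id\<close> is again an injective right linear
  map between small modules.\<close>

lemma TCC_map_inj:
  assumes "HA_module k H A M" "HA_module k H A N" "small U (carrier M)" "small U (carrier N)"
    "right_linear A M (ract M) N (ract N) f" "inj_on f (carrier M)"
  shows "inj_on (tensor_map (TCC N) (tensor_map (TC N) f)) (carrier (TCC M))"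
  using flat_small[OF flat TC_right_module[OF assms(1)] small_TC[OF assms(1,3)] TC_right_module[OF assms(2)]
      small_TC[OF assms(2,4)] TC_map_right_linear[OF assms(1,2,5)] TC_map_inj[OF assms]]
  by (simp add: tensor_A2_def)

lemma HC_comodule_injective:
  assumes M: "HC_comodule k H A C M" and N: "HA_module k H A N" and aN: "additive N (TC N) (coact N)"
    and f: "HA_map N M f" and co: "colinear N M f" and inj: "inj_on f (carrier N)"
    and sm: "small U (carrier M)" "small U (carrier N)"
  shows "HC_comodule k H A C N"
  using HC_comodule_pullback[OF M N aN f co inj] TC_map_inj[OF N HC_comoduleD(1)[OF M] sm(2,1) HA_mapD(1)[OF f] inj]
    TCC_map_inj[OF N HC_comoduleD(1)[OF M] sm(2,1) HA_mapD(1)[OF f] inj] by blast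

text \<open>Closure under scalars of \<open>k\<close> follows, since they act through
  \<open>A\<close>.\<close>

definition sub_HA :: "('k, 'h, 'a, 'm, 'x) HA_module_scheme \<Rightarrow> 'm set \<Rightarrow> bool" where
  "sub_HA M S \<longleftrightarrow> subgroup S (add_monoid M) \<and> (\<forall>h\<in>carrier H. \<forall>s\<in>S. hact M h s \<in> S) \<and>
     (\<forall>a\<in>carrier A. \<forall>s\<in>S. ract M s a \<in> S)"

lemma sub_HA_module:
  fixes M :: "('k, 'h, 'a, 'm, 'x) HA_module_scheme"
  assumes M: "HA_module k H A M" and S: "sub_HA M S"
  shows "HA_module k H A (M\<lparr>carrier := S\<rparr>)" "HA_map (M\<lparr>carrier := S\<rparr>) M (\<lambda>x. x)" "S \<subseteq> carrier M"
proof -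
  interpret Mg: abelian_group M by (rule M_group[OF M])
  interpret Am: module k A by (rule A_module_k)
  have Sg: "subgroup S (add_monoid M)" using S by (simp add: sub_HA_def)
  show sub: "S \<subseteq> carrier M" using subgroup.subset[OF Sg] by simp
  have um: "\<ominus>\<^bsub>M\<^esub> x \<in> S" if "x \<in> S" for x using subgroup.m_inv_closed[OF Sg that] by (simp add: a_inv_def)
  have ac: "x \<oplus>\<^bsub>M\<^esub> y \<in> S" if "x \<in> S" "y \<in> S" for x y using subgroup.m_closed[OF Sg that] by simp
  have zc: "\<zero>\<^bsub>M\<^esub> \<in> S" using subgroup.one_closed[OF Sg] by simp
  have sg: "abelian_group (M\<lparr>carrier := S\<rparr>)"
  proof (rule abelian_groupI)
    show "\<exists>y\<in>carrier (M\<lparr>carrier := S\<rparr>). y \<oplus>\<^bsub>M\<lparr>carrier := S\<rparr>\<^esub> x = \<zero>\<^bsub>M\<lparr>carrier := S\<rparr>\<^esub>"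
      if "x \<in> carrier (M\<lparr>carrier := S\<rparr>)" for x
      proof (rule bexI)
      show "\<ominus>\<^bsub>M\<^esub> x \<oplus>\<^bsub>M\<lparr>carrier := S\<rparr>\<^esub> x = \<zero>\<^bsub>M\<lparr>carrier := S\<rparr>\<^esub>"
        using Mg.l_neg[of x] that sub by auto
      show "\<ominus>\<^bsub>M\<^esub> x \<in> carrier (M\<lparr>carrier := S\<rparr>)" using um that by simp
    qed
  next
    fix x y z assume *: "x \<in> carrier (M\<lparr>carrier := S\<rparr>)" "y \<in> carrier (M\<lparr>carrier := S\<rparr>)" "z \<in> carrier (M\<lparr>carrier := S\<rparr>)"
    then have M3: "x \<in> carrier M" "y \<in> carrier M" "z \<in> carrier M" using sub by auto
    show "x \<oplus>\<^bsub>M\<lparr>carrier := S\<rparr>\<^esub> y \<oplus>\<^bsub>M\<lparr>carrier := S\<rparr>\<^esub> z =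
      x \<oplus>\<^bsub>M\<lparr>carrier := S\<rparr>\<^esub> (y \<oplus>\<^bsub>M\<lparr>carrier := S\<rparr>\<^esub> z)"
      using Mg.a_assoc[OF M3] by simp
  next
    fix x y assume *: "x \<in> carrier (M\<lparr>carrier := S\<rparr>)" "y \<in> carrier (M\<lparr>carrier := S\<rparr>)"
    then have M2: "x \<in> carrier M" "y \<in> carrier M" using sub by auto
    show "x \<oplus>\<^bsub>M\<lparr>carrier := S\<rparr>\<^esub> y = y \<oplus>\<^bsub>M\<lparr>carrier := S\<rparr>\<^esub> x"
      using Mg.a_comm[OF M2] by simp
    show "x \<oplus>\<^bsub>M\<lparr>carrier := S\<rparr>\<^esub> y \<in> carrier (M\<lparr>carrier := S\<rparr>)" using * ac by simp
    show "\<zero>\<^bsub>M\<lparr>carrier := S\<rparr>\<^esub> \<oplus>\<^bsub>M\<lparr>carrier := S\<rparr>\<^esub> x = x" using Mg.l_zero[OF M2(1)] by simp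
  next
    show "\<zero>\<^bsub>M\<lparr>carrier := S\<rparr>\<^esub> \<in> carrier (M\<lparr>carrier := S\<rparr>)" using zc by simp
  qed
  have ad: "additive (M\<lparr>carrier := S\<rparr>) M (\<lambda>x. x)" using sub by (auto simp: additive_def)
  show N: "HA_module k H A (M\<lparr>carrier := S\<rparr>)"
  proof (rule HA_module_injective[OF M sg ad])
    show "c \<odot>\<^bsub>M\<lparr>carrier := S\<rparr>\<^esub> n \<in> carrier (M\<lparr>carrier := S\<rparr>)"
      if "c \<in> carrier k" "n \<in> carrier (M\<lparr>carrier := S\<rparr>)" for c n
    proof -
      interpret A: ring A by (rule A_ring)
      show ?thesis using that sub S M_smult_eq[OF M, of c n] by (auto simp: sub_HA_def subset_iff)
    qed
  qed (use S in \<open>auto simp: sub_HA_def\<close>)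
  show "HA_map (M\<lparr>carrier := S\<rparr>) M (\<lambda>x. x)" using ad by (intro HA_mapI) auto
qed

text \<open>A tensor product does not see the coaction, so a record can be completed by a coaction
  whose target was formed from the record before the change.\<close>

lemma TC_coact_update [simp]: "TC (M\<lparr>coact := \<rho>\<rparr>) = TC M"
  by (simp add: tensor_A_def tensor_def tensor_group_def tensor_relations_def)

lemma image_subgroup_additive:
  assumes "abelian_group X" "abelian_group Y" "additive X Y f"
  shows "subgroup (f ` carrier X) (add_monoid Y)"
  using group_hom.img_is_subgroup[OF additive_group_hom[OF assms]] by simp

text \<open>By flatness \<open>S \<otimes> C\<close> embeds in \<open>M \<otimes> C\<close>, so each
  value of the coaction has exactly one preimage. Uniqueness makes the restricted coaction additive,
  and \<open>HC_comodule_injective\<close> pulls the axioms back.\<close>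

lemma subcomodule:
  fixes M :: "('k, 'h, 'a, 'c, 'm) HC_comodule"
  assumes M: "HC_comodule k H A C M" and sm: "small U (carrier M)" and S: "sub_HA M S"
    and \<rho>S: "\<And>s. s \<in> S \<Longrightarrow> coact M s \<in> tensor_map (TC M) (\<lambda>x. x) ` carrier (TC (M\<lparr>carrier := S\<rparr>))"
  obtains N :: "('k, 'h, 'a, 'c, 'm) HC_comodule" where "HC_comodule k H A C N" "carrier N = S"
    "HA_map N M (\<lambda>x. x)" "colinear N M (\<lambda>x. x)"
proof -
  note M' = HC_comoduleD(1)[OF M]
  let ?N0 = "M\<lparr>carrier := S\<rparr>"
  note sub = sub_HA_module[OF M' S]
  let ?j = "tensor_map (TC M) (\<lambda>x. x)"
  define \<rho> where "\<rho> = inv_into (carrier (TC ?N0)) ?j \<circ> coact M"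
  define N where "N = ?N0\<lparr>coact := \<rho>\<rparr>"
  have \<rho>: "\<rho> s \<in> carrier (TC ?N0)" "?j (\<rho> s) = coact M s" if "s \<in> S" for s
    using \<rho>S[OF that] by (auto simp: \<rho>_def inv_into_into f_inv_into_f)
  have smN: "small U S" using sm sub(3) by (rule small_subset)
  have inj: "inj_on ?j (carrier (TC ?N0))"
    using sub(1) M' smN sm HA_mapD(1)[OF sub(2)] by (intro TC_map_inj) auto
  note jad = TC_map_additive[OF sub(1) M' HA_mapD(1)[OF sub(2)]]
  have ab: "abelian_group (TC ?N0)" by (rule TC_group[OF sub(1)])
  have Sg: "subgroup S (add_monoid M)" using S by (simp add: sub_HA_def)
  have ad: "additive N (TC N) (coact N)"
  proof (rule additiveI)
    fix x y assume xy: "x \<in> carrier N" "y \<in> carrier N"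
    then have xyS: "x \<in> S" "y \<in> S" "x \<oplus>\<^bsub>M\<^esub> y \<in> S" using subgroup.m_closed[OF Sg] by (auto simp: N_def)
    have "?j (\<rho> (x \<oplus>\<^bsub>M\<^esub> y)) = ?j (\<rho> x \<oplus>\<^bsub>TC ?N0\<^esub> \<rho> y)"
      using xyS \<rho> sub(3) by (auto simp: additive_add[OF jad] additive_add[OF HC_comoduleD(3)[OF M]] subset_iff)
    then have "\<rho> (x \<oplus>\<^bsub>M\<^esub> y) = \<rho> x \<oplus>\<^bsub>TC ?N0\<^esub> \<rho> y"
      by (rule inj_onD[OF inj]) (use xyS \<rho> abelian_groupE(1)[OF ab] in auto)
    then show "coact N (x \<oplus>\<^bsub>N\<^esub> y) = coact N x \<oplus>\<^bsub>TC N\<^esub> coact N y" by (simp add: N_def)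
  qed (use \<rho> in \<open>auto simp: N_def\<close>)
  have Ng: "abelian_group N"
    by (rule abelian_group_cong[OF M_group[OF sub(1)]]) (simp_all add: N_def)
  have idN: "additive N ?N0 (\<lambda>x. x)" by (simp add: additive_def N_def)
  have HN: "HA_module k H A N"
    by (rule HA_module_injective[OF sub(1) Ng idN])
      (use M_hact_closed[OF sub(1)] M_ract_closed[OF sub(1)] additive_closed[OF M_smult_additive[OF sub(1)]]
        in \<open>simp_all add: N_def\<close>)
  have f: "HA_map N M (\<lambda>x. x)" using sub(3) by (intro HA_mapI) (auto simp: N_def additive_def)
  have co: "colinear N M (\<lambda>x. x)" using \<rho> by (simp add: colinear_def N_def)
  have "HC_comodule k H A C N"
    using smN by (intro HC_comodule_injective[OF M HN ad f co _ sm]) (auto simp: N_def)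
  then show thesis using f co by (intro that[of N]) (auto simp: N_def)
qed

text \<open>\<open>f\<close> is factored through its image \<open>Q\<close>. Right exactness shows
  that what \<open>M \<otimes> C \<rightarrow> Q \<otimes> C\<close> kills comes from
  \<open>K \<otimes> C\<close>; flatness, applied to the inclusion of \<open>Q\<close> in
  \<open>N\<close>, shows that the coaction of a kernel element is killed already in
  \<open>Q \<otimes> C\<close>.\<close>

lemma kernel_subcomodule:
  fixes M :: "('k, 'h, 'a, 'c, 'm) HC_comodule" and N :: "('k, 'h, 'a, 'c, 'n) HC_comodule"
  assumes M: "HC_comodule k H A C M" and N: "HC_comodule k H A C N"
    and sm: "small U (carrier M)" "small U (carrier N)"
    and f: "HA_map M N f" and co: "colinear M N f"
  obtains K :: "('k, 'h, 'a, 'c, 'm) HC_comodule" where "HC_comodule k H A C K"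
    "carrier K = {m \<in> carrier M. f m = \<zero>\<^bsub>N\<^esub>}" "HA_map K M (\<lambda>x. x)" "colinear K M (\<lambda>x. x)"
proof -
  note M' = HC_comoduleD(1)[OF M] and N' = HC_comoduleD(1)[OF N]
  note fd = HA_mapD[OF f]
  interpret Mg: abelian_group M by (rule M_group[OF M'])
  interpret Ng: abelian_group N by (rule M_group[OF N'])
  interpret fh: group_hom "add_monoid M" "add_monoid N" f
    by (rule additive_group_hom[OF M_group[OF M'] M_group[OF N'] fd(2)])
  let ?S = "{m \<in> carrier M. f m = \<zero>\<^bsub>N\<^esub>}"
  have z: "hact N h \<zero>\<^bsub>N\<^esub> = \<zero>\<^bsub>N\<^esub>" "ract N \<zero>\<^bsub>N\<^esub> a = \<zero>\<^bsub>N\<^esub>" if "h \<in> carrier H" "a \<in> carrier A" for h a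
    using additive_zero[OF M_group[OF N'] M_group[OF N'] M_hact_additive(1)[OF N' that(1)]]
      additive_zero[OF M_group[OF N'] M_group[OF N'] M_ract_additive(1)[OF N' that(2)]] by auto
  have A0: "\<zero>\<^bsub>A\<^esub> \<in> carrier A" and H0: "\<zero>\<^bsub>H\<^esub> \<in> carrier H"
    using A_ring H_ring by (auto intro: ring.ring_simprules)
  have "subgroup ?S (add_monoid M)"
    using fh.subgroup_kernel by (simp add: kernel_def)
  then have S: "sub_HA M ?S"
    using z[OF _ A0] z[OF H0] fd(4,5)
    by (simp add: sub_HA_def M_hact_closed[OF M'] M_ract_closed[OF M'])
  let ?K0 = "M\<lparr>carrier := ?S\<rparr>"
  note sub = sub_HA_module[OF M' S]
  define Q where "Q = N\<lparr>carrier := f ` carrier M\<rparr>"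
  have im: "sub_HA N (f ` carrier M)"
    using image_subgroup_additive[OF M_group[OF M'] M_group[OF N'] fd(2)]
    by (auto simp: sub_HA_def fd(4,5)[symmetric] intro!: imageI M_hact_closed[OF M'] M_ract_closed[OF M'])
  note Q = sub_HA_module[OF N' im, folded Q_def]
  have pQ: "right_linear A M (ract M) Q (ract Q) f"
    using fd by (intro right_linearI additiveI) (auto simp: Q_def additive_add)
  have smQ: "small U (carrier Q)" using sm(2) Q(3) small_subset by (auto simp: Q_def)
  have injQ: "inj_on (tensor_map (TC N) (\<lambda>x. x)) (carrier (TC Q))"
    using TC_map_inj[OF Q(1) N' smQ sm(2) HA_mapD(1)[OF Q(2)]] by simp
  let ?j = "tensor_map (TC M) (\<lambda>x. x)"
  let ?I = "?j ` carrier (TC ?K0)"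
  note jad = TC_map_additive[OF sub(1) M' HA_mapD(1)[OF sub(2)]]
  have I: "subgroup ?I (add_monoid (TC M))"
    by (rule image_subgroup_additive[OF TC_group[OF sub(1)] TC_group[OF M'] jad])
  have "coact M s \<in> ?I" if s: "s \<in> ?S" for s
  proof (rule tensor_map_kernel[OF M_right_module[OF M'] M_right_module[OF Q(1)] C_left_module pQ,
        folded tensor_A_def])
    show "f ` carrier M = carrier Q" by (simp add: Q_def)
    show "subgroup ?I (add_monoid (TC M))" by (rule I)
    show "coact M s \<in> carrier (TC M)" using s HC_comoduleD(4)[OF M] by simp
    show "pure (TC M) m n \<in> ?I" if "m \<in> carrier M" "n \<in> carrier C" "f m = \<zero>\<^bsub>Q\<^esub>" for m n
      using that TC_map_pure[OF sub(1) M' HA_mapD(1)[OF sub(2)], of m n]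
      by (intro image_eqI[of _ _ "pure (TC ?K0) m n"]) (auto simp: Q_def intro!: TC_pure_closed[OF sub(1)])
    let ?t = "tensor_map (TC Q) f (coact M s)"
    have t: "?t \<in> carrier (TC Q)"
      using TC_map_closed[OF M' Q(1) pQ] HC_comoduleD(4)[OF M] s by simp
    have "tensor_map (TC N) (\<lambda>x. x) ?t = tensor_map (TC N) f (coact M s)"
      using tensor_map_comp[OF M_right_module[OF M'] M_right_module[OF Q(1)] M_right_module[OF N'] C_left_module
        pQ HA_mapD(1)[OF Q(2)], folded tensor_A_def] HC_comoduleD(4)[OF M] s by simp
    also have "\<dots> = coact N (f s)"
      by (rule bspec[OF co[unfolded colinear_def], symmetric]) (use s in simp)
    also have "\<dots> = \<zero>\<^bsub>TC N\<^esub>"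
      using s additive_zero[OF M_group[OF N'] TC_group[OF N'] HC_comoduleD(3)[OF N]] by simp
    also have "\<dots> = tensor_map (TC N) (\<lambda>x. x) \<zero>\<^bsub>TC Q\<^esub>"
      by (rule additive_zero[OF TC_group[OF Q(1)] TC_group[OF N']
            TC_map_additive[OF Q(1) N' HA_mapD(1)[OF Q(2)]], symmetric])
    finally show "?t = \<zero>\<^bsub>TC Q\<^esub>"
      using inj_onD[OF injQ] t abelian_groupE(2)[OF TC_group[OF Q(1)]] by blast
  qed
  then show thesis using subcomodule[OF M sm(1) S] that by blast
qed

subsection \<open>Elements lie in small subcomodules\<close>

text \<open>Writes every generated element as an integral combination of the
  \<open>\<beta> w\<close>, which bounds the size of the generated subgroup by the index set
  alone.\<close>

lemma generate_frag_sum: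
  assumes M: "abelian_group M" and \<beta>: "\<And>w. w \<in> W \<Longrightarrow> \<beta> w \<in> carrier M"
    and x: "x \<in> generate (add_monoid M) (\<beta> ` W)"
  shows "x \<in> frag_sum M \<beta> ` carrier (free_Abelian_group W)"
proof -
  interpret M: abelian_group M by (rule M)
  have "group_hom (free_Abelian_group W) (add_monoid M) (frag_sum M \<beta>)"
    using M.frag_sum_hom[of W \<beta>, OF \<beta>] M.a_group by (simp add: group_hom_def group_hom_axioms_def)
  then have "subgroup (frag_sum M \<beta> ` carrier (free_Abelian_group W)) (add_monoid M)"
    by (rule group_hom.img_is_subgroup)
  moreover have "\<beta> w \<in> frag_sum M \<beta> ` carrier (free_Abelian_group W)" if "w \<in> W" for w
    using that \<beta> by (intro image_eqI[of _ _ "frag_of w"]) (simp_all add: M.frag_sum_frag_of)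
  ultimately have "generate (add_monoid M) (\<beta> ` W) \<subseteq> frag_sum M \<beta> ` carrier (free_Abelian_group W)"
    by (intro M.add.generate_subgroup_incl) auto
  then show ?thesis using x by blast
qed

text \<open>Reduces the stability of a generated subgroup, under an action or the coaction, to its
  generators.\<close>

lemma generate_additive_image:
  assumes M: "abelian_group M" and N: "abelian_group N" and f: "additive M N f"
    and X: "X \<subseteq> carrier M" and I: "subgroup I (add_monoid N)"
    and fX: "\<And>x. x \<in> X \<Longrightarrow> f x \<in> I" and x: "x \<in> generate (add_monoid M) X"
  shows "f x \<in> I"
proof -
  interpret M: abelian_group M by (rule M)
  interpret I: subgroup I "add_monoid N" by (rule I)
  have cl: "generate (add_monoid M) X \<subseteq> carrier M" using M.add.generate_incl[of X] X by simp
  from x show ?thesis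
  proof (induction x rule: generate.induct)
    case one
    then show ?case using additive_zero[OF M N f] I.one_closed by simp
  next
    case (incl h)
    then show ?case by (rule fX)
  next
    case (inv h)
    then show ?case using additive_uminus[OF M N f, of h] I.m_inv_closed[OF fX[OF inv]] X
      by (auto simp: a_inv_def)
  next
    case (eng h1 h2)
    then have "h1 \<in> carrier M" "h2 \<in> carrier M" using cl by auto
    then show ?case using additive_add[OF f, of h1 h2] I.m_closed[OF eng(3,4)] by simp
  qed
qed

text \<open>Letters are actions by \<open>H\<close>, actions by \<open>A\<close>, and positions in a
  list of components. The alphabet does not mention the comodule, which makes the bound on small
  subcomodules uniform.\<close>

definition words :: "('h + 'a + nat) list set" where
  "words = lists (carrier H <+> carrier A <+> UNIV)"

text \<open>The subcomodule is spanned by the elements obtained from \<open>m\<close> by repeatedly acting with \<open>H\<close> and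
  \<open>A\<close> and passing from \<open>x\<close> to some component \<open>x\<^sub>i\<close> in \<open>\<rho>(x) = \<Sum> x\<^sub>i \<otimes> c\<^sub>i\<close>.\<close>

lemma ex_small_subcomodule:
  fixes M :: "('k, 'h, 'a, 'c, 'm) HC_comodule"
  assumes M: "HC_comodule k H A C M" and sm: "small U (carrier M)" and m: "m \<in> carrier M"
  obtains N :: "('k, 'h, 'a, 'c, 'm) HC_comodule" where "HC_comodule k H A C N" "m \<in> carrier N"
    "carrier N \<lesssim> carrier (free_Abelian_group words)"
    "HA_map N M (\<lambda>x. x)" "colinear N M (\<lambda>x. x)"
proof -
  note M' = HC_comoduleD(1)[OF M]
  interpret Mg: abelian_group M by (rule M_group[OF M'])
  interpret T: tensor_pair A M "ract M" C "lact C"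
    rewrites "tensor A M (ract M) C (lact C) \<equiv> TC M"
    by (rule TC_pair[OF M']) (rule TC_eq[OF M'])
  \<comment> \<open>The same choice as in \<open>sweedler\<close>, so that the sum over
    \<open>rep x\<close> gives back \<open>coact M x\<close>.\<close>
  define rep where "rep x = (SOME z. z \<in> coact M x)" for x
  have keys: "fst p \<in> carrier M" "snd p \<in> carrier C" if "x \<in> carrier M" "p \<in> Poly_Mapping.keys (rep x)" for x p
    using T.keys_rep[OF HC_comoduleD(4)[OF M that(1)]] that(2) by (auto simp: rep_def)
  \<comment> \<open>The finitely many left components are listed so that a natural number can name
    one of them.\<close>
  define comps where "comps x = (SOME l. set l = fst ` Poly_Mapping.keys (rep x))" for x
  have comps: "set (comps x) = fst ` Poly_Mapping.keys (rep x)" for x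
    unfolding comps_def by (rule someI_ex) (rule finite_list, simp)
  \<comment> \<open>A position beyond the list yields 0, so that \<open>step\<close> stays in the
    carrier for every letter.\<close>
  define step where "step g x = (case g of Inl h \<Rightarrow> hact M h x | Inr (Inl a) \<Rightarrow> ract M x a
    | Inr (Inr n) \<Rightarrow> if n < length (comps x) then comps x ! n else \<zero>\<^bsub>M\<^esub>)" for g :: "'h + 'a + nat" and x
  have step_cl: "step g x \<in> carrier M" if "g \<in> carrier H <+> carrier A <+> UNIV" "x \<in> carrier M" for g x
    using that keys[OF that(2)] comps[of x] nth_mem[of _ "comps x"]
    by (auto simp: step_def M_hact_closed[OF M'] M_ract_closed[OF M'] split: sum.splits) fastforce
  define \<beta> where "\<beta> w = foldr step w m" for w
  have \<beta>_cl: "\<beta> w \<in> carrier M" if "w \<in> words" for w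
    using that unfolding words_def \<beta>_def
    by (induction w) (auto simp: m simp del: Plus_def intro!: step_cl)
  have \<beta>_step: "step g (\<beta> w) \<in> \<beta> ` words" if "g \<in> carrier H <+> carrier A <+> UNIV" "w \<in> words" for g w
    using that by (intro image_eqI[of _ _ "g # w"]) (auto simp: \<beta>_def words_def)
  define S where "S = generate (add_monoid M) (\<beta> ` words)"
  have X: "\<beta> ` words \<subseteq> carrier M" using \<beta>_cl by auto
  have sg: "subgroup S (add_monoid M)" unfolding S_def using X by (intro Mg.add.generate_is_subgroup) simp
  have XS: "\<beta> ` words \<subseteq> S" unfolding S_def by (auto intro: generate.incl)
  have "hact M h s \<in> S" if "h \<in> carrier H" "s \<in> S" for h s
  proof (rule generate_additive_image[OF M_group[OF M'] M_group[OF M'] M_hact_additive(1)[OF M' that(1)] X sg])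
    show "s \<in> generate (add_monoid M) (\<beta> ` words)" using that by (simp add: S_def)
    show "hact M h x \<in> S" if "x \<in> \<beta> ` words" for x
      using that \<beta>_step[of "Inl h"] \<open>h \<in> carrier H\<close> XS by (auto simp: step_def)
  qed
  moreover have "ract M s a \<in> S" if "a \<in> carrier A" "s \<in> S" for a s
  proof (rule generate_additive_image[OF M_group[OF M'] M_group[OF M'] M_ract_additive(1)[OF M' that(1)] X sg])
    show "s \<in> generate (add_monoid M) (\<beta> ` words)" using that by (simp add: S_def)
    show "ract M x a \<in> S" if "x \<in> \<beta> ` words" for x
      using that \<beta>_step[of "Inr (Inl a)"] \<open>a \<in> carrier A\<close> XS by (auto simp: step_def)
  qed
  ultimately have S: "sub_HA M S" using sg by (simp add: sub_HA_def)
  let ?N0 = "M\<lparr>carrier := S\<rparr>"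
  note sub = sub_HA_module[OF M' S]
  let ?j = "tensor_map (TC M) (\<lambda>x. x)"
  let ?I = "?j ` carrier (TC ?N0)"
  note jr = HA_mapD(1)[OF sub(2)]
  note jad = TC_map_additive[OF sub(1) M' jr]
  have I: "subgroup ?I (add_monoid (TC M))"
    by (rule image_subgroup_additive[OF TC_group[OF sub(1)] TC_group[OF M'] jad])
  have coX: "coact M x \<in> ?I" if x: "x \<in> \<beta> ` words" for x
  proof -
    have xM: "x \<in> carrier M" using x X by auto
    have kS: "fst p \<in> S" if p: "p \<in> Poly_Mapping.keys (rep x)" for p
    proof -
      have "fst p \<in> set (comps x)" using p comps by auto
      then obtain n where n: "n < length (comps x)" "comps x ! n = fst p" by (auto simp: in_set_conv_nth)
      obtain w where w: "w \<in> words" "x = \<beta> w" using x by blast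
      have "step (Inr (Inr n)) (\<beta> w) \<in> \<beta> ` words" using w(1) by (intro \<beta>_step) auto
      then show ?thesis using n w(2) XS by (auto simp: step_def)
    qed
    \<comment> \<open>The left components of the chosen representative are values of longer words,
      hence lie in \<open>S\<close>. The same formal sum is therefore a tensor over
      \<open>S\<close>, and the inclusion sends it to \<open>coact M x\<close>.\<close>
    let ?t = "frag_sum (TC ?N0) (\<lambda>p. pure (TC ?N0) (fst p) (snd p)) (rep x)"
    have cl: "pure (TC ?N0) (fst p) (snd p) \<in> carrier (TC ?N0)" if "p \<in> Poly_Mapping.keys (rep x)" for p
      using kS[OF that] keys[OF xM that] by (intro TC_pure_closed[OF sub(1)]) auto
    have "?j ?t = frag_sum (TC M) (\<lambda>p. ?j (pure (TC ?N0) (fst p) (snd p))) (rep x)"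
      by (rule frag_sum_additive[OF TC_group[OF sub(1)] TC_group[OF M'] jad cl])
    also have "\<dots> = frag_sum (TC M) (\<lambda>p. pure (TC M) (fst p) (snd p)) (rep x)"
    proof (rule frag_sum_cong[OF TC_group[OF M']])
      fix p assume p: "p \<in> Poly_Mapping.keys (rep x)"
      show "?j (pure (TC ?N0) (fst p) (snd p)) \<in> carrier (TC M)" by (rule additive_closed[OF jad cl[OF p]])
      show "?j (pure (TC ?N0) (fst p) (snd p)) = pure (TC M) (fst p) (snd p)"
        using kS[OF p] keys[OF xM p] by (intro TC_map_pure[OF sub(1) M' jr]) auto
    qed
    also have "\<dots> = sweedler (TC M) (coact M x) (pure (TC M))"
      by (simp add: sweedler_eq_frag_sum rep_def)
    also have "\<dots> = coact M x" using T.sweedler_pure_id[OF HC_comoduleD(4)[OF M xM]] .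
    finally have eq: "?j ?t = coact M x" .
    have "?t \<in> carrier (TC ?N0)" using abelian_group.frag_sum_closed[OF TC_group[OF sub(1)] cl] .
    then show ?thesis unfolding eq[symmetric] by (rule imageI)
  qed
  have "coact M s \<in> ?I" if "s \<in> S" for s
    using generate_additive_image[OF M_group[OF M'] TC_group[OF M'] HC_comoduleD(3)[OF M] X I coX] that
    by (simp add: S_def)
  then obtain N :: "('k, 'h, 'a, 'c, 'm) HC_comodule" where N: "HC_comodule k H A C N" "carrier N = S"
    "HA_map N M (\<lambda>x. x)" "colinear N M (\<lambda>x. x)"
    using subcomodule[OF M sm S] by blast
  have "\<beta> [] \<in> S" using XS by (auto simp: words_def)
  then have "m \<in> carrier N" by (simp add: N \<beta>_def)
  moreover have "S \<lesssim> carrier (free_Abelian_group words)"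
    using generate_frag_sum[OF M_group[OF M'] \<beta>_cl] by (intro subset_image_lepoll[of _ "frag_sum M \<beta>"]) (auto simp: S_def)
  ultimately show thesis using N that by blast
qed

end

section \<open>Colimits of comodules\<close>

lemma (in universe) transport_group:
  assumes "abelian_group M" "small U (carrier M)"
  obtains M' :: "'u ring" and e where "carrier M' \<in> U" "abelian_group M'" "additive M M' e"
    "inj_on e (carrier M)" "e ` carrier M = carrier M'"
proof -
  interpret Mg: abelian_group M by fact
  obtain e where e: "inj_on e (carrier M)" "e ` carrier M \<in> U" using small_obtain[OF assms(2)] .
  define g where "g = inv_into (carrier M) e"
  define M' :: "'u ring" where "M' = \<lparr>carrier = e ` carrier M, monoid.mult = undefined, one = undefined,
    zero = e \<zero>\<^bsub>M\<^esub>, add = \<lambda>x y. e (g x \<oplus>\<^bsub>M\<^esub> g y)\<rparr>"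
  have ge [simp]: "g (e m) = m" if "m \<in> carrier M" for m using that e by (simp add: g_def)
  have [simp]: "carrier M' = e ` carrier M" "\<zero>\<^bsub>M'\<^esub> = e \<zero>\<^bsub>M\<^esub>" "x \<oplus>\<^bsub>M'\<^esub> y = e (g x \<oplus>\<^bsub>M\<^esub> g y)" for x y
    by (simp_all add: M'_def)
  have gr: "abelian_group M'"
  proof (rule abelian_groupI)
    show "\<exists>y\<in>carrier M'. y \<oplus>\<^bsub>M'\<^esub> x = \<zero>\<^bsub>M'\<^esub>" if "x \<in> carrier M'" for x
      using that by (intro bexI[of _ "e (\<ominus>\<^bsub>M\<^esub> g x)"]) (auto simp: Mg.l_neg)
  qed (auto simp: Mg.a_ac)
  have "additive M M' e" by (intro additiveI) auto
  then show thesis using e gr by (intro that[of M' e]) simp_all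
qed

text \<open>The quotient is small but consists of cosets; it is copied into \<open>U\<close> because
  objects of the category are carried by members of \<open>U\<close>.\<close>

lemma (in universe) ex_presented:
  assumes "small U S" "R \<subseteq> carrier (free_Abelian_group S)"
  obtains L :: "'u ring" and q where "presented S R L q" "carrier L \<in> U"
proof -
  define F where "F = free_Abelian_group S"
  define K where "K = generate F R"
  define Q where "Q = additive_group (F Mod K)"
  interpret P: presented S R Q "\<lambda>x. K #>\<^bsub>F\<^esub> x"
    unfolding Q_def K_def F_def by (rule presented_quotient[OF assms(2)])
  have "small U (carrier Q)" using P.small_presented[OF universe_axioms assms(1)] .
  then obtain L :: "'u ring" and e where L: "carrier L \<in> U" "abelian_group L" "additive Q L e"
    "inj_on e (carrier Q)" "e ` carrier Q = carrier L"
    using transport_group[OF P.L_group] by blast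
  let ?q = "\<lambda>x. e (K #>\<^bsub>F\<^esub> x)"
  have "presented S R L ?q"
  proof (rule presented.intro)
    show "abelian_group L" by (rule L(2))
    show "R \<subseteq> carrier (free_Abelian_group S)" by (rule assms(2))
    show "?q \<in> hom (free_Abelian_group S) (add_monoid L)"
      using P.q_closed P.q_add additive_closed[OF L(3)] additive_add[OF L(3)] by (intro homI) auto
    show "?q ` carrier (free_Abelian_group S) = carrier L"
      using P.q_surj L(5) by (metis image_image)
    show "?q x = \<zero>\<^bsub>L\<^esub> \<longleftrightarrow> x \<in> generate (free_Abelian_group S) R" if "Poly_Mapping.keys x \<subseteq> S" for x
    proof -
      have "?q x = \<zero>\<^bsub>L\<^esub> \<longleftrightarrow> e (K #>\<^bsub>F\<^esub> x) = e \<zero>\<^bsub>Q\<^esub>" using additive_zero[OF P.L_group L(2,3)] by simp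
      also have "\<dots> \<longleftrightarrow> (K #>\<^bsub>F\<^esub> x) = \<zero>\<^bsub>Q\<^esub>"
        using inj_on_eq_iff[OF L(4) P.q_closed[OF that] abelian_groupE(2)[OF P.L_group]] .
      finally show ?thesis using P.q_kernel[OF that] by simp
    qed
  qed
  then show thesis using that L(1) by blast
qed

lemma spans_cong:
  assumes L: "abelian_group L" and X: "spans L X"
    and eq: "carrier L' = carrier L" "\<zero>\<^bsub>L'\<^esub> = \<zero>\<^bsub>L\<^esub>" "\<And>x y. x \<oplus>\<^bsub>L'\<^esub> y = x \<oplus>\<^bsub>L\<^esub> y"
  shows "spans L' X"
proof -
  interpret L: abelian_group L by (rule L)
  have L': "abelian_group L'" by (rule abelian_group_cong[OF L eq(1,2)]) (rule eq(3))
  interpret L': abelian_group L' by (rule L')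
  have X': "X \<subseteq> carrier L'" using X generate.incl[of _ X "add_monoid L"] by (auto simp: spans_def eq(1))
  have sg: "subgroup (generate (add_monoid L') X) (add_monoid L')"
    using X' by (intro L'.add.generate_is_subgroup) simp
  have "x \<in> generate (add_monoid L') X" if "x \<in> carrier L" for x
    using L X that
  proof (induction x rule: spans_induct)
    case (incl x)
    then show ?case by (rule generate.incl)
  next
    case zero
    then show ?case using subgroup.one_closed[OF sg] by (simp add: eq(2))
  next
    case (add x y)
    then show ?case using subgroup.m_closed[OF sg add(3,4)] by (simp add: eq(3)[of x y])
  next
    case (uminus x)
    have "\<ominus>\<^bsub>L'\<^esub> x = \<ominus>\<^bsub>L\<^esub> x"
      using uminus(1) by (intro L'.minus_equality) (simp_all add: eq L.l_neg)
    then show ?case using subgroup.m_inv_closed[OF sg uminus(2)] by (simp add: a_inv_def)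
  qed
  moreover have "generate (add_monoid L') X \<subseteq> carrier L'" using L'.add.generate_incl[of X] X' by simp
  ultimately show ?thesis by (auto simp: spans_def eq(1))
qed

text \<open>Diagrams over a graph with vertices \<open>I\<close> and edges \<open>E\<close>; no composition of edges is needed to
  form a colimit.\<close>

locale graph_diagram = flat_coring k H A C U
  for k :: "'k ring" and H :: "('k, 'h) bialgebra" and A :: "('k, 'h, 'a) H_module"
    and C :: "('k, 'h, 'a, 'c) HA_coring" and U :: "'u set set" +
  fixes I :: "'i set" and D :: "'i \<Rightarrow> ('k, 'h, 'a, 'c, 'm) HC_comodule"
    and E :: "'e set" and src tgt :: "'e \<Rightarrow> 'i" and \<phi> :: "'e \<Rightarrow> 'm \<Rightarrow> 'm"
  assumes small_I: "small U I" and D: "\<And>i. i \<in> I \<Longrightarrow> HC_comodule k H A C (D i)"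
    and small_D: "\<And>i. i \<in> I \<Longrightarrow> small U (carrier (D i))"
    and src: "\<And>e. e \<in> E \<Longrightarrow> src e \<in> I" and tgt: "\<And>e. e \<in> E \<Longrightarrow> tgt e \<in> I"
    and \<phi>: "\<And>e. e \<in> E \<Longrightarrow> HA_map (D (src e)) (D (tgt e)) (\<phi> e)"
    "\<And>e. e \<in> E \<Longrightarrow> colinear (D (src e)) (D (tgt e)) (\<phi> e)"
begin

abbreviation gens :: "('i \<times> 'm) set" where "gens \<equiv> Sigma I (\<lambda>i. carrier (D i))"

text \<open>The first family makes the maps from the vertices additive, the second identifies
  elements along edges.\<close>

definition rels :: "(('i \<times> 'm) \<Rightarrow>\<^sub>0 int) set" where
  "rels = {frag_of (i, x \<oplus>\<^bsub>D i\<^esub> y) - frag_of (i, x) - frag_of (i, y) | i x y.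
       i \<in> I \<and> x \<in> carrier (D i) \<and> y \<in> carrier (D i)} \<union>
     {frag_of (src e, x) - frag_of (tgt e, \<phi> e x) | e x. e \<in> E \<and> x \<in> carrier (D (src e))}"

lemma D_HA: "i \<in> I \<Longrightarrow> HA_module k H A (D i)"
  by (rule HC_comoduleD(1)[OF D])

lemma D_group: "i \<in> I \<Longrightarrow> abelian_group (D i)"
  by (rule M_group[OF D_HA])

lemma \<phi>_closed: "e \<in> E \<Longrightarrow> x \<in> carrier (D (src e)) \<Longrightarrow> \<phi> e x \<in> carrier (D (tgt e))"
  by (rule HA_mapD(3)[OF \<phi>(1)])

lemma D_add_closed: "i \<in> I \<Longrightarrow> x \<in> carrier (D i) \<Longrightarrow> y \<in> carrier (D i) \<Longrightarrow> x \<oplus>\<^bsub>D i\<^esub> y \<in> carrier (D i)"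
  using abelian_groupE(1)[OF D_group] by blast

lemma small_gens: "small U gens"
  using small_I small_D by (rule small_Sigma)

lemma rels_closed: "rels \<subseteq> carrier (free_Abelian_group gens)"
  unfolding rels_def
  by (auto dest!: subsetD[OF keys_diff] simp: src tgt \<phi>_closed D_add_closed split: if_splits)

text \<open>Cocones in abelian groups only: by this one extension principle the actions and the
  coaction are built on the colimit before it is a comodule.\<close>

definition compatible :: "('g, 'z) ring_scheme \<Rightarrow> ('i \<Rightarrow> 'm \<Rightarrow> 'g) \<Rightarrow> bool" where
  "compatible G \<beta> \<longleftrightarrow> (\<forall>i\<in>I. additive (D i) G (\<beta> i)) \<and>
     (\<forall>e\<in>E. \<forall>x\<in>carrier (D (src e)). \<beta> (tgt e) (\<phi> e x) = \<beta> (src e) x)"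

lemma compatible_kills:
  assumes G: "abelian_group G" and \<beta>: "compatible G \<beta>" and r: "r \<in> rels"
  shows "frag_sum G (case_prod \<beta>) r = \<zero>\<^bsub>G\<^esub>"
proof -
  interpret G: abelian_group G by (rule G)
  let ?f = "frag_sum G (case_prod \<beta>)"
  have cl: "\<beta> i x \<in> carrier G" if "i \<in> I" "x \<in> carrier (D i)" for i x
    using \<beta> that additive_closed[of "D i" G "\<beta> i" x] by (simp add: compatible_def)
  have f1: "?f (frag_of (i, x)) = \<beta> i x" if "i \<in> I" "x \<in> carrier (D i)" for i x
    using that cl by (simp add: G.frag_sum_frag_of)
  have f2: "?f (frag_of (i, x) - frag_of (j, y)) = \<beta> i x \<ominus>\<^bsub>G\<^esub> \<beta> j y"
    if "i \<in> I" "x \<in> carrier (D i)" "j \<in> I" "y \<in> carrier (D j)" for i x j y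
    using that cl by (subst G.frag_sum_diff) (auto simp: f1)
  consider (1) i x y where "r = frag_of (i, x \<oplus>\<^bsub>D i\<^esub> y) - frag_of (i, x) - frag_of (i, y)"
      "i \<in> I" "x \<in> carrier (D i)" "y \<in> carrier (D i)"
    | (2) e x where "r = frag_of (src e, x) - frag_of (tgt e, \<phi> e x)" "e \<in> E" "x \<in> carrier (D (src e))"
    using r unfolding rels_def by blast
  then show ?thesis
  proof cases
    case 1
    have "?f r = \<beta> i (x \<oplus>\<^bsub>D i\<^esub> y) \<ominus>\<^bsub>G\<^esub> \<beta> i x \<ominus>\<^bsub>G\<^esub> \<beta> i y"
      unfolding 1(1) using 1 cl
      by (subst G.frag_sum_diff) (auto simp: f1 f2 D_add_closed dest!: subsetD[OF keys_diff] split: if_splits)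
    also have "\<beta> i (x \<oplus>\<^bsub>D i\<^esub> y) = \<beta> i x \<oplus>\<^bsub>G\<^esub> \<beta> i y"
      using \<beta> 1 additive_add[of "D i" G "\<beta> i"] by (auto simp: compatible_def)
    also have "\<beta> i x \<oplus>\<^bsub>G\<^esub> \<beta> i y \<ominus>\<^bsub>G\<^esub> \<beta> i x \<ominus>\<^bsub>G\<^esub> \<beta> i y =
        (\<beta> i x \<oplus>\<^bsub>G\<^esub> \<ominus>\<^bsub>G\<^esub> \<beta> i x) \<oplus>\<^bsub>G\<^esub> (\<beta> i y \<oplus>\<^bsub>G\<^esub> \<ominus>\<^bsub>G\<^esub> \<beta> i y)"
      using 1 cl by (simp add: a_minus_def G.a_ac)
    finally show ?thesis using 1 cl by (simp add: G.r_neg)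
  next
    case 2
    then show ?thesis
      using f2[of "src e" x "tgt e" "\<phi> e x"] src tgt \<phi>_closed \<beta> cl
      by (simp add: compatible_def G.minus_eq_zero_iff)
  qed
qed

end

locale graph_colimit = graph_diagram k H A C U I D E src tgt \<phi> + presented gens rels L q
  for k :: "'k ring" and H :: "('k, 'h) bialgebra" and A :: "('k, 'h, 'a) H_module"
    and C :: "('k, 'h, 'a, 'c) HA_coring" and U :: "'u set set"
    and I :: "'i set" and D :: "'i \<Rightarrow> ('k, 'h, 'a, 'c, 'm) HC_comodule"
    and E :: "'e set" and src tgt :: "'e \<Rightarrow> 'i" and \<phi> :: "'e \<Rightarrow> 'm \<Rightarrow> 'm"
    and L :: "('l, 'x) ring_scheme" and q :: "('i \<times> 'm \<Rightarrow>\<^sub>0 int) \<Rightarrow> 'l"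
begin

definition \<gamma> :: "'i \<Rightarrow> 'm \<Rightarrow> 'l" where "\<gamma> i x = q (frag_of (i, x))"

definition ext :: "('g, 'z) ring_scheme \<Rightarrow> ('i \<Rightarrow> 'm \<Rightarrow> 'g) \<Rightarrow> 'l \<Rightarrow> 'g" where
  "ext G \<beta> = lift G (case_prod \<beta>)"

context
  fixes G :: "('g, 'z) ring_scheme" and \<beta> :: "'i \<Rightarrow> 'm \<Rightarrow> 'g"
  assumes G: "abelian_group G" and \<beta>: "compatible G \<beta>"
begin

lemma \<beta>_closed: "s \<in> gens \<Longrightarrow> case_prod \<beta> s \<in> carrier G"
  using \<beta> additive_closed[of "D (fst s)" G "\<beta> (fst s)" "snd s"] by (auto simp: compatible_def)

lemma ext_additive: "additive L G (ext G \<beta>)"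
  unfolding ext_def by (rule lift_additive[OF G \<beta>_closed compatible_kills[OF G \<beta>]])

lemma ext_\<gamma>: "i \<in> I \<Longrightarrow> x \<in> carrier (D i) \<Longrightarrow> ext G \<beta> (\<gamma> i x) = \<beta> i x"
  unfolding ext_def \<gamma>_def by (subst lift_gen[OF G \<beta>_closed compatible_kills[OF G \<beta>]]) auto

end

lemma \<gamma>_closed: "i \<in> I \<Longrightarrow> x \<in> carrier (D i) \<Longrightarrow> \<gamma> i x \<in> carrier L"
  unfolding \<gamma>_def by (rule q_closed) auto

lemma q_rels: "r \<in> rels \<Longrightarrow> q r = \<zero>\<^bsub>L\<^esub>"
proof -
  assume r: "r \<in> rels"
  then have "r \<in> carrier (free_Abelian_group gens)" using rels_closed by (rule subsetD[rotated])
  then show ?thesis using q_kernel[of r] generate.incl[OF r] by simp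
qed

lemma \<gamma>_compatible: "compatible L \<gamma>"
  unfolding compatible_def
proof (intro conjI ballI additiveI)
  interpret L: abelian_group L by (rule L_group)
  fix i x y assume *: "i \<in> I" "x \<in> carrier (D i)" "y \<in> carrier (D i)"
  have k: "Poly_Mapping.keys (frag_of (i, x) + frag_of (i, y)) \<subseteq> gens"
    using * by (auto dest!: subsetD[OF keys_add] split: if_splits)
  have k': "Poly_Mapping.keys (frag_of (i, x \<oplus>\<^bsub>D i\<^esub> y)) \<subseteq> gens"
    using * by (simp add: D_add_closed)
  have "frag_of (i, x \<oplus>\<^bsub>D i\<^esub> y) - (frag_of (i, x) + frag_of (i, y)) \<in> rels"
    using * by (auto simp: rels_def diff_diff_eq)
  from q_rels[OF this] have "q (frag_of (i, x \<oplus>\<^bsub>D i\<^esub> y)) \<ominus>\<^bsub>L\<^esub> q (frag_of (i, x) + frag_of (i, y)) = \<zero>\<^bsub>L\<^esub>"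
    by (simp only: q_diff[OF k' k])
  then have "q (frag_of (i, x \<oplus>\<^bsub>D i\<^esub> y)) = q (frag_of (i, x) + frag_of (i, y))"
    using L.minus_eq_zero_iff[OF q_closed[OF k'] q_closed[OF k]] by simp
  then show "\<gamma> i (x \<oplus>\<^bsub>D i\<^esub> y) = \<gamma> i x \<oplus>\<^bsub>L\<^esub> \<gamma> i y"
    using * by (simp add: \<gamma>_def q_add)
next
  interpret L: abelian_group L by (rule L_group)
  fix e x assume *: "e \<in> E" "x \<in> carrier (D (src e))"
  then have k': "Poly_Mapping.keys (frag_of (src e, x)) \<subseteq> gens"
    and k: "Poly_Mapping.keys (frag_of (tgt e, \<phi> e x)) \<subseteq> gens"
    by (simp_all add: src tgt \<phi>_closed)
  have "frag_of (src e, x) - frag_of (tgt e, \<phi> e x) \<in> rels" using * by (auto simp: rels_def)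
  then show "\<gamma> (tgt e) (\<phi> e x) = \<gamma> (src e) x"
    using q_diff[OF k' k] q_rels L.minus_eq_zero_iff[OF q_closed[OF k'] q_closed[OF k]] by (simp add: \<gamma>_def)
qed (rule \<gamma>_closed)

lemma \<gamma>_additive: "i \<in> I \<Longrightarrow> additive (D i) L (\<gamma> i)"
  using \<gamma>_compatible by (simp add: compatible_def)

lemma \<gamma>_\<phi>: "e \<in> E \<Longrightarrow> x \<in> carrier (D (src e)) \<Longrightarrow> \<gamma> (tgt e) (\<phi> e x) = \<gamma> (src e) x"
  using \<gamma>_compatible by (simp add: compatible_def)

lemma \<gamma>_spans: "spans L (\<Union>i\<in>I. \<gamma> i ` carrier (D i))"
proof -
  have "(\<lambda>s. q (frag_of s)) ` gens = (\<Union>i\<in>I. \<gamma> i ` carrier (D i))"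
    by (auto simp: \<gamma>_def image_iff)
  then show ?thesis using spans_presented by simp
qed

lemma \<gamma>_eqI:
  assumes "abelian_group G" "additive L G f" "additive L G g" "x \<in> carrier L"
    "\<And>i y. i \<in> I \<Longrightarrow> y \<in> carrier (D i) \<Longrightarrow> f (\<gamma> i y) = g (\<gamma> i y)"
  shows "f x = g x"
  by (rule spans_additive_eqI[OF L_group assms(1) \<gamma>_spans assms(2,3) _ assms(4)]) (use assms(5) in auto)

text \<open>An additive endomorphism of the diagram induces one of the colimit group; the actions of
  \<open>H\<close>, \<open>A\<close> and \<open>k\<close> are instances.\<close>

lemma natural_compatible:
  assumes "\<And>i. i \<in> I \<Longrightarrow> additive (D i) (D i) (\<sigma> i)"
    and "\<And>e x. e \<in> E \<Longrightarrow> x \<in> carrier (D (src e)) \<Longrightarrow> \<sigma> (tgt e) (\<phi> e x) = \<phi> e (\<sigma> (src e) x)"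
  shows "compatible L (\<lambda>i x. \<gamma> i (\<sigma> i x))"
  unfolding compatible_def
proof (intro conjI ballI)
  show "additive (D i) L (\<lambda>x. \<gamma> i (\<sigma> i x))" if "i \<in> I" for i
    by (rule additive_comp[OF assms(1) \<gamma>_additive]) (rule that)+
  show "\<gamma> (tgt e) (\<sigma> (tgt e) (\<phi> e x)) = \<gamma> (src e) (\<sigma> (src e) x)" if "e \<in> E" "x \<in> carrier (D (src e))" for e x
    using that by (simp add: assms(2) \<gamma>_\<phi> additive_closed[OF assms(1)] src)
qed

lemma hact_compatible: "h \<in> carrier H \<Longrightarrow> compatible L (\<lambda>i x. \<gamma> i (hact (D i) h x))"
  by (rule natural_compatible) (simp_all add: M_hact_additive[OF D_HA] HA_mapD(5)[OF \<phi>(1)])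

lemma ract_compatible: "a \<in> carrier A \<Longrightarrow> compatible L (\<lambda>i x. \<gamma> i (ract (D i) x a))"
  by (rule natural_compatible) (simp_all add: M_ract_additive[OF D_HA] HA_mapD(4)[OF \<phi>(1)])

lemma smult_compatible:
  assumes c: "c \<in> carrier k" shows "compatible L (\<lambda>i x. \<gamma> i (c \<odot>\<^bsub>D i\<^esub> x))"
proof (rule natural_compatible)
  interpret A: ring A by (rule A_ring)
  interpret Am: module k A by (rule A_module_k)
  show "additive (D i) (D i) (\<lambda>x. c \<odot>\<^bsub>D i\<^esub> x)" if "i \<in> I" for i by (rule M_smult_additive[OF D_HA[OF that] c])
  show "c \<odot>\<^bsub>D (tgt e)\<^esub> \<phi> e x = \<phi> e (c \<odot>\<^bsub>D (src e)\<^esub> x)" if "e \<in> E" "x \<in> carrier (D (src e))" for e x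
    using that c by (simp add: M_smult_eq[OF D_HA] src tgt \<phi>_closed HA_mapD(4)[OF \<phi>(1)])
qed

text \<open>The coaction is still missing, as its values lie in
  \<open>LA \<otimes>\<^sub>A C\<close>, for which the right action must exist first;
  \<open>LC\<close> supplies it.\<close>

definition LA :: "('k, 'h, 'a, 'c, 'l) HC_comodule" where
  "LA = \<lparr>carrier = carrier L, monoid.mult = undefined, one = undefined, zero = \<zero>\<^bsub>L\<^esub>, add = add L,
     smult = \<lambda>c. ext L (\<lambda>i x. \<gamma> i (c \<odot>\<^bsub>D i\<^esub> x)), hact = \<lambda>h. ext L (\<lambda>i x. \<gamma> i (hact (D i) h x)),
     ract = \<lambda>y a. ext L (\<lambda>i x. \<gamma> i (ract (D i) x a)) y, coact = undefined\<rparr>"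

definition LC :: "('k, 'h, 'a, 'c, 'l) HC_comodule" where
  "LC = LA\<lparr>coact := ext (TC LA) (\<lambda>i x. tensor_map (TC LA) (\<gamma> i) (coact (D i) x))\<rparr>"

lemma LA_simps [simp]:
  "carrier LA = carrier L" "\<zero>\<^bsub>LA\<^esub> = \<zero>\<^bsub>L\<^esub>" "x \<oplus>\<^bsub>LA\<^esub> y = x \<oplus>\<^bsub>L\<^esub> y"
  "c \<odot>\<^bsub>LA\<^esub> x = ext L (\<lambda>i x. \<gamma> i (c \<odot>\<^bsub>D i\<^esub> x)) x"
  "hact LA h x = ext L (\<lambda>i x. \<gamma> i (hact (D i) h x)) x"
  "ract LA x a = ext L (\<lambda>i x. \<gamma> i (ract (D i) x a)) x"
  by (simp_all add: LA_def)

lemma LC_simps [simp]: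
  "carrier LC = carrier L" "\<zero>\<^bsub>LC\<^esub> = \<zero>\<^bsub>L\<^esub>" "x \<oplus>\<^bsub>LC\<^esub> y = x \<oplus>\<^bsub>L\<^esub> y"
  "c \<odot>\<^bsub>LC\<^esub> x = ext L (\<lambda>i x. \<gamma> i (c \<odot>\<^bsub>D i\<^esub> x)) x"
  "hact LC h x = ext L (\<lambda>i x. \<gamma> i (hact (D i) h x)) x"
  "ract LC x a = ext L (\<lambda>i x. \<gamma> i (ract (D i) x a)) x"
  by (simp_all add: LC_def)

lemma additive_L_cong:
  assumes "carrier L' = carrier L" "\<And>x y. x \<oplus>\<^bsub>L'\<^esub> y = x \<oplus>\<^bsub>L\<^esub> y"
  shows "additive L' G f \<longleftrightarrow> additive L G f" "additive G L' g \<longleftrightarrow> additive G L g"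
  by (simp_all add: additive_def assms)

lemmas additive_LA = additive_L_cong[of LA, OF LA_simps(1,3)]
lemmas additive_LC = additive_L_cong[of LC, OF LC_simps(1,3)]

lemma LA_module: "HA_module k H A LA" and LC_module: "HA_module k H A LC"
proof -
  \<comment> \<open>Stated for any record with these operations, so that it covers both
    \<open>LA\<close> and \<open>LC\<close>, which differ in the coaction.\<close>
  have *: "HA_module k H A L'"
    if "carrier L' = carrier L" "\<zero>\<^bsub>L'\<^esub> = \<zero>\<^bsub>L\<^esub>" "\<And>x y. x \<oplus>\<^bsub>L'\<^esub> y = x \<oplus>\<^bsub>L\<^esub> y"
      "\<And>c x. c \<odot>\<^bsub>L'\<^esub> x = ext L (\<lambda>i x. \<gamma> i (c \<odot>\<^bsub>D i\<^esub> x)) x"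
      "\<And>h x. hact L' h x = ext L (\<lambda>i x. \<gamma> i (hact (D i) h x)) x"
      "\<And>a x. ract L' x a = ext L (\<lambda>i x. \<gamma> i (ract (D i) x a)) x"
    for L' :: "('k, 'h, 'a, 'c, 'l) HC_comodule"
  proof -
    have h: "hact L' h = ext L (\<lambda>i x. \<gamma> i (hact (D i) h x))" for h using that(5) by (intro HOL.ext)
    note ad = additive_L_cong[OF that(1,3)]
    show ?thesis
    proof (rule HA_module_generated[of I D L' \<gamma>])
      show "abelian_group L'" by (rule abelian_group_cong[OF L_group that(1,2)]) (rule that(3))
      show "spans L' (\<Union>i\<in>I. \<gamma> i ` carrier (D i))" by (rule spans_cong[OF L_group \<gamma>_spans that(1-3)])
    qed (simp_all add: D_HA that(4,6) h ad \<gamma>_additive ext_additive[OF L_group smult_compatible]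
        ext_additive[OF L_group hact_compatible] ext_additive[OF L_group ract_compatible]
        ext_\<gamma>[OF L_group smult_compatible] ext_\<gamma>[OF L_group hact_compatible] ext_\<gamma>[OF L_group ract_compatible])
  qed
  show "HA_module k H A LA" "HA_module k H A LC" by (rule *; simp)+
qed

lemma \<gamma>_HA_map: "i \<in> I \<Longrightarrow> HA_map (D i) LA (\<gamma> i)" "i \<in> I \<Longrightarrow> HA_map (D i) LC (\<gamma> i)"
  by (rule HA_mapI; simp add: additive_LA additive_LC \<gamma>_additive ext_\<gamma>[OF L_group hact_compatible] ext_\<gamma>[OF L_group ract_compatible])+

text \<open>Colinearity of \<open>\<phi> e\<close> moves it through the coaction; then the cocone
  identity for \<open>\<gamma>\<close> is applied in the left tensor factor.\<close>

lemma coact_compatible: "compatible (TC LA) (\<lambda>i x. tensor_map (TC LA) (\<gamma> i) (coact (D i) x))"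
  unfolding compatible_def
proof (intro conjI ballI)
  show "additive (D i) (TC LA) (\<lambda>x. tensor_map (TC LA) (\<gamma> i) (coact (D i) x))" if "i \<in> I" for i
    by (rule additive_comp[OF HC_comoduleD(3)[OF D[OF that]]
          TC_map_additive[OF D_HA[OF that] LA_module HA_mapD(1)[OF \<gamma>_HA_map(1)[OF that]]]])
  fix e x assume *: "e \<in> E" "x \<in> carrier (D (src e))"
  note s = src[OF *(1)] and t = tgt[OF *(1)]
  have x: "coact (D (src e)) x \<in> carrier (TC (D (src e)))" by (rule HC_comoduleD(4)[OF D[OF s] *(2)])
  have "tensor_map (TC LA) (\<gamma> (tgt e)) (coact (D (tgt e)) (\<phi> e x)) =
    tensor_map (TC LA) (\<gamma> (tgt e)) (tensor_map (TC (D (tgt e))) (\<phi> e) (coact (D (src e)) x))"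
    using \<phi>(2)[OF *(1)] *(2) by (simp add: colinear_def)
  also have "\<dots> = tensor_map (TC LA) (\<lambda>y. \<gamma> (tgt e) (\<phi> e y)) (coact (D (src e)) x)"
    by (rule tensor_map_comp[OF M_right_module[OF D_HA[OF s]] M_right_module[OF D_HA[OF t]] M_right_module[OF LA_module]
        C_left_module HA_mapD(1)[OF \<phi>(1)[OF *(1)]] HA_mapD(1)[OF \<gamma>_HA_map(1)[OF t]], folded tensor_A_def, OF x])
  also have "\<dots> = tensor_map (TC LA) (\<gamma> (src e)) (coact (D (src e)) x)"
  proof (rule tensor_map_cong[OF TC_pair[OF D_HA[OF s]] TC_group[OF LA_module], folded tensor_A_def, OF x])
    fix m n assume mn: "m \<in> carrier (D (src e))" "n \<in> carrier C"
    show "pure (TC LA) (\<gamma> (tgt e) (\<phi> e m)) n \<in> carrier (TC LA)"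
      using mn * t by (intro TC_pure_closed[OF LA_module]) (auto intro!: \<gamma>_closed \<phi>_closed)
  qed (rule \<gamma>_\<phi>[OF *(1)])
  finally show "tensor_map (TC LA) (\<gamma> (tgt e)) (coact (D (tgt e)) (\<phi> e x)) =
    tensor_map (TC LA) (\<gamma> (src e)) (coact (D (src e)) x)" .
qed

lemma TC_LC [simp]: "TC LC = TC LA"
  by (simp add: LC_def)

lemma coact_LC: "coact LC = ext (TC LA) (\<lambda>i x. tensor_map (TC LA) (\<gamma> i) (coact (D i) x))"
  by (simp add: LC_def)

lemma \<gamma>_colinear: "i \<in> I \<Longrightarrow> colinear (D i) LC (\<gamma> i)"
  by (simp add: colinear_def coact_LC ext_\<gamma>[OF TC_group[OF LA_module] coact_compatible])

lemma LC_coact_additive: "additive LC (TC LC) (coact LC)"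
  using ext_additive[OF TC_group[OF LA_module] coact_compatible]
  by (simp add: coact_LC additive_LC)

lemma LC_comodule: "HC_comodule k H A C LC"
  by (rule HC_comodule_generated[OF D LC_module LC_coact_additive \<gamma>_HA_map(2) \<gamma>_colinear])
    (auto intro: spans_cong[OF L_group \<gamma>_spans])

text \<open>The mediating map of groups inherits linearity and colinearity, since these are
  equalities of additive maps and hold on the images of the \<open>\<gamma> i\<close>.\<close>

lemma ext_LC:
  assumes X: "HC_comodule k H A C X"
    and d: "\<And>i. i \<in> I \<Longrightarrow> HA_map (D i) X (d i)" "\<And>i. i \<in> I \<Longrightarrow> colinear (D i) X (d i)"
    and d\<phi>: "\<And>e x. e \<in> E \<Longrightarrow> x \<in> carrier (D (src e)) \<Longrightarrow> d (tgt e) (\<phi> e x) = d (src e) x"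
  shows "HA_map LC X (ext X d)" "colinear LC X (ext X d)" "compatible X d"
proof -
  note X' = HC_comoduleD(1)[OF X] and Xg = M_group[OF HC_comoduleD(1)[OF X]]
  show comp: "compatible X d" using HA_mapD(2)[OF d(1)] d\<phi> by (simp add: compatible_def)
  note e = ext_additive[OF Xg comp] ext_\<gamma>[OF Xg comp]
  have eL: "additive LC X (ext X d)" using e(1) by (simp add: additive_LC)
  have g: "\<gamma> i (hact (D i) h y) = hact LC h (\<gamma> i y)" "\<gamma> i (ract (D i) y a) = ract LC (\<gamma> i y) a"
    if "i \<in> I" "y \<in> carrier (D i)" "h \<in> carrier H" "a \<in> carrier A" for i y h a
    using HA_mapD(4,5)[OF \<gamma>_HA_map(2)[OF that(1)]] that(2-) by auto
  have A0: "\<zero>\<^bsub>A\<^esub> \<in> carrier A" and H0: "\<zero>\<^bsub>H\<^esub> \<in> carrier H"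
    using abelian_groupE(2)[OF A_group] abelian_groupE(2)[OF H_group] .
  show map: "HA_map LC X (ext X d)"
  proof (rule HA_mapI[OF eL])
    fix a x assume *: "a \<in> carrier A" "x \<in> carrier LC"
    show "ext X d (ract LC x a) = ract X (ext X d x) a"
    proof (rule \<gamma>_eqI[OF Xg])
      show "additive L X (\<lambda>x. ext X d (ract LC x a))" "additive L X (\<lambda>x. ract X (ext X d x) a)"
        using additive_comp[OF M_ract_additive(1)[OF LC_module *(1)] eL]
          additive_comp[OF e(1) M_ract_additive(1)[OF X' *(1)]] by (simp_all add: additive_LC del: LC_simps(4-6))
      show "ext X d (ract LC (\<gamma> i y) a) = ract X (ext X d (\<gamma> i y)) a" if "i \<in> I" "y \<in> carrier (D i)" for i y
        using that * HA_mapD(4)[OF d(1)] M_ract_closed[OF D_HA]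
        by (simp add: g(2)[OF that H0 *(1), symmetric] e(2) del: LC_simps(4-6))
    qed (use * in simp)
  next
    fix h x assume *: "h \<in> carrier H" "x \<in> carrier LC"
    show "ext X d (hact LC h x) = hact X h (ext X d x)"
    proof (rule \<gamma>_eqI[OF Xg])
      show "additive L X (\<lambda>x. ext X d (hact LC h x))" "additive L X (\<lambda>x. hact X h (ext X d x))"
        using additive_comp[OF M_hact_additive(1)[OF LC_module *(1)] eL]
          additive_comp[OF e(1) M_hact_additive(1)[OF X' *(1)]] by (simp_all add: additive_LC del: LC_simps(4-6))
      show "ext X d (hact LC h (\<gamma> i y)) = hact X h (ext X d (\<gamma> i y))" if "i \<in> I" "y \<in> carrier (D i)" for i y
        using that * HA_mapD(5)[OF d(1)] M_hact_closed[OF D_HA]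
        by (simp add: g(1)[OF that *(1) A0, symmetric] e(2) del: LC_simps(4-6))
    qed (use * in simp)
  qed
  show "colinear LC X (ext X d)"
    unfolding colinear_def
  proof
    fix x assume x: "x \<in> carrier LC"
    note mapL = TC_map_additive[OF LC_module X' HA_mapD(1)[OF map]]
    show "coact X (ext X d x) = tensor_map (TC X) (ext X d) (coact LC x)"
    proof (rule \<gamma>_eqI[OF TC_group[OF X']])
      show "additive L (TC X) (\<lambda>x. coact X (ext X d x))"
        by (rule additive_comp[OF e(1) HC_comoduleD(3)[OF X]])
      show "additive L (TC X) (\<lambda>x. tensor_map (TC X) (ext X d) (coact LC x))"
        using additive_comp[OF LC_coact_additive mapL] by (simp add: additive_LC)
      fix i y assume iy: "i \<in> I" "y \<in> carrier (D i)"
      have y: "coact (D i) y \<in> carrier (TC (D i))" by (rule HC_comoduleD(4)[OF D[OF iy(1)] iy(2)])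
      have "tensor_map (TC X) (ext X d) (coact LC (\<gamma> i y)) =
        tensor_map (TC X) (ext X d) (tensor_map (TC LC) (\<gamma> i) (coact (D i) y))"
        using \<gamma>_colinear[OF iy(1)] iy(2) by (simp add: colinear_def)
      also have "\<dots> = tensor_map (TC X) (\<lambda>z. ext X d (\<gamma> i z)) (coact (D i) y)"
        by (rule tensor_map_comp[OF M_right_module[OF D_HA[OF iy(1)]] M_right_module[OF LC_module] M_right_module[OF X']
            C_left_module HA_mapD(1)[OF \<gamma>_HA_map(2)[OF iy(1)]] HA_mapD(1)[OF map], folded tensor_A_def, OF y])
      also have "\<dots> = tensor_map (TC X) (d i) (coact (D i) y)"
        using iy HA_mapD(3)[OF d(1)]
        by (intro tensor_map_cong[OF TC_pair[OF D_HA[OF iy(1)]] TC_group[OF X'], folded tensor_A_def, OF y])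
          (auto simp: e(2) intro!: TC_pure_closed[OF X'])
      also have "\<dots> = coact X (ext X d (\<gamma> i y))"
        using d(2)[OF iy(1)] iy by (simp add: colinear_def e(2))
      finally show "coact X (ext X d (\<gamma> i y)) = tensor_map (TC X) (ext X d) (coact LC (\<gamma> i y))" by simp
    qed (use x in simp)
  qed
qed

end

lemma (in graph_diagram) ex_graph_colimit:
  obtains L :: "'u ring" and q where "graph_colimit k H A C U I D E src tgt \<phi> L q" "carrier L \<in> U"
proof -
  obtain L :: "'u ring" and q where "presented gens rels L q" "carrier L \<in> U"
    using ex_presented[OF small_gens rels_closed] .
  then show thesis using that graph_diagram_axioms graph_colimit.intro by blast
qed

section \<open>The category of comodules\<close>

context coring_setting
begin

text \<open>Morphisms as plain functions, free of the extensionality demanded by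
  \<open>HC_hom\<close>; functions are normalised only when arrows are formed
  (\<open>arr\<close>).\<close>

definition mor :: "('k, 'h, 'a, 'c, 'm) HC_comodule \<Rightarrow> ('k, 'h, 'a, 'c, 'n) HC_comodule \<Rightarrow> ('m \<Rightarrow> 'n) \<Rightarrow> bool" where
  "mor M N f \<longleftrightarrow> HA_map M N f \<and> colinear M N f"

lemma HC_hom_iff: "f \<in> HC_hom H A C M N \<longleftrightarrow> f \<in> extensional (carrier M) \<and> mor M N f"
  by (auto simp: HC_hom_def mor_def HA_map_def colinear_def tensor_map_def)

lemma morD:
  assumes "mor M N f"
  shows "additive M N f" "right_linear A M (ract M) N (ract N) f" "x \<in> carrier M \<Longrightarrow> f x \<in> carrier N"
    "x \<in> carrier M \<Longrightarrow> coact N (f x) = tensor_map (TC N) f (coact M x)"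
  using assms HA_mapD[of M N f] by (auto simp: mor_def colinear_def)

lemma mor_cong:
  assumes M: "HC_comodule k H A C M" and N: "HC_comodule k H A C N" and f: "mor M N f"
    and eq: "\<And>x. x \<in> carrier M \<Longrightarrow> f x = g x"
  shows "mor M N g"
proof -
  note M' = HC_comoduleD(1)[OF M] and N' = HC_comoduleD(1)[OF N]
  have fm: "HA_map M N f" and co: "colinear M N f" using f by (auto simp: mor_def)
  note fd = HA_mapD[OF fm]
  have "HA_map M N g"
    using fd additive_cong[where N=N, OF eq M_group[OF M']]
    by (intro HA_mapI) (auto simp: eq[symmetric] M_hact_closed[OF M'] M_ract_closed[OF M'])
  moreover have "tensor_map (TC N) f t = tensor_map (TC N) g t" if t: "t \<in> carrier (TC M)" for t
    using fd(3) eq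
    by (intro tensor_map_cong[OF TC_pair[OF M'] TC_group[OF N'], folded tensor_A_def, OF t] TC_pure_closed[OF N']) auto
  then have "colinear M N g" using co HC_comoduleD(4)[OF M] by (simp add: colinear_def eq)
  ultimately show ?thesis by (simp add: mor_def)
qed

lemma mor_comp:
  assumes M: "HC_comodule k H A C M" and N: "HC_comodule k H A C N" and P: "HC_comodule k H A C P"
    and f: "mor M N f" and g: "mor N P g"
  shows "mor M P (\<lambda>x. g (f x))"
proof -
  note M' = HC_comoduleD(1)[OF M] and N' = HC_comoduleD(1)[OF N] and P' = HC_comoduleD(1)[OF P]
  have fm: "HA_map M N f" "colinear M N f" and gm: "HA_map N P g" "colinear N P g" using f g by (auto simp: mor_def)
  note fd = HA_mapD[OF fm(1)] and gd = HA_mapD[OF gm(1)]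
  have "HA_map M P (\<lambda>x. g (f x))"
    using fd gd by (intro HA_mapI additive_comp[OF fd(2) gd(2)]) auto
  moreover have "colinear M P (\<lambda>x. g (f x))"
    unfolding colinear_def
  proof
    fix x assume x: "x \<in> carrier M"
    have "coact P (g (f x)) = tensor_map (TC P) g (tensor_map (TC N) f (coact M x))"
      using x fm gm fd by (simp add: colinear_def)
    also have "\<dots> = tensor_map (TC P) (\<lambda>x. g (f x)) (coact M x)"
      by (rule tensor_map_comp[OF M_right_module[OF M'] M_right_module[OF N'] M_right_module[OF P'] C_left_module
          fd(1) gd(1), folded tensor_A_def, OF HC_comoduleD(4)[OF M x]])
    finally show "coact P (g (f x)) = tensor_map (TC P) (\<lambda>x. g (f x)) (coact M x)" .
  qed
  ultimately show ?thesis by (simp add: mor_def)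
qed

lemma mor_id: assumes M: "HC_comodule k H A C M" shows "mor M M (\<lambda>x. x)"
proof -
  note M' = HC_comoduleD(1)[OF M]
  have "colinear M M (\<lambda>x. x)"
    using tensor_map_id[OF M_right_module[OF M'] C_left_module, folded tensor_A_def] HC_comoduleD(4)[OF M]
    by (simp add: colinear_def)
  then show ?thesis by (auto simp: mor_def additive_def intro!: HA_mapI)
qed

lemma HA_act_zero:
  assumes M: "HA_module k H A M"
  shows "h \<in> carrier H \<Longrightarrow> hact M h \<zero>\<^bsub>M\<^esub> = \<zero>\<^bsub>M\<^esub>" "a \<in> carrier A \<Longrightarrow> ract M \<zero>\<^bsub>M\<^esub> a = \<zero>\<^bsub>M\<^esub>"
  using additive_zero[OF M_group[OF M] M_group[OF M] M_hact_additive(1)[OF M]]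
    additive_zero[OF M_group[OF M] M_group[OF M] M_ract_additive(1)[OF M]] by auto

lemma mor_zero:
  assumes M: "HC_comodule k H A C M" and N: "HC_comodule k H A C N"
  shows "mor M N (\<lambda>_. \<zero>\<^bsub>N\<^esub>)"
proof -
  note M' = HC_comoduleD(1)[OF M] and N' = HC_comoduleD(1)[OF N]
  have ha: "HA_map M N (\<lambda>_. \<zero>\<^bsub>N\<^esub>)"
    using HA_act_zero[OF N'] by (intro HA_mapI additive_zero_map[OF M_group[OF N']]) auto
  have "tensor_map (TC N) (\<lambda>_. \<zero>\<^bsub>N\<^esub>) t = \<zero>\<^bsub>TC N\<^esub>" if t: "t \<in> carrier (TC M)" for t
    using TC_map_additive[OF M' N' HA_mapD(1)[OF ha]] additive_zero_map[OF TC_group[OF N']] t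
  proof (rule TC_additive_eqI[OF M'])
    fix m n assume "m \<in> carrier M" "n \<in> carrier C"
    then show "tensor_map (TC N) (\<lambda>_. \<zero>\<^bsub>N\<^esub>) (pure (TC M) m n) = \<zero>\<^bsub>TC N\<^esub>"
      using additive_zero[OF M_group[OF N'] TC_group[OF N'] TC_pure(1)[OF N']]
      by (simp add: TC_map_pure[OF M' N' HA_mapD(1)[OF ha]])
  qed
  then show ?thesis
    using ha HC_comoduleD(4)[OF M] additive_zero[OF M_group[OF N'] TC_group[OF N'] HC_comoduleD(3)[OF N]]
    by (simp add: mor_def colinear_def)
qed

lemma mor_add:
  assumes M: "HC_comodule k H A C M" and N: "HC_comodule k H A C N" and f: "mor M N f" and g: "mor M N g"
  shows "mor M N (\<lambda>x. f x \<oplus>\<^bsub>N\<^esub> g x)"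
proof -
  note M' = HC_comoduleD(1)[OF M] and N' = HC_comoduleD(1)[OF N]
  have fm: "HA_map M N f" and gm: "HA_map M N g" using f g by (auto simp: mor_def)
  note fd = HA_mapD[OF fm] and gd = HA_mapD[OF gm]
  have ha: "HA_map M N (\<lambda>x. f x \<oplus>\<^bsub>N\<^esub> g x)"
    using fd gd additive_add[OF M_ract_additive(1)[OF N']] additive_add[OF M_hact_additive(1)[OF N']]
    by (intro HA_mapI additive_sum_map[OF M_group[OF N']]) auto
  have "tensor_map (TC N) (\<lambda>x. f x \<oplus>\<^bsub>N\<^esub> g x) t = tensor_map (TC N) f t \<oplus>\<^bsub>TC N\<^esub> tensor_map (TC N) g t"
    if t: "t \<in> carrier (TC M)" for t
    using TC_map_additive[OF M' N' HA_mapD(1)[OF ha]]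
      additive_sum_map[OF TC_group[OF N'] TC_map_additive[OF M' N' fd(1)] TC_map_additive[OF M' N' gd(1)]] t
    by (rule TC_additive_eqI[OF M'])
      (simp add: TC_map_pure[OF M' N' HA_mapD(1)[OF ha]] TC_map_pure[OF M' N' fd(1)] TC_map_pure[OF M' N' gd(1)]
        additive_add[OF TC_pure(1)[OF N']] fd(3) gd(3))
  then show ?thesis
    using ha HC_comoduleD(4)[OF M] additive_add[OF HC_comoduleD(3)[OF N]] morD(3,4)[OF f] morD(3,4)[OF g]
    by (simp add: mor_def colinear_def)
qed

lemma mor_uminus:
  assumes M: "HC_comodule k H A C M" and N: "HC_comodule k H A C N" and f: "mor M N f"
  shows "mor M N (\<lambda>x. \<ominus>\<^bsub>N\<^esub> f x)"
proof -
  note M' = HC_comoduleD(1)[OF M] and N' = HC_comoduleD(1)[OF N]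
  have fm: "HA_map M N f" using f by (auto simp: mor_def)
  note fd = HA_mapD[OF fm] and Ng = M_group[OF N']
  have ha: "HA_map M N (\<lambda>x. \<ominus>\<^bsub>N\<^esub> f x)"
    using fd additive_uminus[OF Ng Ng M_ract_additive(1)[OF N']] additive_uminus[OF Ng Ng M_hact_additive(1)[OF N']]
    by (intro HA_mapI additive_uminus_map[OF Ng]) auto
  have "tensor_map (TC N) (\<lambda>x. \<ominus>\<^bsub>N\<^esub> f x) t = \<ominus>\<^bsub>TC N\<^esub> tensor_map (TC N) f t"
    if t: "t \<in> carrier (TC M)" for t
    using TC_map_additive[OF M' N' HA_mapD(1)[OF ha]]
      additive_uminus_map[OF TC_group[OF N'] TC_map_additive[OF M' N' fd(1)]] t
    by (rule TC_additive_eqI[OF M'])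
      (simp add: TC_map_pure[OF M' N' HA_mapD(1)[OF ha]] TC_map_pure[OF M' N' fd(1)]
        additive_uminus[OF Ng TC_group[OF N'] TC_pure(1)[OF N']] fd(3))
  then show ?thesis
    using ha HC_comoduleD(4)[OF M] additive_uminus[OF Ng TC_group[OF N'] HC_comoduleD(3)[OF N]] morD(3,4)[OF f]
    by (simp add: mor_def colinear_def)
qed

text \<open>\<open>u\<close> is \<open>g\<close> after an arbitrary section of \<open>p\<close>. The
  kernel condition gives \<open>u \<circ> p = g\<close>, and the properties of \<open>u\<close> are
  then read off from those of \<open>g\<close> through the surjection \<open>p\<close>.\<close>

lemma mor_factor_surjective:
  assumes Y: "HC_comodule k H A C Y" and Q: "HC_comodule k H A C Q" and W: "HC_comodule k H A C W"
    and p: "mor Y Q p" "p ` carrier Y = carrier Q" and g: "mor Y W g"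
    and ker: "\<And>y. y \<in> carrier Y \<Longrightarrow> p y = \<zero>\<^bsub>Q\<^esub> \<Longrightarrow> g y = \<zero>\<^bsub>W\<^esub>"
  obtains u where "mor Q W u" "\<And>y. y \<in> carrier Y \<Longrightarrow> u (p y) = g y"
proof -
  note Y' = HC_comoduleD(1)[OF Y] and Q' = HC_comoduleD(1)[OF Q] and W' = HC_comoduleD(1)[OF W]
  interpret Yg: abelian_group Y by (rule M_group[OF Y'])
  interpret Qg: abelian_group Q by (rule M_group[OF Q'])
  interpret Wg: abelian_group W by (rule M_group[OF W'])
  have pm: "HA_map Y Q p" and gm: "HA_map Y W g" using p g by (auto simp: mor_def)
  note pd = HA_mapD[OF pm] and gd = HA_mapD[OF gm]
  define \<sigma> where "\<sigma> = inv_into (carrier Y) p"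
  define u where "u x = g (\<sigma> x)" for x
  have \<sigma>: "\<sigma> x \<in> carrier Y" "p (\<sigma> x) = x" if "x \<in> carrier Q" for x
    using that p(2) unfolding \<sigma>_def by (auto intro: inv_into_into f_inv_into_f)
  have u: "u (p y) = g y" if y: "y \<in> carrier Y" for y
  proof -
    have z: "\<sigma> (p y) \<in> carrier Y" "p (\<sigma> (p y)) = p y" using \<sigma> pd(3) y by auto
    then have "p (\<sigma> (p y) \<ominus>\<^bsub>Y\<^esub> y) = \<zero>\<^bsub>Q\<^esub>"
      using y pd(3) by (simp add: additive_minus[OF M_group[OF Y'] M_group[OF Q'] pd(2)] Qg.minus_eq_zero_iff)
    then have "g (\<sigma> (p y) \<ominus>\<^bsub>Y\<^esub> y) = \<zero>\<^bsub>W\<^esub>" using ker z y by simp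
    then show ?thesis
      using z y gd(3) by (simp add: u_def additive_minus[OF M_group[OF Y'] M_group[OF W'] gd(2)] Wg.minus_eq_zero_iff)
  qed
  have ha: "HA_map Q W u"
  proof (intro HA_mapI additiveI)
    fix x x' assume *: "x \<in> carrier Q" "x' \<in> carrier Q"
    have "u (p (\<sigma> x \<oplus>\<^bsub>Y\<^esub> \<sigma> x')) = g (\<sigma> x) \<oplus>\<^bsub>W\<^esub> g (\<sigma> x')"
      using * \<sigma> u by (simp add: additive_add[OF gd(2)])
    then show "u (x \<oplus>\<^bsub>Q\<^esub> x') = u x \<oplus>\<^bsub>W\<^esub> u x'" using * \<sigma> by (simp add: additive_add[OF pd(2)] u_def)
  next
    fix a x assume *: "a \<in> carrier A" "x \<in> carrier Q"
    have "u (p (ract Y (\<sigma> x) a)) = ract W (g (\<sigma> x)) a"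
      using * \<sigma> u gd(4) M_ract_closed[OF Y'] by simp
    then show "u (ract Q x a) = ract W (u x) a" using * \<sigma> pd(4) by (simp add: u_def)
  next
    fix h x assume *: "h \<in> carrier H" "x \<in> carrier Q"
    have "u (p (hact Y h (\<sigma> x))) = hact W h (g (\<sigma> x))"
      using * \<sigma> u gd(5) M_hact_closed[OF Y'] by simp
    then show "u (hact Q h x) = hact W h (u x)" using * \<sigma> pd(5) by (simp add: u_def)
  qed (use \<sigma> gd(3) in \<open>auto simp: u_def\<close>)
  have "colinear Q W u"
    unfolding colinear_def
  proof
    fix x assume x: "x \<in> carrier Q"
    let ?t = "coact Y (\<sigma> x)"
    have t: "?t \<in> carrier (TC Y)" using \<sigma> x HC_comoduleD(4)[OF Y] by simp
    have "coact W (u x) = tensor_map (TC W) g ?t" using morD(4)[OF g] \<sigma> x by (simp add: u_def)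
    also have "\<dots> = tensor_map (TC W) (\<lambda>y. u (p y)) ?t"
      using gd(3) u by (intro tensor_map_cong[OF TC_pair[OF Y'] TC_group[OF W'], folded tensor_A_def, OF t]
          TC_pure_closed[OF W']) auto
    also have "\<dots> = tensor_map (TC W) u (tensor_map (TC Q) p ?t)"
      by (rule tensor_map_comp[OF M_right_module[OF Y'] M_right_module[OF Q'] M_right_module[OF W'] C_left_module
          pd(1) HA_mapD(1)[OF ha], folded tensor_A_def, OF t, symmetric])
    also have "tensor_map (TC Q) p ?t = coact Q x" using morD(4)[OF p(1), of "\<sigma> x"] \<sigma> x by simp
    finally show "coact W (u x) = tensor_map (TC W) u (coact Q x)" .
  qed
  then show thesis using ha u by (intro that[of u]) (auto simp: mor_def)
qed

end

context flat_coring
begin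

text \<open>Dual to \<open>mor_factor_surjective\<close>, but colinearity of \<open>u\<close> is
  tested after applying \<open>i \<otimes> id\<close>, which flatness makes injective.\<close>

lemma mor_factor_injective:
  assumes K: "HC_comodule k H A C K" and X: "HC_comodule k H A C X" and W: "HC_comodule k H A C W"
    and sm: "small U (carrier K)" "small U (carrier X)"
    and i: "mor K X i" "inj_on i (carrier K)" and g: "mor W X g" and im: "g ` carrier W \<subseteq> i ` carrier K"
  obtains u where "mor W K u" "\<And>w. w \<in> carrier W \<Longrightarrow> i (u w) = g w"
proof -
  note K' = HC_comoduleD(1)[OF K] and X' = HC_comoduleD(1)[OF X] and W' = HC_comoduleD(1)[OF W]
  have im': "HA_map K X i" and gm: "HA_map W X g" using i g by (auto simp: mor_def)
  note idd = HA_mapD[OF im'] and gd = HA_mapD[OF gm]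
  define u where "u w = inv_into (carrier K) i (g w)" for w
  have u: "u w \<in> carrier K" "i (u w) = g w" if "w \<in> carrier W" for w
    using that im unfolding u_def by (auto intro!: inv_into_into f_inv_into_f)
  have eq: "x = y" if "i x = i y" "x \<in> carrier K" "y \<in> carrier K" for x y using i(2) that by (rule inj_onD)
  note Kadd = abelian_groupE(1)[OF M_group[OF K']] and Wadd = abelian_groupE(1)[OF M_group[OF W']]
  have ha: "HA_map W K u"
  proof (intro HA_mapI additiveI)
    show "u (x \<oplus>\<^bsub>W\<^esub> y) = u x \<oplus>\<^bsub>K\<^esub> u y" if "x \<in> carrier W" "y \<in> carrier W" for x y
      by (rule eq) (use that u Kadd Wadd in \<open>simp_all add: additive_add[OF idd(2)] additive_add[OF gd(2)]\<close>)
    show "u (ract W x a) = ract K (u x) a" if "a \<in> carrier A" "x \<in> carrier W" for a x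
      by (rule eq) (use that u in \<open>simp_all add: idd(4) gd(4) M_ract_closed[OF K'] M_ract_closed[OF W']\<close>)
    show "u (hact W h x) = hact K h (u x)" if "h \<in> carrier H" "x \<in> carrier W" for h x
      by (rule eq) (use that u in \<open>simp_all add: idd(5) gd(5) M_hact_closed[OF K'] M_hact_closed[OF W']\<close>)
  qed (rule u(1))
  note inj = TC_map_inj[OF K' X' sm idd(1) i(2)]
  have "colinear W K u"
    unfolding colinear_def
  proof
    fix w assume w: "w \<in> carrier W"
    note t = HC_comoduleD(4)[OF W w]
    have "tensor_map (TC X) i (tensor_map (TC K) u (coact W w)) = tensor_map (TC X) (\<lambda>w. i (u w)) (coact W w)"
      by (rule tensor_map_comp[OF M_right_module[OF W'] M_right_module[OF K'] M_right_module[OF X'] C_left_module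
          HA_mapD(1)[OF ha] idd(1), folded tensor_A_def, OF t])
    also have "\<dots> = tensor_map (TC X) g (coact W w)"
      using gd(3) u by (intro tensor_map_cong[OF TC_pair[OF W'] TC_group[OF X'], folded tensor_A_def, OF t]
          TC_pure_closed[OF X']) auto
    also have "\<dots> = coact X (i (u w))" using morD(4)[OF g w] u w by simp
    also have "\<dots> = tensor_map (TC X) i (coact K (u w))" by (rule morD(4)[OF i(1) u(1)[OF w]])
    finally show "coact K (u w) = tensor_map (TC K) u (coact W w)"
      using inj_onD[OF inj] HC_comoduleD(4)[OF K u(1)[OF w]] TC_map_closed[OF W' K' HA_mapD(1)[OF ha] t] by metis
  qed
  then show thesis using ha u by (intro that[of u]) (auto simp: mor_def)
qed

section \<open>Arrows of the category and their underlying functions\<close>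

abbreviation CAT where "CAT \<equiv> comodule_category U k H A C"

lemma CAT_Ob: "M \<in> Ob CAT \<longleftrightarrow> HC_comodule k H A C M \<and> carrier M \<in> U"
  by (simp add: comodule_category_def Let_def)

lemma ObD:
  assumes "M \<in> Ob CAT"
  shows "HC_comodule k H A C M" "carrier M \<in> U" "small U (carrier M)" "HA_module k H A M" "abelian_group M"
    "\<zero>\<^bsub>M\<^esub> \<in> carrier M"
  using assms small_member HC_comoduleD(1)[of M] M_group[of M] abelian_groupE(2)[of M] by (auto simp: CAT_Ob)

text \<open>Restriction to the carrier makes the function canonical, so equality of arrows is
  equality of values (\<open>arr_eq_iff\<close>).\<close>

definition arr :: "('k, 'h, 'a, 'c, 'u) HC_comodule \<Rightarrow> ('u \<Rightarrow> 'u) \<Rightarrow> ('k, 'h, 'a, 'c, 'u) HC_comodule \<Rightarrow>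
    ('k, 'h, 'a, 'c, 'u) HC_comodule \<times> ('u \<Rightarrow> 'u) \<times> ('k, 'h, 'a, 'c, 'u) HC_comodule" where
  "arr X f Y = (X, restrict f (carrier X), Y)"

lemma arr_eq_iff: "arr X f Y = arr X g Y \<longleftrightarrow> (\<forall>x\<in>carrier X. f x = g x)"
  by (auto simp: arr_def restrict_def fun_eq_iff)

lemma arr_Hom: "X \<in> Ob CAT \<Longrightarrow> Y \<in> Ob CAT \<Longrightarrow> mor X Y f \<Longrightarrow> arr X f Y \<in> Hom CAT X Y"
  using mor_cong[of X Y f "restrict f (carrier X)"]
  by (auto simp: Hom_def arr_def comodule_category_def Let_def HC_hom_iff)

lemma Hom_arr:
  assumes "a \<in> Hom CAT X Y"
  obtains f where "X \<in> Ob CAT" "Y \<in> Ob CAT" "mor X Y f" "a = arr X f Y"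
proof -
  obtain f where "a = (X, f, Y)" "X \<in> Ob CAT" "Y \<in> Ob CAT" "f \<in> HC_hom H A C X Y"
    using assms by (auto simp: Hom_def comodule_category_def Let_def)
  then show thesis
    by (intro that[of f]) (auto simp: HC_hom_iff arr_def extensional_restrict)
qed

lemma arr_comp:
  assumes "\<And>x. x \<in> carrier X \<Longrightarrow> f x \<in> carrier Y"
  shows "arr Y g Z \<star>\<^bsub>CAT\<^esub> arr X f Y = arr X (\<lambda>x. g (f x)) Z"
  using assms by (auto simp: arr_def comodule_category_def Let_def compose_def restrict_def)

lemma arr_comp_mor: "mor X Y f \<Longrightarrow> arr Y g Z \<star>\<^bsub>CAT\<^esub> arr X f Y = arr X (\<lambda>x. g (f x)) Z"
  by (rule arr_comp) (rule morD(3))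

lemma arr_Arr: "X \<in> Ob CAT \<Longrightarrow> Y \<in> Ob CAT \<Longrightarrow> mor X Y f \<Longrightarrow> arr X f Y \<in> Arr CAT"
  using arr_Hom by (auto simp: Hom_def)

lemma Dom_arr [simp]: "Dom CAT (arr X f Y) = X" and Cod_arr [simp]: "Cod CAT (arr X f Y) = Y"
  by (simp_all add: arr_def comodule_category_def Let_def)

lemma Idt_arr: "Idt CAT X = arr X (\<lambda>x. x) X"
  by (simp add: arr_def comodule_category_def Let_def)

lemma Arr_arr:
  assumes "a \<in> Arr CAT"
  obtains X f Y where "X \<in> Ob CAT" "Y \<in> Ob CAT" "mor X Y f" "a = arr X f Y"
proof -
  have "a \<in> Hom CAT (Dom CAT a) (Cod CAT a)" using assms by (simp add: Hom_def)
  then show thesis using that by (elim Hom_arr)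
qed

lemma category_CAT: "category CAT"
proof
  fix f assume "f \<in> Arr CAT"
  then show "Dom CAT f \<in> Ob CAT" "Cod CAT f \<in> Ob CAT" by (auto elim!: Arr_arr)
next
  fix X assume "X \<in> Ob CAT"
  then show "Idt CAT X \<in> Hom CAT X X" unfolding Idt_arr by (intro arr_Hom mor_id ObD(1))
next
  fix f X Y g Z assume "f \<in> Hom CAT X Y" "g \<in> Hom CAT Y Z"
  then show "g \<star>\<^bsub>CAT\<^esub> f \<in> Hom CAT X Z"
    by (elim Hom_arr) (auto simp: arr_comp_mor intro!: arr_Hom intro: mor_comp[of _ Y] ObD(1))
next
  fix f X Y assume "f \<in> Hom CAT X Y"
  then show "f \<star>\<^bsub>CAT\<^esub> Idt CAT X = f" "Idt CAT Y \<star>\<^bsub>CAT\<^esub> f = f"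
    by (auto elim!: Hom_arr simp: Idt_arr arr_comp_mor arr_comp)
next
  fix f W X g Y h Z assume "f \<in> Hom CAT W X" "g \<in> Hom CAT X Y" "h \<in> Hom CAT Y Z"
  then show "(h \<star>\<^bsub>CAT\<^esub> g) \<star>\<^bsub>CAT\<^esub> f = h \<star>\<^bsub>CAT\<^esub> (g \<star>\<^bsub>CAT\<^esub> f)"
    by (elim Hom_arr) (simp add: arr_comp_mor arr_comp morD(3))
qed

end

lemma (in graph_colimit) \<gamma>_mor: "i \<in> I \<Longrightarrow> mor (D i) LC (\<gamma> i)"
  using \<gamma>_HA_map(2) \<gamma>_colinear by (simp add: mor_def)

lemma (in graph_colimit) ext_mor:
  assumes X: "HC_comodule k H A C X" and d: "\<And>i. i \<in> I \<Longrightarrow> mor (D i) X (d i)"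
    and d\<phi>: "\<And>e x. e \<in> E \<Longrightarrow> x \<in> carrier (D (src e)) \<Longrightarrow> d (tgt e) (\<phi> e x) = d (src e) x"
  obtains u where "mor LC X u" "\<And>i x. i \<in> I \<Longrightarrow> x \<in> carrier (D i) \<Longrightarrow> u (\<gamma> i x) = d i x"
proof -
  have d': "\<And>i. i \<in> I \<Longrightarrow> HA_map (D i) X (d i)" "\<And>i. i \<in> I \<Longrightarrow> colinear (D i) X (d i)"
    using d by (auto simp: mor_def)
  note e = ext_LC[OF X d' d\<phi>]
  have "mor LC X (ext X d)" using e by (simp add: mor_def)
  then show thesis
    using ext_\<gamma>[OF M_group[OF HC_comoduleD(1)[OF X]] e(3)] by (intro that[of "ext X d"])
qed

lemma (in graph_colimit) mor_eqI:
  assumes X: "HC_comodule k H A C X" and u: "mor LC X u" and v: "mor LC X v"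
    and eq: "\<And>i x. i \<in> I \<Longrightarrow> x \<in> carrier (D i) \<Longrightarrow> u (\<gamma> i x) = v (\<gamma> i x)" and x: "x \<in> carrier LC"
  shows "u x = v x"
  by (rule \<gamma>_eqI[OF M_group[OF HC_comoduleD(1)[OF X]], of u v])
    (use morD(1)[OF u] morD(1)[OF v] x eq in \<open>auto simp: additive_LC\<close>)

context flat_coring
begin

lemma mor_compO:
  assumes "X \<in> Ob CAT" "Y \<in> Ob CAT" "Z \<in> Ob CAT" "mor X Y f" "mor Y Z g"
  shows "mor X Z (\<lambda>x. g (f x))"
  using assms by (intro mor_comp[OF ObD(1) ObD(1) ObD(1) assms(4,5)])

subsection \<open>Zero object and kernels\<close>

text \<open>The colimit of the empty graph: its group is a quotient of the free group on no
  generators.\<close>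

lemma ex_trivial: obtains Z where "Z \<in> Ob CAT" "carrier Z = {\<zero>\<^bsub>Z\<^esub>}"
proof -
  interpret G: graph_diagram k H A C U "{} :: nat set" "\<lambda>_. undefined :: ('k, 'h, 'a, 'c, 'u) HC_comodule"
    "{} :: nat set" "\<lambda>_. 0" "\<lambda>_. 0" "\<lambda>_ x. x"
    by (intro graph_diagram.intro flat_coring_axioms graph_diagram_axioms.intro) (auto intro: small_countable)
  obtain L :: "'u ring" and q where L: "graph_colimit k H A C U ({} :: nat set)
    (\<lambda>_. undefined :: ('k, 'h, 'a, 'c, 'u) HC_comodule) ({} :: nat set) (\<lambda>_. 0) (\<lambda>_. 0) (\<lambda>_ x. x) L q"
    "carrier L \<in> U"
    using G.ex_graph_colimit by blast
  interpret L: graph_colimit k H A C U "{} :: nat set" "\<lambda>_. undefined :: ('k, 'h, 'a, 'c, 'u) HC_comodule"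
    "{} :: nat set" "\<lambda>_. 0" "\<lambda>_. 0" "\<lambda>_ x. x" L q by (rule L(1))
  have "carrier L = {\<zero>\<^bsub>L\<^esub>}"
    using L.q_surj L.q_zero by (auto simp: free_Abelian_group_def)
  then show thesis using L(2) L.LC_comodule by (intro that[of L.LC]) (auto simp: CAT_Ob)
qed

lemma trivial_zero_object:
  assumes Z: "Z \<in> Ob CAT" "carrier Z = {\<zero>\<^bsub>Z\<^esub>}"
  shows "zero_object CAT Z"
  unfolding zero_object_def
proof (intro conjI ballI ex1I)
  show "Z \<in> Ob CAT" by (rule Z(1))
  fix X assume X: "X \<in> Ob CAT"
  show "arr X (\<lambda>_. \<zero>\<^bsub>Z\<^esub>) Z \<in> Hom CAT X Z" "arr Z (\<lambda>_. \<zero>\<^bsub>X\<^esub>) X \<in> Hom CAT Z X"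
    by (intro arr_Hom mor_zero ObD(1) X Z(1))+
  show "f = arr X (\<lambda>_. \<zero>\<^bsub>Z\<^esub>) Z" if "f \<in> Hom CAT X Z" for f
    using that Z(2) by (elim Hom_arr) (auto simp: arr_eq_iff dest!: morD(3))
  show "f = arr Z (\<lambda>_. \<zero>\<^bsub>X\<^esub>) X" if "f \<in> Hom CAT Z X" for f
    using that
  proof (elim Hom_arr)
    fix g assume "mor Z X g" "f = arr Z g X"
    then show ?thesis
      using Z(2) additive_zero[OF ObD(5)[OF Z(1)] ObD(5)[OF X] morD(1)] by (auto simp: arr_eq_iff)
  qed
qed

text \<open>The only arrow from \<open>X\<close> to a zero object is the zero map, so factoring
  through a zero object means vanishing; conversely the trivial comodule provides a
  factorization.\<close>

lemma zero_arrow_iff: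
  assumes X: "X \<in> Ob CAT" and Y: "Y \<in> Ob CAT" and f: "mor X Y f"
  shows "zero_arrow CAT (arr X f Y) \<longleftrightarrow> (\<forall>x\<in>carrier X. f x = \<zero>\<^bsub>Y\<^esub>)"
proof
  assume "zero_arrow CAT (arr X f Y)"
  then obtain Z g h where Z: "zero_object CAT Z" and g: "g \<in> Hom CAT X Z" and h: "h \<in> Hom CAT Z Y"
    and eq: "arr X f Y = h \<star>\<^bsub>CAT\<^esub> g"
    by (auto simp: zero_arrow_def)
  have ZO: "Z \<in> Ob CAT" using Z by (simp add: zero_object_def)
  have "arr X (\<lambda>_. \<zero>\<^bsub>Z\<^esub>) Z \<in> Hom CAT X Z" using X ZO by (intro arr_Hom mor_zero ObD(1))
  then have g0: "g = arr X (\<lambda>_. \<zero>\<^bsub>Z\<^esub>) Z" using Z X g unfolding zero_object_def by blast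
  obtain h' where h': "mor Z Y h'" "h = arr Z h' Y" using h by (elim Hom_arr)
  have "arr X f Y = arr X (\<lambda>_. h' \<zero>\<^bsub>Z\<^esub>) Y"
    unfolding eq g0 h' using ObD(6)[OF ZO] by (intro arr_comp)
  then show "\<forall>x\<in>carrier X. f x = \<zero>\<^bsub>Y\<^esub>"
    using additive_zero[OF ObD(5)[OF ZO] ObD(5)[OF Y] morD(1)[OF h'(1)]] by (simp add: arr_eq_iff)
next
  assume 0: "\<forall>x\<in>carrier X. f x = \<zero>\<^bsub>Y\<^esub>"
  obtain Z where Z: "Z \<in> Ob CAT" "carrier Z = {\<zero>\<^bsub>Z\<^esub>}" by (rule ex_trivial)
  have "arr X f Y = arr Z (\<lambda>_. \<zero>\<^bsub>Y\<^esub>) Y \<star>\<^bsub>CAT\<^esub> arr X (\<lambda>_. \<zero>\<^bsub>Z\<^esub>) Z"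
    using 0 Z by (subst arr_comp) (auto simp: arr_eq_iff)
  then show "zero_arrow CAT (arr X f Y)"
    unfolding zero_arrow_def Dom_arr Cod_arr
    using arr_Arr[OF X Y f] trivial_zero_object[OF Z]
      arr_Hom[OF X Z(1) mor_zero[OF ObD(1)[OF X] ObD(1)[OF Z(1)]]]
      arr_Hom[OF Z(1) Y mor_zero[OF ObD(1)[OF Z(1)] ObD(1)[OF Y]]] by blast
qed

lemma kernel_ofI:
  assumes X: "X \<in> Ob CAT" and Y: "Y \<in> Ob CAT" and K: "K \<in> Ob CAT" and f: "mor X Y f" and i: "mor K X i"
    and inj: "inj_on i (carrier K)" and im: "i ` carrier K = {x \<in> carrier X. f x = \<zero>\<^bsub>Y\<^esub>}"
  shows "kernel_of CAT (arr X f Y) (arr K i X)"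
  unfolding kernel_of_def
proof (intro conjI allI ballI impI)
  show "arr X f Y \<in> Arr CAT" "arr K i X \<in> Arr CAT" by (intro arr_Arr X Y K f i)+
  show "Cod CAT (arr K i X) = Dom CAT (arr X f Y)" by simp
  have fi: "mor K Y (\<lambda>x. f (i x))" by (rule mor_compO[OF K X Y i f])
  show "zero_arrow CAT (arr X f Y \<star>\<^bsub>CAT\<^esub> arr K i X)"
    using im by (simp add: arr_comp_mor[OF i] zero_arrow_iff[OF K Y fi]) blast
  fix W g assume g: "g \<in> Hom CAT W (Dom CAT (arr X f Y))" and z: "zero_arrow CAT (arr X f Y \<star>\<^bsub>CAT\<^esub> g)"
  obtain g' where W: "W \<in> Ob CAT" and g': "mor W X g'" "g = arr W g' X" using g by (auto elim: Hom_arr)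
  have "mor W Y (\<lambda>x. f (g' x))" by (rule mor_compO[OF W X Y g'(1) f])
  then have "\<forall>w\<in>carrier W. f (g' w) = \<zero>\<^bsub>Y\<^esub>"
    using z by (simp add: g'(2) arr_comp_mor[OF g'(1)] zero_arrow_iff[OF W Y])
  then have "g' ` carrier W \<subseteq> i ` carrier K" using morD(3)[OF g'(1)] im by auto
  then obtain u where u: "mor W K u" "\<And>w. w \<in> carrier W \<Longrightarrow> i (u w) = g' w"
    using mor_factor_injective[OF ObD(1)[OF K] ObD(1)[OF X] ObD(1)[OF W] ObD(3)[OF K] ObD(3)[OF X] i inj g'(1)] by blast
  show "\<exists>!u. u \<in> Hom CAT W (Dom CAT (arr K i X)) \<and> arr K i X \<star>\<^bsub>CAT\<^esub> u = g"
  proof (rule ex1I[of _ "arr W u K"])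
    show "arr W u K \<in> Hom CAT W (Dom CAT (arr K i X)) \<and> arr K i X \<star>\<^bsub>CAT\<^esub> arr W u K = g"
      using arr_Hom[OF W K u(1)] u(2) by (simp add: arr_comp_mor[OF u(1)] g'(2) arr_eq_iff)
    fix v assume v: "v \<in> Hom CAT W (Dom CAT (arr K i X)) \<and> arr K i X \<star>\<^bsub>CAT\<^esub> v = g"
    then obtain v' where v': "mor W K v'" "v = arr W v' K" by (auto elim: Hom_arr)
    have "i (v' w) = i (u w)" if "w \<in> carrier W" for w
      using v u(2) that by (simp add: v'(2) arr_comp_mor[OF v'(1)] g'(2) arr_eq_iff)
    then show "v = arr W u K"
      using inj_onD[OF inj] morD(3)[OF v'(1)] morD(3)[OF u(1)] by (simp add: v'(2) arr_eq_iff)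
  qed
qed

lemma ex_kernel_object:
  assumes X: "X \<in> Ob CAT" and Y: "Y \<in> Ob CAT" and f: "mor X Y f"
  obtains K where "K \<in> Ob CAT" "carrier K = {x \<in> carrier X. f x = \<zero>\<^bsub>Y\<^esub>}" "mor K X (\<lambda>x. x)"
    "kernel_of CAT (arr X f Y) (arr K (\<lambda>x. x) X)"
proof -
  have fm: "HA_map X Y f" "colinear X Y f" using f by (auto simp: mor_def)
  obtain K :: "('k, 'h, 'a, 'c, 'u) HC_comodule" where K: "HC_comodule k H A C K"
    "carrier K = {m \<in> carrier X. f m = \<zero>\<^bsub>Y\<^esub>}" "HA_map K X (\<lambda>x. x)" "colinear K X (\<lambda>x. x)"
    using kernel_subcomodule[OF ObD(1)[OF X] ObD(1)[OF Y] ObD(3)[OF X] ObD(3)[OF Y] fm] by blast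
  have KO: "K \<in> Ob CAT" using K(1,2) subset_closed[OF ObD(2)[OF X], of "carrier K"] by (auto simp: CAT_Ob)
  have i: "mor K X (\<lambda>x. x)" using K by (simp add: mor_def)
  have "kernel_of CAT (arr X f Y) (arr K (\<lambda>x. x) X)"
    by (rule kernel_ofI[OF X Y KO f i]) (use K(2) in auto)
  then show thesis using that KO K(2) i by blast
qed

text \<open>Kernels are unique up to isomorphism: comparison with the kernel on elements shows that
  any categorical kernel is injective with the right image. This makes hypotheses phrased by
  \<open>short_exact\<close> usable elementwise.\<close>

lemma kernel_of_iff:
  assumes X: "X \<in> Ob CAT" and Y: "Y \<in> Ob CAT" and K: "K \<in> Ob CAT" and f: "mor X Y f" and i: "mor K X i"
  shows "kernel_of CAT (arr X f Y) (arr K i X) \<longleftrightarrow>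
    inj_on i (carrier K) \<and> i ` carrier K = {x \<in> carrier X. f x = \<zero>\<^bsub>Y\<^esub>}"
proof
  assume ker: "kernel_of CAT (arr X f Y) (arr K i X)"
  have fi: "mor K Y (\<lambda>x. f (i x))" by (rule mor_compO[OF K X Y i f])
  have fi0: "f (i x) = \<zero>\<^bsub>Y\<^esub>" if "x \<in> carrier K" for x
    using ker that by (simp add: kernel_of_def arr_comp_mor[OF i] zero_arrow_iff[OF K Y fi])
  obtain K' where K': "K' \<in> Ob CAT" "carrier K' = {x \<in> carrier X. f x = \<zero>\<^bsub>Y\<^esub>}" "mor K' X (\<lambda>x. x)"
    "kernel_of CAT (arr X f Y) (arr K' (\<lambda>x. x) X)"
    using ex_kernel_object[OF X Y f] .
  have uniq: "\<exists>!u. u \<in> Hom CAT W K \<and> arr K i X \<star>\<^bsub>CAT\<^esub> u = arr W g X"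
    if W: "W \<in> Ob CAT" and g: "mor W X g" and g0: "\<And>w. w \<in> carrier W \<Longrightarrow> f (g w) = \<zero>\<^bsub>Y\<^esub>" for W g
  proof -
    have fg: "mor W Y (\<lambda>x. f (g x))" by (rule mor_compO[OF W X Y g f])
    have "zero_arrow CAT (arr X f Y \<star>\<^bsub>CAT\<^esub> arr W g X)"
      using g0 by (simp add: arr_comp_mor[OF g] zero_arrow_iff[OF W Y fg])
    moreover have "arr W g X \<in> Hom CAT W (Dom CAT (arr X f Y))" using arr_Hom[OF W X g] by simp
    ultimately show ?thesis using ker unfolding kernel_of_def by auto
  qed
  obtain u' where u': "u' \<in> Hom CAT K' K" "arr K i X \<star>\<^bsub>CAT\<^esub> u' = arr K' (\<lambda>x. x) X"
    using uniq[OF K'(1,3)] K'(2) by auto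
  then obtain u where u: "mor K' K u" "\<And>x. x \<in> carrier K' \<Longrightarrow> i (u x) = x"
    by (elim Hom_arr) (auto simp: arr_comp_mor arr_eq_iff)
  have im: "i ` carrier K \<subseteq> carrier K'" using fi0 morD(3)[OF i] K'(2) by auto
  obtain v where v: "mor K K' v" "\<And>x. x \<in> carrier K \<Longrightarrow> v x = i x"
    using mor_factor_injective[OF ObD(1)[OF K'(1)] ObD(1)[OF X] ObD(1)[OF K] ObD(3)[OF K'(1)] ObD(3)[OF X] K'(3) _ i]
      im by auto
  \<comment> \<open>The endomorphism \<open>u \<circ> v\<close> of \<open>K\<close> and the identity
    have the same composite with \<open>i\<close>; uniqueness makes them equal, whence
    \<open>i\<close> is injective.\<close>
  have uv: "mor K K (\<lambda>x. u (v x))" by (rule mor_compO[OF K K'(1) K v(1) u(1)])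
  have "arr K i X \<star>\<^bsub>CAT\<^esub> arr K (\<lambda>x. u (v x)) K = arr K i X"
    using u(2) v(2) morD(3)[OF v(1)] by (simp add: arr_comp_mor[OF uv] arr_eq_iff)
  moreover have "arr K i X \<star>\<^bsub>CAT\<^esub> arr K (\<lambda>x. x) K = arr K i X" by (simp add: arr_comp)
  ultimately have "arr K (\<lambda>x. u (v x)) K = arr K (\<lambda>x. x) K"
    using uniq[OF K i fi0] arr_Hom[OF K K uv] arr_Hom[OF K K mor_id[OF ObD(1)[OF K]]] by blast
  then have "u (i x) = x" if "x \<in> carrier K" for x using that v(2) by (simp add: arr_eq_iff)
  then have "inj_on i (carrier K)" by (metis inj_onI)
  moreover have "i ` carrier K = carrier K'"
  proof
    show "carrier K' \<subseteq> i ` carrier K" using u(2) morD(3)[OF u(1)] by (metis image_eqI subsetI)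
  qed (rule im)
  ultimately show "inj_on i (carrier K) \<and> i ` carrier K = {x \<in> carrier X. f x = \<zero>\<^bsub>Y\<^esub>}" by (simp add: K'(2))
qed (blast intro: kernel_ofI assms)

subsection \<open>Cokernels\<close>

lemma cokernel_ofI:
  assumes X: "X \<in> Ob CAT" and Y: "Y \<in> Ob CAT" and Q: "Q \<in> Ob CAT" and f: "mor X Y f" and p: "mor Y Q p"
    and surj: "p ` carrier Y = carrier Q" and ker: "{y \<in> carrier Y. p y = \<zero>\<^bsub>Q\<^esub>} = f ` carrier X"
  shows "cokernel_of CAT (arr X f Y) (arr Y p Q)"
  unfolding cokernel_of_def
proof (intro conjI allI ballI impI)
  show "arr X f Y \<in> Arr CAT" "arr Y p Q \<in> Arr CAT" by (intro arr_Arr X Y Q f p)+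
  show "Dom CAT (arr Y p Q) = Cod CAT (arr X f Y)" by simp
  have pf: "mor X Q (\<lambda>x. p (f x))" by (rule mor_compO[OF X Y Q f p])
  show "zero_arrow CAT (arr Y p Q \<star>\<^bsub>CAT\<^esub> arr X f Y)"
    using ker by (simp add: arr_comp_mor[OF f] zero_arrow_iff[OF X Q pf]) blast
  fix W g assume g: "g \<in> Hom CAT (Cod CAT (arr X f Y)) W" and z: "zero_arrow CAT (g \<star>\<^bsub>CAT\<^esub> arr X f Y)"
  obtain g' where W: "W \<in> Ob CAT" and g': "mor Y W g'" "g = arr Y g' W" using g by (auto elim: Hom_arr)
  have "mor X W (\<lambda>x. g' (f x))" by (rule mor_compO[OF X Y W f g'(1)])
  then have z': "\<forall>x\<in>carrier X. g' (f x) = \<zero>\<^bsub>W\<^esub>"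
    using z by (simp add: g'(2) arr_comp_mor[OF f] zero_arrow_iff[OF X W])
  have "g' y = \<zero>\<^bsub>W\<^esub>" if "y \<in> carrier Y" "p y = \<zero>\<^bsub>Q\<^esub>" for y
  proof -
    have "y \<in> f ` carrier X" using that by (simp add: ker[symmetric])
    then show ?thesis using z' by auto
  qed
  then obtain u where u: "mor Q W u" "\<And>y. y \<in> carrier Y \<Longrightarrow> u (p y) = g' y"
    using mor_factor_surjective[OF ObD(1)[OF Y] ObD(1)[OF Q] ObD(1)[OF W] p surj g'(1)] by blast
  show "\<exists>!u. u \<in> Hom CAT (Cod CAT (arr Y p Q)) W \<and> u \<star>\<^bsub>CAT\<^esub> arr Y p Q = g"
  proof (rule ex1I[of _ "arr Q u W"])
    show "arr Q u W \<in> Hom CAT (Cod CAT (arr Y p Q)) W \<and> arr Q u W \<star>\<^bsub>CAT\<^esub> arr Y p Q = g"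
      using arr_Hom[OF Q W u(1)] u(2) by (simp add: arr_comp_mor[OF p] g'(2) arr_eq_iff)
    fix v assume v: "v \<in> Hom CAT (Cod CAT (arr Y p Q)) W \<and> v \<star>\<^bsub>CAT\<^esub> arr Y p Q = g"
    then obtain v' where v': "mor Q W v'" "v = arr Q v' W" by (auto elim: Hom_arr)
    have "v' (p y) = u (p y)" if "y \<in> carrier Y" for y
      using v u(2) that by (simp add: v'(2) arr_comp_mor[OF p] g'(2) arr_eq_iff)
    then show "v = arr Q u W"
      unfolding v'(2) arr_eq_iff surj[symmetric] by blast
  qed
qed

text \<open>The coequalizer of \<open>f\<close> and the zero map, as the colimit of two parallel
  edges from \<open>X\<close> to \<open>Y\<close>. The kernel of the projection is found by mapping
  the colimit to the group \<open>Y / f(X)\<close>, which detects every element outside the image of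
  \<open>f\<close>.\<close>

lemma ex_cokernel_object:
  assumes X: "X \<in> Ob CAT" and Y: "Y \<in> Ob CAT" and f: "mor X Y f"
  obtains Q p where "Q \<in> Ob CAT" "mor Y Q p" "p ` carrier Y = carrier Q"
    "{y \<in> carrier Y. p y = \<zero>\<^bsub>Q\<^esub>} = f ` carrier X" "cokernel_of CAT (arr X f Y) (arr Y p Q)"
proof -
  let ?D = "\<lambda>b. if b then Y else X" and ?\<phi> = "\<lambda>e. if e then f else (\<lambda>_. \<zero>\<^bsub>Y\<^esub>)"
  have zero: "mor X Y (\<lambda>_. \<zero>\<^bsub>Y\<^esub>)" using X Y by (intro mor_zero ObD(1))
  interpret G: graph_diagram k H A C U "UNIV :: bool set" ?D "UNIV :: bool set" "\<lambda>_. False" "\<lambda>_. True" ?\<phi>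
    by (intro graph_diagram.intro flat_coring_axioms graph_diagram_axioms.intro)
      (use small_countable[of "UNIV :: bool set"] ObD(1,3)[OF X] ObD(1,3)[OF Y] f zero in \<open>simp_all add: mor_def\<close>)
  obtain L :: "'u ring" and q where L: "graph_colimit k H A C U (UNIV :: bool set) ?D (UNIV :: bool set)
    (\<lambda>_. False) (\<lambda>_. True) ?\<phi> L q" "carrier L \<in> U"
    using G.ex_graph_colimit by blast
  interpret L: graph_colimit k H A C U "UNIV :: bool set" ?D "UNIV :: bool set" "\<lambda>_. False" "\<lambda>_. True" ?\<phi> L q
    by (rule L(1))
  let ?p = "L.\<gamma> True"
  have Q: "L.LC \<in> Ob CAT" using L.LC_comodule L(2) by (simp add: CAT_Ob)
  have p: "mor Y L.LC ?p" using L.\<gamma>_mor[of True] by simp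
  note pa = morD(1)[OF p]
  interpret Yg: abelian_group Y by (rule ObD(5)[OF Y])
  \<comment> \<open>The edges \<open>True\<close> and \<open>False\<close> carry \<open>f\<close>
    and 0, so the image of \<open>x\<close> equals both \<open>p (f x)\<close> and 0: the vertex
    \<open>X\<close> adds nothing to the image of \<open>Y\<close>.\<close>
  have gF: "L.\<gamma> False x = ?p (f x)" "L.\<gamma> False x = \<zero>\<^bsub>L\<^esub>" if "x \<in> carrier X" for x
    using L.\<gamma>_\<phi>[of True x] L.\<gamma>_\<phi>[of False x] that additive_zero[OF ObD(5)[OF Y] ObD(5)[OF Q] pa] by auto
  have sg: "subgroup (?p ` carrier Y) (add_monoid L.LC)"
    by (rule image_subgroup_additive[OF ObD(5)[OF Y] ObD(5)[OF Q] pa])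
  have surj: "?p ` carrier Y = carrier L.LC"
  proof
    show "?p ` carrier Y \<subseteq> carrier L.LC" using morD(3)[OF p] by auto
    have sp: "spans L.LC (\<Union>i\<in>UNIV. L.\<gamma> i ` carrier (?D i))"
      by (rule spans_cong[OF L.L_group L.\<gamma>_spans]) simp_all
    have "x \<in> ?p ` carrier Y" if x: "x \<in> carrier L.LC" for x
      using ObD(5)[OF Q] sp x
    proof (induction x rule: spans_induct)
      case (incl x)
      then obtain b y where "x = L.\<gamma> b y" "y \<in> carrier (?D b)" by auto
      then show ?case using gF morD(3)[OF f] by (cases b) auto
    next
      case zero
      then show ?case using subgroup.one_closed[OF sg] by simp
    next
      case (add x y)
      then show ?case using subgroup.m_closed[OF sg add(3,4)] by simp
    next
      case (uminus x)
      then show ?case using subgroup.m_inv_closed[OF sg uminus(2)] by (simp add: a_inv_def)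
    qed
    then show "carrier L.LC \<subseteq> ?p ` carrier Y" by auto
  qed
  have fs: "subgroup (f ` carrier X) (add_monoid Y)"
    by (rule image_subgroup_additive[OF ObD(5)[OF X] ObD(5)[OF Y] morD(1)[OF f]])
  note quot = quotient_group[OF Yg.a_comm_group fs]
  define G where "G = additive_group (add_monoid Y Mod f ` carrier X)"
  define \<pi> where "\<pi> y = (f ` carrier X #>\<^bsub>add_monoid Y\<^esub> y)" for y
  have Gg: "abelian_group G" unfolding G_def by (rule quot(1))
  have \<pi>: "additive Y G \<pi>" unfolding G_def \<pi>_def using quot(2,3) by (intro additiveI) auto
  have \<pi>0: "\<pi> y = \<zero>\<^bsub>G\<^esub> \<longleftrightarrow> y \<in> f ` carrier X" if "y \<in> carrier Y" for y
    using quot(5)[of y] that by (simp add: \<pi>_def G_def)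
  \<comment> \<open>A cocone into \<open>Y / f(X)\<close>; the edge carrying 0 forces the value 0 at
    the vertex \<open>X\<close>.\<close>
  let ?\<beta> = "\<lambda>b. if b then \<pi> else (\<lambda>_. \<zero>\<^bsub>G\<^esub>)"
  have comp: "G.compatible G ?\<beta>"
    unfolding G.compatible_def
    using \<pi> additive_zero_map[OF Gg] \<pi>0 morD(3)[OF f] additive_zero[OF ObD(5)[OF Y] Gg \<pi>] by auto
  note ext = L.ext_additive[OF Gg comp] L.ext_\<gamma>[OF Gg comp]
  have ker: "{y \<in> carrier Y. ?p y = \<zero>\<^bsub>L.LC\<^esub>} = f ` carrier X"
  proof (intro equalityI subsetI)
    fix y assume y: "y \<in> {y \<in> carrier Y. ?p y = \<zero>\<^bsub>L.LC\<^esub>}"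
    then have "\<pi> y = L.ext G ?\<beta> \<zero>\<^bsub>L\<^esub>" using ext(2)[of True y] by simp
    then show "y \<in> f ` carrier X" using \<pi>0 y additive_zero[OF L.L_group Gg ext(1)] by simp
  next
    fix y assume "y \<in> f ` carrier X"
    then show "y \<in> {y \<in> carrier Y. ?p y = \<zero>\<^bsub>L.LC\<^esub>}" using gF morD(3)[OF f] by auto
  qed
  show thesis by (rule that[OF Q p surj ker cokernel_ofI[OF X Y Q f p surj ker]])
qed

text \<open>As in \<open>kernel_of_iff\<close>, an arbitrary cokernel is compared with the
  constructed one; \<open>v \<circ> u = id\<close> on \<open>Q\<close> gives surjectivity.\<close>

lemma cokernel_of_iff:
  assumes X: "X \<in> Ob CAT" and Y: "Y \<in> Ob CAT" and Q: "Q \<in> Ob CAT" and f: "mor X Y f" and p: "mor Y Q p"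
  shows "cokernel_of CAT (arr X f Y) (arr Y p Q) \<longleftrightarrow>
    p ` carrier Y = carrier Q \<and> {y \<in> carrier Y. p y = \<zero>\<^bsub>Q\<^esub>} = f ` carrier X"
proof
  assume cok: "cokernel_of CAT (arr X f Y) (arr Y p Q)"
  have pf: "mor X Q (\<lambda>x. p (f x))" by (rule mor_compO[OF X Y Q f p])
  have pf0: "p (f x) = \<zero>\<^bsub>Q\<^esub>" if "x \<in> carrier X" for x
    using cok that by (simp add: cokernel_of_def arr_comp_mor[OF f] zero_arrow_iff[OF X Q pf])
  obtain Q' p' where Q': "Q' \<in> Ob CAT" "mor Y Q' p'" "p' ` carrier Y = carrier Q'"
    "{y \<in> carrier Y. p' y = \<zero>\<^bsub>Q'\<^esub>} = f ` carrier X" "cokernel_of CAT (arr X f Y) (arr Y p' Q')"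
    by (rule ex_cokernel_object[OF X Y f])
  have uniq: "\<exists>!u. u \<in> Hom CAT Q W \<and> u \<star>\<^bsub>CAT\<^esub> arr Y p Q = arr Y g W"
    if W: "W \<in> Ob CAT" and g: "mor Y W g" and g0: "\<And>x. x \<in> carrier X \<Longrightarrow> g (f x) = \<zero>\<^bsub>W\<^esub>" for W g
  proof -
    have gf: "mor X W (\<lambda>x. g (f x))" by (rule mor_compO[OF X Y W f g])
    have "zero_arrow CAT (arr Y g W \<star>\<^bsub>CAT\<^esub> arr X f Y)"
      using g0 by (simp add: arr_comp_mor[OF f] zero_arrow_iff[OF X W gf])
    moreover have "arr Y g W \<in> Hom CAT (Cod CAT (arr X f Y)) W" using arr_Hom[OF Y W g] by simp
    ultimately show ?thesis using cok unfolding cokernel_of_def by auto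
  qed
  have p'f: "p' (f x) = \<zero>\<^bsub>Q'\<^esub>" if "x \<in> carrier X" for x
    using Q'(4) imageI[OF that, of f] by auto
  obtain u' where u': "u' \<in> Hom CAT Q Q'" "u' \<star>\<^bsub>CAT\<^esub> arr Y p Q = arr Y p' Q'"
    using uniq[OF Q'(1,2) p'f] by blast
  then obtain u where u: "mor Q Q' u" "\<And>y. y \<in> carrier Y \<Longrightarrow> u (p y) = p' y"
    by (elim Hom_arr) (auto simp: arr_comp_mor[OF p] arr_eq_iff)
  have "p y = \<zero>\<^bsub>Q\<^esub>" if "y \<in> carrier Y" "p' y = \<zero>\<^bsub>Q'\<^esub>" for y
  proof -
    have "y \<in> f ` carrier X" using that by (simp add: Q'(4)[symmetric])
    then show ?thesis using pf0 by auto
  qed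
  then obtain v where v: "mor Q' Q v" "\<And>y. y \<in> carrier Y \<Longrightarrow> v (p' y) = p y"
    using mor_factor_surjective[OF ObD(1)[OF Y] ObD(1)[OF Q'(1)] ObD(1)[OF Q] Q'(2,3) p] by blast
  have vu: "mor Q Q (\<lambda>x. v (u x))" by (rule mor_compO[OF Q Q'(1) Q u(1) v(1)])
  have "arr Q (\<lambda>x. v (u x)) Q \<star>\<^bsub>CAT\<^esub> arr Y p Q = arr Y p Q"
    using u(2) v(2) by (simp add: arr_comp_mor[OF p] arr_eq_iff)
  moreover have "arr Q (\<lambda>x. x) Q \<star>\<^bsub>CAT\<^esub> arr Y p Q = arr Y p Q" by (simp add: arr_comp_mor[OF p])
  ultimately have "arr Q (\<lambda>x. v (u x)) Q = arr Q (\<lambda>x. x) Q"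
    using uniq[OF Q p pf0] arr_Hom[OF Q Q vu] arr_Hom[OF Q Q mor_id[OF ObD(1)[OF Q]]] by blast
  then have vu': "v (u x) = x" if "x \<in> carrier Q" for x using that by (simp add: arr_eq_iff)
  have "p ` carrier Y = carrier Q"
  proof (intro equalityI subsetI)
    fix x assume x: "x \<in> carrier Q"
    then have "u x \<in> p' ` carrier Y" using morD(3)[OF u(1)] Q'(3) by simp
    then obtain y where "y \<in> carrier Y" "u x = p' y" by blast
    then show "x \<in> p ` carrier Y" using v(2) vu'[OF x] by (metis imageI)
  qed (use morD(3)[OF p] in auto)
  moreover have "p y = \<zero>\<^bsub>Q\<^esub> \<longleftrightarrow> p' y = \<zero>\<^bsub>Q'\<^esub>" if "y \<in> carrier Y" for y
    using that u(2) v(2) additive_zero[OF ObD(5)[OF Q] ObD(5)[OF Q'(1)] morD(1)[OF u(1)]]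
      additive_zero[OF ObD(5)[OF Q'(1)] ObD(5)[OF Q] morD(1)[OF v(1)]] by metis
  then have "{y \<in> carrier Y. p y = \<zero>\<^bsub>Q\<^esub>} = f ` carrier X" unfolding Q'(4)[symmetric] by blast
  ultimately show "p ` carrier Y = carrier Q \<and> {y \<in> carrier Y. p y = \<zero>\<^bsub>Q\<^esub>} = f ` carrier X"
    by blast
qed (blast intro: cokernel_ofI assms)

text \<open>The inclusion of the kernel and the zero map have the same composite with
  \<open>f\<close>.\<close>

lemma monic_injective:
  assumes X: "X \<in> Ob CAT" and Y: "Y \<in> Ob CAT" and f: "mor X Y f" and m: "monic CAT (arr X f Y)"
  shows "inj_on f (carrier X)"
proof (rule additive_inj_onI[OF ObD(5)[OF X] ObD(5)[OF Y] morD(1)[OF f]])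
  obtain K where K: "K \<in> Ob CAT" "carrier K = {x \<in> carrier X. f x = \<zero>\<^bsub>Y\<^esub>}" "mor K X (\<lambda>x. x)"
    "kernel_of CAT (arr X f Y) (arr K (\<lambda>x. x) X)"
    by (rule ex_kernel_object[OF X Y f])
  have z: "mor K X (\<lambda>_. \<zero>\<^bsub>X\<^esub>)" using K(1) X by (intro mor_zero ObD(1))
  have "arr X f Y \<star>\<^bsub>CAT\<^esub> arr K (\<lambda>x. x) X = arr X f Y \<star>\<^bsub>CAT\<^esub> arr K (\<lambda>_. \<zero>\<^bsub>X\<^esub>) X"
    using K(2) additive_zero[OF ObD(5)[OF X] ObD(5)[OF Y] morD(1)[OF f]]
    by (simp add: arr_comp_mor[OF K(3)] arr_comp_mor[OF z] arr_eq_iff)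
  moreover have "arr K (\<lambda>x. x) X \<in> Hom CAT K (Dom CAT (arr X f Y))"
    "arr K (\<lambda>_. \<zero>\<^bsub>X\<^esub>) X \<in> Hom CAT K (Dom CAT (arr X f Y))"
    using arr_Hom[OF K(1) X K(3)] arr_Hom[OF K(1) X z] by simp_all
  ultimately have "arr K (\<lambda>x. x) X = arr K (\<lambda>_. \<zero>\<^bsub>X\<^esub>) X" using m unfolding monic_def by blast
  then show "x = \<zero>\<^bsub>X\<^esub>" if "x \<in> carrier X" "f x = \<zero>\<^bsub>Y\<^esub>" for x
    using that K(2) by (simp add: arr_eq_iff)
qed

text \<open>The cokernel projection and the zero map agree after \<open>f\<close>, so the projection
  vanishes and its kernel, the image of \<open>f\<close>, is everything.\<close>

lemma epic_surjective:
  assumes X: "X \<in> Ob CAT" and Y: "Y \<in> Ob CAT" and f: "mor X Y f" and e: "epic CAT (arr X f Y)"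
  shows "f ` carrier X = carrier Y"
proof -
  obtain Q p where Q: "Q \<in> Ob CAT" "mor Y Q p" "p ` carrier Y = carrier Q"
    "{y \<in> carrier Y. p y = \<zero>\<^bsub>Q\<^esub>} = f ` carrier X" "cokernel_of CAT (arr X f Y) (arr Y p Q)"
    by (rule ex_cokernel_object[OF X Y f])
  have z: "mor Y Q (\<lambda>_. \<zero>\<^bsub>Q\<^esub>)" using Q(1) Y by (intro mor_zero ObD(1))
  have "p (f x) = \<zero>\<^bsub>Q\<^esub>" if "x \<in> carrier X" for x
    using Q(4) imageI[OF that, of f] by auto
  then have "arr Y p Q \<star>\<^bsub>CAT\<^esub> arr X f Y = arr Y (\<lambda>_. \<zero>\<^bsub>Q\<^esub>) Q \<star>\<^bsub>CAT\<^esub> arr X f Y"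
    by (simp add: arr_comp_mor[OF f] arr_eq_iff)
  moreover have "arr Y p Q \<in> Hom CAT (Cod CAT (arr X f Y)) Q"
    "arr Y (\<lambda>_. \<zero>\<^bsub>Q\<^esub>) Q \<in> Hom CAT (Cod CAT (arr X f Y)) Q"
    using arr_Hom[OF Y Q(1,2)] arr_Hom[OF Y Q(1) z] by simp_all
  ultimately have "arr Y p Q = arr Y (\<lambda>_. \<zero>\<^bsub>Q\<^esub>) Q" using e unfolding epic_def by blast
  then show ?thesis using Q(4) by (auto simp: arr_eq_iff)
qed

subsection \<open>Biproducts and the additive structure\<close>

text \<open>The colimit of two vertices without edges. The universal property is kept on elements,
  since both the categorical coproduct and the product are derived from it.\<close>

lemma CAT_binary_coproduct:
  assumes X: "X \<in> Ob CAT" and Y: "Y \<in> Ob CAT"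
  obtains S i j where "S \<in> Ob CAT" "mor X S i" "mor Y S j"
    "\<And>Z f g. Z \<in> Ob CAT \<Longrightarrow> mor X Z f \<Longrightarrow> mor Y Z g \<Longrightarrow>
      \<exists>u. mor S Z u \<and> (\<forall>x\<in>carrier X. u (i x) = f x) \<and> (\<forall>y\<in>carrier Y. u (j y) = g y)"
    "\<And>Z u v. Z \<in> Ob CAT \<Longrightarrow> mor S Z u \<Longrightarrow> mor S Z v \<Longrightarrow> \<forall>x\<in>carrier X. u (i x) = v (i x) \<Longrightarrow>
      \<forall>y\<in>carrier Y. u (j y) = v (j y) \<Longrightarrow> \<forall>s\<in>carrier S. u s = v s"
proof -
  let ?D = "\<lambda>b. if b then Y else X"
  interpret G: graph_diagram k H A C U "UNIV :: bool set" ?D "{} :: bool set" "\<lambda>_. False" "\<lambda>_. True" "\<lambda>_ x. x"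
    by (intro graph_diagram.intro flat_coring_axioms graph_diagram_axioms.intro)
      (use small_countable[of "UNIV :: bool set"] ObD(1,3)[OF X] ObD(1,3)[OF Y] in simp_all)
  obtain L :: "'u ring" and q where L: "graph_colimit k H A C U (UNIV :: bool set) ?D ({} :: bool set)
    (\<lambda>_. False) (\<lambda>_. True) (\<lambda>_ x. x) L q" "carrier L \<in> U"
    using G.ex_graph_colimit by blast
  interpret L: graph_colimit k H A C U "UNIV :: bool set" ?D "{} :: bool set" "\<lambda>_. False" "\<lambda>_. True" "\<lambda>_ x. x" L q
    by (rule L(1))
  have S: "L.LC \<in> Ob CAT" using L.LC_comodule L(2) by (simp add: CAT_Ob)
  show thesis
  proof (rule that[OF S])
    show "mor X L.LC (L.\<gamma> False)" "mor Y L.LC (L.\<gamma> True)" using L.\<gamma>_mor[of False] L.\<gamma>_mor[of True] by simp_all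
    fix Z f g assume Z: "Z \<in> Ob CAT" and f: "mor X Z f" and g: "mor Y Z g"
    obtain u where "mor L.LC Z u" "\<And>i x. x \<in> carrier (?D i) \<Longrightarrow> u (L.\<gamma> i x) = (if i then g else f) x"
      by (rule L.ext_mor[of Z "\<lambda>b. if b then g else f", OF ObD(1)[OF Z]]) (use f g in auto)
    from this(1) this(2)[of _ False] this(2)[of _ True]
    show "\<exists>u. mor L.LC Z u \<and> (\<forall>x\<in>carrier X. u (L.\<gamma> False x) = f x) \<and> (\<forall>y\<in>carrier Y. u (L.\<gamma> True y) = g y)"
      by auto
  next
    fix Z u v assume Z: "Z \<in> Ob CAT" and u: "mor L.LC Z u" and v: "mor L.LC Z v"
      and eq: "\<forall>x\<in>carrier X. u (L.\<gamma> False x) = v (L.\<gamma> False x)" "\<forall>y\<in>carrier Y. u (L.\<gamma> True y) = v (L.\<gamma> True y)"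
    have "u (L.\<gamma> i x) = v (L.\<gamma> i x)" if "x \<in> carrier (?D i)" for i x using that eq by (cases i) auto
    then show "\<forall>s\<in>carrier L.LC. u s = v s" using L.mor_eqI[OF ObD(1)[OF Z] u v] by blast
  qed
qed

lemma ex_binary_coproduct:
  assumes X: "X \<in> Ob CAT" and Y: "Y \<in> Ob CAT"
  shows "\<exists>S i j. binary_coproduct CAT X Y S i j"
proof -
  obtain S i j where S: "S \<in> Ob CAT" and i: "mor X S i" and j: "mor Y S j"
    and ex: "\<And>Z f g. Z \<in> Ob CAT \<Longrightarrow> mor X Z f \<Longrightarrow> mor Y Z g \<Longrightarrow>
      \<exists>u. mor S Z u \<and> (\<forall>x\<in>carrier X. u (i x) = f x) \<and> (\<forall>y\<in>carrier Y. u (j y) = g y)"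
    and uniq: "\<And>Z u v. Z \<in> Ob CAT \<Longrightarrow> mor S Z u \<Longrightarrow> mor S Z v \<Longrightarrow> \<forall>x\<in>carrier X. u (i x) = v (i x) \<Longrightarrow>
      \<forall>y\<in>carrier Y. u (j y) = v (j y) \<Longrightarrow> \<forall>s\<in>carrier S. u s = v s"
    by (rule CAT_binary_coproduct[OF X Y]) blast
  have "binary_coproduct CAT X Y S (arr X i S) (arr Y j S)"
    unfolding binary_coproduct_def
  proof (intro conjI allI ballI)
    show "arr X i S \<in> Hom CAT X S" "arr Y j S \<in> Hom CAT Y S" by (intro arr_Hom X Y S i j)+
    fix Z f g assume f: "f \<in> Hom CAT X Z" and g: "g \<in> Hom CAT Y Z"
    obtain f' where Z: "Z \<in> Ob CAT" and f': "mor X Z f'" "f = arr X f' Z" using f by (elim Hom_arr)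
    obtain g' where g': "mor Y Z g'" "g = arr Y g' Z" using g by (elim Hom_arr)
    obtain u where u: "mor S Z u" "\<forall>x\<in>carrier X. u (i x) = f' x" "\<forall>y\<in>carrier Y. u (j y) = g' y"
      using ex[OF Z f'(1) g'(1)] by blast
    show "\<exists>!u. u \<in> Hom CAT S Z \<and> u \<star>\<^bsub>CAT\<^esub> arr X i S = f \<and> u \<star>\<^bsub>CAT\<^esub> arr Y j S = g"
    proof (rule ex1I[of _ "arr S u Z"])
      show "arr S u Z \<in> Hom CAT S Z \<and> arr S u Z \<star>\<^bsub>CAT\<^esub> arr X i S = f \<and> arr S u Z \<star>\<^bsub>CAT\<^esub> arr Y j S = g"
        using arr_Hom[OF S Z u(1)] u f' g' by (simp add: arr_comp_mor[OF i] arr_comp_mor[OF j] arr_eq_iff)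
      fix v assume v: "v \<in> Hom CAT S Z \<and> v \<star>\<^bsub>CAT\<^esub> arr X i S = f \<and> v \<star>\<^bsub>CAT\<^esub> arr Y j S = g"
      then obtain v' where v': "mor S Z v'" "v = arr S v' Z" by (auto elim: Hom_arr)
      have "\<forall>s\<in>carrier S. v' s = u s"
        using v u f' g' by (intro uniq[OF Z v'(1) u(1)])
          (simp_all add: v'(2) arr_comp_mor[OF i] arr_comp_mor[OF j] arr_eq_iff)
      then show "v = arr S u Z" by (simp add: v'(2) arr_eq_iff)
    qed
  qed
  then show ?thesis by blast
qed

text \<open>The coproduct is a biproduct: \<open>i p + j q = 1\<close>.\<close>

lemma ex_binary_product:
  assumes X: "X \<in> Ob CAT" and Y: "Y \<in> Ob CAT"
  shows "\<exists>P p q. binary_product CAT X Y P p q"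
proof -
  obtain S i j where S: "S \<in> Ob CAT" and i: "mor X S i" and j: "mor Y S j"
    and ex: "\<And>Z f g. Z \<in> Ob CAT \<Longrightarrow> mor X Z f \<Longrightarrow> mor Y Z g \<Longrightarrow>
      \<exists>u. mor S Z u \<and> (\<forall>x\<in>carrier X. u (i x) = f x) \<and> (\<forall>y\<in>carrier Y. u (j y) = g y)"
    and uniq: "\<And>Z u v. Z \<in> Ob CAT \<Longrightarrow> mor S Z u \<Longrightarrow> mor S Z v \<Longrightarrow> \<forall>x\<in>carrier X. u (i x) = v (i x) \<Longrightarrow>
      \<forall>y\<in>carrier Y. u (j y) = v (j y) \<Longrightarrow> \<forall>s\<in>carrier S. u s = v s"
    by (rule CAT_binary_coproduct[OF X Y]) blast
  note cX = ObD(1)[OF X] and cY = ObD(1)[OF Y] and cS = ObD(1)[OF S]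
  interpret Xg: abelian_group X by (rule ObD(5)[OF X])
  interpret Yg: abelian_group Y by (rule ObD(5)[OF Y])
  interpret Sg: abelian_group S by (rule ObD(5)[OF S])
  obtain p where p: "mor S X p" "\<forall>x\<in>carrier X. p (i x) = x" "\<forall>y\<in>carrier Y. p (j y) = \<zero>\<^bsub>X\<^esub>"
    using ex[OF X mor_id[OF cX] mor_zero[OF cY cX]] by blast
  obtain q where q: "mor S Y q" "\<forall>x\<in>carrier X. q (i x) = \<zero>\<^bsub>Y\<^esub>" "\<forall>y\<in>carrier Y. q (j y) = y"
    using ex[OF Y mor_zero[OF cX cY] mor_id[OF cY]] by blast
  note iz = additive_zero[OF ObD(5)[OF X] ObD(5)[OF S] morD(1)[OF i]]
    and jz = additive_zero[OF ObD(5)[OF Y] ObD(5)[OF S] morD(1)[OF j]]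
  \<comment> \<open>Both sides are morphisms in \<open>s\<close>, so uniqueness reduces the identity
    to elements \<open>i x\<close> and \<open>j y\<close>.\<close>
  have "\<forall>s\<in>carrier S. i (p s) \<oplus>\<^bsub>S\<^esub> j (q s) = s"
    using p q iz jz morD(3)[OF i] morD(3)[OF j]
    by (intro uniq[OF S mor_add[OF cS cS mor_comp[OF cS cX cS p(1) i] mor_comp[OF cS cY cS q(1) j]] mor_id[OF cS]]) simp_all
  then have dec: "i (p s) \<oplus>\<^bsub>S\<^esub> j (q s) = s" if "s \<in> carrier S" for s using that by blast
  have "binary_product CAT X Y S (arr S p X) (arr S q Y)"
    unfolding binary_product_def
  proof (intro conjI allI ballI)
    show "arr S p X \<in> Hom CAT S X" "arr S q Y \<in> Hom CAT S Y" by (intro arr_Hom X Y S p(1) q(1))+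
    fix Z f g assume f: "f \<in> Hom CAT Z X" and g: "g \<in> Hom CAT Z Y"
    obtain f' where Z: "Z \<in> Ob CAT" and f': "mor Z X f'" "f = arr Z f' X" using f by (elim Hom_arr)
    obtain g' where g': "mor Z Y g'" "g = arr Z g' Y" using g by (elim Hom_arr)
    note cZ = ObD(1)[OF Z]
    let ?u = "\<lambda>z. i (f' z) \<oplus>\<^bsub>S\<^esub> j (g' z)"
    have u: "mor Z S ?u"
      by (rule mor_add[OF cZ cS mor_comp[OF cZ cX cS f'(1) i] mor_comp[OF cZ cY cS g'(1) j]])
    have pu: "p (?u z) = f' z" "q (?u z) = g' z" if "z \<in> carrier Z" for z
      using that p q morD(3)[OF f'(1)] morD(3)[OF g'(1)] morD(3)[OF i] morD(3)[OF j]
      by (simp_all add: additive_add[OF morD(1)[OF p(1)]] additive_add[OF morD(1)[OF q(1)]])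
    show "\<exists>!u. u \<in> Hom CAT Z S \<and> arr S p X \<star>\<^bsub>CAT\<^esub> u = f \<and> arr S q Y \<star>\<^bsub>CAT\<^esub> u = g"
    proof (rule ex1I[of _ "arr Z ?u S"])
      show "arr Z ?u S \<in> Hom CAT Z S \<and> arr S p X \<star>\<^bsub>CAT\<^esub> arr Z ?u S = f \<and> arr S q Y \<star>\<^bsub>CAT\<^esub> arr Z ?u S = g"
        using arr_Hom[OF Z S u] pu f'(2) g'(2) by (simp add: arr_comp_mor[OF u] arr_eq_iff)
      fix v assume v: "v \<in> Hom CAT Z S \<and> arr S p X \<star>\<^bsub>CAT\<^esub> v = f \<and> arr S q Y \<star>\<^bsub>CAT\<^esub> v = g"
      then obtain v' where v': "mor Z S v'" "v = arr Z v' S" by (auto elim: Hom_arr)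
      have "v' z = ?u z" if "z \<in> carrier Z" for z
      proof -
        have "p (v' z) = f' z" "q (v' z) = g' z"
          using v f'(2) g'(2) that by (simp_all add: v'(2) arr_comp_mor[OF v'(1)] arr_eq_iff)
        then show ?thesis using dec[OF morD(3)[OF v'(1) that]] by simp
      qed
      then show "v = arr Z ?u S" by (simp add: v'(2) arr_eq_iff)
    qed
  qed
  then show ?thesis by blast
qed

lemma CAT_preadditive: "preadditive CAT"
proof -
  \<comment> \<open>A total operation on triples: domain and codomain are taken from the first
    arrow, which is no loss within one hom set.\<close>
  define plus where "plus = (\<lambda>(X, f, Y) (X' :: ('k, 'h, 'a, 'c, 'u) HC_comodule, g,
    Y' :: ('k, 'h, 'a, 'c, 'u) HC_comodule). arr X (\<lambda>x. f x \<oplus>\<^bsub>Y\<^esub> g x) Y)"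
  have plus: "plus (arr X f Y) (arr X g Y) = arr X (\<lambda>x. f x \<oplus>\<^bsub>Y\<^esub> g x) Y" for X Y f g
    by (auto simp: plus_def arr_def)
  show ?thesis
    unfolding preadditive_def
  proof (intro exI[of _ plus] conjI ballI allI)
    fix X Y assume X: "X \<in> Ob CAT" and Y: "Y \<in> Ob CAT"
    interpret Yg: abelian_group Y by (rule ObD(5)[OF Y])
    note c = ObD(1)[OF X] ObD(1)[OF Y]
    let ?z = "arr X (\<lambda>_. \<zero>\<^bsub>Y\<^esub>) Y"
    have "comm_group \<lparr>carrier = Hom CAT X Y, monoid.mult = plus, one = ?z\<rparr>"
    proof (rule comm_groupI, simp_all only: partial_object.simps monoid.simps)
      show "?z \<in> Hom CAT X Y" by (intro arr_Hom X Y mor_zero c)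
      fix a b assume "a \<in> Hom CAT X Y" "b \<in> Hom CAT X Y"
      then obtain f g where fg: "mor X Y f" "a = arr X f Y" "mor X Y g" "b = arr X g Y" by (auto elim!: Hom_arr)
      show "plus a b \<in> Hom CAT X Y" using mor_add[OF c fg(1,3)] by (auto simp: fg plus intro: arr_Hom X Y)
      show "plus a b = plus b a"
        using morD(3)[OF fg(1)] morD(3)[OF fg(3)] by (simp add: fg plus arr_eq_iff Yg.a_comm)
      fix d assume "d \<in> Hom CAT X Y"
      then obtain h where h: "mor X Y h" "d = arr X h Y" by (auto elim!: Hom_arr)
      show "plus (plus a b) d = plus a (plus b d)"
        using morD(3)[OF fg(1)] morD(3)[OF fg(3)] morD(3)[OF h(1)] by (simp add: fg h plus arr_eq_iff Yg.a_assoc)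
    next
      fix a assume "a \<in> Hom CAT X Y"
      then obtain f where f: "mor X Y f" "a = arr X f Y" by (auto elim!: Hom_arr)
      show "plus ?z a = a" using morD(3)[OF f(1)] by (simp add: f plus arr_eq_iff)
      show "\<exists>b\<in>Hom CAT X Y. plus b a = ?z"
        using morD(3)[OF f(1)] mor_uminus[OF c f(1)]
        by (intro bexI[of _ "arr X (\<lambda>x. \<ominus>\<^bsub>Y\<^esub> f x) Y"]) (auto simp: f plus arr_eq_iff Yg.l_neg intro: arr_Hom X Y)
    qed
    then show "\<exists>z. comm_group \<lparr>carrier = Hom CAT X Y, monoid.mult = plus, one = z\<rparr>" by blast
  next
    fix X Y Z a a' b b' assume "a \<in> Hom CAT X Y" "a' \<in> Hom CAT X Y" "b \<in> Hom CAT Y Z" "b' \<in> Hom CAT Y Z"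
    then obtain f f' g g' where O: "X \<in> Ob CAT" "Y \<in> Ob CAT" "Z \<in> Ob CAT"
      and m: "mor X Y f" "a = arr X f Y" "mor X Y f'" "a' = arr X f' Y" "mor Y Z g" "b = arr Y g Z"
        "mor Y Z g'" "b' = arr Y g' Z" by (auto elim!: Hom_arr)
    have s: "mor X Y (\<lambda>x. f x \<oplus>\<^bsub>Y\<^esub> f' x)" using mor_add[OF ObD(1)[OF O(1)] ObD(1)[OF O(2)] m(1,3)] .
    show "b \<star>\<^bsub>CAT\<^esub> plus a a' = plus (b \<star>\<^bsub>CAT\<^esub> a) (b \<star>\<^bsub>CAT\<^esub> a')"
      using morD(3)[OF m(1)] morD(3)[OF m(3)]
      by (simp add: m(2,4,6) plus arr_comp_mor[OF s] arr_comp_mor[OF m(1)] arr_comp_mor[OF m(3)] arr_eq_iff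
          additive_add[OF morD(1)[OF m(5)]])
    show "plus b b' \<star>\<^bsub>CAT\<^esub> a = plus (b \<star>\<^bsub>CAT\<^esub> a) (b' \<star>\<^bsub>CAT\<^esub> a)"
      by (simp add: m(2,6,8) plus arr_comp_mor[OF m(1)])
  qed
qed

lemma abelian_CAT: "abelian_category CAT"
proof (rule abelian_category.intro[OF category_CAT], rule abelian_category_axioms.intro)
  show "preadditive CAT" by (rule CAT_preadditive)
  show "\<exists>Z. zero_object CAT Z" by (rule ex_trivial) (blast dest: trivial_zero_object)
  show "\<exists>P p q. binary_product CAT X Y P p q" "\<exists>S i j. binary_coproduct CAT X Y S i j"
    if "X \<in> Ob CAT" "Y \<in> Ob CAT" for X Y
    using ex_binary_product[OF that] ex_binary_coproduct[OF that] .
  show "\<exists>i. kernel_of CAT f i" "\<exists>p. cokernel_of CAT f p" if fA: "f \<in> Arr CAT" for f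
  proof -
    obtain X g Y where O: "X \<in> Ob CAT" "Y \<in> Ob CAT" and g: "mor X Y g" "f = arr X g Y" using fA by (elim Arr_arr)
    show "\<exists>i. kernel_of CAT f i" unfolding g(2) by (rule ex_kernel_object[OF O g(1)]) blast
    show "\<exists>p. cokernel_of CAT f p" unfolding g(2) by (rule ex_cokernel_object[OF O g(1)]) blast
  qed
  show "\<exists>g. kernel_of CAT g f" if m: "monic CAT f" for f
  proof -
    have "f \<in> Arr CAT" using m by (simp add: monic_def)
    then obtain X g Y where O: "X \<in> Ob CAT" "Y \<in> Ob CAT" and g: "mor X Y g" "f = arr X g Y" by (elim Arr_arr)
    obtain Q p where Q: "Q \<in> Ob CAT" "mor Y Q p" "p ` carrier Y = carrier Q"
      "{y \<in> carrier Y. p y = \<zero>\<^bsub>Q\<^esub>} = g ` carrier X" "cokernel_of CAT (arr X g Y) (arr Y p Q)"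
      by (rule ex_cokernel_object[OF O g(1)])
    \<comment> \<open>A monic is the kernel of its cokernel: the kernel of \<open>p\<close> on
      elements is the image of \<open>g\<close>.\<close>
    have "kernel_of CAT (arr Y p Q) f"
      unfolding g(2) using monic_injective[OF O g(1)] m g(2) Q(4)
      by (intro kernel_ofI[OF O(2) Q(1) O(1) Q(2) g(1)]) auto
    then show ?thesis by blast
  qed
  show "\<exists>g. cokernel_of CAT g f" if e: "epic CAT f" for f
  proof -
    have "f \<in> Arr CAT" using e by (simp add: epic_def)
    then obtain X g Y where O: "X \<in> Ob CAT" "Y \<in> Ob CAT" and g: "mor X Y g" "f = arr X g Y" by (elim Arr_arr)
    obtain K where K: "K \<in> Ob CAT" "carrier K = {x \<in> carrier X. g x = \<zero>\<^bsub>Y\<^esub>}" "mor K X (\<lambda>x. x)"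
      "kernel_of CAT (arr X g Y) (arr K (\<lambda>x. x) X)"
      by (rule ex_kernel_object[OF O g(1)])
    \<comment> \<open>Dually, an epic is the cokernel of its kernel.\<close>
    have "cokernel_of CAT (arr K (\<lambda>x. x) X) f"
      unfolding g(2) using epic_surjective[OF O g(1)] e g(2) K(2)
      by (intro cokernel_ofI[OF K(1) O(1,2) K(3) g(1)]) auto
    then show ?thesis by blast
  qed
qed

end

section \<open>Filtered colimits\<close>

definition arrow_fun :: "'o \<times> 'f \<times> 'p \<Rightarrow> 'f" where
  "arrow_fun a = fst (snd a)"

locale comodule_diagram = flat_coring k H A C U
  for k :: "'k ring" and H :: "('k, 'h) bialgebra" and A :: "('k, 'h, 'a) H_module"
    and C :: "('k, 'h, 'a, 'c) HA_coring" and U :: "'u set set" +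
  fixes J :: "('u, 'u) category" and D :: "'u \<Rightarrow> ('k, 'h, 'a, 'c, 'u) HC_comodule"
    and D' :: "'u \<Rightarrow> ('k, 'h, 'a, 'c, 'u) HC_comodule \<times> ('u \<Rightarrow> 'u) \<times> ('k, 'h, 'a, 'c, 'u) HC_comodule"
  assumes J: "category J" and Ob_J: "Ob J \<in> U" and diagram: "diagram J CAT D D'"
begin

definition \<phi> :: "'u \<Rightarrow> 'u \<Rightarrow> 'u" where "\<phi> a = arrow_fun (D' a)"

lemma D_Ob: "i \<in> Ob J \<Longrightarrow> D i \<in> Ob CAT"
  using diagram by (simp add: diagram_def)

lemma HomJ_Ob: "a \<in> Hom J i j \<Longrightarrow> i \<in> Ob J" "a \<in> Hom J i j \<Longrightarrow> j \<in> Ob J"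
  using category.Dom_Ob[OF J] category.Cod_Ob[OF J] by (auto simp: Hom_def)

lemma D'_arr:
  assumes "a \<in> Hom J i j"
  shows "mor (D i) (D j) (\<phi> a)" "D' a = arr (D i) (\<phi> a) (D j)"
proof -
  have "D' a \<in> Hom CAT (D i) (D j)" using assms diagram by (auto simp: diagram_def Hom_def)
  then obtain f where f: "mor (D i) (D j) f" "D' a = arr (D i) f (D j)" "D i \<in> Ob CAT" "D j \<in> Ob CAT"
    by (elim Hom_arr)
  have e: "\<phi> a = restrict f (carrier (D i))" by (simp add: \<phi>_def arrow_fun_def f(2) arr_def)
  show "mor (D i) (D j) (\<phi> a)"
    unfolding e by (rule mor_cong[OF ObD(1)[OF f(3)] ObD(1)[OF f(4)] f(1)]) simp
  show "D' a = arr (D i) (\<phi> a) (D j)" unfolding e f(2) by (simp add: arr_def)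
qed

lemma \<phi>_comp:
  assumes a: "a \<in> Hom J i j" and b: "b \<in> Hom J j l" and x: "x \<in> carrier (D i)"
  shows "\<phi> (b \<star>\<^bsub>J\<^esub> a) x = \<phi> b (\<phi> a x)"
proof -
  have "D' (b \<star>\<^bsub>J\<^esub> a) = D' b \<star>\<^bsub>CAT\<^esub> D' a" using a b diagram by (simp add: diagram_def Hom_def)
  then have "arr (D i) (\<phi> (b \<star>\<^bsub>J\<^esub> a)) (D l) = arr (D i) (\<lambda>x. \<phi> b (\<phi> a x)) (D l)"
    using D'_arr(2)[OF category.Comp_Hom[OF J a b]]
    by (simp add: D'_arr(2)[OF a] D'_arr(2)[OF b] arr_comp_mor[OF D'_arr(1)[OF a]])
  then show ?thesis using x by (simp add: arr_eq_iff)
qed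

lemma ArrJ: "a \<in> Arr J \<Longrightarrow> a \<in> Hom J (Dom J a) (Cod J a)"
  by (simp add: Hom_def)

lemmas \<phi>_add = morD(1)[OF D'_arr(1)]
lemmas \<phi>_cl = morD(3)[OF D'_arr(1)]
lemmas Dg = ObD(5)[OF D_Ob]

text \<open>Composition in \<open>J\<close> is forgotten here, since a cocone is a condition on
  single arrows. It returns for filtered diagrams.\<close>

sublocale graph_diagram k H A C U "Ob J" D "Arr J" "Dom J" "Cod J" \<phi>
proof (intro graph_diagram.intro flat_coring_axioms graph_diagram_axioms.intro)
  show "small U (Ob J)" using Ob_J by (rule small_member)
  fix a assume "a \<in> Arr J"
  then have a: "a \<in> Hom J (Dom J a) (Cod J a)" by (rule ArrJ)
  show "Dom J a \<in> Ob J" "Cod J a \<in> Ob J" using HomJ_Ob[OF a] .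
  show "HA_map (D (Dom J a)) (D (Cod J a)) (\<phi> a)" "colinear (D (Dom J a)) (D (Cod J a)) (\<phi> a)"
    using D'_arr(1)[OF a] by (simp_all add: mor_def)
qed (use ObD(1,3)[OF D_Ob] in auto)

end

locale comodule_colimit = comodule_diagram k H A C U J D D' + presented gens rels L q
  for k :: "'k ring" and H :: "('k, 'h) bialgebra" and A :: "('k, 'h, 'a) H_module"
    and C :: "('k, 'h, 'a, 'c) HA_coring" and U :: "'u set set"
    and J :: "('u, 'u) category" and D :: "'u \<Rightarrow> ('k, 'h, 'a, 'c, 'u) HC_comodule"
    and D' :: "'u \<Rightarrow> ('k, 'h, 'a, 'c, 'u) HC_comodule \<times> ('u \<Rightarrow> 'u) \<times> ('k, 'h, 'a, 'c, 'u) HC_comodule"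
    and L :: "'u ring" and q :: "('u \<times> 'u \<Rightarrow>\<^sub>0 int) \<Rightarrow> 'u" +
  assumes L_small: "carrier L \<in> U"
begin

sublocale graph_colimit k H A C U "Ob J" D "Arr J" "Dom J" "Cod J" \<phi> L q
  by (intro graph_colimit.intro graph_diagram_axioms presented_axioms)

lemma LC_Ob: "LC \<in> Ob CAT"
  using LC_comodule L_small by (simp add: CAT_Ob)

lemma LC_cocone: "cocone J CAT D D' LC (\<lambda>i. arr (D i) (\<gamma> i) LC)"
  unfolding cocone_def
proof (intro conjI ballI)
  show "LC \<in> Ob CAT" by (rule LC_Ob)
  show "arr (D i) (\<gamma> i) LC \<in> Hom CAT (D i) LC" if "i \<in> Ob J" for i
    by (rule arr_Hom[OF D_Ob[OF that] LC_Ob \<gamma>_mor[OF that]])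
  fix a assume aJ: "a \<in> Arr J"
  note a = ArrJ[OF aJ]
  show "arr (D (Cod J a)) (\<gamma> (Cod J a)) LC \<star>\<^bsub>CAT\<^esub> D' a = arr (D (Dom J a)) (\<gamma> (Dom J a)) LC"
    using \<gamma>_\<phi>[OF aJ] by (simp add: D'_arr(2)[OF a] arr_comp_mor[OF D'_arr(1)[OF a]] arr_eq_iff)
qed

lemma cocone_arr:
  assumes "cocone J CAT D D' X d"
  shows "X \<in> Ob CAT"
    "i \<in> Ob J \<Longrightarrow> mor (D i) X (arrow_fun (d i))" "i \<in> Ob J \<Longrightarrow> d i = arr (D i) (arrow_fun (d i)) X"
    "a \<in> Arr J \<Longrightarrow> x \<in> carrier (D (Dom J a)) \<Longrightarrow> arrow_fun (d (Cod J a)) (\<phi> a x) = arrow_fun (d (Dom J a)) x"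
proof -
  show X: "X \<in> Ob CAT" using assms by (simp add: cocone_def)
  have *: "mor (D i) X (arrow_fun (d i)) \<and> d i = arr (D i) (arrow_fun (d i)) X" if i: "i \<in> Ob J" for i
  proof -
    have "d i \<in> Hom CAT (D i) X" using assms i by (simp add: cocone_def)
    then obtain f where f: "mor (D i) X f" "d i = arr (D i) f X" by (elim Hom_arr)
    have e: "arrow_fun (d i) = restrict f (carrier (D i))" by (simp add: arrow_fun_def f(2) arr_def)
    have "mor (D i) X (arrow_fun (d i))"
      unfolding e by (rule mor_cong[OF ObD(1)[OF D_Ob[OF i]] ObD(1)[OF X] f(1)]) simp
    moreover have "d i = arr (D i) (arrow_fun (d i)) X" by (simp add: f(2) arr_def arrow_fun_def)
    ultimately show ?thesis by blast
  qed
  show "i \<in> Ob J \<Longrightarrow> mor (D i) X (arrow_fun (d i))" "i \<in> Ob J \<Longrightarrow> d i = arr (D i) (arrow_fun (d i)) X"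
    using * by blast+
  assume aJ: "a \<in> Arr J" and x: "x \<in> carrier (D (Dom J a))"
  note a = ArrJ[OF aJ]
  have "d (Cod J a) \<star>\<^bsub>CAT\<^esub> D' a = d (Dom J a)" using assms aJ by (simp add: cocone_def)
  moreover have "d (Cod J a) = arr (D (Cod J a)) (arrow_fun (d (Cod J a))) X"
    "d (Dom J a) = arr (D (Dom J a)) (arrow_fun (d (Dom J a))) X"
    using * HomJ_Ob[OF a] by blast+
  ultimately have "arr (D (Dom J a)) (\<lambda>x. arrow_fun (d (Cod J a)) (\<phi> a x)) X =
      arr (D (Dom J a)) (arrow_fun (d (Dom J a))) X"
    by (metis D'_arr(2)[OF a] arr_comp_mor[OF D'_arr(1)[OF a]])
  then show "arrow_fun (d (Cod J a)) (\<phi> a x) = arrow_fun (d (Dom J a)) x" using x by (simp add: arr_eq_iff)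
qed

lemma LC_universal:
  assumes X: "cocone J CAT D D' X d"
  obtains u where "mor LC X u" "\<And>i x. i \<in> Ob J \<Longrightarrow> x \<in> carrier (D i) \<Longrightarrow> u (\<gamma> i x) = arrow_fun (d i) x"
proof (rule ext_mor[of X "\<lambda>i. arrow_fun (d i)", OF ObD(1)[OF cocone_arr(1)[OF X]] cocone_arr(2)[OF X] cocone_arr(4)[OF X]])
  fix u assume "mor LC X u" "\<And>i x. i \<in> Ob J \<Longrightarrow> x \<in> carrier (D i) \<Longrightarrow> u (\<gamma> i x) = arrow_fun (d i) x"
  then show thesis by (rule that)
qed

lemma LC_colimit: "colimit J CAT D D' LC (\<lambda>i. arr (D i) (\<gamma> i) LC)"
  unfolding colimit_def
proof (intro conjI LC_cocone allI impI)
  fix X d assume c: "cocone J CAT D D' X d"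
  note X = cocone_arr[OF c]
  obtain u where u: "mor LC X u" "\<And>i x. i \<in> Ob J \<Longrightarrow> x \<in> carrier (D i) \<Longrightarrow> u (\<gamma> i x) = arrow_fun (d i) x"
    using LC_universal[OF c] by blast
  show "\<exists>!u. u \<in> Hom CAT LC X \<and> (\<forall>i\<in>Ob J. u \<star>\<^bsub>CAT\<^esub> arr (D i) (\<gamma> i) LC = d i)"
  proof (rule ex1I[of _ "arr LC u X"])
    have "arr LC u X \<star>\<^bsub>CAT\<^esub> arr (D i) (\<gamma> i) LC = d i" if i: "i \<in> Ob J" for i
      by (subst X(3)[OF i], subst arr_comp_mor[OF \<gamma>_mor[OF i]]) (simp add: arr_eq_iff u(2)[OF i])
    then show "arr LC u X \<in> Hom CAT LC X \<and> (\<forall>i\<in>Ob J. arr LC u X \<star>\<^bsub>CAT\<^esub> arr (D i) (\<gamma> i) LC = d i)"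
      using arr_Hom[OF LC_Ob X(1) u(1)] by blast
    fix v assume v: "v \<in> Hom CAT LC X \<and> (\<forall>i\<in>Ob J. v \<star>\<^bsub>CAT\<^esub> arr (D i) (\<gamma> i) LC = d i)"
    then obtain v' where v': "mor LC X v'" "v = arr LC v' X" by (auto elim: Hom_arr)
    have "v' (\<gamma> i x) = u (\<gamma> i x)" if i: "i \<in> Ob J" and x: "x \<in> carrier (D i)" for i x
    proof -
      have "arr LC v' X \<star>\<^bsub>CAT\<^esub> arr (D i) (\<gamma> i) LC = d i" using v i unfolding v'(2) by blast
      then have "arr (D i) (\<lambda>x. v' (\<gamma> i x)) X = d i" by (simp only: arr_comp_mor[OF \<gamma>_mor[OF i]])
      then have "arr (D i) (\<lambda>x. v' (\<gamma> i x)) X = arr (D i) (arrow_fun (d i)) X" using X(3)[OF i] by (rule trans)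
      then show ?thesis using x u(2)[OF i x] by (simp add: arr_eq_iff)
    qed
    then have "v' x = u x" if "x \<in> carrier LC" for x
      by (rule mor_eqI[OF ObD(1)[OF X(1)] v'(1) u(1)]) (use that in auto)
    then show "v = arr LC u X" by (simp add: v'(2) arr_eq_iff)
  qed
qed

text \<open>A colimit given abstractly is compared with the constructed one:
  \<open>u \<circ> v\<close> is the identity, being an endomorphism of \<open>X\<close> compatible
  with its cocone. Statements on elements of \<open>LC\<close> thereby pass to any colimit.\<close>

lemma colimit_iso:
  assumes c: "colimit J CAT D D' X d"
  obtains u v where "mor LC X u" "mor X LC v" "\<And>x. x \<in> carrier X \<Longrightarrow> u (v x) = x"
    "\<And>i x. i \<in> Ob J \<Longrightarrow> x \<in> carrier (D i) \<Longrightarrow> u (\<gamma> i x) = arrow_fun (d i) x"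
    "\<And>i x. i \<in> Ob J \<Longrightarrow> x \<in> carrier (D i) \<Longrightarrow> v (arrow_fun (d i) x) = \<gamma> i x"
proof -
  have cc: "cocone J CAT D D' X d" using c by (simp add: colimit_def)
  note X = cocone_arr[OF cc]
  obtain u where u: "mor LC X u" "\<And>i x. i \<in> Ob J \<Longrightarrow> x \<in> carrier (D i) \<Longrightarrow> u (\<gamma> i x) = arrow_fun (d i) x"
    using LC_universal[OF cc] by blast
  obtain v0 where "v0 \<in> Hom CAT X LC" "\<forall>i\<in>Ob J. v0 \<star>\<^bsub>CAT\<^esub> d i = arr (D i) (\<gamma> i) LC"
    using c LC_cocone unfolding colimit_def by blast
  then obtain v where v: "mor X LC v" and vd: "\<forall>i\<in>Ob J. arr X v LC \<star>\<^bsub>CAT\<^esub> d i = arr (D i) (\<gamma> i) LC"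
    by (auto elim: Hom_arr)
  have v2: "v (arrow_fun (d i) x) = \<gamma> i x" if i: "i \<in> Ob J" and x: "x \<in> carrier (D i)" for i x
  proof -
    have "arr (D i) (\<lambda>x. v (arrow_fun (d i) x)) LC = arr X v LC \<star>\<^bsub>CAT\<^esub> arr (D i) (arrow_fun (d i)) X"
      by (rule arr_comp_mor[OF X(2)[OF i], symmetric])
    also have "\<dots> = arr (D i) (\<gamma> i) LC" using vd i X(3)[OF i] by simp
    finally show ?thesis using x by (simp add: arr_eq_iff)
  qed
  have uv: "mor X X (\<lambda>x. u (v x))" by (rule mor_compO[OF X(1) LC_Ob X(1) v u(1)])
  have "arr X (\<lambda>x. u (v x)) X \<star>\<^bsub>CAT\<^esub> d i = d i" if i: "i \<in> Ob J" for i
    by (subst (1 2) X(3)[OF i], subst arr_comp_mor[OF X(2)[OF i]]) (simp add: arr_eq_iff u(2)[OF i] v2[OF i])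
  moreover have "arr X (\<lambda>x. x) X \<star>\<^bsub>CAT\<^esub> d i = d i" if i: "i \<in> Ob J" for i
    by (subst (1 2) X(3)[OF i], subst arr_comp_mor[OF X(2)[OF i]]) simp
  moreover have "\<exists>!w. w \<in> Hom CAT X X \<and> (\<forall>i\<in>Ob J. w \<star>\<^bsub>CAT\<^esub> d i = d i)"
    using c cc unfolding colimit_def by blast
  ultimately have "arr X (\<lambda>x. u (v x)) X = arr X (\<lambda>x. x) X"
    using arr_Hom[OF X(1) X(1) uv] arr_Hom[OF X(1) X(1) mor_id[OF ObD(1)[OF X(1)]]] by blast
  then have "\<And>x. x \<in> carrier X \<Longrightarrow> u (v x) = x" by (simp add: arr_eq_iff)
  then show thesis using that u v v2 by blast
qed

end

lemma (in comodule_diagram) ex_comodule_colimit: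
  obtains L q where "comodule_colimit k H A C U J D D' L q"
  by (rule ex_presented[OF small_gens rels_closed])
    (blast intro: comodule_colimit.intro comodule_diagram_axioms comodule_colimit_axioms.intro)

subsection \<open>The group of germs of a filtered diagram\<close>

locale filtered_diagram = comodule_diagram k H A C U J D D'
  for k :: "'k ring" and H :: "('k, 'h) bialgebra" and A :: "('k, 'h, 'a) H_module"
    and C :: "('k, 'h, 'a, 'c) HA_coring" and U :: "'u set set"
    and J :: "('u, 'u) category" and D :: "'u \<Rightarrow> ('k, 'h, 'a, 'c, 'u) HC_comodule"
    and D' :: "'u \<Rightarrow> ('k, 'h, 'a, 'c, 'u) HC_comodule \<times> ('u \<Rightarrow> 'u) \<times> ('k, 'h, 'a, 'c, 'u) HC_comodule" +
  assumes filtered: "filtered_category J"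
begin

lemma upper: assumes "i \<in> Ob J" "j \<in> Ob J" obtains l a b where "a \<in> Hom J i l" "b \<in> Hom J j l"
  using filtered_category.upper_bound[OF filtered assms] by blast

lemma coeq: assumes "a \<in> Hom J i j" "b \<in> Hom J i j" obtains l c where "c \<in> Hom J j l" "c \<star>\<^bsub>J\<^esub> a = c \<star>\<^bsub>J\<^esub> b"
  using filtered_category.coequalize[OF filtered assms] by blast

definition germ_rel :: "(('u \<times> 'u) \<times> ('u \<times> 'u)) set" where
  "germ_rel = {((i, x), (j, y)). i \<in> Ob J \<and> j \<in> Ob J \<and> x \<in> carrier (D i) \<and> y \<in> carrier (D j) \<and>
     (\<exists>l. \<exists>a\<in>Hom J i l. \<exists>b\<in>Hom J j l. \<phi> a x = \<phi> b y)}"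

text \<open>Equality at some stage \<open>m\<close> is turned into equality at a stage beyond the
  prescribed \<open>l\<close>. After moving \<open>l\<close> and \<open>m\<close> to a common
  \<open>n\<close> the two paths from \<open>i\<close> need not agree, nor those from
  \<open>j\<close>; each pair is coequalized in turn.\<close>

lemma germ_rel_along:
  assumes r: "((i, x), (j, y)) \<in> germ_rel" and a: "a \<in> Hom J i l" and b: "b \<in> Hom J j l"
  obtains p c where "c \<in> Hom J l p" "\<phi> c (\<phi> a x) = \<phi> c (\<phi> b y)"
proof -
  obtain m a0 b0 where x: "x \<in> carrier (D i)" and y: "y \<in> carrier (D j)"
    and a0: "a0 \<in> Hom J i m" and b0: "b0 \<in> Hom J j m" and eq: "\<phi> a0 x = \<phi> b0 y"
    using r by (auto simp: germ_rel_def)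
  note comp = category.Comp_Hom[OF J]
  obtain n s t where s: "s \<in> Hom J l n" and t: "t \<in> Hom J m n" using upper HomJ_Ob(2)[OF a] HomJ_Ob(2)[OF a0] by blast
  obtain n1 w1 where w1: "w1 \<in> Hom J n n1" "w1 \<star>\<^bsub>J\<^esub> (s \<star>\<^bsub>J\<^esub> a) = w1 \<star>\<^bsub>J\<^esub> (t \<star>\<^bsub>J\<^esub> a0)"
    using coeq[OF comp[OF a s] comp[OF a0 t]] .
  note ws = comp[OF s w1(1)] and wt = comp[OF t w1(1)]
  obtain n2 w2 where w2: "w2 \<in> Hom J n1 n2"
    "w2 \<star>\<^bsub>J\<^esub> ((w1 \<star>\<^bsub>J\<^esub> s) \<star>\<^bsub>J\<^esub> b) = w2 \<star>\<^bsub>J\<^esub> ((w1 \<star>\<^bsub>J\<^esub> t) \<star>\<^bsub>J\<^esub> b0)"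
    using coeq[OF comp[OF b ws] comp[OF b0 wt]] .
  let ?c = "w2 \<star>\<^bsub>J\<^esub> (w1 \<star>\<^bsub>J\<^esub> s)"
  note c = comp[OF ws w2(1)]
  have x1: "\<phi> w1 (\<phi> s (\<phi> a x)) = \<phi> w1 (\<phi> t (\<phi> a0 x))"
  proof -
    have "\<phi> w1 (\<phi> s (\<phi> a x)) = \<phi> (w1 \<star>\<^bsub>J\<^esub> (s \<star>\<^bsub>J\<^esub> a)) x"
      by (simp add: \<phi>_comp[OF comp[OF a s] w1(1) x] \<phi>_comp[OF a s x])
    also have "\<dots> = \<phi> w1 (\<phi> t (\<phi> a0 x))"
      by (simp add: w1(2) \<phi>_comp[OF comp[OF a0 t] w1(1) x] \<phi>_comp[OF a0 t x])
    finally show ?thesis .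
  qed
  have ct: "\<phi> (w2 \<star>\<^bsub>J\<^esub> (w \<star>\<^bsub>J\<^esub> d)) z = \<phi> w2 (\<phi> w (\<phi> d z))"
    if "d \<in> Hom J i' m'" "w \<in> Hom J m' n1" "z \<in> carrier (D i')" for w d z i' m'
    by (simp add: \<phi>_comp[OF comp[OF that(1,2)] w2(1) that(3)] \<phi>_comp[OF that(1,2) that(3)])
  have "\<phi> ?c (\<phi> a x) = \<phi> w2 (\<phi> w1 (\<phi> s (\<phi> a x)))"
    by (rule ct[OF s w1(1) \<phi>_cl[OF a x]])
  also have "\<dots> = \<phi> w2 (\<phi> (w1 \<star>\<^bsub>J\<^esub> t) (\<phi> b0 y))"
    by (simp add: x1 eq \<phi>_comp[OF t w1(1) \<phi>_cl[OF b0 y]])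
  also have "\<dots> = \<phi> (w2 \<star>\<^bsub>J\<^esub> ((w1 \<star>\<^bsub>J\<^esub> t) \<star>\<^bsub>J\<^esub> b0)) y" by (rule ct[OF b0 wt y, symmetric])
  also have "\<dots> = \<phi> w2 (\<phi> (w1 \<star>\<^bsub>J\<^esub> s) (\<phi> b y))" unfolding w2(2)[symmetric] by (rule ct[OF b ws y])
  also have "\<dots> = \<phi> ?c (\<phi> b y)" by (rule \<phi>_comp[OF ws w2(1) \<phi>_cl[OF b y], symmetric])
  finally show thesis using that[OF c] by blast
qed

lemma germ_relI:
  assumes "x \<in> carrier (D i)" "y \<in> carrier (D j)" "a \<in> Hom J i l" "b \<in> Hom J j l" "\<phi> a x = \<phi> b y"
  shows "((i, x), (j, y)) \<in> germ_rel"
  using assms HomJ_Ob by (auto simp: germ_rel_def)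

lemma IdtJ: "i \<in> Ob J \<Longrightarrow> Idt J i \<in> Hom J i i"
  by (rule category.Idt_Hom[OF J])

lemma germ_equiv: "equiv gens germ_rel"
proof (rule equivI)
  show "germ_rel \<subseteq> gens \<times> gens" by (auto simp: germ_rel_def)
  show "refl_on gens germ_rel"
    using IdtJ by (auto simp: refl_on_def intro!: germ_relI[of _ _ _ _ "Idt J _" _ "Idt J _"])
  show "sym germ_rel" by (rule symI) (auto simp: germ_rel_def, metis)
  show "trans germ_rel"
  proof (rule transI, clarify)
    fix i x j y l z assume r1: "((i, x), (j, y)) \<in> germ_rel" and r2: "((j, y), (l, z)) \<in> germ_rel"
    obtain m a b where a: "a \<in> Hom J i m" "b \<in> Hom J j m" "\<phi> a x = \<phi> b y" and x: "x \<in> carrier (D i)"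
      and y: "y \<in> carrier (D j)" using r1 by (auto simp: germ_rel_def)
    have z: "z \<in> carrier (D l)" "l \<in> Ob J" using r2 by (auto simp: germ_rel_def)
    obtain n s t where s: "s \<in> Hom J m n" and t: "t \<in> Hom J l n" using upper HomJ_Ob(2)[OF a(1)] z(2) by blast
    note comp = category.Comp_Hom[OF J]
    obtain p c where c: "c \<in> Hom J n p" "\<phi> c (\<phi> (s \<star>\<^bsub>J\<^esub> b) y) = \<phi> c (\<phi> t z)"
      using germ_rel_along[OF r2 comp[OF a(2) s] t] .
    show "((i, x), (l, z)) \<in> germ_rel"
    proof (rule germ_relI[OF x z(1) comp[OF comp[OF a(1) s] c(1)] comp[OF t c(1)]])
      show "\<phi> (c \<star>\<^bsub>J\<^esub> (s \<star>\<^bsub>J\<^esub> a)) x = \<phi> (c \<star>\<^bsub>J\<^esub> t) z"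
        using c(2) by (simp add: \<phi>_comp[OF comp[OF a(1) s] c(1) x] \<phi>_comp[OF a(1) s x] \<phi>_comp[OF t c(1) z(1)]
            \<phi>_comp[OF a(2) s y] a(3))
    qed
  qed
qed

definition germ :: "'u \<Rightarrow> 'u \<Rightarrow> ('u \<times> 'u) set" where
  "germ i x = germ_rel `` {(i, x)}"

lemma germ_eq_iff:
  assumes "i \<in> Ob J" "x \<in> carrier (D i)" "j \<in> Ob J" "y \<in> carrier (D j)"
  shows "germ i x = germ j y \<longleftrightarrow> ((i, x), (j, y)) \<in> germ_rel"
  unfolding germ_def using eq_equiv_class_iff[OF germ_equiv] assms by auto

lemma germ_push:
  assumes a: "a \<in> Hom J i l" and x: "x \<in> carrier (D i)"
  shows "germ l (\<phi> a x) = germ i x"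
proof -
  have "((i, x), (l, \<phi> a x)) \<in> germ_rel"
    using category.Idt_Comp[OF J a] \<phi>_comp[OF a IdtJ[OF HomJ_Ob(2)[OF a]] x]
    by (intro germ_relI[OF x \<phi>_cl[OF a x] a IdtJ[OF HomJ_Ob(2)[OF a]]]) simp
  then show ?thesis using germ_eq_iff[OF HomJ_Ob(1)[OF a] x HomJ_Ob(2)[OF a] \<phi>_cl[OF a x]] by simp
qed

text \<open>The union runs over all pairs of representatives at a common stage; by
  \<open>germ_add\<close> these give a single germ, so the union is that germ. The zero is taken at
  an arbitrary vertex, see \<open>germ_zero\<close>.\<close>

definition germ_group :: "('u \<times> 'u) set ring" where
  "germ_group = \<lparr>carrier = (\<lambda>(i, x). germ i x) ` gens, monoid.mult = undefined, one = undefined,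
     zero = germ (SOME i. i \<in> Ob J) \<zero>\<^bsub>D (SOME i. i \<in> Ob J)\<^esub>,
     add = \<lambda>X Y. \<Union>{germ l (x \<oplus>\<^bsub>D l\<^esub> y) | l x y. l \<in> Ob J \<and> x \<in> carrier (D l) \<and> y \<in> carrier (D l) \<and>
       germ l x = X \<and> germ l y = Y}\<rparr>"

text \<open>The representatives of the first summand are aligned first, then those of the second
  beyond that stage along the composite arrows, so that one pair of arrows serves both
  summands.\<close>

lemma germ_add:
  assumes l: "l \<in> Ob J" and x: "x \<in> carrier (D l)" and y: "y \<in> carrier (D l)"
  shows "germ l x \<oplus>\<^bsub>germ_group\<^esub> germ l y = germ l (x \<oplus>\<^bsub>D l\<^esub> y)"
proof -
  have "germ l' (x' \<oplus>\<^bsub>D l'\<^esub> y') = germ l (x \<oplus>\<^bsub>D l\<^esub> y)"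
    if l': "l' \<in> Ob J" and x': "x' \<in> carrier (D l')" and y': "y' \<in> carrier (D l')"
      and eq: "germ l' x' = germ l x" "germ l' y' = germ l y" for l' x' y'
  proof -
    have r: "((l', x'), (l, x)) \<in> germ_rel" "((l', y'), (l, y)) \<in> germ_rel"
      using eq germ_eq_iff[OF l' x' l x] germ_eq_iff[OF l' y' l y] by auto
    note comp = category.Comp_Hom[OF J]
    obtain m a b where a: "a \<in> Hom J l' m" and b: "b \<in> Hom J l m" using upper[OF l' l] .
    obtain n c where c: "c \<in> Hom J m n" "\<phi> c (\<phi> a x') = \<phi> c (\<phi> b x)" using germ_rel_along[OF r(1) a b] .
    note ca = comp[OF a c(1)] and cb = comp[OF b c(1)]
    obtain p d where d: "d \<in> Hom J n p" "\<phi> d (\<phi> (c \<star>\<^bsub>J\<^esub> a) y') = \<phi> d (\<phi> (c \<star>\<^bsub>J\<^esub> b) y)"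
      using germ_rel_along[OF r(2) ca cb] .
    note da = comp[OF ca d(1)] and db = comp[OF cb d(1)]
    have X: "\<phi> (d \<star>\<^bsub>J\<^esub> (c \<star>\<^bsub>J\<^esub> a)) x' = \<phi> (d \<star>\<^bsub>J\<^esub> (c \<star>\<^bsub>J\<^esub> b)) x"
      by (simp add: \<phi>_comp[OF ca d(1) x'] \<phi>_comp[OF cb d(1) x] \<phi>_comp[OF a c(1) x'] \<phi>_comp[OF b c(1) x] c(2))
    have Y: "\<phi> (d \<star>\<^bsub>J\<^esub> (c \<star>\<^bsub>J\<^esub> a)) y' = \<phi> (d \<star>\<^bsub>J\<^esub> (c \<star>\<^bsub>J\<^esub> b)) y"
      by (simp add: \<phi>_comp[OF ca d(1) y'] \<phi>_comp[OF cb d(1) y] d(2))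
    have s: "x' \<oplus>\<^bsub>D l'\<^esub> y' \<in> carrier (D l')" "x \<oplus>\<^bsub>D l\<^esub> y \<in> carrier (D l)"
      using D_add_closed l l' x y x' y' by auto
    have "\<phi> (d \<star>\<^bsub>J\<^esub> (c \<star>\<^bsub>J\<^esub> a)) (x' \<oplus>\<^bsub>D l'\<^esub> y') = \<phi> (d \<star>\<^bsub>J\<^esub> (c \<star>\<^bsub>J\<^esub> b)) (x \<oplus>\<^bsub>D l\<^esub> y)"
      by (simp add: additive_add[OF \<phi>_add[OF da] x' y'] additive_add[OF \<phi>_add[OF db] x y] X Y)
    then show ?thesis using germ_eq_iff[OF l' s(1) l s(2)] germ_relI[OF s da db] by simp
  qed
  then have "{germ l' (x' \<oplus>\<^bsub>D l'\<^esub> y') | l' x' y'. l' \<in> Ob J \<and> x' \<in> carrier (D l') \<and> y' \<in> carrier (D l') \<and>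
       germ l' x' = germ l x \<and> germ l' y' = germ l y} = {germ l (x \<oplus>\<^bsub>D l\<^esub> y)}"
    using assms by blast
  then show ?thesis by (simp add: germ_group_def)
qed

lemma germ_zero: assumes i: "i \<in> Ob J" shows "germ i \<zero>\<^bsub>D i\<^esub> = \<zero>\<^bsub>germ_group\<^esub>"
proof -
  let ?j = "SOME i. i \<in> Ob J"
  have j: "?j \<in> Ob J" using i by (rule someI)
  obtain l a b where a: "a \<in> Hom J i l" and b: "b \<in> Hom J ?j l" using upper[OF i j] .
  have "germ i \<zero>\<^bsub>D i\<^esub> = germ l \<zero>\<^bsub>D l\<^esub>" "germ ?j \<zero>\<^bsub>D ?j\<^esub> = germ l \<zero>\<^bsub>D l\<^esub>"
    using germ_push[OF a ObD(6)[OF D_Ob[OF i]]] germ_push[OF b ObD(6)[OF D_Ob[OF j]]]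
      additive_zero[OF Dg[OF i] Dg[OF HomJ_Ob(2)[OF a]] \<phi>_add[OF a]]
      additive_zero[OF Dg[OF j] Dg[OF HomJ_Ob(2)[OF a]] \<phi>_add[OF b]] by simp_all
  then show ?thesis by (simp add: germ_group_def)
qed

lemma germ_carrier: "i \<in> Ob J \<Longrightarrow> x \<in> carrier (D i) \<Longrightarrow> germ i x \<in> carrier germ_group"
  by (auto simp: germ_group_def)

lemma germ_cases:
  assumes "X \<in> carrier germ_group" obtains i x where "i \<in> Ob J" "x \<in> carrier (D i)" "X = germ i x"
  using assms by (auto simp: germ_group_def)

lemma germ_cases2:
  assumes "X \<in> carrier germ_group" "Y \<in> carrier germ_group"
  obtains l x y where "l \<in> Ob J" "x \<in> carrier (D l)" "y \<in> carrier (D l)" "X = germ l x" "Y = germ l y"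
proof -
  obtain i x where i: "i \<in> Ob J" "x \<in> carrier (D i)" "X = germ i x" using germ_cases[OF assms(1)] .
  obtain j y where j: "j \<in> Ob J" "y \<in> carrier (D j)" "Y = germ j y" using germ_cases[OF assms(2)] .
  obtain l a b where a: "a \<in> Hom J i l" and b: "b \<in> Hom J j l" using upper[OF i(1) j(1)] .
  show thesis
    using that[OF HomJ_Ob(2)[OF a] \<phi>_cl[OF a i(2)] \<phi>_cl[OF b j(2)]] germ_push[OF a i(2)] germ_push[OF b j(2)] i j by simp
qed

lemma germ_cases3:
  assumes "X \<in> carrier germ_group" "Y \<in> carrier germ_group" "Z \<in> carrier germ_group"
  obtains l x y z where "l \<in> Ob J" "x \<in> carrier (D l)" "y \<in> carrier (D l)" "z \<in> carrier (D l)"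
    "X = germ l x" "Y = germ l y" "Z = germ l z"
proof -
  obtain i x y where i: "i \<in> Ob J" "x \<in> carrier (D i)" "y \<in> carrier (D i)" "X = germ i x" "Y = germ i y"
    using germ_cases2[OF assms(1,2)] .
  obtain j z where j: "j \<in> Ob J" "z \<in> carrier (D j)" "Z = germ j z" using germ_cases[OF assms(3)] .
  obtain l a b where a: "a \<in> Hom J i l" and b: "b \<in> Hom J j l" using upper[OF i(1) j(1)] .
  show thesis
    using that[OF HomJ_Ob(2)[OF a] \<phi>_cl[OF a i(2)] \<phi>_cl[OF a i(3)] \<phi>_cl[OF b j(2)]]
      germ_push[OF a i(2)] germ_push[OF a i(3)] germ_push[OF b j(2)] i j by simp
qed

text \<open>Finitely many germs have representatives at one vertex, where the group laws
  hold.\<close>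

lemma germ_group: "abelian_group germ_group"
proof (rule abelian_groupI)
  obtain i where i: "i \<in> Ob J" using filtered_category.nonempty[OF filtered] by blast
  show "\<zero>\<^bsub>germ_group\<^esub> \<in> carrier germ_group"
    using germ_carrier[OF i ObD(6)[OF D_Ob[OF i]]] germ_zero[OF i] by simp
next
  fix X Y assume "X \<in> carrier germ_group" "Y \<in> carrier germ_group"
  then obtain l x y where l: "l \<in> Ob J" "x \<in> carrier (D l)" "y \<in> carrier (D l)" "X = germ l x" "Y = germ l y"
    by (rule germ_cases2)
  interpret abelian_group "D l" by (rule Dg[OF l(1)])
  show "X \<oplus>\<^bsub>germ_group\<^esub> Y \<in> carrier germ_group" "X \<oplus>\<^bsub>germ_group\<^esub> Y = Y \<oplus>\<^bsub>germ_group\<^esub> X"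
    using l by (simp_all add: germ_add germ_carrier a_comm)
next
  fix X Y Z assume "X \<in> carrier germ_group" "Y \<in> carrier germ_group" "Z \<in> carrier germ_group"
  then obtain l x y z where l: "l \<in> Ob J" "x \<in> carrier (D l)" "y \<in> carrier (D l)" "z \<in> carrier (D l)"
    "X = germ l x" "Y = germ l y" "Z = germ l z"
    by (rule germ_cases3)
  interpret abelian_group "D l" by (rule Dg[OF l(1)])
  show "X \<oplus>\<^bsub>germ_group\<^esub> Y \<oplus>\<^bsub>germ_group\<^esub> Z = X \<oplus>\<^bsub>germ_group\<^esub> (Y \<oplus>\<^bsub>germ_group\<^esub> Z)"
    using l by (simp add: germ_add a_assoc)
next
  fix X assume "X \<in> carrier germ_group"
  then obtain l x where l: "l \<in> Ob J" "x \<in> carrier (D l)" "X = germ l x" by (rule germ_cases)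
  interpret abelian_group "D l" by (rule Dg[OF l(1)])
  show "\<zero>\<^bsub>germ_group\<^esub> \<oplus>\<^bsub>germ_group\<^esub> X = X" using l by (simp add: germ_zero[OF l(1), symmetric] germ_add)
  show "\<exists>Y\<in>carrier germ_group. Y \<oplus>\<^bsub>germ_group\<^esub> X = \<zero>\<^bsub>germ_group\<^esub>"
    using l by (intro bexI[of _ "germ l (\<ominus>\<^bsub>D l\<^esub> x)"])
      (simp_all add: germ_zero[OF l(1), symmetric] germ_add l_neg germ_carrier)
qed

text \<open>Makes the germs a test group: by the universal property \<open>\<gamma> i x\<close> is
  sent to \<open>germ i x\<close>, so equality in the colimit forces equality at a later
  stage.\<close>

lemma germ_compatible: "compatible germ_group germ"
  unfolding compatible_def
  by (auto intro!: additiveI germ_carrier simp: germ_add germ_push[OF ArrJ])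

end

locale filtered_colimit = comodule_colimit k H A C U J D D' L q + filtered_diagram k H A C U J D D'
  for k :: "'k ring" and H :: "('k, 'h) bialgebra" and A :: "('k, 'h, 'a) H_module"
    and C :: "('k, 'h, 'a, 'c) HA_coring" and U :: "'u set set"
    and J :: "('u, 'u) category" and D :: "'u \<Rightarrow> ('k, 'h, 'a, 'c, 'u) HC_comodule"
    and D' :: "'u \<Rightarrow> ('k, 'h, 'a, 'c, 'u) HC_comodule \<times> ('u \<Rightarrow> 'u) \<times> ('k, 'h, 'a, 'c, 'u) HC_comodule"
    and L :: "'u ring" and q :: "('u \<times> 'u \<Rightarrow>\<^sub>0 int) \<Rightarrow> 'u"
begin

lemma \<gamma>_push: "a \<in> Hom J i l \<Longrightarrow> x \<in> carrier (D i) \<Longrightarrow> \<gamma> l (\<phi> a x) = \<gamma> i x"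
  using \<gamma>_\<phi>[of a x] by (auto simp: Hom_def)

text \<open>The elements coming from a single vertex are closed under sums, because two vertices
  have a common successor; so they exhaust the group that they generate.\<close>

lemma filtered_elements:
  assumes "x \<in> carrier L" obtains i y where "i \<in> Ob J" "y \<in> carrier (D i)" "x = \<gamma> i y"
proof -
  have "\<exists>i y. i \<in> Ob J \<and> y \<in> carrier (D i) \<and> x = \<gamma> i y"
    using L_group \<gamma>_spans assms
  proof (induction x rule: spans_induct)
    case zero
    obtain i where i: "i \<in> Ob J" using filtered_category.nonempty[OF filtered] by blast
    show ?case
      using i ObD(6)[OF D_Ob[OF i]] additive_zero[OF Dg[OF i] L_group \<gamma>_additive[OF i]] by (metis (no_types))
  next
    case (add x y)
    then obtain i x' j y' where *: "i \<in> Ob J" "x' \<in> carrier (D i)" "x = \<gamma> i x'" "j \<in> Ob J" "y' \<in> carrier (D j)" "y = \<gamma> j y'"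
      by blast
    obtain l a b where a: "a \<in> Hom J i l" and b: "b \<in> Hom J j l" using upper[OF *(1,4)] .
    note l = HomJ_Ob(2)[OF a]
    have "x \<oplus>\<^bsub>L\<^esub> y = \<gamma> l (\<phi> a x' \<oplus>\<^bsub>D l\<^esub> \<phi> b y')"
      using * by (simp add: additive_add[OF \<gamma>_additive[OF l] \<phi>_cl[OF a] \<phi>_cl[OF b]] \<gamma>_push[OF a] \<gamma>_push[OF b])
    then show ?case using l D_add_closed[OF l \<phi>_cl[OF a *(2)] \<phi>_cl[OF b *(5)]] by blast
  next
    case (uminus x)
    then obtain i x' where *: "i \<in> Ob J" "x' \<in> carrier (D i)" "x = \<gamma> i x'" by blast
    interpret Di: abelian_group "D i" by (rule Dg[OF *(1)])
    show ?case using * additive_uminus[OF Dg[OF *(1)] L_group \<gamma>_additive[OF *(1)] *(2)] by (metis Di.a_inv_closed)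
  qed auto
  then show thesis using that by blast
qed

text \<open>Vanishing in the colimit gives a vanishing germ, and the germ relation names a stage
  where \<open>y\<close> already has the same image as 0.\<close>

lemma filtered_zero:
  assumes i: "i \<in> Ob J" and y: "y \<in> carrier (D i)" and z: "\<gamma> i y = \<zero>\<^bsub>L\<^esub>"
  obtains l a where "a \<in> Hom J i l" "\<phi> a y = \<zero>\<^bsub>D l\<^esub>"
proof -
  note e = ext_additive[OF germ_group germ_compatible] ext_\<gamma>[OF germ_group germ_compatible]
  have "germ i y = ext germ_group germ (\<gamma> i y)" using e(2)[OF i y] by simp
  also have "\<dots> = germ i \<zero>\<^bsub>D i\<^esub>"
    unfolding z germ_zero[OF i] by (rule additive_zero[OF L_group germ_group e(1)])
  finally have "((i, y), (i, \<zero>\<^bsub>D i\<^esub>)) \<in> germ_rel"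
    using germ_eq_iff[OF i y i ObD(6)[OF D_Ob[OF i]]] by simp
  then obtain l a b where a: "a \<in> Hom J i l" and b: "b \<in> Hom J i l" and eq: "\<phi> a y = \<phi> b \<zero>\<^bsub>D i\<^esub>"
    by (auto simp: germ_rel_def)
  have "\<phi> b \<zero>\<^bsub>D i\<^esub> = \<zero>\<^bsub>D l\<^esub>" by (rule additive_zero[OF Dg[OF i] Dg[OF HomJ_Ob(2)[OF b]] \<phi>_add[OF b]])
  then show thesis using that a eq by simp
qed

lemma colimit_elements:
  assumes c: "colimit J CAT D D' X d"
  shows "x \<in> carrier X \<Longrightarrow> \<exists>i\<in>Ob J. \<exists>y\<in>carrier (D i). x = arrow_fun (d i) y"
    and "i \<in> Ob J \<Longrightarrow> y \<in> carrier (D i) \<Longrightarrow> arrow_fun (d i) y = \<zero>\<^bsub>X\<^esub> \<Longrightarrow>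
      \<exists>l. \<exists>a\<in>Hom J i l. \<phi> a y = \<zero>\<^bsub>D l\<^esub>"
proof -
  have X: "X \<in> Ob CAT" using c by (simp add: colimit_def cocone_def)
  obtain u v where uv: "mor LC X u" "mor X LC v" "\<And>x. x \<in> carrier X \<Longrightarrow> u (v x) = x"
    "\<And>i x. i \<in> Ob J \<Longrightarrow> x \<in> carrier (D i) \<Longrightarrow> u (\<gamma> i x) = arrow_fun (d i) x"
    "\<And>i x. i \<in> Ob J \<Longrightarrow> x \<in> carrier (D i) \<Longrightarrow> v (arrow_fun (d i) x) = \<gamma> i x"
    using colimit_iso[OF c] by blast
  show "\<exists>i\<in>Ob J. \<exists>y\<in>carrier (D i). x = arrow_fun (d i) y" if x: "x \<in> carrier X"
  proof -
    have "v x \<in> carrier L" using morD(3)[OF uv(2) x] by simp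
    then obtain i y where "i \<in> Ob J" "y \<in> carrier (D i)" "v x = \<gamma> i y" by (rule filtered_elements)
    then show ?thesis using uv(3)[OF x] uv(4) by force
  qed
  assume i: "i \<in> Ob J" and y: "y \<in> carrier (D i)" and z: "arrow_fun (d i) y = \<zero>\<^bsub>X\<^esub>"
  have "\<gamma> i y = \<zero>\<^bsub>L\<^esub>"
    using uv(5)[OF i y] z additive_zero[OF ObD(5)[OF X] ObD(5)[OF LC_Ob] morD(1)[OF uv(2)]] by simp
  then show "\<exists>l. \<exists>a\<in>Hom J i l. \<phi> a y = \<zero>\<^bsub>D l\<^esub>" using filtered_zero[OF i y] by metis
qed

end

section \<open>Exactness of filtered colimits\<close>

context flat_coring
begin

lemma short_exact_iff:
  assumes "X \<in> Ob CAT" "Y \<in> Ob CAT" "Z \<in> Ob CAT" "mor X Y f" "mor Y Z g"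
  shows "short_exact CAT (arr X f Y) (arr Y g Z) \<longleftrightarrow>
    inj_on f (carrier X) \<and> f ` carrier X = {y \<in> carrier Y. g y = \<zero>\<^bsub>Z\<^esub>} \<and> g ` carrier Y = carrier Z"
  unfolding short_exact_def kernel_of_iff[OF assms(2,3,1,5,4)] cokernel_of_iff[OF assms] by auto

lemma Hom_arrow_fun:
  assumes "a \<in> Hom CAT X Y"
  shows "X \<in> Ob CAT" "Y \<in> Ob CAT" "mor X Y (arrow_fun a)" "a = arr X (arrow_fun a) Y"
proof -
  obtain f where f: "X \<in> Ob CAT" "Y \<in> Ob CAT" "mor X Y f" "a = arr X f Y" using assms by (elim Hom_arr)
  have e: "arrow_fun a = restrict f (carrier X)" by (simp add: arrow_fun_def f(4) arr_def)
  show "X \<in> Ob CAT" "Y \<in> Ob CAT" by (rule f)+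
  show "mor X Y (arrow_fun a)" unfolding e by (rule mor_cong[OF ObD(1)[OF f(1)] ObD(1)[OF f(2)] f(3)]) simp
  show "a = arr X (arrow_fun a) Y" by (simp add: f(4) arr_def arrow_fun_def)
qed

lemma comp_eq_arrow_fun:
  assumes "a \<in> Hom CAT X Y" "b \<in> Hom CAT Y Z" "c \<in> Hom CAT X Y'" "d \<in> Hom CAT Y' Z"
    and "b \<star>\<^bsub>CAT\<^esub> a = d \<star>\<^bsub>CAT\<^esub> c" and "x \<in> carrier X"
  shows "arrow_fun b (arrow_fun a x) = arrow_fun d (arrow_fun c x)"
proof -
  note a = Hom_arrow_fun[OF assms(1)] and b = Hom_arrow_fun[OF assms(2)]
    and c = Hom_arrow_fun[OF assms(3)] and d = Hom_arrow_fun[OF assms(4)]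
  have "b \<star>\<^bsub>CAT\<^esub> a = arr X (\<lambda>x. arrow_fun b (arrow_fun a x)) Z"
    using arr_comp_mor[OF a(3), of "arrow_fun b" Z] a(4) b(4) by simp
  moreover have "d \<star>\<^bsub>CAT\<^esub> c = arr X (\<lambda>x. arrow_fun d (arrow_fun c x)) Z"
    using arr_comp_mor[OF c(3), of "arrow_fun d" Z] c(4) d(4) by simp
  ultimately have "arr X (\<lambda>x. arrow_fun b (arrow_fun a x)) Z = arr X (\<lambda>x. arrow_fun d (arrow_fun c x)) Z"
    using assms(5) by simp
  then show ?thesis using assms(6) by (simp add: arr_eq_iff)
qed

lemma CAT_cocomplete:
  assumes "category (J :: ('u, 'u) category)" "Ob J \<in> U" "diagram J CAT D D'"
  shows "\<exists>L c. colimit J CAT D D' L c"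
proof -
  interpret comodule_diagram k H A C U J D D'
    using assms by (intro comodule_diagram.intro flat_coring_axioms comodule_diagram_axioms.intro)
  obtain L q where "comodule_colimit k H A C U J D D' L q" by (rule ex_comodule_colimit)
  then interpret comodule_colimit k H A C U J D D' L q .
  show ?thesis using LC_colimit by blast
qed

text \<open>Stated outside the locales of diagrams, since exactness uses it for three diagrams over
  the same \<open>J\<close> at once.\<close>

lemma colimit_elements_CAT:
  assumes J: "filtered_category (J :: ('u, 'u) category)" "Ob J \<in> U" and dg: "diagram J CAT D D'"
    and c: "colimit J CAT D D' X d"
  shows "x \<in> carrier X \<Longrightarrow> \<exists>i\<in>Ob J. \<exists>y\<in>carrier (D i). x = arrow_fun (d i) y"
    and "i \<in> Ob J \<Longrightarrow> y \<in> carrier (D i) \<Longrightarrow> arrow_fun (d i) y = \<zero>\<^bsub>X\<^esub> \<Longrightarrow>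
      \<exists>l. \<exists>a\<in>Hom J i l. arrow_fun (D' a) y = \<zero>\<^bsub>D l\<^esub>"
    and "a \<in> Hom J i l \<Longrightarrow> y \<in> carrier (D i) \<Longrightarrow> arrow_fun (d l) (arrow_fun (D' a) y) = arrow_fun (d i) y"
    and "a \<in> Hom J i l \<Longrightarrow> D' a \<in> Hom CAT (D i) (D l)"
    and "i \<in> Ob J \<Longrightarrow> d i \<in> Hom CAT (D i) X"
    and "a \<in> Hom J i l \<Longrightarrow> i \<in> Ob J" and "a \<in> Hom J i l \<Longrightarrow> l \<in> Ob J"
proof -
  have cat: "category J" using J(1) by (simp add: filtered_category_def)
  interpret filtered_diagram k H A C U J D D'
    using assms cat
    by (intro filtered_diagram.intro comodule_diagram.intro flat_coring_axioms comodule_diagram_axioms.intro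
        filtered_diagram_axioms.intro)
  obtain L q where "comodule_colimit k H A C U J D D' L q" by (rule ex_comodule_colimit)
  then interpret comodule_colimit k H A C U J D D' L q .
  interpret filtered_colimit k H A C U J D D' L q
    by (intro filtered_colimit.intro comodule_colimit_axioms filtered_diagram_axioms)
  show "x \<in> carrier X \<Longrightarrow> \<exists>i\<in>Ob J. \<exists>y\<in>carrier (D i). x = arrow_fun (d i) y"
    by (rule colimit_elements(1)[OF c])
  show "i \<in> Ob J \<Longrightarrow> y \<in> carrier (D i) \<Longrightarrow> arrow_fun (d i) y = \<zero>\<^bsub>X\<^esub> \<Longrightarrow>
      \<exists>l. \<exists>a\<in>Hom J i l. arrow_fun (D' a) y = \<zero>\<^bsub>D l\<^esub>"
    using colimit_elements(2)[OF c, of i y] by (simp add: \<phi>_def)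
  have cc: "cocone J CAT D D' X d" using c by (simp add: colimit_def)
  show "a \<in> Hom J i l \<Longrightarrow> y \<in> carrier (D i) \<Longrightarrow> arrow_fun (d l) (arrow_fun (D' a) y) = arrow_fun (d i) y"
    using cocone_arr(4)[OF cc, of a y] by (auto simp: Hom_def \<phi>_def)
  show "a \<in> Hom J i l \<Longrightarrow> D' a \<in> Hom CAT (D i) (D l)" using dg by (auto simp: diagram_def Hom_def)
  show "i \<in> Ob J \<Longrightarrow> d i \<in> Hom CAT (D i) X" using cc by (simp add: cocone_def)
  show "a \<in> Hom J i l \<Longrightarrow> i \<in> Ob J" "a \<in> Hom J i l \<Longrightarrow> l \<in> Ob J" by (blast intro: HomJ_Ob)+
qed

text \<open>A chase on elements: each element of a colimit comes from some vertex, where the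
  sequence is exact, and each vanishing in a colimit happens at a later vertex.\<close>

lemma CAT_filtered_exact:
  assumes J: "filtered_category (J :: ('u, 'u) category)" "Ob J \<in> U"
    and D1: "diagram J CAT D1 D1'" and D2: "diagram J CAT D2 D2'" and D3: "diagram J CAT D3 D3'"
    and s: "natural J CAT D1 D1' D2 D2' s" and t: "natural J CAT D2 D2' D3 D3' t"
    and ex: "\<And>i. i \<in> Ob J \<Longrightarrow> short_exact CAT (s i) (t i)"
    and c1: "colimit J CAT D1 D1' L1 c1" and c2: "colimit J CAT D2 D2' L2 c2" and c3: "colimit J CAT D3 D3' L3 c3"
    and f: "f \<in> Hom CAT L1 L2" "\<And>i. i \<in> Ob J \<Longrightarrow> f \<star>\<^bsub>CAT\<^esub> c1 i = c2 i \<star>\<^bsub>CAT\<^esub> s i"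
    and g: "g \<in> Hom CAT L2 L3" "\<And>i. i \<in> Ob J \<Longrightarrow> g \<star>\<^bsub>CAT\<^esub> c2 i = c3 i \<star>\<^bsub>CAT\<^esub> t i"
  shows "short_exact CAT f g"
proof -
  note e1 = colimit_elements_CAT[OF J D1 c1] and e2 = colimit_elements_CAT[OF J D2 c2]
    and e3 = colimit_elements_CAT[OF J D3 c3]
  have sH: "s i \<in> Hom CAT (D1 i) (D2 i)" and tH: "t i \<in> Hom CAT (D2 i) (D3 i)" if "i \<in> Ob J" for i
    using s t that by (auto simp: natural_def)
  define F G \<sigma> \<tau> where "F = arrow_fun f" and "G = arrow_fun g" and "\<sigma> i = arrow_fun (s i)" and "\<tau> i = arrow_fun (t i)" for i
  define \<gamma>1 \<gamma>2 \<gamma>3 where "\<gamma>1 i = arrow_fun (c1 i)" and "\<gamma>2 i = arrow_fun (c2 i)" and "\<gamma>3 i = arrow_fun (c3 i)" for i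
  define \<phi>1 \<phi>2 \<phi>3 where "\<phi>1 a = arrow_fun (D1' a)" and "\<phi>2 a = arrow_fun (D2' a)" and "\<phi>3 a = arrow_fun (D3' a)" for a
  note defs = F_def G_def \<sigma>_def \<tau>_def \<gamma>1_def \<gamma>2_def \<gamma>3_def \<phi>1_def \<phi>2_def \<phi>3_def
  note d1 = e1[folded defs] and d2 = e2[folded defs] and d3 = e3[folded defs]
  note fH = Hom_arrow_fun[OF f(1), folded F_def] and gH = Hom_arrow_fun[OF g(1), folded G_def]
  note sm = Hom_arrow_fun[OF sH, folded \<sigma>_def] and tm = Hom_arrow_fun[OF tH, folded \<tau>_def]
  have exi: "inj_on (\<sigma> i) (carrier (D1 i))" "\<sigma> i ` carrier (D1 i) = {y \<in> carrier (D2 i). \<tau> i y = \<zero>\<^bsub>D3 i\<^esub>}"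
    "\<tau> i ` carrier (D2 i) = carrier (D3 i)" if i: "i \<in> Ob J" for i
  proof -
    have "short_exact CAT (arr (D1 i) (\<sigma> i) (D2 i)) (arr (D2 i) (\<tau> i) (D3 i))"
      using ex[OF i] sm(4)[OF i] tm(4)[OF i] by simp
    then show "inj_on (\<sigma> i) (carrier (D1 i))" "\<sigma> i ` carrier (D1 i) = {y \<in> carrier (D2 i). \<tau> i y = \<zero>\<^bsub>D3 i\<^esub>}"
      "\<tau> i ` carrier (D2 i) = carrier (D3 i)"
      using short_exact_iff[OF sm(1)[OF i] sm(2)[OF i] tm(2)[OF i] sm(3)[OF i] tm(3)[OF i]] by auto
  qed
  have Fc: "F (\<gamma>1 i x) = \<gamma>2 i (\<sigma> i x)" if "i \<in> Ob J" "x \<in> carrier (D1 i)" for i x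
    unfolding defs by (rule comp_eq_arrow_fun[OF e1(5)[OF that(1)] f(1) sH[OF that(1)] e2(5)[OF that(1)] f(2)[OF that(1)] that(2)])
  have Gc: "G (\<gamma>2 i x) = \<gamma>3 i (\<tau> i x)" if "i \<in> Ob J" "x \<in> carrier (D2 i)" for i x
    unfolding defs by (rule comp_eq_arrow_fun[OF e2(5)[OF that(1)] g(1) tH[OF that(1)] e3(5)[OF that(1)] g(2)[OF that(1)] that(2)])
  have nat1: "\<sigma> l (\<phi>1 a x) = \<phi>2 a (\<sigma> i x)" if a: "a \<in> Hom J i l" and x: "x \<in> carrier (D1 i)" for a i l x
  proof -
    have "s l \<star>\<^bsub>CAT\<^esub> D1' a = D2' a \<star>\<^bsub>CAT\<^esub> s i" using s a by (auto simp: natural_def Hom_def)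
    then show ?thesis unfolding defs
      by (rule comp_eq_arrow_fun[OF e1(4)[OF a] sH[OF e1(7)[OF a]] sH[OF e1(6)[OF a]] e2(4)[OF a] _ x])
  qed
  have nat2: "\<tau> l (\<phi>2 a x) = \<phi>3 a (\<tau> i x)" if a: "a \<in> Hom J i l" and x: "x \<in> carrier (D2 i)" for a i l x
  proof -
    have "t l \<star>\<^bsub>CAT\<^esub> D2' a = D3' a \<star>\<^bsub>CAT\<^esub> t i" using t a by (auto simp: natural_def Hom_def)
    then show ?thesis unfolding defs
      by (rule comp_eq_arrow_fun[OF e2(4)[OF a] tH[OF e1(7)[OF a]] tH[OF e1(6)[OF a]] e3(4)[OF a] _ x])
  qed
  have cl: "\<phi>1 a x \<in> carrier (D1 l)" if "a \<in> Hom J i l" "x \<in> carrier (D1 i)" for a i l x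
    unfolding defs by (rule morD(3)[OF Hom_arrow_fun(3)[OF e1(4)[OF that(1)]] that(2)])
  have cl2: "\<phi>2 a x \<in> carrier (D2 l)" if "a \<in> Hom J i l" "x \<in> carrier (D2 i)" for a i l x
    unfolding defs by (rule morD(3)[OF Hom_arrow_fun(3)[OF e2(4)[OF that(1)]] that(2)])
  have \<gamma>cl: "\<gamma>1 i x \<in> carrier L1" if "i \<in> Ob J" "x \<in> carrier (D1 i)" for i x
    unfolding defs by (rule morD(3)[OF Hom_arrow_fun(3)[OF e1(5)[OF that(1)]] that(2)])
  have \<gamma>cl2: "\<gamma>2 i x \<in> carrier L2" if "i \<in> Ob J" "x \<in> carrier (D2 i)" for i x
    unfolding defs by (rule morD(3)[OF Hom_arrow_fun(3)[OF e2(5)[OF that(1)]] that(2)])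
  have \<gamma>0: "\<gamma>1 i \<zero>\<^bsub>D1 i\<^esub> = \<zero>\<^bsub>L1\<^esub>" if "i \<in> Ob J" for i
    unfolding defs by (rule additive_zero[OF ObD(5)[OF sm(1)[OF that]] ObD(5)[OF fH(1)] morD(1)[OF Hom_arrow_fun(3)[OF e1(5)[OF that]]]])
  have \<gamma>30: "\<gamma>3 i \<zero>\<^bsub>D3 i\<^esub> = \<zero>\<^bsub>L3\<^esub>" if "i \<in> Ob J" for i
    unfolding defs by (rule additive_zero[OF ObD(5)[OF tm(2)[OF that]] ObD(5)[OF gH(2)] morD(1)[OF Hom_arrow_fun(3)[OF e3(5)[OF that]]]])
  note scl = morD(3)[OF sm(3)] and tcl = morD(3)[OF tm(3)]
  have inj: "inj_on F (carrier L1)"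
  proof (rule additive_inj_onI[OF ObD(5)[OF fH(1)] ObD(5)[OF fH(2)] morD(1)[OF fH(3)]])
    fix x assume x: "x \<in> carrier L1" "F x = \<zero>\<^bsub>L2\<^esub>"
    obtain i y where i: "i \<in> Ob J" and y: "y \<in> carrier (D1 i)" "x = \<gamma>1 i y" using d1(1)[OF x(1)] by blast
    have "\<gamma>2 i (\<sigma> i y) = \<zero>\<^bsub>L2\<^esub>" using x(2) Fc[OF i y(1)] y(2) by simp
    \<comment> \<open>The image of \<open>y\<close> under \<open>\<sigma> i\<close> dies at a later
      vertex \<open>l\<close>; as \<open>\<sigma> l\<close> is injective, \<open>y\<close> dies
      there as well.\<close>
    then obtain l a where a: "a \<in> Hom J i l" "\<phi>2 a (\<sigma> i y) = \<zero>\<^bsub>D2 l\<^esub>" using d2(2)[OF i scl[OF i y(1)]] by blast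
    note l = d1(7)[OF a(1)]
    have "\<sigma> l (\<phi>1 a y) = \<sigma> l \<zero>\<^bsub>D1 l\<^esub>"
      using nat1[OF a(1) y(1)] a(2) additive_zero[OF ObD(5)[OF sm(1)[OF l]] ObD(5)[OF sm(2)[OF l]] morD(1)[OF sm(3)[OF l]]] by simp
    then have "\<phi>1 a y = \<zero>\<^bsub>D1 l\<^esub>" by (rule inj_onD[OF exi(1)[OF l] _ cl[OF a(1) y(1)] ObD(6)[OF sm(1)[OF l]]])
    then show "x = \<zero>\<^bsub>L1\<^esub>" using d1(3)[OF a(1) y(1)] \<gamma>0[OF l] y(2) by simp
  qed
  have ker: "F ` carrier L1 = {y \<in> carrier L2. G y = \<zero>\<^bsub>L3\<^esub>}"
  proof (intro equalityI subsetI)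
    fix z assume "z \<in> F ` carrier L1"
    then obtain x where x: "x \<in> carrier L1" "z = F x" by blast
    obtain i y where i: "i \<in> Ob J" and y: "y \<in> carrier (D1 i)" "x = \<gamma>1 i y" using d1(1)[OF x(1)] by blast
    have "\<tau> i (\<sigma> i y) = \<zero>\<^bsub>D3 i\<^esub>" using exi(2)[OF i] imageI[OF y(1), of "\<sigma> i"] by auto
    then have "G z = \<zero>\<^bsub>L3\<^esub>" using x(2) y(2) Fc[OF i y(1)] Gc[OF i scl[OF i y(1)]] \<gamma>30[OF i] by simp
    then show "z \<in> {y \<in> carrier L2. G y = \<zero>\<^bsub>L3\<^esub>}" using morD(3)[OF fH(3) x(1)] x(2) by simp
  next
    fix z assume "z \<in> {y \<in> carrier L2. G y = \<zero>\<^bsub>L3\<^esub>}"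
    then have z: "z \<in> carrier L2" "G z = \<zero>\<^bsub>L3\<^esub>" by auto
    obtain i y where i: "i \<in> Ob J" and y: "y \<in> carrier (D2 i)" "z = \<gamma>2 i y" using d2(1)[OF z(1)] by blast
    have "\<gamma>3 i (\<tau> i y) = \<zero>\<^bsub>L3\<^esub>" using z(2) Gc[OF i y(1)] y(2) by simp
    \<comment> \<open>The image of \<open>y\<close> under \<open>\<tau> i\<close> dies only at
      \<open>l\<close>, so exactness is applied there and not at \<open>i\<close>.\<close>
    then obtain l a where a: "a \<in> Hom J i l" "\<phi>3 a (\<tau> i y) = \<zero>\<^bsub>D3 l\<^esub>" using d3(2)[OF i tcl[OF i y(1)]] by blast
    note l = d1(7)[OF a(1)]
    have "\<phi>2 a y \<in> \<sigma> l ` carrier (D1 l)"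
      unfolding exi(2)[OF l] using nat2[OF a(1) y(1)] a(2) cl2[OF a(1) y(1)] by simp
    then obtain x where x: "x \<in> carrier (D1 l)" "\<phi>2 a y = \<sigma> l x" by blast
    have "z = F (\<gamma>1 l x)" using d2(3)[OF a(1) y(1)] y(2) x(2) Fc[OF l x(1)] by simp
    then show "z \<in> F ` carrier L1" using \<gamma>cl[OF l x(1)] by blast
  qed
  have surj: "G ` carrier L2 = carrier L3"
  proof (intro equalityI subsetI)
    fix z assume "z \<in> carrier L3"
    then obtain i y where i: "i \<in> Ob J" and y: "y \<in> carrier (D3 i)" "z = \<gamma>3 i y" using d3(1) by blast
    then obtain x where x: "x \<in> carrier (D2 i)" "y = \<tau> i x" using exi(3)[OF i] by blast
    then have "z = G (\<gamma>2 i x)" using Gc[OF i x(1)] y(2) by simp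
    then show "z \<in> G ` carrier L2" using \<gamma>cl2[OF i x(1)] by blast
  qed (use morD(3)[OF gH(3)] in auto)
  have "short_exact CAT (arr L1 F L2) (arr L2 G L3)"
    using short_exact_iff[OF fH(1,2) gH(2) fH(3) gH(3)] inj ker surj by blast
  then show ?thesis using fH(4) gH(4) by simp
qed

end

section \<open>A generator\<close>

lemma lepoll_Pow: "A \<lesssim> B \<Longrightarrow> Pow A \<lesssim> Pow B"
  unfolding lepoll_def by (meson image_Pow_mono inj_on_image_Pow)

text \<open>A subset of a disjoint union is a pair of subsets.\<close>

lemma (in universe) small_Pow_Plus:
  assumes "small U (Pow A)" "small U (Pow B)" shows "small U (Pow (A <+> B))"
proof -
  have "inj_on (\<lambda>X. (Inl -` X, Inr -` X)) (Pow (A <+> B))"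
  proof (rule inj_onI)
    fix X Y :: "('a + 'b) set"
    assume eq: "(Inl -` X, Inr -` X) = (Inl -` Y, Inr -` Y)"
    have "z \<in> X \<longleftrightarrow> z \<in> Y" for z
      using eq by (cases z) (auto dest: equalityD1 equalityD2)
    then show "X = Y" by blast
  qed
  moreover have "(\<lambda>X. (Inl -` X, Inr -` X)) ` Pow (A <+> B) \<subseteq> Pow A \<times> Pow B" by auto
  ultimately have "Pow (A <+> B) \<lesssim> Pow A \<times> Pow B" by (auto simp: lepoll_def)
  then show ?thesis using small_times[OF assms] by (rule small_lepoll)
qed

section \<open>Copies of comodules and the comparison of structures\<close>

context coring_setting
begin

text \<open>The copy is generated by the single map \<open>e\<close>, so its axioms follow from
  \<open>HA_module_generated\<close> and \<open>HC_comodule_generated\<close> over a one-element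
  index set.\<close>

lemma transport_comodule:
  fixes N :: "('k, 'h, 'a, 'c, 'm) HC_comodule" and e :: "'m \<Rightarrow> 'v"
  assumes N: "HC_comodule k H A C N" and e: "inj_on e (carrier N)"
  obtains P :: "('k, 'h, 'a, 'c, 'v) HC_comodule" and g where "HC_comodule k H A C P"
    "carrier P = e ` carrier N" "mor P N g" "\<And>n. n \<in> carrier N \<Longrightarrow> g (e n) = n"
proof -
  note N' = HC_comoduleD(1)[OF N]
  interpret Ng: abelian_group N by (rule M_group[OF N'])
  define r where "r = inv_into (carrier N) e"
  have re: "r (e n) = n" if "n \<in> carrier N" for n using that e by (simp add: r_def)
  \<comment> \<open>As for \<open>LA\<close> and \<open>LC\<close>, the coaction is added once its
    target exists.\<close>
  define P0 :: "('k, 'h, 'a, 'c, 'v) HC_comodule" where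
    "P0 = \<lparr>carrier = e ` carrier N, monoid.mult = undefined, one = undefined, zero = e \<zero>\<^bsub>N\<^esub>,
      add = \<lambda>x y. e (r x \<oplus>\<^bsub>N\<^esub> r y), smult = \<lambda>c x. e (c \<odot>\<^bsub>N\<^esub> r x), hact = \<lambda>h x. e (hact N h (r x)),
      ract = \<lambda>x a. e (ract N (r x) a), coact = undefined\<rparr>"
  define P where "P = P0\<lparr>coact := \<lambda>x. tensor_map (TC P0) e (coact N (r x))\<rparr>"
  have P_simps: "carrier P = e ` carrier N" "\<zero>\<^bsub>P\<^esub> = e \<zero>\<^bsub>N\<^esub>" "x \<oplus>\<^bsub>P\<^esub> y = e (r x \<oplus>\<^bsub>N\<^esub> r y)"
    "c \<odot>\<^bsub>P\<^esub> x = e (c \<odot>\<^bsub>N\<^esub> r x)" "hact P h x = e (hact N h (r x))" "ract P x a = e (ract N (r x) a)"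
    "coact P x = tensor_map (TC P0) e (coact N (r x))" for x y c h a
    by (simp_all add: P_def P0_def)
  have TCP: "TC P = TC P0" by (simp add: P_def tensor_A_def tensor_def tensor_group_def tensor_relations_def)
  note smult_cl = additive_closed[OF M_smult_additive[OF N']]
  note cl = M_hact_closed[OF N'] M_ract_closed[OF N'] smult_cl
  have Pg: "abelian_group P"
  proof (rule abelian_groupI)
    show "\<exists>y\<in>carrier P. y \<oplus>\<^bsub>P\<^esub> x = \<zero>\<^bsub>P\<^esub>" if "x \<in> carrier P" for x
      using that by (intro bexI[of _ "e (\<ominus>\<^bsub>N\<^esub> r x)"]) (auto simp: P_simps re Ng.l_neg)
  qed (auto simp: P_simps re Ng.a_ac)
  have ea: "additive N P e" by (intro additiveI) (auto simp: P_simps re)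
  have cg: "e ` carrier N = carrier P" by (simp add: P_simps)
  have sp: "spans P (\<Union>i\<in>{()}. e ` carrier N)"
  proof -
    interpret Pg: abelian_group P by (rule Pg)
    have "carrier P \<subseteq> generate (add_monoid P) (carrier P)" by (auto intro: generate.incl)
    moreover have "generate (add_monoid P) (carrier P) \<subseteq> carrier P" using Pg.add.generate_incl[of "carrier P"] by simp
    ultimately show ?thesis by (simp add: spans_def cg)
  qed
  have P': "HA_module k H A P"
  proof (rule HA_module_generated[of "{()}" "\<lambda>_. N" P "\<lambda>_. e"])
    show "additive P P (\<lambda>x. c \<odot>\<^bsub>P\<^esub> x)" if "c \<in> carrier k" for c
      using that by (intro additiveI) (auto simp: P_simps re cl additive_add[OF M_smult_additive[OF N']])
    show "additive P P (hact P h)" if "h \<in> carrier H" for h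
      using that by (intro additiveI) (auto simp: P_simps re cl additive_add[OF M_hact_additive(1)[OF N']])
    show "additive P P (\<lambda>x. ract P x a)" if "a \<in> carrier A" for a
      using that by (intro additiveI) (auto simp: P_simps re cl additive_add[OF M_ract_additive(1)[OF N']])
  qed (auto simp: N' Pg ea P_simps(4-6) re intro: sp[simplified])
  have em: "HA_map N P e" using ea by (intro HA_mapI) (auto simp: P_simps re)
  have co: "colinear N P e" by (simp add: colinear_def P_simps(7) TCP re)
  have ca: "additive P (TC P) (coact P)"
  proof (rule additiveI)
    note m = TC_map_additive[OF N' P' HA_mapD(1)[OF em], unfolded TCP]
    note c = additive_comp[OF HC_comoduleD(3)[OF N] m]
    show "coact P x \<in> carrier (TC P)" if "x \<in> carrier P" for x
      using that additive_closed[OF c] by (auto simp: P_simps(1,7) TCP re)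
    show "coact P (x \<oplus>\<^bsub>P\<^esub> y) = coact P x \<oplus>\<^bsub>TC P\<^esub> coact P y" if "x \<in> carrier P" "y \<in> carrier P" for x y
      using that additive_add[OF c] by (auto simp: P_simps(1,3,7) TCP re)
  qed
  have P: "HC_comodule k H A C P"
    by (rule HC_comodule_generated[of "{()}" "\<lambda>_. N" P "\<lambda>_. e"]) (use N P' ca em co sp in auto)
  have e': "mor N P e" using em co by (simp add: mor_def)
  \<comment> \<open>Injectivity of \<open>e\<close> supplies the kernel condition of
    \<open>mor_factor_surjective\<close>, which yields the inverse as a morphism.\<close>
  have "n = \<zero>\<^bsub>N\<^esub>" if "n \<in> carrier N" "e n = \<zero>\<^bsub>P\<^esub>" for n
    using that inj_onD[OF e, of n "\<zero>\<^bsub>N\<^esub>"] by (simp add: P_simps)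
  then obtain g where "mor P N g" "\<And>n. n \<in> carrier N \<Longrightarrow> g (e n) = n"
    using mor_factor_surjective[OF N P N e' cg mor_id[OF N]] by blast
  then show thesis using that[OF P] by (simp add: P_simps)
qed

text \<open>Only values on the carrier are recorded, since the records of isomorphic comodules may differ by junk
  values. The scalar multiplication is omitted because \<open>k\<close> acts through \<open>A\<close>.\<close>

definition structure_graph :: "('k, 'h, 'a, 'c, 'u) HC_comodule \<Rightarrow>
    'u set \<times> ('u \<times> 'u \<times> 'u) set \<times> ('h \<times> 'u \<times> 'u) set \<times> ('a \<times> 'u \<times> 'u) set \<times> ('u \<times> ('u \<times> 'c \<Rightarrow>\<^sub>0 int)) set" where
  "structure_graph M = (carrier M,
     {(x, y, x \<oplus>\<^bsub>M\<^esub> y) | x y. x \<in> carrier M \<and> y \<in> carrier M},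
     {(h, x, hact M h x) | h x. h \<in> carrier H \<and> x \<in> carrier M},
     {(a, x, ract M x a) | a x. a \<in> carrier A \<and> x \<in> carrier M},
     {(x, t). x \<in> carrier M \<and> t \<in> coact M x})"

text \<open>Equal graphs give equal tensor relations and hence one and the same group
  \<open>TC M = TC N\<close>; the two coactions agree there as sets, so the identity is
  colinear.\<close>

lemma same_graph_mor:
  assumes M: "HC_comodule k H A C M" and N: "HC_comodule k H A C N" and eq: "structure_graph M = structure_graph N"
  shows "carrier M = carrier N" "mor M N (\<lambda>x. x)"
proof -
  note M' = HC_comoduleD(1)[OF M]
  show car: "carrier M = carrier N" using eq by (simp add: structure_graph_def)
  note c = eq[unfolded structure_graph_def prod.inject]
  have g1: "{(x, y, x \<oplus>\<^bsub>M\<^esub> y) | x y. x \<in> carrier M \<and> y \<in> carrier M} =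
      {(x, y, x \<oplus>\<^bsub>N\<^esub> y) | x y. x \<in> carrier N \<and> y \<in> carrier N}"
    and g2: "{(h, x, hact M h x) | h x. h \<in> carrier H \<and> x \<in> carrier M} =
      {(h, x, hact N h x) | h x. h \<in> carrier H \<and> x \<in> carrier N}"
    and g3: "{(a, x, ract M x a) | a x. a \<in> carrier A \<and> x \<in> carrier M} =
      {(a, x, ract N x a) | a x. a \<in> carrier A \<and> x \<in> carrier N}"
    and g4: "{(x, t). x \<in> carrier M \<and> t \<in> coact M x} = {(x, t). x \<in> carrier N \<and> t \<in> coact N x}"
    by (rule c[THEN conjunct2, THEN conjunct1], rule c[THEN conjunct2, THEN conjunct2, THEN conjunct1],
      rule c[THEN conjunct2, THEN conjunct2, THEN conjunct2, THEN conjunct1],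
      rule c[THEN conjunct2, THEN conjunct2, THEN conjunct2, THEN conjunct2])
  have add: "x \<oplus>\<^bsub>M\<^esub> y = x \<oplus>\<^bsub>N\<^esub> y" if "x \<in> carrier M" "y \<in> carrier M" for x y
  proof -
    have "(x, y, x \<oplus>\<^bsub>M\<^esub> y) \<in> {(x, y, x \<oplus>\<^bsub>N\<^esub> y) | x y. x \<in> carrier N \<and> y \<in> carrier N}"
      unfolding g1[symmetric] using that by blast
    then show ?thesis by simp
  qed
  have ha: "hact M h x = hact N h x" if "h \<in> carrier H" "x \<in> carrier M" for h x
  proof -
    have "(h, x, hact M h x) \<in> {(h, x, hact N h x) | h x. h \<in> carrier H \<and> x \<in> carrier N}"
      unfolding g2[symmetric] using that by blast
    then show ?thesis by simp
  qed
  have ra: "ract M x a = ract N x a" if "a \<in> carrier A" "x \<in> carrier M" for a x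
  proof -
    have "(a, x, ract M x a) \<in> {(a, x, ract N x a) | a x. a \<in> carrier A \<and> x \<in> carrier N}"
      unfolding g3[symmetric] using that by blast
    then show ?thesis by simp
  qed
  have co: "coact M x = coact N x" if "x \<in> carrier M" for x
  proof -
    have "t \<in> coact M x \<longleftrightarrow> t \<in> coact N x" for t
      using g4 that car by (auto simp: set_eq_iff)
    then show ?thesis by blast
  qed
  have r1: "{frag_of (m \<oplus>\<^bsub>M\<^esub> m', n) - frag_of (m, n) - frag_of (m', n) | m m' n.
        m \<in> carrier M \<and> m' \<in> carrier M \<and> n \<in> carrier C} =
     {frag_of (m \<oplus>\<^bsub>N\<^esub> m', n) - frag_of (m, n) - frag_of (m', n) | m m' n.
        m \<in> carrier N \<and> m' \<in> carrier N \<and> n \<in> carrier C}"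
    using add by (intro Collect_cong ex_cong1) (auto simp: car)
  have r3: "{frag_of (ract M m a, n) - frag_of (m, lact C a n) | m a n.
        m \<in> carrier M \<and> a \<in> carrier A \<and> n \<in> carrier C} =
     {frag_of (ract N m a, n) - frag_of (m, lact C a n) | m a n.
        m \<in> carrier N \<and> a \<in> carrier A \<and> n \<in> carrier C}"
    using ra by (intro Collect_cong ex_cong1) (auto simp: car)
  have "tensor_relations A M (ract M) C (lact C) = tensor_relations A N (ract N) C (lact C)"
    by (simp only: tensor_relations_def r1 r3) (simp only: car)
  then have TC: "TC M = TC N" by (simp add: tensor_A_def tensor_def tensor_group_def car)
  have "HA_map M N (\<lambda>x. x)"
    using add ha ra by (intro HA_mapI additiveI) (auto simp: car)
  moreover have "colinear M N (\<lambda>x. x)"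
    using co HC_comoduleD(4)[OF M] TC
      tensor_map_id[OF M_right_module[OF M'] C_left_module, folded tensor_A_def]
    by (simp add: colinear_def)
  ultimately show "mor M N (\<lambda>x. x)" by (simp add: mor_def)
qed

end

context flat_coring
begin

text \<open>\<open>B\<close> is a copy of the disjoint union of \<open>H\<close>, \<open>A\<close>,
  \<open>C\<close> and the natural numbers. Being infinite it absorbs finite products and lists, so
  it has room for every subcomodule of \<open>ex_small_subcomodule\<close>, while the structures on
  its subsets are counted by copies of its power set, which is small.\<close>

lemma ex_test_set:
  obtains B where "B \<in> U" "carrier (free_Abelian_group words) \<lesssim> B"
    "small U (structure_graph ` {M \<in> Ob CAT. carrier M \<subseteq> B})"
proof -
  \<comment> \<open>The natural numbers make \<open>Z\<close> infinite and provide the third kind of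
    letters of \<open>words\<close>; the power set of each of the four parts is small.\<close>
  define Z where "Z = (carrier H <+> carrier A) <+> (carrier C <+> (UNIV :: nat set))"
  have PZ: "small U (Pow Z)"
    unfolding Z_def by (intro small_Pow_Plus small_Pow small_Pow_nat)
  have "small U Z" using lepoll_Pow_self PZ by (rule small_lepoll)
  then obtain e where e: "inj_on e Z" "e ` Z \<in> U" by (rule small_obtain)
  define B where "B = e ` Z"
  have BZ: "B \<lesssim> Z" and ZB: "Z \<lesssim> B" unfolding B_def using e(1) by (simp_all add: image_lepoll)
  have "inj (\<lambda>n :: nat. Inr (Inr n) :: ('h + 'a) + ('c + nat))" by (auto intro: injI)
  then have "infinite (range (\<lambda>n :: nat. Inr (Inr n) :: ('h + 'a) + ('c + nat)))" by (simp add: finite_image_iff)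
  then have Zinf: "infinite Z" by (rule infinite_super[rotated]) (auto simp: Z_def)
  have intZ: "(UNIV :: int set) \<lesssim> Z"
    using Zinf by (meson countable_lepoll infinite_le_lepoll lepoll_trans countableI_type countable_def lepoll_def top_greatest)
  have parts: "carrier H \<lesssim> Z" "carrier A \<lesssim> Z" "carrier C \<lesssim> Z"
    unfolding lepoll_def Z_def
    by (rule exI[of _ "\<lambda>x. Inl (Inl x)"], force simp: inj_on_def)
      (rule exI[of _ "\<lambda>x. Inl (Inr x)"], force simp: inj_on_def,
       rule exI[of _ "\<lambda>x. Inr (Inl x)"], force simp: inj_on_def)
  have "carrier H <+> carrier A <+> (UNIV :: nat set) \<lesssim> Z"
    unfolding lepoll_def Z_def
    by (rule exI[of _ "case_sum (\<lambda>h. Inl (Inl h)) (case_sum (\<lambda>a. Inl (Inr a)) (\<lambda>n. Inr (Inr n)))"])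
      (force simp: inj_on_def)
  then have "words \<lesssim> Z" unfolding words_def using lists_lepoll_mono infinite_lists_lepoll[OF Zinf] lepoll_trans by blast
  have "words \<times> (UNIV :: int set) \<lesssim> Z"
    using times_lepoll_mono[OF \<open>words \<lesssim> Z\<close> intZ] infinite_times_lepoll[OF Zinf] by (rule lepoll_trans)
  then have "lists (words \<times> (UNIV :: int set)) \<lesssim> Z"
    using lists_lepoll_mono infinite_lists_lepoll[OF Zinf] lepoll_trans by blast
  then have FZ: "carrier (free_Abelian_group words) \<lesssim> Z"
    using free_Abelian_group_lepoll_lists lepoll_trans by blast
  then have FB: "carrier (free_Abelian_group words) \<lesssim> B" using ZB by (rule lepoll_trans)
  have "(B \<times> carrier C) \<times> (UNIV :: int set) \<lesssim> Z"
    using times_lepoll_mono[OF times_lepoll_mono[OF BZ parts(3)] intZ]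
      times_lepoll_mono[OF infinite_times_lepoll[OF Zinf] lepoll_refl[of Z]] infinite_times_lepoll[OF Zinf]
    by (blast intro: lepoll_trans)
  then have "lists ((B \<times> carrier C) \<times> (UNIV :: int set)) \<lesssim> Z"
    using lists_lepoll_mono infinite_lists_lepoll[OF Zinf] lepoll_trans by blast
  then have FBC: "carrier (free_Abelian_group (B \<times> carrier C)) \<lesssim> Z"
    using free_Abelian_group_lepoll_lists lepoll_trans by blast
  \<comment> \<open>One factor per entry of \<open>structure_graph\<close>, each the power set of a
    set no larger than \<open>Z\<close>. Listing the coaction by pairs of \<open>x\<close> and a
    member of its coset keeps it within a single power set.\<close>
  let ?G = "Pow B \<times> Pow (B \<times> B \<times> B) \<times> Pow (carrier H \<times> B \<times> B) \<times> Pow (carrier A \<times> B \<times> B) \<times>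
    Pow (B \<times> carrier (free_Abelian_group (B \<times> carrier C)))"
  have BB: "B \<times> B \<lesssim> Z" using times_lepoll_mono[OF BZ BZ] infinite_times_lepoll[OF Zinf] by (rule lepoll_trans)
  have sG: "small U ?G"
    by (intro small_times small_lepoll[OF lepoll_Pow PZ] BZ
        lepoll_trans[OF times_lepoll_mono infinite_times_lepoll[OF Zinf]] BB parts FBC)
  have "structure_graph M \<in> ?G" if M: "M \<in> Ob CAT" and MB: "carrier M \<subseteq> B" for M
  proof -
    note M' = ObD(4)[OF M]
    interpret T: tensor_pair A M "ract M" C "lact C"
      rewrites "tensor A M (ract M) C (lact C) \<equiv> TC M"
      by (rule TC_pair[OF M']) (rule TC_eq[OF M'])
    \<comment> \<open>Members of the coset are formal sums over \<open>carrier M\<close> and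
      \<open>C\<close>, hence over \<open>B\<close> and \<open>C\<close>.\<close>
    have "t \<in> carrier (free_Abelian_group (B \<times> carrier C))" if "x \<in> carrier M" "t \<in> coact M x" for x t
    proof -
      have "coact M x \<in> carrier (TC M)" using HC_comoduleD(4)[OF ObD(1)[OF M]] that(1) .
      then obtain y where y: "y \<in> carrier T.F" "coact M x = (T.K #>\<^bsub>T.F\<^esub> y)"
        using T.quot(2) T.T_eq by auto
      have "t \<in> carrier T.F" using T.quot(7)[OF y(1), of t] that(2) y(2) by simp
      then show ?thesis using MB by (simp only: carrier_free_Abelian_group_iff) blast
    qed
    moreover have "x \<oplus>\<^bsub>M\<^esub> y \<in> carrier M" if "x \<in> carrier M" "y \<in> carrier M" for x y
      using abelian_groupE(1)[OF ObD(5)[OF M]] that .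
    ultimately show ?thesis
      using MB M_hact_closed[OF M'] M_ract_closed[OF M']
      by (auto simp: structure_graph_def subset_iff simp del: carrier_free_Abelian_group_iff)
  qed
  then have "structure_graph ` {M \<in> Ob CAT. carrier M \<subseteq> B} \<subseteq> ?G" by blast
  then have "small U (structure_graph ` {M \<in> Ob CAT. carrier M \<subseteq> B})" by (rule small_subset[OF sG])
  then show thesis using that[of B] e(2) FB by (simp add: B_def)
qed

text \<open>If \<open>f\<close> and \<open>g\<close> differ at \<open>m\<close>, a copy of a small
  subcomodule containing \<open>m\<close> has the same graph as one of the summands. The morphism
  from the coproduct that is zero on the other summands then has \<open>m\<close> in its image and
  separates \<open>f\<close> from \<open>g\<close>.\<close>

lemma ex_generator: "\<exists>G. generator CAT G"
proof -
  obtain B where B: "B \<in> U" "carrier (free_Abelian_group words) \<lesssim> B"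
    "small U (structure_graph ` {M \<in> Ob CAT. carrier M \<subseteq> B})"
    by (rule ex_test_set)
  define T where "T = structure_graph ` {M \<in> Ob CAT. carrier M \<subseteq> B}"
  \<comment> \<open>One comodule is chosen per graph: the set of graphs is small by
    \<open>ex_test_set\<close>, whereas comodules with the same graph may differ as records.\<close>
  define D where "D t = (SOME M. M \<in> Ob CAT \<and> carrier M \<subseteq> B \<and> structure_graph M = t)" for t
  have D: "D t \<in> Ob CAT" "structure_graph (D t) = t" if "t \<in> T" for t
  proof -
    have "\<exists>M. M \<in> Ob CAT \<and> carrier M \<subseteq> B \<and> structure_graph M = t" using that by (auto simp: T_def)
    then have "D t \<in> Ob CAT \<and> carrier (D t) \<subseteq> B \<and> structure_graph (D t) = t" unfolding D_def by (rule someI_ex)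
    then show "D t \<in> Ob CAT" "structure_graph (D t) = t" by blast+
  qed
  interpret G: graph_diagram k H A C U T D "{} :: nat set" "\<lambda>_. undefined" "\<lambda>_. undefined" "\<lambda>_ x. x"
    by (intro graph_diagram.intro flat_coring_axioms graph_diagram_axioms.intro)
      (use B(3) ObD(1,3)[OF D(1)] in \<open>simp_all add: T_def\<close>)
  obtain L :: "'u ring" and q where L: "graph_colimit k H A C U T D ({} :: nat set) (\<lambda>_. undefined) (\<lambda>_. undefined) (\<lambda>_ x. x) L q"
    "carrier L \<in> U"
    using G.ex_graph_colimit by blast
  interpret L: graph_colimit k H A C U T D "{} :: nat set" "\<lambda>_. undefined" "\<lambda>_. undefined" "\<lambda>_ x. x" L q
    by (rule L(1))
  have LO: "L.LC \<in> Ob CAT" using L.LC_comodule L(2) by (simp add: CAT_Ob)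
  have "\<exists>h\<in>Hom CAT L.LC X. f \<star>\<^bsub>CAT\<^esub> h \<noteq> g \<star>\<^bsub>CAT\<^esub> h"
    if f: "f \<in> Hom CAT X Y" and g: "g \<in> Hom CAT X Y" and ne: "f \<noteq> g" for X Y f g
  proof -
    obtain f' where X: "X \<in> Ob CAT" and f': "mor X Y f'" "f = arr X f' Y" using f by (elim Hom_arr)
    obtain g' where g': "mor X Y g'" "g = arr X g' Y" using g by (elim Hom_arr)
    obtain m where m: "m \<in> carrier X" "f' m \<noteq> g' m" using ne f'(2) g'(2) by (auto simp: arr_eq_iff)
    obtain N :: "('k, 'h, 'a, 'c, 'u) HC_comodule" where N: "HC_comodule k H A C N" "m \<in> carrier N"
      "carrier N \<lesssim> carrier (free_Abelian_group words)" "HA_map N X (\<lambda>x. x)" "colinear N X (\<lambda>x. x)"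
      using ex_small_subcomodule[OF ObD(1)[OF X] ObD(3)[OF X] m(1)] by blast
    have NX: "mor N X (\<lambda>x. x)" using N by (simp add: mor_def)
    \<comment> \<open>The bound on \<open>carrier N\<close> is independent of \<open>X\<close>, so
      \<open>N\<close> can be copied into the test set.\<close>
    obtain e where e: "inj_on e (carrier N)" "e ` carrier N \<subseteq> B"
      using lepoll_trans[OF N(3) B(2)] by (auto simp: lepoll_def)
    obtain P :: "('k, 'h, 'a, 'c, 'u) HC_comodule" and r where P: "HC_comodule k H A C P"
      "carrier P = e ` carrier N" "mor P N r" "\<And>n. n \<in> carrier N \<Longrightarrow> r (e n) = n"
      using transport_comodule[OF N(1) e(1)] by blast
    have PO: "P \<in> Ob CAT" using P(1,2) e(2) subset_closed[OF B(1)] by (simp add: CAT_Ob)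
    define t where "t = structure_graph P"
    have t: "t \<in> T" unfolding t_def T_def using PO P(2) e(2) by auto
    have "structure_graph (D t) = structure_graph P" unfolding D(2)[OF t] by (rule t_def)
    note same = same_graph_mor[OF ObD(1)[OF D(1)[OF t]] P(1) this]
    note DP = same(2)
    have DN: "mor (D t) N r"
      using mor_comp[OF ObD(1)[OF D(1)[OF t]] P(1) N(1) DP P(3)] .
    have DX: "mor (D t) X r"
      using mor_comp[OF ObD(1)[OF D(1)[OF t]] N(1) ObD(1)[OF X] DN NX] .
    have em: "e m \<in> carrier (D t)" using same(1) P(2) N(2) by simp
    let ?d = "\<lambda>s. if s = t then r else (\<lambda>_. \<zero>\<^bsub>X\<^esub>)"
    have d: "mor (D s) X (?d s)" if "s \<in> T" for s
      using DX mor_zero[OF ObD(1)[OF D(1)[OF that]] ObD(1)[OF X]] by auto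
    obtain u where u: "mor L.LC X u" "\<And>s x. s \<in> T \<Longrightarrow> x \<in> carrier (D s) \<Longrightarrow> u (L.\<gamma> s x) = ?d s x"
      using L.ext_mor[of X ?d, OF ObD(1)[OF X] d] by blast
    have um: "u (L.\<gamma> t (e m)) = m" using u(2)[OF t em] P(4)[OF N(2)] by simp
    have "arr X f' Y \<star>\<^bsub>CAT\<^esub> arr L.LC u X \<noteq> arr X g' Y \<star>\<^bsub>CAT\<^esub> arr L.LC u X"
    proof
      assume "arr X f' Y \<star>\<^bsub>CAT\<^esub> arr L.LC u X = arr X g' Y \<star>\<^bsub>CAT\<^esub> arr L.LC u X"
      then have "f' (u x) = g' (u x)" if "x \<in> carrier L.LC" for x
        using that by (simp add: arr_comp_mor[OF u(1)] arr_eq_iff)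
      from this[of "L.\<gamma> t (e m)"] show False using um m(2) L.\<gamma>_closed[OF t em] by simp
    qed
    then show ?thesis using arr_Hom[OF LO X u(1)] f'(2) g'(2) by blast
  qed
  then have "generator CAT L.LC" using LO unfolding generator_def by blast
  then show ?thesis by blast
qed

lemma grothendieck_CAT: "grothendieck_category U CAT"
proof (rule grothendieck_category.intro[OF abelian_CAT], rule grothendieck_category_axioms.intro)
  show "\<exists>L c. colimit J CAT D D' L c"
    if "category J" "Ob J \<in> U" "Arr J \<in> U" "diagram J CAT D D'" for J :: "('u, 'u) category" and D D'
    by (rule CAT_cocomplete[OF that(1,2,4)])
  show "\<exists>G. generator CAT G" by (rule ex_generator)
qed (rule CAT_filtered_exact)

end

theorem lemma2p7:
  fixes U :: "'u set set"
    and k :: "'k ring"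
    and H :: "('k, 'h) bialgebra"
    and A :: "('k, 'h, 'a) H_module"
    and C :: "('k, 'h, 'a, 'c) HA_coring"
  assumes "universe U"
    and "small U (Pow (carrier H))" "small U (Pow (carrier A))" "small U (Pow (carrier C))"
    and "cring k"
    and "bialgebra k H"
    and "module_algebra k H A"
    and "HA_coring k H A C"
    and "flat_left_module U A C (lact C)"
  shows "grothendieck_category U (comodule_category U k H A C)"
proof -
  interpret flat_coring k H A C U
    using assms by (intro flat_coring.intro coring_setting.intro flat_coring_axioms.intro)
  show ?thesis by (rule grothendieck_CAT)
qed

end
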